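(* There is a constant $C$ depending only on $N$ such that for every Borel set $E\subset\mathbb{R}^{N+1}$, $$\gamma_{\Theta,+}^{1/2}(E)\le\gamma_{\Theta}^{1/2}(E)\le C\,\mathcal{H}^{N}_\infty(E),$$ and $$\dim_H(E)>N\quad\Longrightarrow\quad \gamma_\Theta^{1/2}(E)>0 .$$
   Context: $N\ge 1$; points of $\mathbb{R}^{N+1}$ are $\bar x=(x,t)$, $x\in\mathbb{R}^N$, $t\in\mathbb{R}$. $P(x,t)=\frac{t}{(t^2+|x|^2)^{(N+1)/2}}$ for $t>0$ and $P(x,t)=0$ for $t\le0$. The $\frac12$-fractional caloric capacity is $\gamma_\Theta^{1/2}(E)=\sup|\langle\nu,1\rangle|$, the supremum being over all (compactly supported) distributions $\nu$ in $\mathbb{R}^{N+1}$ with $\operatorname{supp}\nu\subset E$ and $\|P*\nu\|_{L^\infty(\mathbb{R}^{N+1})}\le1$. The capacity $\gamma_{\Theta,+}^{1/2}(E)$ is defined in the same way but with the supremum restricted to positive measures $\nu$. $\mathcal{H}^N_\infty$ is the (Euclidean) $N$-dimensional Hausdorff content, $\mathcal{H}^N_\infty(E)=\inf\{\sum_i \operatorname{diam}(A_i)^N: E\subset\bigcup_i A_i\}$, and $\dim_H$ is the (Euclidean) Hausdorff dimension. *)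

theory Defs
  imports "HOL-Analysis.Analysis"
begin

section \<open>Test functions and distributions\<close>

fun iter_deriv :: "'a list \<Rightarrow> ('a::euclidean_space \<Rightarrow> complex) \<Rightarrow> 'a \<Rightarrow> complex" where
  "iter_deriv [] f = f"
| "iter_deriv (v # vs) f = (\<lambda>x. frechet_derivative (iter_deriv vs f) (at x) v)"

text \<open>Differentiability of every iterated partial derivative makes all of them continuous,
  so this is the usual class of infinitely differentiable functions.\<close>

definition smooth :: "('a::euclidean_space \<Rightarrow> complex) \<Rightarrow> bool" where
  "smooth f \<longleftrightarrow> (\<forall>vs. set vs \<subseteq> Basis \<longrightarrow> (\<forall>x. iter_deriv vs f differentiable at x))"

definition fun_supp :: "('a::euclidean_space \<Rightarrow> complex) \<Rightarrow> 'a set" where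
  "fun_supp f = closure {x. f x \<noteq> 0}"

definition test_funs :: "('a::euclidean_space \<Rightarrow> complex) set" where
  "test_funs = {\<phi>. smooth \<phi> \<and> compact (fun_supp \<phi>)}"

text \<open>A distribution is modelled by a functional on all functions of which only the values
  on test functions matter; its values elsewhere are never used.\<close>

definition distribution :: "(('a::euclidean_space \<Rightarrow> complex) \<Rightarrow> complex) \<Rightarrow> bool" where
  "distribution T \<longleftrightarrow>
     (\<forall>\<phi>\<in>test_funs. \<forall>\<psi>\<in>test_funs. T (\<lambda>x. \<phi> x + \<psi> x) = T \<phi> + T \<psi>) \<and>
     (\<forall>c. \<forall>\<phi>\<in>test_funs. T (\<lambda>x. c * \<phi> x) = c * T \<phi>) \<and>
     (\<forall>K. compact K \<longrightarrow> (\<exists>C m. \<forall>\<phi>\<in>test_funs. fun_supp \<phi> \<subseteq> K \<longrightarrow>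
        cmod (T \<phi>) \<le>
          C * (\<Sum>vs | set vs \<subseteq> Basis \<and> length vs \<le> m. SUP x. cmod (iter_deriv vs \<phi> x))))"

definition dist_supp :: "(('a::euclidean_space \<Rightarrow> complex) \<Rightarrow> complex) \<Rightarrow> 'a set" where
  "dist_supp T = - \<Union>{U. open U \<and> (\<forall>\<phi>\<in>test_funs. fun_supp \<phi> \<subseteq> U \<longrightarrow> T \<phi> = 0)}"

text \<open>The extension of a compactly supported distribution to arbitrary smooth \<open>\<psi>\<close>:
  its value is \<open>T (\<eta> \<psi>)\<close> for any test function \<open>\<eta>\<close> equal to 1 near the support of \<open>T\<close>.\<close>

definition dist_pair ::
  "(('a::euclidean_space \<Rightarrow> complex) \<Rightarrow> complex) \<Rightarrow> ('a \<Rightarrow> complex) \<Rightarrow> complex" where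
  "dist_pair T \<psi> = (THE c. \<forall>\<eta>\<in>test_funs.
     (\<exists>U. open U \<and> dist_supp T \<subseteq> U \<and> (\<forall>x\<in>U. \<eta> x = 1)) \<longrightarrow> T (\<lambda>x. \<eta> x * \<psi> x) = c)"

text \<open>The distribution \<open>k * T\<close> for locally integrable \<open>k\<close> and compactly supported \<open>T\<close>:
  it maps \<open>\<phi>\<close> to the pairing of \<open>T\<close> with the convolution of \<open>\<phi>\<close> and the reflection of \<open>k\<close>,
  which is smooth but in general not compactly supported.\<close>

definition dist_conv ::
  "('a::euclidean_space \<Rightarrow> real) \<Rightarrow> (('a \<Rightarrow> complex) \<Rightarrow> complex) \<Rightarrow> ('a \<Rightarrow> complex) \<Rightarrow> complex" where
  "dist_conv k T \<phi> = dist_pair T (\<lambda>y. LINT x|lborel. k (x - y) *\<^sub>R \<phi> x)"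

definition Linfty_norm_le :: "(('a::euclidean_space \<Rightarrow> complex) \<Rightarrow> complex) \<Rightarrow> real \<Rightarrow> bool" where
  "Linfty_norm_le S M \<longleftrightarrow> (\<exists>f\<in>borel_measurable lborel.
     (AE x in lborel. cmod (f x) \<le> M) \<and>
     (\<forall>\<phi>\<in>test_funs. S \<phi> = (LINT x|lborel. f x * \<phi> x)))"

definition positive_measure_dist :: "(('a::euclidean_space \<Rightarrow> complex) \<Rightarrow> complex) \<Rightarrow> bool" where
  "positive_measure_dist T \<longleftrightarrow> (\<exists>\<mu>. sets \<mu> = sets borel \<and>
     (\<forall>K. compact K \<longrightarrow> emeasure \<mu> K < \<infinity>) \<and>
     (\<forall>\<phi>\<in>test_funs. T \<phi> = (LINT x|\<mu>. \<phi> x)))"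


section \<open>The half-fractional caloric capacities\<close>

text \<open>Space-time is \<open>(real ^ 'n) \<times> real\<close>, so the spatial dimension is \<open>N = CARD('n)\<close>.\<close>

definition P_kernel :: "(real ^ 'n) \<times> real \<Rightarrow> real" where
  "P_kernel = (\<lambda>(x, t). if t > 0
     then t / (t\<^sup>2 + (norm x)\<^sup>2) powr ((real CARD('n) + 1) / 2) else 0)"

definition admissible ::
  "((real ^ 'n) \<times> real) set \<Rightarrow> (((real ^ 'n) \<times> real \<Rightarrow> complex) \<Rightarrow> complex) \<Rightarrow> bool" where
  "admissible E \<nu> \<longleftrightarrow> distribution \<nu> \<and> compact (dist_supp \<nu>) \<and> dist_supp \<nu> \<subseteq> E \<and>
     Linfty_norm_le (dist_conv P_kernel \<nu>) 1"

definition caloric_capacity :: "((real ^ 'n) \<times> real) set \<Rightarrow> ennreal" where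
  "caloric_capacity E = (SUP \<nu>\<in>{\<nu>. admissible E \<nu>}. ennreal (cmod (dist_pair \<nu> (\<lambda>_. 1))))"

definition caloric_capacity_pos :: "((real ^ 'n) \<times> real) set \<Rightarrow> ennreal" where
  "caloric_capacity_pos E = (SUP \<nu>\<in>{\<nu>. admissible E \<nu> \<and> positive_measure_dist \<nu>}.
     ennreal (cmod (dist_pair \<nu> (\<lambda>_. 1))))"


section \<open>Hausdorff content, measure and dimension\<close>

text \<open>Covers are restricted to bounded sets because \<^const>\<open>diameter\<close> is only meaningful for
  those; an unbounded set would contribute infinity to the sum.\<close>

definition hausdorff_content :: "nat \<Rightarrow> 'a::metric_space set \<Rightarrow> ennreal" where
  "hausdorff_content n E =
     (INF A\<in>{A :: nat \<Rightarrow> 'a set. E \<subseteq> (\<Union>i. A i) \<and> (\<forall>i. bounded (A i))}.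
        \<Sum>i. ennreal (diameter (A i) ^ n))"

definition hausdorff_measure :: "real \<Rightarrow> 'a::metric_space set \<Rightarrow> ennreal" where
  "hausdorff_measure s E = (SUP \<delta>\<in>{0::real<..}.
     INF A\<in>{A :: nat \<Rightarrow> 'a set. E \<subseteq> (\<Union>i. A i) \<and> (\<forall>i. bounded (A i) \<and> diameter (A i) \<le> \<delta>)}.
       \<Sum>i. ennreal (diameter (A i) powr s))"

text \<open>The exponent \<open>s = 0\<close> is left out, which does not change the infimum.\<close>

definition hausdorff_dim :: "'a::metric_space set \<Rightarrow> ennreal" where
  "hausdorff_dim E = (INF s\<in>{s. 0 < s \<and> hausdorff_measure s E = 0}. ennreal s)"

end

theory Submission
  imports Defs "HOL-Computational_Algebra.Polynomial"
begin

text \<open>Upper bound: the Poisson kernels form a convolution semigroup, so convolution with the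
  space-time kernel \<open>P\<close> is inverted approximately by a difference quotient of two time-shifted slices.
  Since the slices are even in space, the first difference acts on a test function as a second
  difference, which makes the approximate inverse of a test function adapted to a ball of radius \<open>r\<close>
  bounded in \<open>L\<^sup>1\<close> by a multiple of \<open>r ^ N\<close>. Hence \<open>\<bar>\<langle>\<nu>, \<phi>\<rangle>\<bar> \<le> C r ^ N\<close> for every admissible \<open>\<nu>\<close>, and
  summation over a partition of unity adapted to a cover of \<open>supp \<nu>\<close> gives the content.
  Lower bound: a set of dimension greater than \<open>N\<close> has positive \<open>s\<close>-dimensional measure for some \<open>s > N\<close>,
  hence meets a unit cube in a set of positive net content on the tree of dyadic cubes. That content
  is a capacity in the sense of Choquet, so a Borel set of positive content contains a compact one.
  Splitting mass along the tree gives a measure on the compact set with \<open>\<mu> (cball x r) \<le> C r powr s\<close>,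
  and since \<open>s > N\<close> its potential is bounded because \<open>P(z) \<le> \<bar>z\<bar> powr (-N)\<close>.\<close>

text \<open>A distribution only accepts test functions. So the time slice is cut off at a radius
  \<open>R\<close>, and the inversion holds only in the limit \<open>h\<close> to 0, uniformly with
  all derivatives, since these are what the seminorms of a distribution see. The exponent
  \<open>N\<close> has this origin. A second difference with step \<open>w\<close> of a function
  adapted to a ball of radius \<open>r\<close> in dimension \<open>N + 1\<close> has L1 norm of
  order \<open>r ^ (N + 1)\<close> times the minimum of \<open>(norm w / r)\<^sup>2\<close> and 1.
  The Poisson slice at time \<open>h\<close> integrates this minimum to order \<open>h / r\<close>:
  the \<open>1 / r\<close> lowers the power of \<open>r\<close>, and the \<open>h\<close> cancels
  the denominator of the difference quotient. A first difference would only give the minimum of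
  \<open>norm w / r\<close> and 1, whose integral carries a factor log (r / h) that blows up as
  \<open>h\<close> tends to 0. In the lower bound the obstacle is that dyadic cylinders are not
  open: the net content is continuous along increasing sequences, but not obviously along decreasing
  compact ones. Capacitability is therefore stated through open neighbourhoods of the compact set
  and transferred back by fattening.\<close>

section \<open>Iterated derivatives and the algebra of smooth functions\<close>

lemma iter_deriv_append: "iter_deriv (vs @ ws) f = iter_deriv vs (iter_deriv ws f)"
  by (induction vs) auto

lemma smooth_differentiable:
  assumes "smooth f"
  shows "f differentiable at x"
  using assms[unfolded smooth_def, rule_format, of "[]" x] by simp

lemma smooth_iter_deriv:
  assumes "smooth f" "set vs \<subseteq> Basis"
  shows "smooth (iter_deriv vs f)"
  unfolding smooth_def iter_deriv_append[symmetric]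
  using assms by (simp add: smooth_def)

lemma iter_deriv_eqI:
  assumes "\<And>x. (f has_derivative f' x) (at x)"
  shows "iter_deriv [v] f = (\<lambda>x. f' x v)"
  using frechet_derivative_at[OF assms] by (auto simp: fun_eq_iff)

lemma smooth_has_derivative:
  assumes "smooth f"
  shows "(f has_derivative (\<lambda>v. iter_deriv [v] f x)) (at x)"
  using smooth_differentiable[OF assms, of x] unfolding frechet_derivative_works by simp

text \<open>A class closed under partial derivatives replaces formulas for higher derivatives: by
  induction on the list of directions every iterated derivative stays in \<open>S\<close>, hence is
  differentiable.\<close>

lemma smooth_coinduct:
  assumes "f \<in> S"
    and "\<And>f. f \<in> S \<Longrightarrow>
      \<exists>f'. (\<forall>x. (f has_derivative f' x) (at x)) \<and> (\<forall>v\<in>Basis. (\<lambda>x. f' x v) \<in> S)"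
  shows "smooth f"
proof -
  have "iter_deriv vs f \<in> S" if "set vs \<subseteq> Basis" for vs
    using that
  proof (induction vs)
    case (Cons v vs)
    then have "iter_deriv vs f \<in> S" "v \<in> Basis" by auto
    from assms(2)[OF this(1)] obtain f' where f': "\<And>x. (iter_deriv vs f has_derivative f' x) (at x)"
      "\<And>v. v \<in> Basis \<Longrightarrow> (\<lambda>x. f' x v) \<in> S" by auto
    have "iter_deriv (v # vs) f = (\<lambda>x. f' x v)"
      using iter_deriv_eqI[OF f'(1), where v=v] by simp
    then show ?case using f'(2)[OF \<open>v \<in> Basis\<close>] by simp
  qed (use assms in auto)
  then show ?thesis
    unfolding smooth_def using assms(2) differentiable_def by metis
qed

lemma smooth_const: "smooth (\<lambda>_. c)"
  by (rule smooth_coinduct[where S="range (\<lambda>c _. c)"])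
    (auto intro!: exI[of _ "\<lambda>_ _. 0"] has_derivative_const)

lemma smooth_inner: "smooth (\<lambda>x. of_real (x \<bullet> w))"
proof (rule smooth_coinduct[where S="{\<lambda>x. of_real (x \<bullet> w)} \<union> range (\<lambda>c _. c)"], goal_cases)
  case (2 f)
  show ?case
  proof (cases "f \<in> range (\<lambda>c _. c)")
    case True then show ?thesis
      by (auto intro!: exI[of _ "\<lambda>_ _. 0"] has_derivative_const)
  next
    case False
    then have f: "f = (\<lambda>x. of_real (x \<bullet> w))" using 2 by auto
    have "bounded_linear (\<lambda>x. complex_of_real (x \<bullet> w))"
      by (rule bounded_linear_compose[OF bounded_linear_of_real bounded_linear_inner_left])
    then show ?thesis unfolding f
      by (intro exI[of _ "\<lambda>_ v. of_real (v \<bullet> w)"]) (auto intro: bounded_linear_imp_has_derivative)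
  qed
qed auto

text \<open>Differentiating sums, products, compositions and reciprocals yields sums of products of
  the same shapes, so this set can serve as the class in \<open>smooth_coinduct\<close>. In
  \<open>comp\<close> and \<open>inv\<close> the ingredients are required to be smooth rather than
  members, so that the derivative of an ingredient is again an admissible ingredient.\<close>

inductive_set smooth_alg :: "('a::euclidean_space \<Rightarrow> complex) set" where
  base: "smooth f \<Longrightarrow> f \<in> smooth_alg"
| add: "f \<in> smooth_alg \<Longrightarrow> g \<in> smooth_alg \<Longrightarrow> (\<lambda>x. f x + g x) \<in> smooth_alg"
| mult: "f \<in> smooth_alg \<Longrightarrow> g \<in> smooth_alg \<Longrightarrow> (\<lambda>x. f x * g x) \<in> smooth_alg"
| comp: "smooth (F :: real \<Rightarrow> complex) \<Longrightarrow> smooth (\<lambda>x. of_real (u x)) \<Longrightarrow> (\<lambda>x. F (u x)) \<in> smooth_alg"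
| inv: "smooth f \<Longrightarrow> (\<And>x. f x \<noteq> 0) \<Longrightarrow> (\<lambda>x. inverse (f x)) \<in> smooth_alg"

text \<open>Smoothness is only defined for complex values, so a real inner function of a composition
  enters through its embedding. Its derivative is real because the imaginary part is constantly
  0.\<close>

lemma has_derivative_of_real_D:
  assumes "((\<lambda>x. complex_of_real (u x)) has_derivative D) (at x)"
  shows "(u has_derivative (\<lambda>v. Re (D v))) (at x)" "of_real (Re (D v)) = D v"
proof -
  have "((\<lambda>x. Re (complex_of_real (u x))) has_derivative (\<lambda>v. Re (D v))) (at x)"
    by (intro bounded_linear.has_derivative[OF bounded_linear_Re] assms)
  then show "(u has_derivative (\<lambda>v. Re (D v))) (at x)" by simp
  have "((\<lambda>x. Im (complex_of_real (u x))) has_derivative (\<lambda>v. Im (D v))) (at x)"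
    by (intro bounded_linear.has_derivative[OF bounded_linear_Im] assms)
  then have "((\<lambda>x. 0) has_derivative (\<lambda>v. Im (D v))) (at x)" by simp
  then have "(\<lambda>v. Im (D v)) = (\<lambda>v. 0)" 
    using has_derivative_const has_derivative_unique by blast
  then show "of_real (Re (D v)) = D v" by (simp add: complex_eq_iff fun_eq_iff)
qed

lemma smooth_compose_has_derivative:
  fixes F :: "real \<Rightarrow> complex" and u :: "'a::euclidean_space \<Rightarrow> real"
  assumes F: "smooth F" and u: "smooth (\<lambda>x. of_real (u x))"
  shows "((\<lambda>x. F (u x)) has_derivative (\<lambda>b. iter_deriv [1] F (u x) * iter_deriv [b] (\<lambda>x. of_real (u x)) x)) (at x)"
proof -
  define D where "D = (\<lambda>v. iter_deriv [v] (\<lambda>x. complex_of_real (u x)) x)"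
  define F' where "F' = iter_deriv [1] F"
  have D: "((\<lambda>x. complex_of_real (u x)) has_derivative D) (at x)"
    unfolding D_def by (rule smooth_has_derivative[OF u])
  have dF: "(F has_derivative (\<lambda>h. h *\<^sub>R F' y)) (at y)" for y
  proof -
    have *: "(F has_derivative (\<lambda>h. iter_deriv [h] F y)) (at y)" by (rule smooth_has_derivative[OF F])
    interpret bounded_linear "\<lambda>h. iter_deriv [h] F y" using * by (rule has_derivative_bounded_linear)
    have "iter_deriv [h] F y = h *\<^sub>R F' y" for h using scale[of h 1] by (simp add: F'_def)
    then show ?thesis using * by (simp del: iter_deriv.simps)
  qed
  have "((\<lambda>x. F (u x)) has_derivative (\<lambda>v. Re (D v) *\<^sub>R F' (u x))) (at x)"
    by (rule has_derivative_compose[OF has_derivative_of_real_D(1)[OF D] dF])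
  then have "((\<lambda>x. F (u x)) has_derivative (\<lambda>b. F' (u x) * D b)) (at x)"
    using has_derivative_of_real_D(2)[OF D] by (simp add: scaleR_conv_of_real mult.commute)
  then show ?thesis
    by (simp only: D_def F'_def)
qed

lemma iter_deriv_compose:
  fixes F :: "real \<Rightarrow> complex" and u :: "'a::euclidean_space \<Rightarrow> real"
  assumes "smooth F" "smooth (\<lambda>x. of_real (u x))"
  shows "iter_deriv [b] (\<lambda>x. F (u x)) = (\<lambda>x. iter_deriv [1] F (u x) * iter_deriv [b] (\<lambda>x. of_real (u x)) x)"
  by (rule iter_deriv_eqI[OF smooth_compose_has_derivative[OF assms]])

lemma smooth_alg_smooth:
  assumes "f \<in> smooth_alg"
  shows "smooth f"
proof (rule smooth_coinduct[OF assms])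
  fix f :: "'a \<Rightarrow> complex" assume "f \<in> smooth_alg"
  then show "\<exists>f'. (\<forall>x. (f has_derivative f' x) (at x)) \<and> (\<forall>v\<in>Basis. (\<lambda>x. f' x v) \<in> smooth_alg)"
  proof induction
    case (base f)
    then show ?case using smooth_has_derivative[OF base]
      by (intro exI[of _ "\<lambda>x v. iter_deriv [v] f x"])
        (use smooth_iter_deriv[OF base] in \<open>auto intro!: smooth_alg.base simp del: iter_deriv.simps\<close>)
  next
    case (add f g)
    from add.IH(1) obtain f' where f': "\<And>x. (f has_derivative f' x) (at x)"
      "\<And>v. v\<in>Basis \<Longrightarrow> (\<lambda>x. f' x v) \<in> smooth_alg" by blast
    from add.IH(2) obtain g' where g': "\<And>x. (g has_derivative g' x) (at x)"
      "\<And>v. v\<in>Basis \<Longrightarrow> (\<lambda>x. g' x v) \<in> smooth_alg" by blast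
    show ?case
      by (intro exI[of _ "\<lambda>x v. f' x v + g' x v"]) (auto intro!: has_derivative_add smooth_alg.add f' g')
  next
    case (mult f g)
    from mult.IH(1) obtain f' where f': "\<And>x. (f has_derivative f' x) (at x)"
      "\<And>v. v\<in>Basis \<Longrightarrow> (\<lambda>x. f' x v) \<in> smooth_alg" by blast
    from mult.IH(2) obtain g' where g': "\<And>x. (g has_derivative g' x) (at x)"
      "\<And>v. v\<in>Basis \<Longrightarrow> (\<lambda>x. g' x v) \<in> smooth_alg" by blast
    show ?case
      by (intro exI[of _ "\<lambda>x v. f x * g' x v + f' x v * g x"])
        (auto intro!: has_derivative_mult smooth_alg.add smooth_alg.mult mult.hyps f' g')
  next
    case (comp F u)
    show ?case
    proof (intro exI[of _ "\<lambda>x v. iter_deriv [1] F (u x) * iter_deriv [v] (\<lambda>x. of_real (u x)) x"] conjI allI ballI)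
      fix x
      show "((\<lambda>x. F (u x)) has_derivative (\<lambda>v. iter_deriv [1] F (u x) * iter_deriv [v] (\<lambda>x. of_real (u x)) x)) (at x)"
        by (rule smooth_compose_has_derivative[OF comp])
    next
      fix v :: 'a assume "v \<in> Basis"
      then show "(\<lambda>x. iter_deriv [1] F (u x) * iter_deriv [v] (\<lambda>x. of_real (u x)) x) \<in> smooth_alg"
        by (intro smooth_alg.mult smooth_alg.comp comp smooth_alg.base smooth_iter_deriv) auto
    qed
  next
    case (inv f)
    define D where "D = (\<lambda>x v. iter_deriv [v] f x)"
    have D: "(f has_derivative D x) (at x)" for x
      using smooth_has_derivative[OF inv(1)] by (simp add: D_def)
    have sD: "smooth (\<lambda>x. D x v)" if "v \<in> Basis" for v
      using smooth_iter_deriv[OF inv(1), of "[v]"] that by (simp add: D_def)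
    show ?case
    proof (intro exI[of _ "\<lambda>x v. (- 1) * (inverse (f x) * D x v * inverse (f x))"] conjI allI ballI)
      fix x
      show "((\<lambda>x. inverse (f x)) has_derivative (\<lambda>v. (- 1) * (inverse (f x) * D x v * inverse (f x)))) (at x)"
        using Deriv.has_derivative_inverse[OF inv(2) D, of x] by simp
    next
      fix v :: 'a assume "v \<in> Basis"
      then show "(\<lambda>x. (- 1) * (inverse (f x) * D x v * inverse (f x))) \<in> smooth_alg"
        by (intro smooth_alg.mult smooth_alg.inv inv smooth_alg.base sD smooth_const)
    qed
  qed
qed

lemma smooth_add: "smooth f \<Longrightarrow> smooth g \<Longrightarrow> smooth (\<lambda>x. f x + g x)"
  by (rule smooth_alg_smooth[OF smooth_alg.add[OF smooth_alg.base smooth_alg.base]])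

lemma smooth_mult: "smooth f \<Longrightarrow> smooth g \<Longrightarrow> smooth (\<lambda>x. f x * g x)"
  by (rule smooth_alg_smooth[OF smooth_alg.mult[OF smooth_alg.base smooth_alg.base]])

lemma smooth_compose: "smooth F \<Longrightarrow> smooth (\<lambda>x. of_real (u x)) \<Longrightarrow> smooth (\<lambda>x. F (u x))"
  by (rule smooth_alg_smooth[OF smooth_alg.comp])

lemma smooth_inverse: "smooth f \<Longrightarrow> (\<And>x. f x \<noteq> 0) \<Longrightarrow> smooth (\<lambda>x. inverse (f x))"
  by (rule smooth_alg_smooth[OF smooth_alg.inv])

lemma smooth_cmult: "smooth f \<Longrightarrow> smooth (\<lambda>x. c * f x)"
  by (intro smooth_mult smooth_const)

lemma smooth_minus: "smooth f \<Longrightarrow> smooth (\<lambda>x. - f x)"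
  using smooth_cmult[of f "-1"] by simp

lemma smooth_diff: "smooth f \<Longrightarrow> smooth g \<Longrightarrow> smooth (\<lambda>x. f x - g x)"
  using smooth_add[OF _ smooth_minus, of f g] by simp

lemma smooth_sum: "(\<And>i. i \<in> I \<Longrightarrow> smooth (f i)) \<Longrightarrow> smooth (\<lambda>x. \<Sum>i\<in>I. f i x)"
  by (induction I rule: infinite_finite_induct) (auto intro: smooth_const smooth_add)

text \<open>Each derivative contributes one factor \<open>c\<close> by the chain rule. The side
  condition on \<open>vs\<close> sits in the conclusion as a disjunct so that the induction runs
  without a premise.\<close>

lemma iter_deriv_affine:
  assumes "smooth f"
  shows "iter_deriv vs (\<lambda>x. f (c *\<^sub>R x + a)) = (\<lambda>x. of_real (c ^ length vs) * iter_deriv vs f (c *\<^sub>R x + a))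
    \<or> \<not> set vs \<subseteq> Basis"
proof (induction vs)
  case (Cons v vs)
  show ?case
  proof (cases "set (v # vs) \<subseteq> Basis")
    case True
    then have IH: "iter_deriv vs (\<lambda>x. f (c *\<^sub>R x + a)) = (\<lambda>x. of_real (c ^ length vs) * iter_deriv vs f (c *\<^sub>R x + a))"
      using Cons by auto
    have s: "smooth (iter_deriv vs f)" using assms True by (intro smooth_iter_deriv) auto
    have "(iter_deriv vs (\<lambda>x. f (c *\<^sub>R x + a)) has_derivative 
      (\<lambda>w. of_real (c ^ length vs) * iter_deriv [c *\<^sub>R w] (iter_deriv vs f) (c *\<^sub>R x + a))) (at x)" for x
      unfolding IH
      by (intro has_derivative_mult_right has_derivative_compose[OF _ smooth_has_derivative[OF s], of "\<lambda>x. c *\<^sub>R x + a"])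
        (auto intro!: derivative_eq_intros)
    then have "iter_deriv [v] (iter_deriv vs (\<lambda>x. f (c *\<^sub>R x + a))) =
      (\<lambda>x. of_real (c ^ length vs) * iter_deriv [c *\<^sub>R v] (iter_deriv vs f) (c *\<^sub>R x + a))"
      by (rule iter_deriv_eqI)
    moreover have "iter_deriv [c *\<^sub>R v] (iter_deriv vs f) y = of_real c * iter_deriv [v] (iter_deriv vs f) y" for y
    proof -
      interpret bounded_linear "\<lambda>h. iter_deriv [h] (iter_deriv vs f) y" 
        using smooth_has_derivative[OF s] by (rule has_derivative_bounded_linear)
      show ?thesis using scale[of c v] by (simp add: scaleR_conv_of_real)
    qed
    ultimately show ?thesis by (simp add: mult_ac)
  qed auto
qed auto

lemma smooth_affine:
  assumes "smooth f"
  shows "smooth (\<lambda>x. f (c *\<^sub>R x + a))"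
proof (rule smooth_coinduct[where S="{\<lambda>x. b * g (c *\<^sub>R x + a) | b g. smooth g}"])
  show "(\<lambda>x. f (c *\<^sub>R x + a)) \<in> {\<lambda>x. b * g (c *\<^sub>R x + a) | b g. smooth g}"
    using assms by (auto intro!: exI[of _ 1])
next
  fix h assume "h \<in> {\<lambda>x. b * g (c *\<^sub>R x + a) | b g. smooth g}"
  then obtain b g where h: "h = (\<lambda>x. b * g (c *\<^sub>R x + a))" and g: "smooth g" by auto
  show "\<exists>h'. (\<forall>x. (h has_derivative h' x) (at x)) \<and> (\<forall>v\<in>Basis. (\<lambda>x. h' x v) \<in> {\<lambda>x. b * g (c *\<^sub>R x + a) | b g. smooth g})"
  proof (intro exI[of _ "\<lambda>x v. b * iter_deriv [c *\<^sub>R v] g (c *\<^sub>R x + a)"] conjI allI ballI)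
    fix x show "(h has_derivative (\<lambda>v. b * iter_deriv [c *\<^sub>R v] g (c *\<^sub>R x + a))) (at x)"
      unfolding h
      by (intro has_derivative_mult_right has_derivative_compose[OF _ smooth_has_derivative[OF g], of "\<lambda>x. c *\<^sub>R x + a"])
        (auto intro!: derivative_eq_intros)
  next
    fix v :: 'a assume v: "v \<in> Basis"
    have *: "iter_deriv [c *\<^sub>R v] g y = of_real c * iter_deriv [v] g y" for y
    proof -
      interpret bounded_linear "\<lambda>h. iter_deriv [h] g y" 
        using smooth_has_derivative[OF g] by (rule has_derivative_bounded_linear)
      show ?thesis using scale[of c v] by (simp add: scaleR_conv_of_real)
    qed
    show "(\<lambda>x. b * iter_deriv [c *\<^sub>R v] g (c *\<^sub>R x + a)) \<in> {\<lambda>x. b * g (c *\<^sub>R x + a) | b g. smooth g}"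
      unfolding * using smooth_iter_deriv[OF g, of "[v]"] v
      by (auto intro!: exI[of _ "b * of_real c"] exI[of _ "iter_deriv [v] g"] simp: mult_ac)
  qed
qed


section \<open>Flat functions, smooth steps and cutoffs\<close>

text \<open>The polynomial factor makes the family closed under differentiation, which
  \<open>exp (- (1 / t))\<close> alone is not.\<close>

definition flat_poly :: "real poly \<Rightarrow> real \<Rightarrow> real" where
  "flat_poly p t = (if t > 0 then poly p (1 / t) * exp (- (1 / t)) else 0)"

lemma poly_exp_tendsto_0: "((\<lambda>y. poly p y * exp (- y)) \<longlongrightarrow> (0::real)) at_top"
proof -
  have "((\<lambda>y. \<Sum>i\<le>degree p. coeff p i * (y ^ i / exp y)) \<longlongrightarrow> (\<Sum>i\<le>degree p. coeff p i * 0)) at_top"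
    by (intro tendsto_sum tendsto_mult_left tendsto_power_div_exp_0)
  then show ?thesis by (simp add: poly_altdef exp_minus field_class.field_divide_inverse sum_distrib_right mult.assoc)
qed

text \<open>With \<open>y = 1 / t\<close>, the derivative of \<open>p(y) exp(-y)\<close> in
  \<open>t\<close> is \<open>y\<^sup>2 (p(y) - p'(y)) exp(-y)\<close>. At 0 the difference quotient
  from the right is \<open>y p(y) exp(-y)\<close> with \<open>y\<close> tending to infinity, and
  from the left it is 0.\<close>

lemma has_real_derivative_flat_poly:
  "(flat_poly p has_real_derivative flat_poly ([:0, 0, 1:] * (p - pderiv p)) t) (at t)"
proof -
  consider "t > 0" | "t < 0" | "t = 0" by linarith
  then show ?thesis
  proof cases
    case 1
    have "((\<lambda>t. poly p (1 / t) * exp (- (1 / t))) has_real_derivative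
       flat_poly ([:0, 0, 1:] * (p - pderiv p)) t) (at t)"
      unfolding flat_poly_def using 1
      by (auto intro!: derivative_eq_intros DERIV_chain2[OF poly_DERIV]
          simp: field_simps power2_eq_square)
    then show ?thesis
      by (rule DERIV_cong_ev[THEN iffD1, OF refl _ refl, rotated])
        (use 1 in \<open>auto simp: flat_poly_def eventually_nhds intro!: exI[of _ "{0<..}"]\<close>)
  next
    case 2
    have "((\<lambda>t. 0) has_real_derivative flat_poly ([:0, 0, 1:] * (p - pderiv p)) t) (at t)"
      unfolding flat_poly_def using 2 by auto
    then show ?thesis
      by (rule DERIV_cong_ev[THEN iffD1, OF refl _ refl, rotated])
        (use 2 in \<open>auto simp: flat_poly_def eventually_nhds intro!: exI[of _ "{..<0}"]\<close>)
  next
    case 3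
    have "((\<lambda>h. poly ([:0, 1:] * p) (1 / h) * exp (- (1 / h))) \<longlongrightarrow> 0) (at_right 0)"
      using poly_exp_tendsto_0[of "[:0, 1:] * p"] unfolding filterlim_at_top_to_right
      by (simp add: inverse_eq_divide)
    moreover have "eventually (\<lambda>h. flat_poly p h / h = poly ([:0, 1:] * p) (1 / h) * exp (- (1 / h))) (at_right 0)"
      by (auto simp: flat_poly_def eventually_at_filter)
    ultimately have r: "((\<lambda>h. flat_poly p h / h) \<longlongrightarrow> 0) (at_right 0)"
      by (subst tendsto_cong) 
    have l: "((\<lambda>h. flat_poly p h / h) \<longlongrightarrow> 0) (at_left 0)"
      by (rule tendsto_eventually) (auto simp: flat_poly_def eventually_at_filter)
    have "((\<lambda>h. flat_poly p h / h) \<longlongrightarrow> 0) (at 0)"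
      using l r by (rule filterlim_split_at)
    then show ?thesis by (simp add: DERIV_def 3 flat_poly_def)
  qed
qed

lemma smooth_flat_poly: "smooth (\<lambda>t. complex_of_real (flat_poly p t))"
proof (rule smooth_coinduct[where S="range (\<lambda>p t. complex_of_real (flat_poly p t))"])
  fix f assume "f \<in> range (\<lambda>p t. complex_of_real (flat_poly p t))"
  then obtain p where f: "f = (\<lambda>t. complex_of_real (flat_poly p t))" by auto
  define q where "q = [:0, 0, 1:] * (p - pderiv p)"
  have "(f has_derivative (\<lambda>h. complex_of_real (flat_poly q t * h))) (at t)" for t
    unfolding f q_def
    using has_real_derivative_flat_poly[of p t] unfolding has_field_derivative_def
    by (rule has_derivative_of_real)
  then show "\<exists>f'. (\<forall>x. (f has_derivative f' x) (at x)) \<and>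
           (\<forall>v\<in>Basis. (\<lambda>x. f' x v) \<in> range (\<lambda>p t. complex_of_real (flat_poly p t)))"
    by (intro exI[of _ "\<lambda>t h. complex_of_real (flat_poly q t * h)"]) auto
qed auto

definition smooth_step :: "real \<Rightarrow> real" where
  "smooth_step t = flat_poly 1 t / (flat_poly 1 t + flat_poly 1 (1 - t))"

lemma flat_poly_1_nonneg: "flat_poly 1 t \<ge> 0" and flat_poly_1_pos: "t > 0 \<Longrightarrow> flat_poly 1 t > 0"
  and flat_poly_nonpos: "t \<le> 0 \<Longrightarrow> flat_poly p t = 0"
  by (auto simp: flat_poly_def)

lemma smooth_step_denom_pos: "flat_poly 1 t + flat_poly 1 (1 - t) > 0"
  using flat_poly_1_pos[of t] flat_poly_1_pos[of "1 - t"] flat_poly_1_nonneg[of t] flat_poly_1_nonneg[of "1 - t"]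
  by (cases "t > 0") (auto intro: add_nonneg_pos add_pos_nonneg)

lemma smooth_step_0: "t \<le> 0 \<Longrightarrow> smooth_step t = 0"
  and smooth_step_1: "t \<ge> 1 \<Longrightarrow> smooth_step t = 1"
  and smooth_step_nonneg: "smooth_step t \<ge> 0"
  and smooth_step_le_1: "smooth_step t \<le> 1"
  using smooth_step_denom_pos[of t] flat_poly_1_nonneg[of t] flat_poly_1_nonneg[of "1-t"]
  by (auto simp: smooth_step_def flat_poly_nonpos)

lemma smooth_smooth_step: "smooth (\<lambda>t. complex_of_real (smooth_step t))"
proof -
  have 1: "smooth (\<lambda>t. complex_of_real (flat_poly 1 (1 - t)))"
    using smooth_affine[OF smooth_flat_poly, of 1 "-1" 1] by (simp add: algebra_simps)
  have "smooth (\<lambda>t. complex_of_real (flat_poly 1 t) * 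
     inverse (complex_of_real (flat_poly 1 t) + complex_of_real (flat_poly 1 (1 - t))))"
  proof (intro smooth_mult smooth_inverse smooth_add smooth_flat_poly 1)
    fix t show "complex_of_real (flat_poly 1 t) + complex_of_real (flat_poly 1 (1 - t)) \<noteq> 0"
      using smooth_step_denom_pos[of t] 
      by (metis of_real_add of_real_eq_0_iff less_irrefl)
  qed
  then show ?thesis by (simp add: smooth_step_def divide_inverse)
qed

text \<open>The square \<open>x \<bullet> x\<close> is a polynomial in the coordinates, so there is
  no trouble with the norm at the origin. The step argument is at least 1 on the closed unit ball
  and nonpositive as soon as \<open>x \<bullet> x \<ge> 2\<close>.\<close>

definition ball_cutoff :: "'a::euclidean_space \<Rightarrow> real" where
  "ball_cutoff x = smooth_step (2 - x \<bullet> x)"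

lemma smooth_ball_cutoff: "smooth (\<lambda>x::'a::euclidean_space. complex_of_real (ball_cutoff x))"
proof -
  have "smooth (\<lambda>x::'a. 2 - (\<Sum>b\<in>Basis. complex_of_real (x \<bullet> b) * complex_of_real (x \<bullet> b)))"
    by (intro smooth_diff smooth_sum smooth_mult smooth_const smooth_inner)
  then have "smooth (\<lambda>x::'a. complex_of_real (2 - x \<bullet> x))"
    by (subst euclidean_inner) simp
  from smooth_compose[OF smooth_smooth_step this] show ?thesis by (simp add: ball_cutoff_def)
qed

lemma ball_cutoff_1:
  assumes "norm x \<le> 1" shows "ball_cutoff x = 1"
proof -
  have "x \<bullet> x \<le> 1" using power_mono[OF assms, of 2] by (simp add: power2_norm_eq_inner)
  then show ?thesis unfolding ball_cutoff_def by (intro smooth_step_1) simp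
qed

lemma ball_cutoff_0:
  assumes "norm x \<ge> 2" shows "ball_cutoff x = 0"
proof -
  have "x \<bullet> x \<ge> 4" using power_mono[OF assms, of 2] by (simp add: power2_norm_eq_inner)
  then show ?thesis unfolding ball_cutoff_def by (intro smooth_step_0) simp
qed

lemma ball_cutoff_nonneg: "ball_cutoff x \<ge> 0" and ball_cutoff_le_1: "ball_cutoff x \<le> 1"
  by (simp_all add: ball_cutoff_def smooth_step_nonneg smooth_step_le_1)

section \<open>Supports and test functions\<close>

lemma smooth_continuous_on: "smooth f \<Longrightarrow> continuous_on S f"
  by (intro differentiable_imp_continuous_on differentiable_at_imp_differentiable_on smooth_differentiable)

lemma fun_supp_subset_closed:
  assumes "closed S" "\<And>x. x \<notin> S \<Longrightarrow> f x = 0"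
  shows "fun_supp f \<subseteq> S"
  unfolding fun_supp_def using assms by (intro closure_minimal) auto

lemma fun_supp_zero: "x \<notin> fun_supp f \<Longrightarrow> f x = 0"
  unfolding fun_supp_def using closure_subset[of "{x. f x \<noteq> 0}"] by auto

lemma closed_fun_supp: "closed (fun_supp f)"
  by (simp add: fun_supp_def)

lemma fun_supp_mult_left: "fun_supp (\<lambda>x. f x * g x) \<subseteq> fun_supp f"
  and fun_supp_mult_right: "fun_supp (\<lambda>x. f x * g x) \<subseteq> fun_supp g"
  by (rule fun_supp_subset_closed[OF closed_fun_supp], simp add: fun_supp_zero)+

lemma test_funs_smooth: "\<phi> \<in> test_funs \<Longrightarrow> smooth \<phi>"
  and test_funs_compact: "\<phi> \<in> test_funs \<Longrightarrow> compact (fun_supp \<phi>)"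
  by (auto simp: test_funs_def)

lemma test_funsI:
  assumes "smooth f" "compact S" "\<And>x. x \<notin> S \<Longrightarrow> f x = 0"
  shows "f \<in> test_funs"
proof -
  have "fun_supp f \<subseteq> S" using assms by (intro fun_supp_subset_closed compact_imp_closed) auto
  then have "compact (fun_supp f)"
    using assms(2) closed_fun_supp by (metis compact_Int_closed inf.absorb_iff2)
  then show ?thesis using assms by (simp add: test_funs_def)
qed

lemma test_funsE:
  assumes "\<phi> \<in> test_funs"
  obtains R where "R > 0" "\<And>x. \<phi> x \<noteq> 0 \<Longrightarrow> norm x \<le> R"
proof -
  have "bounded (fun_supp \<phi>)" using assms by (intro compact_imp_bounded test_funs_compact)
  then obtain R where "R > 0" "\<forall>x\<in>fun_supp \<phi>. norm x \<le> R" by (auto simp: bounded_pos)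
  then show ?thesis using that[of R] fun_supp_zero by blast
qed

lemma test_funs_mult_left: "\<phi> \<in> test_funs \<Longrightarrow> smooth f \<Longrightarrow> (\<lambda>x. \<phi> x * f x) \<in> test_funs"
  by (rule test_funsI[of _ "fun_supp \<phi>"]) (auto intro: smooth_mult test_funs_smooth test_funs_compact simp: fun_supp_zero)

lemma test_funs_cmult: "\<phi> \<in> test_funs \<Longrightarrow> (\<lambda>x. c * \<phi> x) \<in> test_funs"
  using test_funs_mult_left[OF _ smooth_const, of \<phi> c] by (simp add: mult.commute)

lemma test_funs_add: "\<phi> \<in> test_funs \<Longrightarrow> \<psi> \<in> test_funs \<Longrightarrow> (\<lambda>x. \<phi> x + \<psi> x) \<in> test_funs"
  by (rule test_funsI[of _ "fun_supp \<phi> \<union> fun_supp \<psi>"])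
    (auto intro: smooth_add test_funs_smooth test_funs_compact simp: fun_supp_zero)

lemma test_funs_diff: "\<phi> \<in> test_funs \<Longrightarrow> \<psi> \<in> test_funs \<Longrightarrow> (\<lambda>x. \<phi> x - \<psi> x) \<in> test_funs"
  by (rule test_funsI[of _ "fun_supp \<phi> \<union> fun_supp \<psi>"])
    (auto intro: smooth_diff test_funs_smooth test_funs_compact simp: fun_supp_zero)

lemma test_funs_0: "(\<lambda>_. 0) \<in> test_funs"
  by (rule test_funsI[of _ "{}"]) (auto intro: smooth_const)

lemma test_funs_sum: "(\<And>i. i \<in> I \<Longrightarrow> f i \<in> test_funs) \<Longrightarrow> (\<lambda>x. \<Sum>i\<in>I. f i x) \<in> test_funs"
  by (induction I rule: infinite_finite_induct) (auto intro: test_funs_0 test_funs_add)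

lemma iter_deriv_add:
  assumes "smooth f" "smooth g" "set vs \<subseteq> Basis"
  shows "iter_deriv vs (\<lambda>x. f x + g x) = (\<lambda>x. iter_deriv vs f x + iter_deriv vs g x)"
  using assms(3)
proof (induction vs)
  case (Cons v vs)
  then have "smooth (iter_deriv vs f)" "smooth (iter_deriv vs g)"
    using assms smooth_iter_deriv by auto
  from smooth_has_derivative[OF this(1)] smooth_has_derivative[OF this(2)]
  have "((\<lambda>x. iter_deriv vs f x + iter_deriv vs g x) has_derivative
    (\<lambda>v. iter_deriv [v] (iter_deriv vs f) x + iter_deriv [v] (iter_deriv vs g) x)) (at x)" for x
    by (rule has_derivative_add)
  from iter_deriv_eqI[OF this, of v] Cons show ?case by simp
qed auto

lemma iter_deriv_cmult:
  assumes "smooth f" "set vs \<subseteq> Basis"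
  shows "iter_deriv vs (\<lambda>x. c * f x) = (\<lambda>x. c * iter_deriv vs f x)"
  using assms(2)
proof (induction vs)
  case (Cons v vs)
  then have "smooth (iter_deriv vs f)"
    using assms smooth_iter_deriv by auto
  from smooth_has_derivative[OF this(1)]
  have "((\<lambda>x. c * iter_deriv vs f x) has_derivative
    (\<lambda>v. c * iter_deriv [v] (iter_deriv vs f) x)) (at x)" for x
    by (rule has_derivative_mult_right)
  from iter_deriv_eqI[OF this, of v] Cons show ?case by simp
qed auto

lemma iter_deriv_diff:
  assumes "smooth f" "smooth g" "set vs \<subseteq> Basis"
  shows "iter_deriv vs (\<lambda>x. f x - g x) = (\<lambda>x. iter_deriv vs f x - iter_deriv vs g x)"
  using iter_deriv_add[OF assms(1) smooth_cmult[OF assms(2)] assms(3), of "-1"]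
    iter_deriv_cmult[OF assms(2,3), of "-1"] by simp

lemma iter_deriv_mult_Basis:
  assumes "smooth f" "smooth g"
  shows "iter_deriv [v] (\<lambda>x. f x * g x) = (\<lambda>x. iter_deriv [v] f x * g x + f x * iter_deriv [v] g x)"
  using iter_deriv_eqI[OF has_derivative_mult[OF smooth_has_derivative[OF assms(1)] smooth_has_derivative[OF assms(2)]], of v]
  by (simp add: add.commute)

lemma fun_supp_iter_deriv: "fun_supp (iter_deriv vs \<phi>) \<subseteq> fun_supp \<phi>"
proof (induction vs)
  case (Cons v vs)
  let ?f = "iter_deriv vs \<phi>"
  have "iter_deriv (v # vs) \<phi> x = 0" if "x \<notin> fun_supp ?f" for x
  proof -
    have "((\<lambda>_. 0::complex) has_derivative (\<lambda>_. 0)) (at x)" by (rule has_derivative_const)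
    then have "(?f has_derivative (\<lambda>_. 0)) (at x)"
      by (rule has_derivative_transform_within_open[of _ _ _ _ "- fun_supp ?f"])
        (use that fun_supp_zero[of _ ?f] closed_fun_supp in auto)
    from frechet_derivative_at[OF this] show ?thesis by (metis iter_deriv.simps(2))
  qed
  then have "fun_supp (iter_deriv (v # vs) \<phi>) \<subseteq> fun_supp ?f"
    by (intro fun_supp_subset_closed closed_fun_supp)
  with Cons show ?case by blast
qed auto

lemma iter_deriv_test_funs:
  assumes "\<phi> \<in> test_funs" "set vs \<subseteq> Basis"
  shows "iter_deriv vs \<phi> \<in> test_funs"
proof (rule test_funsI)
  show "iter_deriv vs \<phi> x = 0" if "x \<notin> fun_supp \<phi>" for x
    using fun_supp_zero that fun_supp_iter_deriv by blast
qed (use assms smooth_iter_deriv test_funs_smooth test_funs_compact in blast)+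

lemma test_funs_bounded:
  assumes "\<phi> \<in> test_funs"
  obtains B where "B > 0" "\<And>x. cmod (\<phi> x) \<le> B"
proof -
  have "compact (\<phi> ` fun_supp \<phi>)"
    using assms by (intro compact_continuous_image smooth_continuous_on test_funs_smooth test_funs_compact)
  from compact_imp_bounded[OF this]
  obtain B where B: "B > 0" "\<forall>x\<in>fun_supp \<phi>. cmod (\<phi> x) \<le> B"
    unfolding bounded_pos by blast
  then have "cmod (\<phi> x) \<le> B" for x using fun_supp_zero[of x \<phi>] by (cases "x \<in> fun_supp \<phi>") auto
  then show ?thesis using that B by blast
qed

definition cutoff :: "'a::euclidean_space \<Rightarrow> real \<Rightarrow> 'a \<Rightarrow> complex" where
  "cutoff a r x = of_real (ball_cutoff ((1 / r) *\<^sub>R x + (- (1 / r)) *\<^sub>R a))"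

lemma cutoff_1: "r > 0 \<Longrightarrow> dist a x \<le> r \<Longrightarrow> cutoff a r x = 1"
  and cutoff_0: "r > 0 \<Longrightarrow> dist a x \<ge> 2 * r \<Longrightarrow> cutoff a r x = 0"
proof -
  assume r: "r > 0"
  have "norm ((1 / r) *\<^sub>R x + (- (1 / r)) *\<^sub>R a) = dist a x / r"
    using r by (simp add: dist_norm norm_minus_commute flip: scaleR_diff_right)
  then have "dist a x \<le> r \<Longrightarrow> norm ((1 / r) *\<^sub>R x + (- (1 / r)) *\<^sub>R a) \<le> 1"
    "dist a x \<ge> 2 * r \<Longrightarrow> norm ((1 / r) *\<^sub>R x + (- (1 / r)) *\<^sub>R a) \<ge> 2"
    using r by (simp_all add: le_divide_eq)
  then show "dist a x \<le> r \<Longrightarrow> cutoff a r x = 1" "dist a x \<ge> 2 * r \<Longrightarrow> cutoff a r x = 0"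
    unfolding cutoff_def by (simp_all only: ball_cutoff_1 ball_cutoff_0 of_real_1 of_real_0)
qed

lemma cutoff_test_funs:
  assumes "r > 0" shows "cutoff a r \<in> test_funs"
proof (rule test_funsI[of _ "cball a (2 * r)"])
  show "smooth (cutoff a r)" unfolding cutoff_def by (rule smooth_affine[OF smooth_ball_cutoff])
qed (use cutoff_0[OF assms, of a] in auto)

lemma fun_supp_cutoff: "r > 0 \<Longrightarrow> fun_supp (cutoff a r) \<subseteq> cball a (2 * r)"
  using cutoff_0[of r a] by (intro fun_supp_subset_closed) auto

section \<open>Distributions and their pairing with smooth functions\<close>

lemma distribution_add:
  "distribution T \<Longrightarrow> \<phi> \<in> test_funs \<Longrightarrow> \<psi> \<in> test_funs \<Longrightarrow> T (\<lambda>x. \<phi> x + \<psi> x) = T \<phi> + T \<psi>"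
  and distribution_cmult: "distribution T \<Longrightarrow> \<phi> \<in> test_funs \<Longrightarrow> T (\<lambda>x. c * \<phi> x) = c * T \<phi>"
  by (auto simp: distribution_def)

lemma distribution_diff:
  assumes "distribution T" "\<phi> \<in> test_funs" "\<psi> \<in> test_funs"
  shows "T (\<lambda>x. \<phi> x - \<psi> x) = T \<phi> - T \<psi>"
  using distribution_add[OF assms(1,2) test_funs_cmult[OF assms(3), of "-1"]]
    distribution_cmult[OF assms(1,3), of "-1"] by simp

lemma distribution_0: "distribution T \<Longrightarrow> T (\<lambda>_. 0) = 0"
  using distribution_cmult[OF _ test_funs_0, of T 0] by simp

lemma distribution_sum:
  assumes "distribution T" "\<And>i. i \<in> I \<Longrightarrow> f i \<in> test_funs"
  shows "T (\<lambda>x. \<Sum>i\<in>I. f i x) = (\<Sum>i\<in>I. T (f i))"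
  using assms(2)
proof (induction I rule: infinite_finite_induct)
  case (insert i I)
  then show ?case using distribution_add[OF assms(1), of "f i" "\<lambda>x. \<Sum>i\<in>I. f i x"] test_funs_sum[of I f]
    by simp
qed (auto simp: distribution_0 assms)

lemma closed_dist_supp: "closed (dist_supp T)"
  unfolding dist_supp_def by auto

text \<open>The complement of \<open>dist_supp T\<close> is a union of open sets on each of which
  \<open>T\<close> vanishes, so a localisation is needed. Finitely many null balls cover the support
  of \<open>\<phi>\<close>; multiplying by \<open>1 - cutoff\<close> for one of them changes
  \<open>\<phi>\<close> by a test function supported in a null ball, hence not the value of
  \<open>T\<close>. The product of all these factors kills \<open>\<phi>\<close>.\<close>

lemma distribution_vanish:
  assumes T: "distribution T" and phi: "\<phi> \<in> test_funs" and disj: "fun_supp \<phi> \<inter> dist_supp T = {}"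
  shows "T \<phi> = 0"
proof -
  define good where "good = (\<lambda>(a, r). r > 0 \<and> (\<forall>\<psi>\<in>test_funs. fun_supp \<psi> \<subseteq> cball a (2 * r) \<longrightarrow> T \<psi> = 0))"
  have remove: "(\<lambda>x. \<phi> x * (\<Prod>p\<in>C. 1 - cutoff (fst p) (snd p) x)) \<in> test_funs \<and>
     T (\<lambda>x. \<phi> x * (\<Prod>p\<in>C. 1 - cutoff (fst p) (snd p) x)) = T \<phi>"
    if "finite C" "\<forall>p\<in>C. good p" for C
    using that
  proof (induction C)
    case (insert p C)
    obtain a r where p: "p = (a, r)" by (cases p)
    have r: "r > 0" and v: "\<And>\<psi>. \<psi> \<in> test_funs \<Longrightarrow> fun_supp \<psi> \<subseteq> cball a (2 * r) \<Longrightarrow> T \<psi> = 0"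
      using insert.prems p by (auto simp: good_def)
    let ?f = "\<lambda>x. \<phi> x * (\<Prod>p\<in>C. 1 - cutoff (fst p) (snd p) x)"
    have f: "?f \<in> test_funs" "T ?f = T \<phi>" using insert by auto
    have g: "(\<lambda>x. ?f x * cutoff a r x) \<in> test_funs"
      by (intro test_funs_mult_left[OF f(1)] test_funs_smooth cutoff_test_funs r)
    have "T (\<lambda>x. ?f x * cutoff a r x) = 0"
      by (rule v[OF g]) (use fun_supp_mult_right[of ?f "cutoff a r"] fun_supp_cutoff[OF r, of a] in blast)
    then have "T (\<lambda>x. ?f x - ?f x * cutoff a r x) = T \<phi>"
      using distribution_diff[OF T f(1) g] f(2) by simp
    moreover have "(\<lambda>x. \<phi> x * (\<Prod>p\<in>insert p C. 1 - cutoff (fst p) (snd p) x)) =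
       (\<lambda>x. ?f x - ?f x * cutoff a r x)"
      using insert.hyps p by (simp add: fun_eq_iff algebra_simps)
    ultimately show ?case using test_funs_diff[OF f(1) g] by simp
  qed (use phi in auto)
  have "\<exists>r. good (a, r)" if "a \<in> fun_supp \<phi>" for a
  proof -
    have "a \<notin> dist_supp T" using that disj by auto
    then obtain U where U: "open U" "a \<in> U" "\<forall>\<psi>\<in>test_funs. fun_supp \<psi> \<subseteq> U \<longrightarrow> T \<psi> = 0"
      by (auto simp: dist_supp_def)
    then obtain e where e: "e > 0" "cball a e \<subseteq> U" using open_contains_cball by blast
    then have "good (a, e / 2)" using U by (auto simp: good_def)
    then show ?thesis by blast
  qed
  then obtain r where r: "\<And>a. a \<in> fun_supp \<phi> \<Longrightarrow> good (a, r a)" by metis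
  have "fun_supp \<phi> \<subseteq> (\<Union>a\<in>fun_supp \<phi>. ball a (r a))"
    using r by (auto simp: good_def intro!: bexI)
  then obtain C where C: "C \<subseteq> fun_supp \<phi>" "finite C" "fun_supp \<phi> \<subseteq> (\<Union>a\<in>C. ball a (r a))"
    using compactE_image[OF test_funs_compact[OF phi], of "fun_supp \<phi>" "\<lambda>a. ball a (r a)"] by auto
  let ?C = "(\<lambda>a. (a, r a)) ` C"
  have "(\<lambda>x. \<phi> x * (\<Prod>p\<in>?C. 1 - cutoff (fst p) (snd p) x)) = (\<lambda>_. 0)"
  proof
    fix x
    show "\<phi> x * (\<Prod>p\<in>?C. 1 - cutoff (fst p) (snd p) x) = 0"
    proof (cases "x \<in> fun_supp \<phi>")
      case True
      then obtain a where a: "a \<in> C" "dist a x < r a" using C by auto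
      then have "r a > 0" using r C by (auto simp: good_def)
      then have "1 - cutoff a (r a) x = 0" using a cutoff_1[of "r a" a x] by simp
      then have "(\<Prod>p\<in>?C. 1 - cutoff (fst p) (snd p) x) = 0"
        using C(2) a(1) by (intro prod_zero) auto
      then show ?thesis by simp
    qed (simp add: fun_supp_zero)
  qed
  then show ?thesis using remove[of ?C] C r distribution_0[OF T] by auto
qed

text \<open>This makes the definite description in \<open>dist_pair\<close> meaningful: two cutoffs
  equal to 1 near the support give test functions whose difference is supported away from
  \<open>dist_supp T\<close>, where \<open>T\<close> vanishes.\<close>

lemma dist_pair_eq:
  assumes T: "distribution T" and eta: "\<eta> \<in> test_funs" and psi: "smooth \<psi>"
    and U: "open U" "dist_supp T \<subseteq> U" "\<And>x. x \<in> U \<Longrightarrow> \<eta> x = 1"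
  shows "dist_pair T \<psi> = T (\<lambda>x. \<eta> x * \<psi> x)"
  unfolding dist_pair_def
proof (rule the_equality)
  show "\<forall>\<eta>'\<in>test_funs. (\<exists>U. open U \<and> dist_supp T \<subseteq> U \<and> (\<forall>x\<in>U. \<eta>' x = 1)) \<longrightarrow>
          T (\<lambda>x. \<eta>' x * \<psi> x) = T (\<lambda>x. \<eta> x * \<psi> x)"
  proof (intro ballI impI)
    fix \<eta>' assume eta': "\<eta>' \<in> test_funs" and "\<exists>U. open U \<and> dist_supp T \<subseteq> U \<and> (\<forall>x\<in>U. \<eta>' x = 1)"
    then obtain V where V: "open V" "dist_supp T \<subseteq> V" "\<And>x. x \<in> V \<Longrightarrow> \<eta>' x = 1" by auto
    have a: "(\<lambda>x. \<eta>' x * \<psi> x) \<in> test_funs" "(\<lambda>x. \<eta> x * \<psi> x) \<in> test_funs"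
      using eta eta' psi by (auto intro: test_funs_mult_left)
    have "T (\<lambda>x. \<eta>' x * \<psi> x - \<eta> x * \<psi> x) = 0"
    proof (rule distribution_vanish[OF T test_funs_diff[OF a]])
      have "fun_supp (\<lambda>x. \<eta>' x * \<psi> x - \<eta> x * \<psi> x) \<subseteq> - (U \<inter> V)"
        using U V by (intro fun_supp_subset_closed) auto
      then show "fun_supp (\<lambda>x. \<eta>' x * \<psi> x - \<eta> x * \<psi> x) \<inter> dist_supp T = {}"
        using U V by blast
    qed
    then show "T (\<lambda>x. \<eta>' x * \<psi> x) = T (\<lambda>x. \<eta> x * \<psi> x)"
      using distribution_diff[OF T a] by simp
  qed
qed (use eta U in blast)

lemma cutoff_near_compact:
  assumes "compact K"
  obtains \<eta> U where "\<eta> \<in> test_funs" "open U" "K \<subseteq> U" "\<And>x. x \<in> U \<Longrightarrow> \<eta> x = (1::complex)"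
proof -
  obtain R where "R > 0" "\<forall>x\<in>K. norm x < R"
    using compact_imp_bounded[OF assms] by (auto simp: bounded_pos_less)
  then show ?thesis
    by (intro that[of "cutoff 0 R" "ball 0 R"] cutoff_test_funs) (auto simp: cutoff_1)
qed

text \<open>Uniform convergence to 0 on the whole space together with all derivatives, without a
  common compact support. Compactness is supplied later by a fixed factor from
  \<open>test_funs\<close>.\<close>

definition unif_null :: "(nat \<Rightarrow> 'a::euclidean_space \<Rightarrow> complex) \<Rightarrow> bool" where
  "unif_null w \<longleftrightarrow> (\<forall>n. smooth (w n)) \<and> (\<forall>vs e. set vs \<subseteq> Basis \<longrightarrow> e > 0 \<longrightarrow>
     (\<forall>\<^sub>F n in sequentially. \<forall>x. cmod (iter_deriv vs (w n) x) \<le> e))"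

lemma unif_nullD:
  assumes "unif_null w" "set vs \<subseteq> Basis" "e > 0"
  shows "\<forall>\<^sub>F n in sequentially. \<forall>x. cmod (iter_deriv vs (w n) x) \<le> e"
  using assms unfolding unif_null_def by blast

lemma unif_null_iter_deriv:
  assumes "unif_null w" "set ws \<subseteq> Basis"
  shows "unif_null (\<lambda>n. iter_deriv ws (w n))"
  using assms unfolding unif_null_def iter_deriv_append[symmetric] by (auto intro: smooth_iter_deriv)

text \<open>The induction peels off the derivative that is applied first, the last list element. The
  product rule then leaves two products of the same form, which is why the inner claim is general in
  \<open>\<eta>\<close> and \<open>w\<close>.\<close>

lemma unif_null_mult:
  assumes "\<eta> \<in> test_funs" "unif_null w"
  shows "unif_null (\<lambda>n x. \<eta> x * w n x)"
proof -
  have "\<forall>\<^sub>F n in sequentially. \<forall>x. cmod (iter_deriv vs (\<lambda>x. \<eta> x * w n x) x) \<le> e"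
    if "set vs \<subseteq> Basis" "e > 0" "\<eta> \<in> test_funs" "unif_null w" for \<eta> w vs e
    using that
  proof (induction vs arbitrary: \<eta> w e rule: rev_induct)
    case Nil
    obtain B where B: "B > 0" "\<And>x. cmod (\<eta> x) \<le> B" using test_funs_bounded[OF \<open>\<eta> \<in> test_funs\<close>] by blast
    have "\<forall>\<^sub>F n in sequentially. \<forall>x. cmod (w n x) \<le> e / B"
      using unif_nullD[OF \<open>unif_null w\<close>, of "[]" "e / B"] Nil B by simp
    then show ?case
    proof (rule eventually_mono)
      fix n assume n: "\<forall>x. cmod (w n x) \<le> e / B"
      have "cmod (\<eta> x) * cmod (w n x) \<le> B * (e / B)" for x
        using n B by (intro mult_mono) auto
      then show "\<forall>x. cmod (iter_deriv [] (\<lambda>x. \<eta> x * w n x) x) \<le> e"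
        using B by (simp add: norm_mult)
    qed
  next
    case (snoc v vs)
    have vs: "set vs \<subseteq> Basis" "v \<in> Basis" "set [v] \<subseteq> Basis" using snoc.prems by auto
    have sm: "smooth \<eta>" "\<And>n. smooth (w n)" using snoc.prems test_funs_smooth by (auto simp: unif_null_def)
    have t: "iter_deriv [v] \<eta> \<in> test_funs" using snoc.prems by (intro iter_deriv_test_funs) auto
    have 1: "\<forall>\<^sub>F n in sequentially. \<forall>x. cmod (iter_deriv vs (\<lambda>x. iter_deriv [v] \<eta> x * w n x) x) \<le> e / 2"
      using snoc.prems vs t by (intro snoc.IH) auto
    have 2: "\<forall>\<^sub>F n in sequentially. \<forall>x. cmod (iter_deriv vs (\<lambda>x. \<eta> x * iter_deriv [v] (w n) x) x) \<le> e / 2"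
      using snoc.prems vs by (intro snoc.IH unif_null_iter_deriv) auto
    from 1 2 show ?case
    proof eventually_elim
      case (elim n)
      have "iter_deriv (vs @ [v]) (\<lambda>x. \<eta> x * w n x) =
        (\<lambda>x. iter_deriv vs (\<lambda>x. iter_deriv [v] \<eta> x * w n x) x + iter_deriv vs (\<lambda>x. \<eta> x * iter_deriv [v] (w n) x) x)"
        unfolding iter_deriv_append iter_deriv_mult_Basis[OF sm]
        by (intro iter_deriv_add smooth_mult sm vs smooth_iter_deriv)
      then show ?case
        using elim by (auto intro!: order_trans[OF norm_triangle_ineq] add_mono[of _ "e/2" _ "e/2", simplified] simp del: iter_deriv.simps)
    qed
  qed
  then show ?thesis
    using assms unfolding unif_null_def[of "\<lambda>n x. \<eta> x * w n x"]
    by (auto intro: smooth_mult test_funs_smooth simp: unif_null_def)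
qed

text \<open>All differences are supported in \<open>fun_supp \<eta>\<close>, so a single estimate
  with finitely many derivatives controls \<open>T\<close> along the whole sequence.\<close>

lemma distribution_limit:
  assumes T: "distribution T" and eta: "\<eta> \<in> test_funs" and u: "\<And>n. smooth (u n)" "smooth v"
    and null: "unif_null (\<lambda>n x. u n x - v x)"
  shows "(\<lambda>n. T (\<lambda>x. \<eta> x * u n x)) \<longlonglongrightarrow> T (\<lambda>x. \<eta> x * v x)"
proof -
  define w where "w = (\<lambda>n x. \<eta> x * (u n x - v x))"
  have w: "unif_null w" unfolding w_def by (rule unif_null_mult[OF eta null])
  have wt: "w n \<in> test_funs" for n unfolding w_def
    using eta u by (intro test_funs_mult_left smooth_diff)
  obtain C m where C: "\<And>\<phi>. \<phi> \<in> test_funs \<Longrightarrow> fun_supp \<phi> \<subseteq> fun_supp \<eta> \<Longrightarrow>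
      cmod (T \<phi>) \<le> C * (\<Sum>vs | set vs \<subseteq> Basis \<and> length vs \<le> m. SUP x. cmod (iter_deriv vs \<phi> x))"
    using T test_funs_compact[OF eta] unfolding distribution_def by meson
  have sup: "(\<lambda>n. SUP x. cmod (iter_deriv vs (w n) x)) \<longlonglongrightarrow> 0" if vs: "set vs \<subseteq> Basis" for vs
  proof (rule LIMSEQ_I)
    fix r :: real assume r: "r > 0"
    have "\<forall>\<^sub>F n in sequentially. \<forall>x. cmod (iter_deriv vs (w n) x) \<le> r / 2"
      by (rule unif_nullD[OF w vs half_gt_zero[OF r]])
    then have "\<forall>\<^sub>F n in sequentially. norm ((SUP x. cmod (iter_deriv vs (w n) x)) - 0) < r"
    proof (rule eventually_mono)
      fix n assume n: "\<forall>x. cmod (iter_deriv vs (w n) x) \<le> r / 2"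
      have "(SUP x. cmod (iter_deriv vs (w n) x)) \<le> r / 2" using n by (intro cSUP_least) auto
      moreover have "cmod (iter_deriv vs (w n) 0) \<le> (SUP x. cmod (iter_deriv vs (w n) x))"
        using n by (intro cSUP_upper) (auto intro!: bdd_aboveI[of _ "r/2"])
      then have "0 \<le> (SUP x. cmod (iter_deriv vs (w n) x))" using norm_ge_zero order_trans by blast
      ultimately show "norm ((SUP x. cmod (iter_deriv vs (w n) x)) - 0) < r" using r by simp
    qed
    then show "\<exists>no. \<forall>n\<ge>no. norm ((SUP x. cmod (iter_deriv vs (w n) x)) - 0) < r"
      by (simp add: eventually_sequentially)
  qed
  have lim: "(\<lambda>n. C * (\<Sum>vs | set vs \<subseteq> Basis \<and> length vs \<le> m. SUP x. cmod (iter_deriv vs (w n) x))) \<longlonglongrightarrow>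
     C * (\<Sum>vs::'a list | set vs \<subseteq> Basis \<and> length vs \<le> m. 0)"
    by (intro tendsto_mult_left tendsto_sum sup) auto
  have "(\<lambda>n. T (w n)) \<longlonglongrightarrow> 0"
  proof (rule Lim_null_comparison)
    show "\<forall>\<^sub>F n in sequentially. norm (T (w n)) \<le>
       C * (\<Sum>vs | set vs \<subseteq> Basis \<and> length vs \<le> m. SUP x. cmod (iter_deriv vs (w n) x))"
      using C[OF wt] fun_supp_mult_left[of \<eta>] by (intro always_eventually allI) (auto simp: w_def)
    show "(\<lambda>n. C * (\<Sum>vs | set vs \<subseteq> Basis \<and> length vs \<le> m. SUP x. cmod (iter_deriv vs (w n) x))) \<longlonglongrightarrow> 0"
      using lim by simp
  qed
  moreover have "T (w n) = T (\<lambda>x. \<eta> x * u n x) - T (\<lambda>x. \<eta> x * v x)" for n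
    using distribution_diff[OF T test_funs_mult_left[OF eta u(1)] test_funs_mult_left[OF eta u(2)], of n]
    by (simp add: w_def right_diff_distrib)
  ultimately show ?thesis by (simp add: LIM_zero_iff)
qed

section \<open>Lipschitz, Taylor and second difference bounds\<close>

lemma iter_deriv_eq_sum:
  fixes f :: "'a::euclidean_space \<Rightarrow> complex"
  assumes "smooth f"
  shows "iter_deriv [v] f x = (\<Sum>b\<in>Basis. (v \<bullet> b) *\<^sub>R iter_deriv [b] f x)"
proof -
  interpret bounded_linear "\<lambda>h. iter_deriv [h] f x"
    using smooth_has_derivative[OF assms] by (rule has_derivative_bounded_linear)
  have "iter_deriv [\<Sum>b\<in>Basis. (v \<bullet> b) *\<^sub>R b] f x = (\<Sum>b\<in>Basis. (v \<bullet> b) *\<^sub>R iter_deriv [b] f x)"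
    by (simp only: sum scaleR)
  then show ?thesis by (simp add: euclidean_representation)
qed

lemma norm_iter_deriv_le:
  fixes f :: "'a::euclidean_space \<Rightarrow> complex" and B :: real
  assumes "smooth f" "\<And>b. b \<in> Basis \<Longrightarrow> cmod (iter_deriv [b] f x) \<le> B"
  shows "cmod (iter_deriv [v] f x) \<le> DIM('a) * B * norm v"
proof -
  have "cmod (iter_deriv [v] f x) \<le> (\<Sum>b::'a\<in>Basis. norm v * B)"
    unfolding iter_deriv_eq_sum[OF assms(1), of v]
  proof (rule sum_norm_le)
    fix b :: 'a assume b: "b \<in> Basis"
    have "\<bar>v \<bullet> b\<bar> * cmod (iter_deriv [b] f x) \<le> norm v * B"
      using assms(2)[OF b] Basis_le_norm[OF b] by (intro mult_mono) auto
    then show "cmod ((v \<bullet> b) *\<^sub>R iter_deriv [b] f x) \<le> norm v * B" by simp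
  qed
  then show ?thesis by (simp add: mult_ac)
qed

lemma smooth_lipschitz:
  fixes f :: "'a::euclidean_space \<Rightarrow> complex" and B :: real
  assumes "smooth f" "\<And>b x. b \<in> Basis \<Longrightarrow> cmod (iter_deriv [b] f x) \<le> B"
  shows "cmod (f x - f y) \<le> DIM('a) * B * norm (x - y)"
proof (rule differentiable_bound[OF convex_UNIV])
  show "(f has_derivative (\<lambda>v. iter_deriv [v] f x)) (at x within UNIV)" for x
    using smooth_has_derivative[OF assms(1)] .
  show "onorm (\<lambda>v. iter_deriv [v] f x) \<le> DIM('a) * B" for x
    by (rule onorm_le) (rule norm_iter_deriv_le[OF assms])
qed auto

text \<open>The mean value inequality is applied to the difference between the derivative and its
  value at \<open>x\<close>. Each passage from partial derivatives to a full derivative costs one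
  factor \<open>DIM('a)\<close>, hence the square.\<close>

lemma smooth_taylor:
  fixes f :: "'a::euclidean_space \<Rightarrow> complex" and B :: real
  assumes f: "smooth f" and B: "\<And>b c x. b \<in> Basis \<Longrightarrow> c \<in> Basis \<Longrightarrow> cmod (iter_deriv [c, b] f x) \<le> B"
  shows "cmod (f (x + h) - f x - iter_deriv [h] f x) \<le> DIM('a)\<^sup>2 * B * (norm h)\<^sup>2"
proof -
  have B0: "B \<ge> 0" using B[OF SOME_Basis SOME_Basis] norm_ge_zero order_trans by blast
  have s: "smooth (iter_deriv [b] f)" if "b \<in> Basis" for b
    using f that by (intro smooth_iter_deriv) auto
  have lip: "cmod (iter_deriv [b] f y - iter_deriv [b] f z) \<le> DIM('a) * B * norm (y - z)" if "b \<in> Basis" for b y z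
    by (rule smooth_lipschitz[OF s[OF that]]) (use B[OF that] in simp)
  have "norm (f (x + h) - f x - iter_deriv [(x + h) - x] f x) \<le> norm ((x + h) - x) * (DIM('a)\<^sup>2 * B * norm h)"
  proof (rule differentiable_bound_linearization[of x "x + h" "cball x (norm h)" f "\<lambda>x v. iter_deriv [v] f x"])
    show "x + t *\<^sub>R (x + h - x) \<in> cball x (norm h)" if "t \<in> {0..1}" for t
      using that by (auto simp: dist_norm intro: mult_left_le_one_le)
    show "(f has_derivative (\<lambda>v. iter_deriv [v] f y)) (at y within cball x (norm h))" for y
      using smooth_has_derivative[OF f] by (rule has_derivative_at_withinI)
    show "onorm ((\<lambda>v. iter_deriv [v] f y) - (\<lambda>v. iter_deriv [v] f x)) \<le> DIM('a)\<^sup>2 * B * norm h"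
      if "y \<in> cball x (norm h)" for y
    proof (rule onorm_le)
      fix v
      have "iter_deriv [v] f y - iter_deriv [v] f x = (\<Sum>b\<in>Basis. (v \<bullet> b) *\<^sub>R (iter_deriv [b] f y - iter_deriv [b] f x))"
        unfolding iter_deriv_eq_sum[OF f, of v] by (simp add: sum_subtractf scaleR_diff_right del: iter_deriv.simps)
      also have "cmod \<dots> \<le> (\<Sum>b::'a\<in>Basis. norm v * (DIM('a) * B * norm h))"
      proof (rule sum_norm_le)
        fix b :: 'a assume b: "b \<in> Basis"
        have "cmod (iter_deriv [b] f y - iter_deriv [b] f x) \<le> DIM('a) * B * norm (y - x)" by (rule lip[OF b])
        also have "\<dots> \<le> DIM('a) * B * norm h"
          using that B0 by (intro mult_left_mono) (auto simp: dist_norm norm_minus_commute)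
        finally have "\<bar>v \<bullet> b\<bar> * cmod (iter_deriv [b] f y - iter_deriv [b] f x) \<le> norm v * (DIM('a) * B * norm h)"
          using Basis_le_norm[OF b] by (intro mult_mono) auto
        then show "cmod ((v \<bullet> b) *\<^sub>R (iter_deriv [b] f y - iter_deriv [b] f x)) \<le> norm v * (DIM('a) * B * norm h)"
          by simp
      qed
      finally show "cmod (((\<lambda>v. iter_deriv [v] f y) - (\<lambda>v. iter_deriv [v] f x)) v) \<le> DIM('a)\<^sup>2 * B * norm h * norm v"
        by (simp add: power2_eq_square mult_ac del: iter_deriv.simps)
    qed
  qed auto
  then show ?thesis by (simp add: power2_eq_square mult_ac del: iter_deriv.simps)
qed

text \<open>The linear terms of the two Taylor expansions at \<open>h\<close> and \<open>- h\<close>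
  cancel.\<close>

lemma smooth_second_difference:
  fixes f :: "'a::euclidean_space \<Rightarrow> complex" and B :: real
  assumes f: "smooth f" and B: "\<And>b c x. b \<in> Basis \<Longrightarrow> c \<in> Basis \<Longrightarrow> cmod (iter_deriv [c, b] f x) \<le> B"
  shows "cmod (f (x + h) + f (x - h) - 2 * f x) \<le> 2 * DIM('a)\<^sup>2 * B * (norm h)\<^sup>2"
proof -
  interpret bounded_linear "\<lambda>h. iter_deriv [h] f x"
    using smooth_has_derivative[OF f] by (rule has_derivative_bounded_linear)
  have "f (x + h) + f (x - h) - 2 * f x = (f (x + h) - f x - iter_deriv [h] f x) + (f (x + - h) - f x - iter_deriv [- h] f x)"
    using neg[of h] by simp
  also have "cmod \<dots> \<le> DIM('a)\<^sup>2 * B * (norm h)\<^sup>2 + DIM('a)\<^sup>2 * B * (norm (- h))\<^sup>2"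
    by (intro order_trans[OF norm_triangle_ineq] add_mono smooth_taylor assms)
  finally show ?thesis by (simp add: mult_ac)
qed

lemma test_funs_iter_bounded:
  fixes \<phi> :: "'a::euclidean_space \<Rightarrow> complex"
  assumes "\<phi> \<in> test_funs"
  obtains B where "B > 0" "\<And>vs x. set vs \<subseteq> Basis \<Longrightarrow> length vs \<le> m \<Longrightarrow> cmod (iter_deriv vs \<phi> x) \<le> B"
proof -
  have "\<exists>B>0. \<forall>x. cmod (iter_deriv vs \<phi> x) \<le> B" if "set vs \<subseteq> Basis" for vs
    using test_funs_bounded[OF iter_deriv_test_funs[OF assms that]] by metis
  then obtain B where B: "\<And>vs. set vs \<subseteq> Basis \<Longrightarrow> B vs > 0" "\<And>vs x. set vs \<subseteq> Basis \<Longrightarrow> cmod (iter_deriv vs \<phi> x) \<le> B vs"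
    by metis
  let ?V = "{vs::'a list. set vs \<subseteq> Basis \<and> length vs \<le> m}"
  have fin: "finite ?V" by (intro finite_lists_length_le) auto
  show ?thesis
  proof (rule that[of "1 + (\<Sum>vs\<in>?V. B vs)"])
    have "0 \<le> (\<Sum>vs\<in>?V. B vs)" using B(1) by (intro sum_nonneg) (auto intro: less_imp_le)
    then show "0 < 1 + (\<Sum>vs\<in>?V. B vs)" by simp
    fix vs :: "'a list" and x assume vs: "set vs \<subseteq> Basis" "length vs \<le> m"
    have "B vs \<le> (\<Sum>vs\<in>?V. B vs)" using B(1) vs fin by (intro member_le_sum) (auto intro: less_imp_le)
    then show "cmod (iter_deriv vs \<phi> x) \<le> 1 + (\<Sum>vs\<in>?V. B vs)" using B(2)[OF vs(1), of x] by linarith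
  qed
qed

section \<open>Convolution with a measure\<close>

text \<open>The sign \<open>y + z\<close> makes this the convolution with the reflected measure,
  which is the adjoint that appears when \<open>k * T\<close> is paired with a test
  function.\<close>

definition conv :: "'a::euclidean_space measure \<Rightarrow> ('a \<Rightarrow> complex) \<Rightarrow> 'a \<Rightarrow> complex" where
  "conv M \<phi> y = (LINT z|M. \<phi> (y + z))"

definition loc_finite :: "'a::euclidean_space measure \<Rightarrow> bool" where
  "loc_finite M \<longleftrightarrow> sets M = sets borel \<and> (\<forall>R. emeasure M (cball 0 R) < \<infinity>)"

lemma loc_finite_measurable:
  assumes "loc_finite M" "continuous_on UNIV (f :: 'a::euclidean_space \<Rightarrow> complex)"
  shows "f \<in> borel_measurable M"
  using borel_measurable_continuous_onI[OF assms(2)] assms(1)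
  by (subst measurable_cong_sets[of M borel borel borel]) (auto simp: loc_finite_def)

lemma loc_finite_integrable:
  fixes f :: "'a::euclidean_space \<Rightarrow> complex"
  assumes M: "loc_finite M" and f: "continuous_on UNIV f" and B: "\<And>z. cmod (f z) \<le> B"
    and R: "\<And>z. norm z > R \<Longrightarrow> f z = 0"
  shows "integrable M f" "cmod (LINT z|M. f z) \<le> B * measure M (cball 0 R)"
proof -
  have s: "cball 0 R \<in> sets M" using M by (simp add: loc_finite_def)
  have i: "integrable M (\<lambda>z. B * indicator (cball 0 R) z)"
    using M s by (intro integrable_mult_right integrable_real_indicator) (auto simp: loc_finite_def)
  have le: "cmod (f z) \<le> B * indicator (cball 0 R) z" for z
    using B[of z] R[of z] by (auto simp: indicator_def dist_norm)
  show I: "integrable M f"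
    by (rule Bochner_Integration.integrable_bound[OF i loc_finite_measurable[OF M f]])
      (use le in \<open>auto intro: order_trans[OF _ abs_ge_self]\<close>)
  have "cmod (LINT z|M. f z) \<le> (LINT z|M. B * indicator (cball 0 R) z)"
    by (rule Bochner_Integration.integral_norm_bound_integral[OF I i le])
  also have "\<dots> = B * measure M (cball 0 R)" using s by simp
  finally show "cmod (LINT z|M. f z) \<le> B * measure M (cball 0 R)" .
qed

lemma test_funs_conv_integrable:
  assumes "loc_finite M" "\<phi> \<in> test_funs"
  shows "integrable M (\<lambda>z. \<phi> (y + z))"
proof -
  obtain B where B: "\<And>x. cmod (\<phi> x) \<le> B" using test_funs_bounded[OF assms(2)] by blast
  obtain R where R: "\<And>x. \<phi> x \<noteq> 0 \<Longrightarrow> norm x \<le> R" using test_funsE[OF assms(2)] by blast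
  show ?thesis
  proof (rule loc_finite_integrable(1)[OF assms(1) _ B])
    show "continuous_on UNIV (\<lambda>z. \<phi> (y + z))"
      by (intro continuous_on_compose2[OF smooth_continuous_on[OF test_funs_smooth[OF assms(2)], of UNIV]] continuous_intros) auto
    show "\<phi> (y + z) = 0" if "norm z > R + norm y" for z
      using R[of "y + z"] that norm_triangle_ineq4[of "y + z" y] by force
  qed
qed

text \<open>Differentiation under the integral by a quadratic remainder: for increments of norm at
  most 1 the Taylor remainder vanishes outside one fixed ball, and that ball has finite
  measure.\<close>

lemma conv_has_derivative:
  fixes \<phi> :: "'a::euclidean_space \<Rightarrow> complex"
  assumes M: "loc_finite M" and phi: "\<phi> \<in> test_funs"
  shows "(conv M \<phi> has_derivative (\<lambda>v. \<Sum>b\<in>Basis. (v \<bullet> b) *\<^sub>R conv M (iter_deriv [b] \<phi>) y)) (at y)"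
proof -
  have sm: "smooth \<phi>" using phi by (rule test_funs_smooth)
  obtain B where B: "B > 0" "\<And>vs x. set vs \<subseteq> Basis \<Longrightarrow> length vs \<le> 2 \<Longrightarrow> cmod (iter_deriv vs \<phi> x) \<le> B"
    using test_funs_iter_bounded[OF phi, of 2] by metis
  obtain R where R: "R > 0" "\<And>x. x \<in> fun_supp \<phi> \<Longrightarrow> norm x \<le> R"
    using compact_imp_bounded[OF test_funs_compact[OF phi]] unfolding bounded_pos by blast
  have bt: "iter_deriv [b] \<phi> \<in> test_funs" if "b \<in> Basis" for b
    using that by (intro iter_deriv_test_funs phi) auto
  define C where "C = DIM('a)\<^sup>2 * B * measure M (cball 0 (R + norm y + 1))"
  have C0: "C \<ge> 0" unfolding C_def using B(1) by simp
  have est: "cmod (conv M \<phi> (y + h) - conv M \<phi> y - (\<Sum>b\<in>Basis. (h \<bullet> b) *\<^sub>R conv M (iter_deriv [b] \<phi>) y)) \<le> C * (norm h)\<^sup>2"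
    if h: "norm h \<le> 1" for h
  proof -
    have i1: "integrable M (\<lambda>z. (h \<bullet> b) *\<^sub>R iter_deriv [b] \<phi> (y + z))" if "b \<in> Basis" for b
      using test_funs_conv_integrable[OF M bt[OF that]] by (intro integrable_scaleR_right)
    have "conv M \<phi> (y + h) - conv M \<phi> y - (\<Sum>b\<in>Basis. (h \<bullet> b) *\<^sub>R conv M (iter_deriv [b] \<phi>) y) = 
      (LINT z|M. \<phi> (y + h + z) - \<phi> (y + z) - (\<Sum>b\<in>Basis. (h \<bullet> b) *\<^sub>R iter_deriv [b] \<phi> (y + z)))"
      unfolding conv_def
      using i1 by (simp add: test_funs_conv_integrable[OF M phi] del: iter_deriv.simps)
    also have "\<dots> = (LINT z|M. \<phi> ((y + z) + h) - \<phi> (y + z) - iter_deriv [h] \<phi> (y + z))"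
      by (simp only: iter_deriv_eq_sum[OF sm, of h] add_ac)
    also have "cmod \<dots> \<le> (DIM('a)\<^sup>2 * B * (norm h)\<^sup>2) * measure M (cball 0 (R + norm y + 1))"
    proof (rule loc_finite_integrable(2)[OF M])
      have "continuous_on UNIV (\<lambda>z. \<phi> ((y + z) + h) - \<phi> (y + z) - (\<Sum>b\<in>Basis. (h \<bullet> b) *\<^sub>R iter_deriv [b] \<phi> (y + z)))"
        by (intro continuous_intros continuous_on_compose2[OF smooth_continuous_on[OF sm, of UNIV]]
            continuous_on_compose2[OF smooth_continuous_on[OF test_funs_smooth[OF bt], of _ UNIV]]) auto
      then show "continuous_on UNIV (\<lambda>z. \<phi> ((y + z) + h) - \<phi> (y + z) - iter_deriv [h] \<phi> (y + z))"
        by (simp only: iter_deriv_eq_sum[OF sm, of h])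
      show "cmod (\<phi> ((y + z) + h) - \<phi> (y + z) - iter_deriv [h] \<phi> (y + z)) \<le> DIM('a)\<^sup>2 * B * (norm h)\<^sup>2" for z
        by (rule smooth_taylor[OF sm]) (rule B(2), auto)
      show "\<phi> ((y + z) + h) - \<phi> (y + z) - iter_deriv [h] \<phi> (y + z) = 0" if z: "norm z > R + norm y + 1" for z
      proof -
        have "norm (y + z) \<ge> norm z - norm y" using norm_triangle_ineq4[of "y + z" y] by simp
        moreover have "norm ((y + z) + h) \<ge> norm (y + z) - norm h" using norm_triangle_ineq4[of "(y + z) + h" h] by simp
        ultimately have "(y + z) + h \<notin> fun_supp \<phi>" "y + z \<notin> fun_supp \<phi>" using z h R(2) by force+
        then show ?thesis
          using fun_supp_zero[of _ \<phi>] fun_supp_zero[of _ "iter_deriv [h] \<phi>"] fun_supp_iter_deriv[of "[h]" \<phi>] by auto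
      qed
    qed
    finally show ?thesis by (simp add: C_def mult_ac)
  qed
  show ?thesis unfolding has_derivative_at_alt
  proof (intro conjI allI impI)
    show "bounded_linear (\<lambda>v. \<Sum>b\<in>Basis. (v \<bullet> b) *\<^sub>R conv M (iter_deriv [b] \<phi>) y)"
      by (intro bounded_linear_sum bounded_linear_compose[OF bounded_linear_scaleR_left] bounded_linear_inner_left)
    fix e :: real assume e: "e > 0"
    show "\<exists>d>0. \<forall>y'. norm (y' - y) < d \<longrightarrow> norm (conv M \<phi> y' - conv M \<phi> y -
        (\<Sum>b\<in>Basis. ((y' - y) \<bullet> b) *\<^sub>R conv M (iter_deriv [b] \<phi>) y)) \<le> e * norm (y' - y)"
    proof (intro exI[of _ "min 1 (e / (C + 1))"] conjI allI impI)
      show "0 < min 1 (e / (C + 1))" using e C0 by simp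
      fix y' assume y': "norm (y' - y) < min 1 (e / (C + 1))"
      have "C * norm (y' - y) \<le> (C + 1) * (e / (C + 1))" using y' C0 by (intro mult_mono) auto
      then have "C * norm (y' - y) \<le> e" using C0 by simp
      then have "C * norm (y' - y) * norm (y' - y) \<le> e * norm (y' - y)" by (rule mult_right_mono) simp
      then show "norm (conv M \<phi> y' - conv M \<phi> y -
        (\<Sum>b\<in>Basis. ((y' - y) \<bullet> b) *\<^sub>R conv M (iter_deriv [b] \<phi>) y)) \<le> e * norm (y' - y)"
        using est[of "y' - y"] y' by (simp add: power2_eq_square mult_ac del: iter_deriv.simps)
    qed
  qed
qed

lemma iter_deriv_conv_Basis:
  fixes \<phi> :: "'a::euclidean_space \<Rightarrow> complex"
  assumes M: "loc_finite M" and phi: "\<phi> \<in> test_funs" and v: "v \<in> Basis"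
  shows "iter_deriv [v] (conv M \<phi>) = conv M (iter_deriv [v] \<phi>)"
proof -
  have "(\<Sum>b\<in>Basis. (v \<bullet> b) *\<^sub>R conv M (iter_deriv [b] \<phi>) y) = conv M (iter_deriv [v] \<phi>) y" for y
  proof -
    have "(\<Sum>b\<in>Basis. (v \<bullet> b) *\<^sub>R conv M (iter_deriv [b] \<phi>) y) =
      (\<Sum>b\<in>Basis. if b = v then conv M (iter_deriv [b] \<phi>) y else 0)"
      using v by (intro sum.cong) (auto simp: inner_Basis)
    then show ?thesis using v by simp
  qed
  then show ?thesis using iter_deriv_eqI[OF conv_has_derivative[OF M phi], of v] by simp
qed

lemma iter_deriv_conv:
  assumes M: "loc_finite M" and phi: "\<phi> \<in> test_funs" and vs: "set vs \<subseteq> Basis"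
  shows "iter_deriv vs (conv M \<phi>) = conv M (iter_deriv vs \<phi>)"
  using vs
proof (induction vs)
  case (Cons v vs)
  then have "iter_deriv [v] (conv M (iter_deriv vs \<phi>)) = conv M (iter_deriv [v] (iter_deriv vs \<phi>))"
    by (intro iter_deriv_conv_Basis[OF M iter_deriv_test_funs[OF phi]]) auto
  with Cons show ?case by simp
qed auto

lemma smooth_conv:
  assumes M: "loc_finite M" and phi: "\<phi> \<in> test_funs"
  shows "smooth (conv M \<phi>)"
proof (rule smooth_coinduct[where S="conv M ` test_funs"])
  fix f assume "f \<in> conv M ` test_funs"
  then obtain \<psi> where psi: "\<psi> \<in> test_funs" and f: "f = conv M \<psi>" by auto
  have "f differentiable at x" for x
    using conv_has_derivative[OF M psi, of x] unfolding f differentiable_def by blast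
  then have D: "(f has_derivative (\<lambda>v. iter_deriv [v] f x)) (at x)" for x
    by (simp add: frechet_derivative_works)
  have "iter_deriv [v] f \<in> conv M ` test_funs" if "v \<in> Basis" for v
    unfolding f iter_deriv_conv_Basis[OF M psi that]
    using that by (intro imageI iter_deriv_test_funs psi) auto
  with D show "\<exists>f'. (\<forall>x. (f has_derivative f' x) (at x)) \<and> (\<forall>v\<in>Basis. (\<lambda>x. f' x v) \<in> conv M ` test_funs)"
    by (intro exI[of _ "\<lambda>x v. iter_deriv [v] f x"]) (auto simp del: iter_deriv.simps)
qed (use phi in auto)

lemma test_funs_conv:
  assumes M: "loc_finite M" and phi: "\<phi> \<in> test_funs" and r: "emeasure M (- cball 0 r) = 0"
  shows "conv M \<phi> \<in> test_funs"
proof -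
  obtain R where R: "\<And>x. \<phi> x \<noteq> 0 \<Longrightarrow> norm x \<le> R" using test_funsE[OF phi] by blast
  have ae: "AE z in M. norm z \<le> r"
    by (rule AE_I[of _ _ "- cball 0 r"]) (use r M in \<open>auto simp: loc_finite_def\<close>)
  show ?thesis
  proof (rule test_funsI[OF smooth_conv[OF M phi] compact_cball[of 0 "R + r"]])
    fix y :: 'a assume y: "y \<notin> cball 0 (R + r)"
    have "AE z in M. \<phi> (y + z) = 0"
      using ae
    proof eventually_elim
      case (elim z)
      have "norm (y + z) \<ge> norm y - norm z" using norm_triangle_ineq4[of "y + z" z] by simp
      then show ?case using y elim R[of "y + z"] by force
    qed
    then show "conv M \<phi> y = 0" unfolding conv_def by (rule integral_eq_zero_AE)
  qed
qed

lemma integral_lborel_shift: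
  fixes f :: "'a::euclidean_space \<Rightarrow> 'b::euclidean_space"
  assumes "f \<in> borel_measurable borel"
  shows "(LINT x|lborel. f (a + x)) = (LINT x|lborel. f x)"
proof -
  have "(LINT x|lborel. f x) = (LINT x|distr lborel borel ((+) a). f x)" by (simp add: lborel_distr_plus)
  also have "\<dots> = (LINT x|lborel. f (a + x))" using assms by (intro integral_distr) auto
  finally show ?thesis by simp
qed

lemma nn_integral_lborel_shift:
  fixes f :: "'a::euclidean_space \<Rightarrow> ennreal"
  assumes "f \<in> borel_measurable borel"
  shows "(\<integral>\<^sup>+x. f (a + x) \<partial>lborel) = (\<integral>\<^sup>+x. f x \<partial>lborel)"
proof -
  have "(\<integral>\<^sup>+x. f x \<partial>lborel) = (\<integral>\<^sup>+x. f x \<partial>distr lborel borel ((+) a))" by (simp add: lborel_distr_plus)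
  also have "\<dots> = (\<integral>\<^sup>+x. f (a + x) \<partial>lborel)" using assms by (intro nn_integral_distr) auto
  finally show ?thesis by simp
qed

lemma test_funs_measurable: "\<phi> \<in> test_funs \<Longrightarrow> \<phi> \<in> borel_measurable borel"
  by (intro borel_measurable_continuous_onI smooth_continuous_on test_funs_smooth)

lemma dist_conv_eq_conv:
  fixes k :: "'a::euclidean_space \<Rightarrow> real"
  assumes k: "k \<in> borel_measurable borel" "\<And>x. k x \<ge> 0" and phi: "\<phi> \<in> test_funs"
  shows "dist_conv k T \<phi> = dist_pair T (conv (density lborel k) \<phi>)"
proof -
  have phim[measurable]: "\<phi> \<in> borel_measurable borel" using phi by (rule test_funs_measurable)
  note k(1)[measurable]
  have "(LINT x|lborel. k (x - y) *\<^sub>R \<phi> x) = conv (density lborel k) \<phi> y" for y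
  proof -
    have "(LINT x|lborel. k (x - y) *\<^sub>R \<phi> x) = (LINT x|lborel. k ((y + x) - y) *\<^sub>R \<phi> (y + x))"
      by (rule integral_lborel_shift[symmetric, of "\<lambda>x. k (x - y) *\<^sub>R \<phi> x"]) measurable
    also have "\<dots> = (LINT x|lborel. k x *\<^sub>R \<phi> (y + x))" by simp
    also have "\<dots> = conv (density lborel k) \<phi> y" unfolding conv_def
      by (rule integral_density[symmetric]) (use k in auto)
    finally show ?thesis .
  qed
  then show ?thesis by (simp add: dist_conv_def)
qed

section \<open>Integrals over dyadic shells\<close>

text \<open>Only the growth of sublevel sets of \<open>\<rho>\<close> is used, so the same estimate
  serves Lebesgue measure, for the Poisson kernel, and the Frostman measure, for its
  potential.\<close>

lemma nn_integral_le_weighted_shells: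
  fixes w R :: "nat \<Rightarrow> real" and \<rho> :: "'a \<Rightarrow> real"
  assumes rho[measurable]: "\<rho> \<in> borel_measurable M"
    and ball: "\<And>r. r > 0 \<Longrightarrow> emeasure M {x \<in> space M. \<rho> x \<le> r} \<le> ennreal (C * r powr s)"
    and C: "C \<ge> 0" and w: "\<And>n. w n \<ge> 0" and R: "\<And>n. R n > 0"
    and g: "\<And>x. x \<in> space M \<Longrightarrow> ennreal (g x) \<le> (\<Sum>n. ennreal (w n) * indicator {x \<in> space M. \<rho> x \<le> R n} x)"
    and sm: "summable (\<lambda>n. w n * R n powr s)"
  shows "(\<integral>\<^sup>+x. ennreal (g x) \<partial>M) \<le> ennreal (C * (\<Sum>n. w n * R n powr s))"
proof -
  have "(\<integral>\<^sup>+x. ennreal (g x) \<partial>M) \<le> (\<integral>\<^sup>+x. (\<Sum>n. ennreal (w n) * indicator {x \<in> space M. \<rho> x \<le> R n} x) \<partial>M)"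
    by (intro nn_integral_mono g)
  also have "\<dots> = (\<Sum>n. \<integral>\<^sup>+x. ennreal (w n) * indicator {x \<in> space M. \<rho> x \<le> R n} x \<partial>M)"
    by (intro nn_integral_suminf) measurable
  also have "\<dots> = (\<Sum>n. ennreal (w n) * emeasure M {x \<in> space M. \<rho> x \<le> R n})"
    by (intro suminf_cong nn_integral_cmult_indicator) measurable
  also have "\<dots> \<le> (\<Sum>n. ennreal (C * (w n * R n powr s)))"
  proof (intro suminf_le summableI)
    fix n
    have "ennreal (w n) * emeasure M {x \<in> space M. \<rho> x \<le> R n} \<le> ennreal (w n) * ennreal (C * R n powr s)"
      by (intro mult_left_mono ball R) auto
    also have "\<dots> = ennreal (C * (w n * R n powr s))"
      using w[of n] C by (simp add: ennreal_mult[symmetric] mult_ac)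
    finally show "ennreal (w n) * emeasure M {x \<in> space M. \<rho> x \<le> R n} \<le> ennreal (C * (w n * R n powr s))" .
  qed
  also have "\<dots> = ennreal (\<Sum>n. C * (w n * R n powr s))"
    using C w sm by (intro suminf_ennreal2 summable_mult) auto
  also have "(\<Sum>n. C * (w n * R n powr s)) = C * (\<Sum>n. w n * R n powr s)"
    using sm by (rule suminf_mult)
  finally show ?thesis .
qed

lemma dyadic_scale_below:
  assumes "0 < (t::real)" "t \<le> 1"
  obtains n :: nat where "(1/2) ^ Suc n < t" "t \<le> (1/2) ^ n"
proof -
  obtain n where n: "(1/2) ^ n < t" using real_arch_pow_inv[OF assms(1), of "1/2"] by auto
  define m where "m = (LEAST n. (1/2) ^ n < t)"
  have m: "(1/2) ^ m < t" unfolding m_def by (rule LeastI[of _ n]) (rule n)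
  then have "m \<noteq> 0" using assms by (intro notI) simp
  then obtain k where k: "m = Suc k" by (cases m) auto
  have "\<not> (1/2) ^ k < t" using not_less_Least[of k "\<lambda>n. (1/2) ^ n < t"] k m_def by simp
  with m k that show ?thesis by force
qed

lemma summable_half_powr:
  assumes "a > 0"
  shows "summable (\<lambda>n. ((1/2) powr a) ^ n :: real)"
  using powr_less_mono2[of a "1/2" 1] assms by (intro summable_geometric) simp

lemma half_pow_powr: "((1/2::real) ^ n) powr a = ((1/2) powr a) ^ n"
  by (simp add: powr_powr powr_power mult.commute flip: powr_realpow)

lemma single_le_suminf_ennreal:
  fixes f :: "nat \<Rightarrow> ennreal"
  assumes "x \<le> f n"
  shows "x \<le> suminf f"
  using sum_le_suminf[of f "{n}"] assms by (auto intro: order_trans)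

text \<open>The dyadic series that bound the integrals of \<open>\<rho> powr (- a)\<close> over
  \<open>\<rho> \<le> 1\<close> and, in \<open>shell_above\<close>, of
  \<open>\<rho> powr (- b)\<close> over \<open>\<rho> \<ge> 1\<close>. They converge for
  \<open>a < s\<close> and \<open>s < b\<close> respectively and depend on the exponents
  alone.\<close>

definition shell_below :: "real \<Rightarrow> real \<Rightarrow> real" where
  "shell_below a s = (\<Sum>n. ((1/2) ^ Suc n) powr (- a) * ((1/2) ^ n) powr s)"

definition shell_above :: "real \<Rightarrow> real \<Rightarrow> real" where
  "shell_above b s = (\<Sum>n. (2 ^ n) powr (- b) * (2 ^ Suc n) powr s)"

lemma nn_integral_shell_below:
  fixes \<rho> :: "'a \<Rightarrow> real"
  assumes rho[measurable]: "\<rho> \<in> borel_measurable M"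
    and ball: "\<And>r. r > 0 \<Longrightarrow> emeasure M {x \<in> space M. \<rho> x \<le> r} \<le> ennreal (C * r powr s)"
    and C: "C \<ge> 0" and a: "0 \<le> a" "a < s" and nn: "\<And>x. x \<in> space M \<Longrightarrow> \<rho> x \<ge> 0"
  shows "(\<integral>\<^sup>+x. ennreal (\<rho> x powr (- a) * indicator {..1} (\<rho> x)) \<partial>M) \<le> ennreal (C * shell_below a s)"
  unfolding shell_below_def
proof (rule nn_integral_le_weighted_shells[OF rho ball C])
  fix x assume x: "x \<in> space M"
  show "ennreal (\<rho> x powr (- a) * indicator {..1} (\<rho> x))
     \<le> (\<Sum>n. ennreal (((1/2) ^ Suc n) powr (- a)) * indicator {x \<in> space M. \<rho> x \<le> (1/2) ^ n} x)"
  proof (cases "0 < \<rho> x \<and> \<rho> x \<le> 1")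
    case True
    then obtain n where n: "(1/2) ^ Suc n < \<rho> x" "\<rho> x \<le> (1/2) ^ n" using dyadic_scale_below by blast
    have "\<rho> x powr (- a) \<le> ((1/2) ^ Suc n) powr (- a)"
      using n a by (intro powr_mono2') auto
    then have "ennreal (\<rho> x powr (- a) * indicator {..1} (\<rho> x)) \<le>
      ennreal (((1/2) ^ Suc n) powr (- a)) * indicator {x \<in> space M. \<rho> x \<le> (1/2) ^ n} x"
      using True n x by (simp add: ennreal_leI)
    then show ?thesis by (rule single_le_suminf_ennreal)
  next
    case False
    \<comment> \<open>At \<open>\<rho> x = 0\<close> the integrand is 0 because
      \<open>0 powr (- a) = 0\<close> by convention.\<close>
    with nn[OF x] have "\<rho> x = 0 \<or> \<rho> x > 1" by linarith
    then show ?thesis by auto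
  qed
next
  have "(\<lambda>n. ((1/2::real) ^ Suc n) powr (- a) * ((1/2) ^ n) powr s) = (\<lambda>n. (1/2) powr (- a) * ((1/2) powr (s - a)) ^ n)"
  proof
    fix n
    have "((1/2::real) ^ Suc n) powr (- a) * ((1/2) ^ n) powr s = (1/2) powr (- a) * (((1/2) powr (- a)) * (1/2) powr s) ^ n"
      unfolding half_pow_powr by (simp add: power_mult_distrib)
    also have "(1/2::real) powr (- a) * (1/2) powr s = (1/2) powr (s - a)" by (simp flip: powr_add)
    finally show "((1/2::real) ^ Suc n) powr (- a) * ((1/2) ^ n) powr s = (1/2) powr (- a) * ((1/2) powr (s - a)) ^ n" .
  qed
  then show "summable (\<lambda>n. ((1/2::real) ^ Suc n) powr (- a) * ((1/2) ^ n) powr s)"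
    using a by (simp only:) (intro summable_mult summable_half_powr, simp)
qed auto

lemma dyadic_scale_above:
  assumes "1 \<le> (t::real)"
  obtains n :: nat where "2 ^ n \<le> t" "t \<le> 2 ^ Suc n"
proof -
  have t: "0 < 1 / t" "1 / t \<le> 1" using assms by auto
  obtain n where n: "(1/2) ^ Suc n < 1 / t" "1 / t \<le> (1/2) ^ n" using dyadic_scale_below[OF t] by blast
  then show ?thesis using that[of n] assms by (simp add: field_simps)
qed

lemma nn_integral_shell_above:
  fixes \<rho> :: "'a \<Rightarrow> real"
  assumes rho[measurable]: "\<rho> \<in> borel_measurable M"
    and ball: "\<And>r. r > 0 \<Longrightarrow> emeasure M {x \<in> space M. \<rho> x \<le> r} \<le> ennreal (C * r powr s)"
    and C: "C \<ge> 0" and b: "s < b" "0 \<le> b"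
  shows "(\<integral>\<^sup>+x. ennreal (\<rho> x powr (- b) * indicator {1..} (\<rho> x)) \<partial>M) \<le> ennreal (C * shell_above b s)"
  unfolding shell_above_def
proof (rule nn_integral_le_weighted_shells[OF rho ball C])
  fix x assume x: "x \<in> space M"
  show "ennreal (\<rho> x powr (- b) * indicator {1..} (\<rho> x))
     \<le> (\<Sum>n. ennreal ((2 ^ n) powr (- b)) * indicator {x \<in> space M. \<rho> x \<le> 2 ^ Suc n} x)"
  proof (cases "1 \<le> \<rho> x")
    case True
    then obtain n where n: "2 ^ n \<le> \<rho> x" "\<rho> x \<le> 2 ^ Suc n" using dyadic_scale_above by blast
    have "\<rho> x powr (- b) \<le> (2 ^ n) powr (- b)"
      using n b by (intro powr_mono2') auto
    then have "ennreal (\<rho> x powr (- b) * indicator {1..} (\<rho> x)) \<le>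
      ennreal ((2 ^ n) powr (- b)) * indicator {x \<in> space M. \<rho> x \<le> 2 ^ Suc n} x"
      using True n x by (simp add: ennreal_leI)
    then show ?thesis by (rule single_le_suminf_ennreal)
  qed auto
next
  have pw: "(2 ^ n) powr c = ((1/2) powr (- c)) ^ n" for n and c :: real
    by (simp add: powr_powr powr_power powr_minus powr_divide power_divide inverse_eq_divide mult.commute flip: powr_realpow)
  have "(\<lambda>n. (2 ^ n) powr (- b) * (2 ^ Suc n) powr s) = (\<lambda>n. (1/2) powr (- s) * ((1/2) powr (b - s)) ^ n)"
  proof
    fix n
    have "(2 ^ n) powr (- b) * (2 ^ Suc n) powr s = (1/2) powr (- s) * (((1/2) powr b) * (1/2) powr (- s)) ^ n"
      unfolding pw by (simp add: power_mult_distrib)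
    also have "(1/2::real) powr b * (1/2) powr (- s) = (1/2) powr (b - s)" by (simp flip: powr_add)
    finally show "(2 ^ n) powr (- b) * (2 ^ Suc n) powr s = (1/2) powr (- s) * ((1/2) powr (b - s)) ^ n" .
  qed
  then show "summable (\<lambda>n. (2 ^ n :: real) powr (- b) * (2 ^ Suc n) powr s)"
    using b by (simp only:) (intro summable_mult summable_half_powr, simp)
qed auto

lemma nn_integral_lborel_scale:
  fixes f :: "'a::euclidean_space \<Rightarrow> ennreal"
  assumes [measurable]: "f \<in> borel_measurable borel" and c: "c > 0"
  shows "ennreal (c ^ DIM('a)) * (\<integral>\<^sup>+x. f (c *\<^sub>R x) \<partial>lborel) = (\<integral>\<^sup>+x. f x \<partial>lborel)"
proof -
  have "(\<integral>\<^sup>+x. f x \<partial>lborel) = (\<integral>\<^sup>+x. f x \<partial>density (distr lborel borel (\<lambda>x. 0 + c *\<^sub>R x)) (\<lambda>_. \<bar>c\<bar>^DIM('a)))"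
    using lborel_affine[of c "0::'a"] c by simp
  also have "\<dots> = ennreal (c ^ DIM('a)) * (\<integral>\<^sup>+x. f (c *\<^sub>R x) \<partial>lborel)"
    using c by (simp add: nn_integral_density nn_integral_distr nn_integral_cmult)
  finally show ?thesis by simp
qed

lemma emeasure_lborel_norm_le:
  fixes r :: real
  assumes "r > 0"
  shows "emeasure lborel {x \<in> space lborel. norm (x::'a::euclidean_space) \<le> r} \<le>
    ennreal (unit_ball_vol DIM('a) * r powr DIM('a))"
proof -
  have "{x \<in> space lborel. norm (x::'a) \<le> r} = cball 0 r" by (auto simp: dist_norm)
  then show ?thesis using emeasure_cball[of r "0::'a"] assms by (simp add: powr_realpow)
qed

text \<open>The Poisson kernel of the half-space is used without its normalising constant.\<close>

definition poisson :: "real \<Rightarrow> 'a::euclidean_space \<Rightarrow> real" where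
  "poisson s y = s / (s\<^sup>2 + (norm y)\<^sup>2) powr ((real DIM('a) + 1) / 2)"

lemma poisson_nonneg: "s \<ge> 0 \<Longrightarrow> poisson s y \<ge> 0"
  by (simp add: poisson_def)

lemma poisson_pos: "s > 0 \<Longrightarrow> poisson s y > 0"
  by (simp add: poisson_def add_pos_nonneg)

lemma poisson_minus [simp]: "poisson s (- y) = poisson s y"
  by (simp add: poisson_def)

lemma poisson_measurable [measurable]:
  assumes [measurable]: "f \<in> borel_measurable M" "g \<in> borel_measurable M"
  shows "(\<lambda>x. poisson (f x) (g x)) \<in> borel_measurable M"
  unfolding poisson_def by measurable

lemma poisson_scale:
  fixes y :: "'a::euclidean_space"
  assumes "c > 0" "s > 0"
  shows "poisson (c * s) (c *\<^sub>R y) = poisson s y / c ^ DIM('a)"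
proof -
  have "((c * s)\<^sup>2 + (norm (c *\<^sub>R y))\<^sup>2) = c\<^sup>2 * (s\<^sup>2 + (norm y)\<^sup>2)"
    by (simp add: power_mult_distrib algebra_simps)
  then have "((c * s)\<^sup>2 + (norm (c *\<^sub>R y))\<^sup>2) powr ((real DIM('a) + 1) / 2) =
     (c\<^sup>2) powr ((real DIM('a) + 1) / 2) * (s\<^sup>2 + (norm y)\<^sup>2) powr ((real DIM('a) + 1) / 2)"
    using assms by (simp add: powr_mult)
  also have "c\<^sup>2 = c powr 2" using assms by simp
  also have "(c powr 2) powr ((real DIM('a) + 1) / 2) = c powr (real DIM('a) + 1)"
    by (simp only: powr_powr) (simp add: add_divide_distrib)
  also have "\<dots> = c * c ^ DIM('a)" using assms by (simp add: powr_add powr_realpow)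
  finally have "poisson (c * s) (c *\<^sub>R y) = (c * s) / (c * c ^ DIM('a) * (s\<^sup>2 + (norm y)\<^sup>2) powr ((real DIM('a) + 1) / 2))"
    by (simp only: poisson_def)
  then show ?thesis using assms by (simp add: poisson_def mult.commute)
qed

lemma poisson_le:
  fixes y :: "'a::euclidean_space"
  assumes "s > 0" "y \<noteq> 0"
  shows "poisson s y \<le> s * norm y powr (- (real DIM('a) + 1))"
proof -
  have "(norm y)\<^sup>2 = norm y powr 2" using assms by simp
  then have "norm y powr (real DIM('a) + 1) = ((norm y)\<^sup>2) powr ((real DIM('a) + 1) / 2)"
    by (simp only: powr_powr) (simp add: add_divide_distrib)
  also have "\<dots> \<le> (s\<^sup>2 + (norm y)\<^sup>2) powr ((real DIM('a) + 1) / 2)"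
    by (intro powr_mono2) auto
  finally have "s / (s\<^sup>2 + (norm y)\<^sup>2) powr ((real DIM('a) + 1) / 2) \<le> s / norm y powr (real DIM('a) + 1)"
    using assms by (intro divide_left_mono mult_pos_pos) (auto simp: add_pos_nonneg)
  then show ?thesis by (simp only: poisson_def powr_minus divide_inverse)
qed

section \<open>The semigroup property of the Poisson kernel\<close>

abbreviation pos_ind :: "real \<Rightarrow> real" where "pos_ind \<equiv> indicator {0<..}"

text \<open>The substitution rule on compact intervals is applied to
  \<open>[1 / (n + 2), n + 2]\<close>, and both sides pass to the limit as measures of increasing
  sets. The offset 2 makes already the first interval nondegenerate. The range \<open>S\<close> is
  given as the union of the image intervals because \<open>g\<close> may be unbounded at both
  ends.\<close>

lemma nn_integral_substitution_pos:
  fixes f :: "real \<Rightarrow> ennreal"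
  assumes f[measurable]: "f \<in> borel_measurable borel"
    and g[measurable]: "g \<in> borel_measurable borel" and g'[measurable]: "g' \<in> borel_measurable borel"
    and deriv: "\<And>q. q > 0 \<Longrightarrow> (g has_real_derivative g' q) (at q)"
    and cont: "continuous_on {0<..} g'" and pos: "\<And>q. q > 0 \<Longrightarrow> g' q \<ge> 0"
    and S: "(\<Union>n. {g (1 / (real n + 2)) .. g (real n + 2)}) = S"
  shows "(\<integral>\<^sup>+z. f z * indicator S z \<partial>lborel) = (\<integral>\<^sup>+q. f (g q) * ennreal (g' q) * indicator {0<..} q \<partial>lborel)"
proof -
  define a b where "a n = 1 / (real n + 2)" and "b n = real n + 2" for n :: nat
  have ab: "a n < b n" "0 < a n" "0 < b n" for n unfolding a_def b_def by (auto simp: divide_simps algebra_simps add_pos_nonneg)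
  have a_mono: "a n \<le> a m" and b_mono: "b m \<le> b n" if "m \<le> n" for m n
    using that by (auto simp: a_def b_def intro!: divide_left_mono)
  have gmono: "g p \<le> g q" if "0 < p" "p \<le> q" for p q
  proof (rule DERIV_nonneg_imp_nondecreasing[OF that(2)])
    fix x assume "p \<le> x"
    then have "x > 0" using that by simp
    then show "\<exists>y. (g has_real_derivative y) (at x) \<and> 0 \<le> y" using deriv pos by blast
  qed
  have Sm[measurable]: "S \<in> sets borel" unfolding S[symmetric] by auto
  have U: "(\<Union>n. {a n .. b n}) = {0<..}"
  proof safe
    fix q :: real assume q: "0 < q"
    obtain n where n: "real n > max q (1 / q)" using reals_Archimedean2 by blast
    have "1 / (real n + 2) \<le> 1 / (1 / q)" using n q by (intro divide_left_mono) auto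
    then have "q \<in> {a n .. b n}" using n q unfolding a_def b_def by auto
    then show "q \<in> (\<Union>n. {a n .. b n})" by blast
  qed (use ab(2) in \<open>auto intro: less_le_trans\<close>)
  have eq: "(\<integral>\<^sup>+z. f z * indicator {g (a n)..g (b n)} z \<partial>lborel) = (\<integral>\<^sup>+q. f (g q) * ennreal (g' q) * indicator {a n..b n} q \<partial>lborel)" for n
    by (rule nn_integral_substitution_aux[OF f])
      (use ab[of n] deriv pos in \<open>auto intro!: continuous_on_subset[OF cont] intro: less_le_trans\<close>)
  have "(SUP n. emeasure (density lborel f) {g (a n)..g (b n)}) = emeasure (density lborel f) (\<Union>n. {g (a n)..g (b n)})"
    by (rule SUP_emeasure_incseq) (auto simp: incseq_def intro!: gmono ab a_mono b_mono intro: order_trans)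
  moreover have "(SUP n. emeasure (density lborel (\<lambda>q. f (g q) * ennreal (g' q))) {a n..b n}) =
    emeasure (density lborel (\<lambda>q. f (g q) * ennreal (g' q))) (\<Union>n. {a n..b n})"
    by (rule SUP_emeasure_incseq) (auto simp: incseq_def dest: a_mono b_mono)
  moreover have "(\<Union>n. {g (a n)..g (b n)}) = S" using S by (simp add: a_def b_def)
  ultimately show ?thesis unfolding U by (simp add: emeasure_density eq)
qed

lemma nn_integral_Gamma_scaled:
  assumes a: "a > 0" and A: "A > 0"
  shows "(\<integral>\<^sup>+l. ennreal (pos_ind l * (l powr (a - 1) * exp (- (l * A)))) \<partial>lborel) = ennreal (Gamma a * A powr (- a))"
proof -
  let ?f = "\<lambda>l. ennreal (pos_ind l * (l powr (a - 1) * exp (- l)))"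
  have "ennreal (Gamma a) = (\<integral>\<^sup>+t. ennreal (t powr (a - 1) / exp t) * indicator {0..} t \<partial>lborel)"
    using a by (intro nn_integral_has_integral_lebesgue'[symmetric] Gamma_integral_real) auto
  also have "\<dots> = (\<integral>\<^sup>+l. ?f l \<partial>lborel)"
    by (intro nn_integral_cong) (auto simp: indicator_def exp_minus divide_inverse)
  also have "\<dots> = \<bar>A\<bar> * (\<integral>\<^sup>+l. ?f (0 + A * l) \<partial>lborel)"
    using A by (intro nn_integral_real_affine) auto
  also have "(\<integral>\<^sup>+l. ?f (0 + A * l) \<partial>lborel) =
    (\<integral>\<^sup>+l. ennreal (A powr (a - 1)) * ennreal (pos_ind l * (l powr (a - 1) * exp (- (l * A)))) \<partial>lborel)"
    using A by (intro nn_integral_cong)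
      (auto simp: indicator_def zero_less_mult_iff powr_mult ennreal_mult[symmetric] mult_ac)
  also have "\<dots> = ennreal (A powr (a - 1)) * (\<integral>\<^sup>+l. ennreal (pos_ind l * (l powr (a - 1) * exp (- (l * A)))) \<partial>lborel)"
    by (intro nn_integral_cmult) auto
  finally have "ennreal (Gamma a) = ennreal A * (ennreal (A powr (a - 1)) *
    (\<integral>\<^sup>+l. ennreal (pos_ind l * (l powr (a - 1) * exp (- (l * A)))) \<partial>lborel))" using A by simp
  then have "ennreal (A powr (- a)) * ennreal (Gamma a) = ennreal (A powr (- a) * (A * A powr (a - 1))) *
    (\<integral>\<^sup>+l. ennreal (pos_ind l * (l powr (a - 1) * exp (- (l * A)))) \<partial>lborel)"
    using A by (simp add: ennreal_mult mult.assoc)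
  moreover have "A powr (- a) * (A * A powr (a - 1)) = 1"
  proof -
    have "A powr (- a) * (A powr 1 * A powr (a - 1)) = A powr (- a + (1 + (a - 1)))"
      by (simp only: powr_add)
    then show ?thesis using A by simp
  qed
  ultimately show ?thesis using a A by (simp add: ennreal_mult[symmetric] Gamma_real_pos less_imp_le mult.commute)
qed

text \<open>Left unevaluated: the normalisation of the semigroup law is recovered afterwards by
  comparing total masses.\<close>

definition gauss_mass :: "'a::euclidean_space itself \<Rightarrow> ennreal" where
  "gauss_mass _ = (\<integral>\<^sup>+y. ennreal (exp (- (norm y)\<^sup>2)) \<partial>(lborel :: 'a measure))"

text \<open>Completing the square: after the shift by \<open>b\<close> the exponent splits into a
  part in \<open>x\<close> with the parameter \<open>l * m / (l + m)\<close> and a centred Gaussian,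
  which is rescaled by \<open>c\<close>.\<close>

lemma nn_integral_gauss_product:
  fixes x :: "'a::euclidean_space"
  assumes l: "l > 0" and m: "m > 0"
  shows "(\<integral>\<^sup>+y. ennreal (exp (- (l * (norm y)\<^sup>2) - m * (norm (x - y))\<^sup>2)) \<partial>(lborel::'a measure)) =
    ennreal ((l + m) powr (- (real DIM('a) / 2)) * exp (- (l * m / (l + m) * (norm x)\<^sup>2))) * gauss_mass TYPE('a)"
proof -
  define b where "b = (m / (l + m)) *\<^sub>R x"
  define c where "c = sqrt (l + m)"
  have lm: "l + m > 0" using l m by simp
  have c: "c > 0" "c\<^sup>2 = l + m" using lm by (auto simp: c_def)
  have sq: "l * (norm (b + z))\<^sup>2 + m * (norm (x - (b + z)))\<^sup>2 = (norm (c *\<^sub>R z))\<^sup>2 + l * m / (l + m) * (norm x)\<^sup>2" for z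
  proof -
    define X Y Z where "X = x \<bullet> x" and "Y = x \<bullet> z" and "Z = z \<bullet> z"
    define r where "r = m / (l + m)"
    have r: "(l + m) * r = m" using lm by (simp add: r_def)
    have "l * (norm (b + z))\<^sup>2 + m * (norm (x - (b + z)))\<^sup>2 = l * (r\<^sup>2 * X + 2 * r * Y + Z) +
       m * ((1 - r)\<^sup>2 * X - 2 * (1 - r) * Y + Z)"
      unfolding power2_norm_eq_inner b_def X_def Y_def Z_def r_def[symmetric]
      by (simp add: inner_simps inner_commute power2_eq_square algebra_simps)
    also have "\<dots> = (l + m) * Z + (2 * ((l + m) * r) - 2 * m) * Y + ((l + m) * r * r - 2 * m * r + m) * X"
      by (simp add: power2_eq_square algebra_simps)
    also have "\<dots> = (l + m) * Z + (m - m * r) * X" unfolding r by (simp add: algebra_simps)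
    also have "m - m * r = l * m / (l + m)" unfolding r_def using lm by (simp add: divide_simps algebra_simps)
    also have "(l + m) * Z = (norm (c *\<^sub>R z))\<^sup>2" using c by (simp add: power_mult_distrib Z_def power2_norm_eq_inner)
    finally show ?thesis by (simp add: X_def power2_norm_eq_inner)
  qed
  have "(\<integral>\<^sup>+y. ennreal (exp (- (l * (norm y)\<^sup>2) - m * (norm (x - y))\<^sup>2)) \<partial>(lborel::'a measure)) =
    (\<integral>\<^sup>+z. ennreal (exp (- (l * (norm (b + z))\<^sup>2) - m * (norm (x - (b + z)))\<^sup>2)) \<partial>(lborel::'a measure))"
    by (rule nn_integral_lborel_shift[symmetric]) measurable
  also have "\<dots> = (\<integral>\<^sup>+z. ennreal (exp (- (l * m / (l + m) * (norm x)\<^sup>2))) * ennreal (exp (- (norm (c *\<^sub>R z))\<^sup>2)) \<partial>(lborel::'a measure))"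
  proof (intro nn_integral_cong)
    fix z
    have "- (l * (norm (b + z))\<^sup>2) - m * (norm (x - (b + z)))\<^sup>2 = - (l * m / (l + m) * (norm x)\<^sup>2) + - (norm (c *\<^sub>R z))\<^sup>2"
      using sq[of z] by linarith
    then show "ennreal (exp (- (l * (norm (b + z))\<^sup>2) - m * (norm (x - (b + z)))\<^sup>2)) =
      ennreal (exp (- (l * m / (l + m) * (norm x)\<^sup>2))) * ennreal (exp (- (norm (c *\<^sub>R z))\<^sup>2))"
      by (simp only: exp_add) (simp add: ennreal_mult)
  qed
  also have "\<dots> = ennreal (exp (- (l * m / (l + m) * (norm x)\<^sup>2))) * (\<integral>\<^sup>+z. ennreal (exp (- (norm (c *\<^sub>R z))\<^sup>2)) \<partial>(lborel::'a measure))"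
    by (intro nn_integral_cmult) measurable
  also have "(\<integral>\<^sup>+z. ennreal (exp (- (norm (c *\<^sub>R z))\<^sup>2)) \<partial>(lborel::'a measure)) = ennreal ((l + m) powr (- (real DIM('a) / 2))) * gauss_mass TYPE('a)"
  proof -
    have "(l + m) powr (- (real DIM('a) / 2)) * c ^ DIM('a) = 1"
    proof -
      have "c ^ DIM('a) = c powr real DIM('a)" using c by (simp add: powr_realpow)
      also have "\<dots> = (l + m) powr (real DIM('a) / 2)" using lm by (simp add: c_def powr_half_sqrt[symmetric] powr_powr)
      finally show ?thesis using lm by (simp add: powr_minus)
    qed
    then have "(\<integral>\<^sup>+z. ennreal (exp (- (norm (c *\<^sub>R z))\<^sup>2)) \<partial>(lborel::'a measure)) = ennreal ((l + m) powr (- (real DIM('a) / 2)) * c ^ DIM('a)) *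
      (\<integral>\<^sup>+z. ennreal (exp (- (norm (c *\<^sub>R z))\<^sup>2)) \<partial>(lborel::'a measure))" by simp
    also have "\<dots> = ennreal ((l + m) powr (- (real DIM('a) / 2))) * (ennreal (c ^ DIM('a)) *
      (\<integral>\<^sup>+z. ennreal (exp (- (norm (c *\<^sub>R z))\<^sup>2)) \<partial>(lborel::'a measure)))"
      using c by (simp add: ennreal_mult mult.assoc)
    also have "\<dots> = ennreal ((l + m) powr (- (real DIM('a) / 2))) * gauss_mass TYPE('a)"
      unfolding gauss_mass_def
      by (subst nn_integral_lborel_scale[OF _ c(1), where f="\<lambda>z. ennreal (exp (- (norm z)\<^sup>2))"]) auto
    finally show ?thesis .
  qed
  finally show ?thesis by (simp add: ennreal_mult mult_ac)
qed

text \<open>The substitution \<open>z = s \<surd>q - t / \<surd>q\<close>; its two derivative terms contribute equally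
  because \<open>q \<mapsto> (t / s)\<^sup>2 / q\<close> maps \<open>z\<close> to \<open>-z\<close>.\<close>

lemma nn_integral_levy:
  fixes s t k :: real
  assumes s: "s > 0" and t: "t > 0" and k: "k > 0"
  shows "(\<integral>\<^sup>+q. ennreal (pos_ind q * ((1 + q) * q powr (- (3/2)) * exp (- (k * (s * sqrt q - t / sqrt q)\<^sup>2)))) \<partial>lborel)
     = ennreal (k powr (- (1/2)) * ((s + t) / (s * t))) * gauss_mass TYPE(real)"
proof -
  define z where "z = (\<lambda>q. s * sqrt q - t / sqrt q)"
  define e where "e = (\<lambda>q. exp (- (k * (z q)\<^sup>2)))"
  have z_meas[measurable]: "z \<in> borel_measurable borel"
    unfolding z_def by measurable
  have e_meas[measurable]: "e \<in> borel_measurable borel"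
    unfolding e_def by measurable
  have e_nonneg: "e q \<ge> 0" for q by (simp add: e_def)
  define A where "A = (\<integral>\<^sup>+q. ennreal (pos_ind q * (q powr (- (1/2)) * e q)) \<partial>lborel)"
  define B where "B = (\<integral>\<^sup>+q. ennreal (pos_ind q * (q powr (- (3/2)) * e q)) \<partial>lborel)"
  define W where "W = ennreal (k powr (- (1/2))) * gauss_mass TYPE(real)"
  have pw1: "q powr (- (1/2)) = 1 / sqrt q" if "q > 0" for q
    using that by (simp add: powr_minus_divide powr_half_sqrt)
  have pw3: "q powr (- (3/2)) = 1 / (q * sqrt q)" if "q > 0" for q :: real
  proof -
    have "q powr (3/2) = q powr (1 + 1/2)" by simp
    also have "\<dots> = q * sqrt q" using that by (simp only: powr_add) (simp add: powr_half_sqrt)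
    finally show ?thesis using that by (simp add: powr_minus_divide)
  qed
  have sum_eq: "ennreal s * A + ennreal t * B = 2 * W"
  proof -
    define z' where "z' = (\<lambda>q. (s * q powr (- (1/2)) + t * q powr (- (3/2))) / 2)"
    have "(\<integral>\<^sup>+x. ennreal (exp (- (k * x\<^sup>2))) * indicator UNIV x \<partial>lborel) =
      (\<integral>\<^sup>+q. ennreal (exp (- (k * (z q)\<^sup>2))) * ennreal (z' q) * indicator {0<..} q \<partial>lborel)"
    proof (rule nn_integral_substitution_pos)
      fix q :: real assume q: "q > 0"
      show "(z has_real_derivative z' q) (at q)"
        unfolding z_def z'_def pw1[OF q] pw3[OF q] using q
        by (auto intro!: derivative_eq_intros simp: field_simps)
      show "z' q \<ge> 0" using s t by (simp add: z'_def)
    next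
      show "continuous_on {0<..} z'" unfolding z'_def by (intro continuous_intros) auto
      show "(\<Union>n. {z (1 / (real n + 2)) .. z (real n + 2)}) = UNIV"
      proof -
        have "\<exists>n. z (1 / (real n + 2)) \<le> x \<and> x \<le> z (real n + 2)" for x
        proof -
          \<comment> \<open>Chosen so that \<open>r \<ge> w\<close> and \<open>r \<ge> 1\<close>
            push both ends of the image interval beyond \<open>\<bar>x\<bar>\<close>:
            \<open>t * r - s \<ge> \<bar>x\<bar>\<close> below and
            \<open>s * r - t \<ge> \<bar>x\<bar>\<close> above.\<close>
          define w where "w = max ((\<bar>x\<bar> + s) / t) ((\<bar>x\<bar> + t) / s)"
          obtain n where n: "real n > w\<^sup>2" using reals_Archimedean2 by blast
          define r where "r = sqrt (real n + 2)"
          have r: "r \<ge> 1" "1 / r \<le> 1" "r \<ge> w" unfolding r_def using n by (auto intro!: real_le_rsqrt)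
          then have "\<bar>x\<bar> + s \<le> t * r" "\<bar>x\<bar> + t \<le> s * r"
            using s t by (auto simp: w_def field_simps)
          moreover have "z (1 / (real n + 2)) = s * (1 / r) - t * r" "z (real n + 2) = s * r - t * (1 / r)"
            by (auto simp: z_def r_def real_sqrt_divide)
          moreover have "s * (1 / r) \<le> s" "t * (1 / r) \<le> t" using mult_left_mono[OF r(2), of s] mult_left_mono[OF r(2), of t] s t by simp_all
          ultimately show ?thesis by (intro exI[of _ n]) auto
        qed
        then show ?thesis by auto
      qed
    qed (unfold z'_def, measurable)
    also have "\<dots> = (\<integral>\<^sup>+q. ennreal (s / 2) * ennreal (pos_ind q * (q powr (- (1/2)) * e q)) +
       ennreal (t / 2) * ennreal (pos_ind q * (q powr (- (3/2)) * e q)) \<partial>lborel)"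
      using s t by (intro nn_integral_cong)
        (auto simp: indicator_def e_def z'_def ennreal_mult[symmetric] ennreal_plus[symmetric] field_simps simp del: ennreal_plus)
    also have "\<dots> = ennreal (s / 2) * A + ennreal (t / 2) * B"
      unfolding A_def B_def by (subst nn_integral_add) (auto simp: nn_integral_cmult)
    also have "(\<integral>\<^sup>+x. ennreal (exp (- (k * x\<^sup>2))) * indicator UNIV x \<partial>lborel) = W"
    proof -
      have "gauss_mass TYPE(real) = ennreal (sqrt k) * (\<integral>\<^sup>+x. ennreal (exp (- (norm (sqrt k *\<^sub>R x))\<^sup>2)) \<partial>(lborel :: real measure))"
        unfolding gauss_mass_def
        using nn_integral_lborel_scale[of "\<lambda>z::real. ennreal (exp (- (norm z)\<^sup>2))" "sqrt k"] k by simp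
      then have "W = ennreal (k powr (- (1/2)) * sqrt k) * (\<integral>\<^sup>+x. ennreal (exp (- (norm (sqrt k *\<^sub>R x))\<^sup>2)) \<partial>(lborel :: real measure))"
        using k by (simp add: W_def ennreal_mult mult.assoc)
      then show ?thesis using k by (simp add: pw1 power_mult_distrib)
    qed
    finally have "2 * W = 2 * (ennreal (s / 2) * A + ennreal (t / 2) * B)" by simp
    also have "\<dots> = ennreal (2 * (s / 2)) * A + ennreal (2 * (t / 2)) * B"
      using s t by (subst (1 2) ennreal_mult) (auto simp: distrib_left mult.assoc)
    finally show ?thesis using s t by simp
  qed
  have inv: "ennreal s * A = ennreal t * B"
  proof -
    define c where "c = (t / s)\<^sup>2"
    have c: "c > 0" "sqrt c = t / s" using s t by (auto simp: c_def)
    \<comment> \<open>The inversion of \<open>q\<close> is decreasing. Reflecting the integrand to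
      the negative axis first makes the substitution \<open>- (c / q)\<close> increasing, as the
      substitution rule demands.\<close>
    let ?f = "\<lambda>q. ennreal (pos_ind (- q) * ((- q) powr (- (1/2)) * e (- q)))"
    have "A = (\<integral>\<^sup>+q. ?f q \<partial>lborel)"
      unfolding A_def by (subst nn_integral_real_affine[of _ "-1" 0]) simp_all
    also have "\<dots> = (\<integral>\<^sup>+q. ?f q * indicator {..<0} q \<partial>lborel)"
      by (intro nn_integral_cong) (auto simp: indicator_def)
    also have "\<dots> = (\<integral>\<^sup>+q. ?f (- (c / q)) * ennreal (c / q\<^sup>2) * indicator {0<..} q \<partial>lborel)"
    proof (rule nn_integral_substitution_pos)
      show "((\<lambda>q. - (c / q)) has_real_derivative c / q\<^sup>2) (at q)" if "q > 0" for q
        using that by (auto intro!: derivative_eq_intros simp: power2_eq_square)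
      show "continuous_on {0<..} (\<lambda>q. c / q\<^sup>2)" by (intro continuous_intros) auto
      show "(\<Union>n. {- (c / (1 / (real n + 2))) .. - (c / (real n + 2))}) = {..<0}"
      proof safe
        fix x :: real assume x: "x < 0"
        obtain n where n: "real n > max (- x / c) (c / (- x))" using reals_Archimedean2 by blast
        have "- x \<le> c * (real n + 2)" using n c x by (simp add: field_simps)
        moreover have "c / (real n + 2) \<le> - x" using n c x by (simp add: field_simps)
        ultimately have "x \<in> {- (c / (1 / (real n + 2))) .. - (c / (real n + 2))}" by simp
        then show "x \<in> (\<Union>n. {- (c / (1 / (real n + 2))) .. - (c / (real n + 2))})" by blast
      next
        fix x n assume "x \<in> {- (c / (1 / (real n + 2))) .. - (c / (real n + 2))}"
        moreover have "c / (real n + 2) > 0" using c by (simp add: add_nonneg_pos)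
        ultimately show "x < 0" by auto
      qed
    qed (use c in auto)
    also have "\<dots> = (\<integral>\<^sup>+q. ennreal (t / s) * ennreal (pos_ind q * (q powr (- (3/2)) * e q)) \<partial>lborel)"
    proof (intro nn_integral_cong)
      fix q :: real
      show "?f (- (c / q)) * ennreal (c / q\<^sup>2) * indicator {0<..} q = ennreal (t / s) * ennreal (pos_ind q * (q powr (- (3/2)) * e q))"
      proof (cases "q > 0")
        case q: True
        have cq: "c / q > 0" "sqrt (c / q) = (t / s) / sqrt q" using c q by (auto simp: real_sqrt_divide)
        have "z (c / q) = - z q" unfolding z_def cq(2) using s t q by (simp add: field_simps)
        then have ee: "e (c / q) = e q" by (simp add: e_def)
        have "(c / q) powr (- (1/2)) * (c / q\<^sup>2) = (t / s) * q powr (- (3/2))"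
        proof -
          have "(c / q) powr (- (1/2)) = sqrt q * s / t"
            unfolding pw1[OF cq(1)] cq(2) by simp
          then have "(c / q) powr (- (1/2)) * (c / q\<^sup>2) = (sqrt q * s / t) * ((t / s)\<^sup>2 / q\<^sup>2)"
            by (simp only: c_def)
          also have "\<dots> = (t / s) * (sqrt q / q\<^sup>2)" using s t by (simp add: power2_eq_square)
          also have "sqrt q / q\<^sup>2 = sqrt q / (q * (sqrt q * sqrt q))" using q by (simp add: power2_eq_square)
          also have "\<dots> = 1 / (q * sqrt q)" using q by (simp add: divide_simps)
          finally show ?thesis unfolding pw3[OF q] .
        qed
        then have "(c / q) powr (- (1/2)) * e q * (c / q\<^sup>2) = (t / s) * (q powr (- (3/2)) * e q)"
          by (simp add: mult_ac)
        then show ?thesis using q cq c s t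
          by (simp add: ee ennreal_mult[symmetric] e_nonneg)
      qed (auto simp: indicator_def)
    qed
    also have "\<dots> = ennreal (t / s) * B" unfolding B_def by (intro nn_integral_cmult) measurable
    finally have AB: "A = ennreal (t / s) * B" .
    have "ennreal s * ennreal (t / s) = ennreal t" using s t by (simp add: ennreal_mult[symmetric])
    then show ?thesis unfolding AB by (simp only: mult.assoc[symmetric])
  qed
  have two: "A = ennreal (1 / s) * W" "B = ennreal (1 / t) * W"
  proof -
    have "2 * (ennreal s * A) = 2 * W" "2 * (ennreal t * B) = 2 * W" using sum_eq inv by (simp_all flip: mult_2)
    then have "ennreal s * A = W" "ennreal t * B = W" by (simp_all add: ennreal_mult_cancel_left)
    moreover have "ennreal (1 / s) * (ennreal s * A) = A" "ennreal (1 / t) * (ennreal t * B) = B"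
      using s t by (simp_all add: mult.assoc[symmetric] ennreal_mult[symmetric])
    ultimately show "A = ennreal (1 / s) * W" "B = ennreal (1 / t) * W" by simp_all
  qed
  have "(\<integral>\<^sup>+q. ennreal (pos_ind q * ((1 + q) * q powr (- (3/2)) * exp (- (k * (s * sqrt q - t / sqrt q)\<^sup>2)))) \<partial>lborel) =
    (\<integral>\<^sup>+q. ennreal (pos_ind q * (q powr (- (1/2)) * e q)) + ennreal (pos_ind q * (q powr (- (3/2)) * e q)) \<partial>lborel)"
  proof (intro nn_integral_cong)
    fix q :: real
    have "(1 + q) * q powr (- (3/2)) = q powr (- (1/2)) + q powr (- (3/2))" if "q > 0"
      unfolding pw1[OF that] pw3[OF that] using that by (simp add: field_simps)
    then show "ennreal (pos_ind q * ((1 + q) * q powr (- (3/2)) * exp (- (k * (s * sqrt q - t / sqrt q)\<^sup>2)))) =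
      ennreal (pos_ind q * (q powr (- (1/2)) * e q)) + ennreal (pos_ind q * (q powr (- (3/2)) * e q))"
      by (cases "q > 0") (auto simp: e_def z_def distrib_right ennreal_plus[symmetric] simp del: ennreal_plus)
  qed
  also have "\<dots> = A + B" unfolding A_def B_def by (intro nn_integral_add) measurable
  also have "\<dots> = ennreal (1 / s + 1 / t) * W" unfolding two using s t by (simp add: distrib_right)
  also have "1 / s + 1 / t = (s + t) / (s * t)" using s t by (simp add: field_simps)
  also have "ennreal ((s + t) / (s * t)) * W = ennreal (k powr (- (1/2)) * ((s + t) / (s * t))) * gauss_mass TYPE(real)"
  proof -
    have "ennreal (k powr (- (1/2)) * ((s + t) / (s * t))) = ennreal (k powr (- (1/2))) * ennreal ((s + t) / (s * t))"
      using s t by (intro ennreal_mult) auto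
    then show ?thesis by (simp only: W_def mult_ac)
  qed
  finally show ?thesis .
qed

text \<open>Subordination: the Gamma integral with parameter
  \<open>s\<^sup>2 + (norm y)\<^sup>2\<close> exhibits the Poisson kernel as a mixture of Gaussians
  in \<open>y\<close>.\<close>

lemma poisson_eq_Gamma_integral:
  fixes y :: "'a::euclidean_space"
  assumes s: "s > 0"
  defines "a \<equiv> (real DIM('a) + 1) / 2"
  shows "ennreal (Gamma a * poisson s y) =
    (\<integral>\<^sup>+l. ennreal (pos_ind l * (s * l powr ((real DIM('a) - 1) / 2) * exp (- (l * (s\<^sup>2 + (norm y)\<^sup>2))))) \<partial>lborel)"
proof -
  have a: "a > 0" by (simp add: a_def add_pos_pos)
  have a1: "(real DIM('a) - 1) / 2 = a - 1" by (simp add: a_def field_simps)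
  have A: "s\<^sup>2 + (norm y)\<^sup>2 > 0" using s by (simp add: add_pos_nonneg)
  have "(\<integral>\<^sup>+l. ennreal (pos_ind l * (s * l powr ((real DIM('a) - 1) / 2) * exp (- (l * (s\<^sup>2 + (norm y)\<^sup>2))))) \<partial>lborel) =
    (\<integral>\<^sup>+l. ennreal s * ennreal (pos_ind l * (l powr (a - 1) * exp (- (l * (s\<^sup>2 + (norm y)\<^sup>2))))) \<partial>lborel)"
    unfolding a1 using s by (intro nn_integral_cong) (simp add: ennreal_mult[symmetric] mult_ac)
  also have "\<dots> = ennreal s * ennreal (Gamma a * (s\<^sup>2 + (norm y)\<^sup>2) powr (- a))"
    unfolding nn_integral_Gamma_scaled[OF a A, symmetric] by (intro nn_integral_cmult) measurable
  also have "\<dots> = ennreal (Gamma a * poisson s y)"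
    using s a by (simp add: ennreal_mult[symmetric] Gamma_real_pos less_imp_le poisson_def a_def[symmetric] powr_minus_divide mult_ac)
  finally show ?thesis by simp
qed

text \<open>The new variables are \<open>q = l / m\<close> and \<open>k = l * m / (l + m)\<close>,
  that is \<open>l = c * k * q\<close> and \<open>m = c * k\<close>. The Gaussian in
  \<open>x\<close> then depends on \<open>k\<close> only, and the exponent in \<open>s\<close> and
  \<open>t\<close> becomes \<open>k * (s + t)\<^sup>2\<close> plus the square in
  \<open>nn_integral_levy\<close>. The prefactor \<open>c * (c * k)\<close> is the Jacobian of the
  two successive substitutions.\<close>

lemma subordination_kernel:
  fixes x :: "'a::euclidean_space" and s t k q :: real
  assumes s: "s > 0" and t: "t > 0" and k: "k > 0" and q: "q > 0"
  defines "H \<equiv> \<lambda>l m. s * t * (l * m) powr ((real DIM('a) - 1) / 2) * exp (- (l * s\<^sup>2) - m * t\<^sup>2) *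
      ((l + m) powr (- (real DIM('a) / 2)) * exp (- (l * m / (l + m) * (norm x)\<^sup>2)))"
  defines "c \<equiv> (1 + q) / q"
  shows "c * (c * k) * H (c * k * q) (c * k) = s * t * (k powr (real DIM('a) / 2) * exp (- (k * ((s + t)\<^sup>2 + (norm x)\<^sup>2)))) *
     ((1 + q) * q powr (- (3/2)) * exp (- (k * (s * sqrt q - t / sqrt q)\<^sup>2)))"
proof -
  define u where "u = (1 + q)\<^sup>2 / q"
  define n where "n = real DIM('a)"
  have u: "u > 0" using q by (simp add: u_def)
  have lm: "(c * k * q) * (c * k) = k\<^sup>2 * u" "c * k * q + c * k = k * u" "c * (c * k) = k * (u / q)"
    using q by (simp_all add: c_def u_def power2_eq_square field_simps)
  have frac: "k\<^sup>2 * u / (k * u) = k" using k u by (simp add: power2_eq_square)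
  have ex: "- (c * k * q * s\<^sup>2) - c * k * t\<^sup>2 = - (k * (s + t)\<^sup>2) + - (k * (s * sqrt q - t / sqrt q)\<^sup>2)"
  proof -
    have "(s * sqrt q - t / sqrt q)\<^sup>2 = s\<^sup>2 * q + t\<^sup>2 / q - 2 * s * t"
      using q by (simp add: power2_diff power_mult_distrib power_divide)
    moreover have "c * q = 1 + q" "c = 1 + 1 / q" using q by (simp_all add: c_def field_simps)
    moreover have "- (c * k * q * s\<^sup>2) - c * k * t\<^sup>2 = - (k * ((c * q) * s\<^sup>2 + c * t\<^sup>2))"
      by (simp add: algebra_simps)
    moreover have "(1 + q) * s\<^sup>2 + (1 + 1 / q) * t\<^sup>2 = (s + t)\<^sup>2 + (s\<^sup>2 * q + t\<^sup>2 / q - 2 * s * t)"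
      by (simp add: power2_sum algebra_simps)
    ultimately have "- (c * k * q * s\<^sup>2) - c * k * t\<^sup>2 = - (k * ((s + t)\<^sup>2 + (s * sqrt q - t / sqrt q)\<^sup>2))"
      by metis
    then show ?thesis by (simp add: algebra_simps)
  qed
  have pw: "(k\<^sup>2 * u) powr ((real DIM('a) - 1) / 2) * (k * u) powr (- (n / 2)) * (k * (u / q)) =
      k powr (n / 2) * ((1 + q) * q powr (- (3/2)))"
  proof -
    have "(k\<^sup>2 * u) powr ((real DIM('a) - 1) / 2) = k powr (2 * ((real DIM('a) - 1) / 2)) * u powr ((real DIM('a) - 1) / 2)"
      using k u by (simp add: powr_mult powr_powr flip: powr_numeral)
    moreover have "(k * u) powr (- (n / 2)) = k powr (- (n / 2)) * u powr (- (n / 2))"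
      using k u by (simp add: powr_mult)
    ultimately have "(k\<^sup>2 * u) powr ((real DIM('a) - 1) / 2) * (k * u) powr (- (n / 2)) * (k * (u / q)) =
      (k powr (2 * ((real DIM('a) - 1) / 2)) * k powr (- (n / 2)) * k powr 1) * (u powr ((real DIM('a) - 1) / 2) * u powr (- (n / 2)) * u powr 1) / q"
      using k u by (simp add: mult_ac)
    also have "k powr (2 * ((real DIM('a) - 1) / 2)) * k powr (- (n / 2)) * k powr 1 = k powr (n / 2)"
      by (simp only: powr_add[symmetric]) (simp add: n_def field_simps)
    also have "u powr ((real DIM('a) - 1) / 2) * u powr (- (n / 2)) * u powr 1 = u powr (1 / 2)"
      by (simp only: powr_add[symmetric]) (simp add: n_def field_simps)
    also have "u powr (1 / 2) = (1 + q) / sqrt q"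
      using q u by (simp add: powr_half_sqrt u_def real_sqrt_divide)
    also have "k powr (n / 2) * ((1 + q) / sqrt q) / q = k powr (n / 2) * ((1 + q) * (1 / (q * sqrt q)))"
      by simp
    also have "1 / (q * sqrt q) = q powr (- (3/2))"
    proof -
      have "q powr (3/2) = q powr (1 + 1/2)" by simp
      also have "\<dots> = q * sqrt q" using q by (simp only: powr_add) (simp add: powr_half_sqrt)
      finally show ?thesis by (simp add: powr_minus_divide)
    qed
    finally show ?thesis .
  qed
  have "c * (c * k) * H (c * k * q) (c * k) = s * t * ((k\<^sup>2 * u) powr ((real DIM('a) - 1) / 2) * (k * u) powr (- (n / 2)) * (k * (u / q))) *
     (exp (- (c * k * q * s\<^sup>2) - c * k * t\<^sup>2) * exp (- (k * (norm x)\<^sup>2)))"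
    unfolding H_def lm frac n_def by (simp only: mult_ac)
  also have "\<dots> = s * t * (k powr (n / 2) * exp (- (k * ((s + t)\<^sup>2 + (norm x)\<^sup>2)))) *
     ((1 + q) * q powr (- (3/2)) * exp (- (k * (s * sqrt q - t / sqrt q)\<^sup>2)))"
    unfolding pw ex by (simp add: exp_add[symmetric] exp_diff algebra_simps flip: exp_add) 
  finally show ?thesis by (simp only: n_def)
qed

lemma nn_integral_lborel_swap:
  fixes f :: "'a::euclidean_space \<Rightarrow> 'b::euclidean_space \<Rightarrow> ennreal"
  assumes [measurable]: "case_prod f \<in> borel_measurable (borel \<Otimes>\<^sub>M borel)"
  shows "(\<integral>\<^sup>+x. \<integral>\<^sup>+y. f x y \<partial>lborel \<partial>lborel) = (\<integral>\<^sup>+y. \<integral>\<^sup>+x. f x y \<partial>lborel \<partial>lborel)"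
  by (rule lborel_pair.Fubini'[symmetric]) simp

text \<open>Both kernels are written as Gaussian mixtures and \<open>y\<close> is integrated out
  first. The substitutions \<open>l = m * q\<close> and \<open>m = c q * k\<close> separate the
  remaining double integral: the integral in \<open>q\<close> is given by
  \<open>nn_integral_levy\<close>, and what is left in \<open>k\<close> is the mixture for time
  \<open>s + t\<close>.\<close>

lemma poisson_convolution_unnormalised:
  fixes x :: "'a::euclidean_space"
  assumes s: "s > 0" and t: "t > 0"
  defines "G \<equiv> Gamma ((real DIM('a) + 1) / 2)"
  shows "(\<integral>\<^sup>+y. ennreal (G * poisson s y) * ennreal (G * poisson t (x - y)) \<partial>lborel) =
    gauss_mass TYPE('a) * gauss_mass TYPE(real) * ennreal (G * poisson (s + t) x)"
proof -
  define e where "e = (real DIM('a) - 1) / 2"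
  define A where "A = (\<lambda>l y::'a. pos_ind l * (s * l powr e * exp (- (l * (s\<^sup>2 + (norm y)\<^sup>2)))))"
  define B where "B = (\<lambda>m y::'a. pos_ind m * (t * m powr e * exp (- (m * (t\<^sup>2 + (norm (x - y))\<^sup>2)))))"
  define H where "H = (\<lambda>l m. s * t * (l * m) powr e * exp (- (l * s\<^sup>2) - m * t\<^sup>2) *
      ((l + m) powr (- (real DIM('a) / 2)) * exp (- (l * m / (l + m) * (norm x)\<^sup>2))))"
  define c where "c = (\<lambda>q::real. (1 + q) / q)"
  define U where "U = (\<lambda>k. s * t * (k powr (real DIM('a) / 2) * exp (- (k * ((s + t)\<^sup>2 + (norm x)\<^sup>2)))))"
  define V where "V = (\<lambda>k q. (1 + q) * q powr (- (3/2)) * exp (- (k * (s * sqrt q - t / sqrt q)\<^sup>2)))"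
  have Am[measurable]: "case_prod A \<in> borel_measurable (borel \<Otimes>\<^sub>M borel)" unfolding A_def by measurable
  have Bm[measurable]: "case_prod B \<in> borel_measurable (borel \<Otimes>\<^sub>M borel)" unfolding B_def by measurable
  have Hm[measurable]: "case_prod H \<in> borel_measurable (borel \<Otimes>\<^sub>M borel)" unfolding H_def by measurable
  have cm[measurable]: "c \<in> borel_measurable borel" unfolding c_def by measurable
  have Um[measurable]: "U \<in> borel_measurable borel" unfolding U_def by measurable
  have Vm[measurable]: "case_prod V \<in> borel_measurable (borel \<Otimes>\<^sub>M borel)" unfolding V_def by measurable
  have nonneg: "A l y \<ge> 0" "B l y \<ge> 0" "H l m \<ge> 0" "U k \<ge> 0" for l y m k
    using s t by (auto simp: A_def B_def H_def U_def)
  have "(\<integral>\<^sup>+y. ennreal (G * poisson s y) * ennreal (G * poisson t (x - y)) \<partial>lborel) =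
    (\<integral>\<^sup>+y. (\<integral>\<^sup>+l. ennreal (A l y) \<partial>lborel) * (\<integral>\<^sup>+m. ennreal (B m y) \<partial>lborel) \<partial>lborel)"
    unfolding G_def poisson_eq_Gamma_integral[OF s] poisson_eq_Gamma_integral[OF t] A_def B_def e_def ..
  also have "\<dots> = (\<integral>\<^sup>+y. \<integral>\<^sup>+l. \<integral>\<^sup>+m. ennreal (A l y) * ennreal (B m y) \<partial>lborel \<partial>lborel \<partial>lborel)"
  proof (intro nn_integral_cong)
    fix y
    have "(\<integral>\<^sup>+l. ennreal (A l y) \<partial>lborel) * (\<integral>\<^sup>+m. ennreal (B m y) \<partial>lborel) =
      (\<integral>\<^sup>+l. ennreal (A l y) * (\<integral>\<^sup>+m. ennreal (B m y) \<partial>lborel) \<partial>lborel)"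
      by (rule nn_integral_multc[symmetric]) measurable
    also have "\<dots> = (\<integral>\<^sup>+l. \<integral>\<^sup>+m. ennreal (A l y) * ennreal (B m y) \<partial>lborel \<partial>lborel)"
      by (intro nn_integral_cong nn_integral_cmult[symmetric]) measurable
    finally show "(\<integral>\<^sup>+l. ennreal (A l y) \<partial>lborel) * (\<integral>\<^sup>+m. ennreal (B m y) \<partial>lborel) =
      (\<integral>\<^sup>+l. \<integral>\<^sup>+m. ennreal (A l y) * ennreal (B m y) \<partial>lborel \<partial>lborel)" .
  qed
  also have "\<dots> = (\<integral>\<^sup>+l. \<integral>\<^sup>+y. \<integral>\<^sup>+m. ennreal (A l y) * ennreal (B m y) \<partial>lborel \<partial>lborel \<partial>lborel)"
    by (rule nn_integral_lborel_swap) measurable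
  also have "\<dots> = (\<integral>\<^sup>+l. \<integral>\<^sup>+m. \<integral>\<^sup>+y. ennreal (A l y) * ennreal (B m y) \<partial>lborel \<partial>lborel \<partial>lborel)"
    by (intro nn_integral_cong nn_integral_lborel_swap) measurable
  also have "\<dots> = (\<integral>\<^sup>+l. \<integral>\<^sup>+m. ennreal (pos_ind l * pos_ind m * H l m) * gauss_mass TYPE('a) \<partial>lborel \<partial>lborel)"
  proof (intro nn_integral_cong)
    fix l m :: real
    show "(\<integral>\<^sup>+y. ennreal (A l y) * ennreal (B m y) \<partial>lborel) = ennreal (pos_ind l * pos_ind m * H l m) * gauss_mass TYPE('a)"
    proof (cases "l > 0 \<and> m > 0")
      case True
      then have lm: "l > 0" "m > 0" by auto
      let ?K = "s * t * (l * m) powr e * exp (- (l * s\<^sup>2) - m * t\<^sup>2)"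
      have "(\<integral>\<^sup>+y. ennreal (A l y) * ennreal (B m y) \<partial>lborel) =
        (\<integral>\<^sup>+y. ennreal ?K * ennreal (exp (- (l * (norm y)\<^sup>2) - m * (norm (x - y))\<^sup>2)) \<partial>lborel)"
      proof (intro nn_integral_cong)
        fix y
        have "- (l * (s\<^sup>2 + (norm y)\<^sup>2)) + - (m * (t\<^sup>2 + (norm (x - y))\<^sup>2)) =
          (- (l * s\<^sup>2) - m * t\<^sup>2) + (- (l * (norm y)\<^sup>2) - m * (norm (x - y))\<^sup>2)" by (simp add: algebra_simps)
        then have "exp (- (l * (s\<^sup>2 + (norm y)\<^sup>2))) * exp (- (m * (t\<^sup>2 + (norm (x - y))\<^sup>2))) =
          exp (- (l * s\<^sup>2) - m * t\<^sup>2) * exp (- (l * (norm y)\<^sup>2) - m * (norm (x - y))\<^sup>2)"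
          by (simp only: exp_add[symmetric])
        then have "A l y * B m y = ?K * exp (- (l * (norm y)\<^sup>2) - m * (norm (x - y))\<^sup>2)"
          using lm by (simp add: A_def B_def powr_mult mult_ac)
        then show "ennreal (A l y) * ennreal (B m y) = ennreal ?K * ennreal (exp (- (l * (norm y)\<^sup>2) - m * (norm (x - y))\<^sup>2))"
          using nonneg s t by (simp add: ennreal_mult[symmetric])
      qed
      also have "\<dots> = ennreal ?K * (\<integral>\<^sup>+y. ennreal (exp (- (l * (norm y)\<^sup>2) - m * (norm (x - y))\<^sup>2)) \<partial>lborel)"
        by (intro nn_integral_cmult) measurable
      also have "\<dots> = ennreal (H l m) * gauss_mass TYPE('a)"
        unfolding nn_integral_gauss_product[OF lm] H_def using s t by (simp add: ennreal_mult mult.assoc)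
      finally show ?thesis using lm by simp
    qed (auto simp: A_def B_def indicator_def)
  qed
  also have "\<dots> = (\<integral>\<^sup>+l. \<integral>\<^sup>+m. ennreal (pos_ind l * pos_ind m * H l m) \<partial>lborel \<partial>lborel) * gauss_mass TYPE('a)"
    by (simp add: nn_integral_multc)
  also have "(\<integral>\<^sup>+l. \<integral>\<^sup>+m. ennreal (pos_ind l * pos_ind m * H l m) \<partial>lborel \<partial>lborel) =
    (\<integral>\<^sup>+m. \<integral>\<^sup>+l. ennreal (pos_ind l * pos_ind m * H l m) \<partial>lborel \<partial>lborel)"
    by (rule nn_integral_lborel_swap) measurable
  also have "\<dots> = (\<integral>\<^sup>+m. \<integral>\<^sup>+q. ennreal (pos_ind q * pos_ind m * (m * H (m * q) m)) \<partial>lborel \<partial>lborel)"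
  proof (rule nn_integral_cong)
    fix m :: real
    show "(\<integral>\<^sup>+l. ennreal (pos_ind l * pos_ind m * H l m) \<partial>lborel) = (\<integral>\<^sup>+q. ennreal (pos_ind q * pos_ind m * (m * H (m * q) m)) \<partial>lborel)"
    proof (cases "m > 0")
      case m: True
      have "(\<integral>\<^sup>+l. ennreal (pos_ind l * pos_ind m * H l m) \<partial>lborel) = \<bar>m\<bar> * (\<integral>\<^sup>+q. ennreal (pos_ind (0 + m * q) * pos_ind m * H (0 + m * q) m) \<partial>lborel)"
        using m by (intro nn_integral_real_affine) auto
      also have "\<dots> = (\<integral>\<^sup>+q. ennreal m * ennreal (pos_ind (0 + m * q) * pos_ind m * H (0 + m * q) m) \<partial>lborel)"
        using m by (subst nn_integral_cmult) auto
      also have "\<dots> = (\<integral>\<^sup>+q. ennreal (pos_ind q * pos_ind m * (m * H (m * q) m)) \<partial>lborel)"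
        using m nonneg by (intro nn_integral_cong) (simp add: indicator_def zero_less_mult_iff ennreal_mult[symmetric])
      finally show ?thesis .
    qed (auto simp: indicator_def)
  qed
  also have "\<dots> = (\<integral>\<^sup>+q. \<integral>\<^sup>+m. ennreal (pos_ind q * pos_ind m * (m * H (m * q) m)) \<partial>lborel \<partial>lborel)"
    by (rule nn_integral_lborel_swap) measurable
  also have "\<dots> = (\<integral>\<^sup>+q. \<integral>\<^sup>+k. ennreal (pos_ind k * U k) * ennreal (pos_ind q * V k q) \<partial>lborel \<partial>lborel)"
  proof (rule nn_integral_cong)
    fix q :: real
    show "(\<integral>\<^sup>+m. ennreal (pos_ind q * pos_ind m * (m * H (m * q) m)) \<partial>lborel) = (\<integral>\<^sup>+k. ennreal (pos_ind k * U k) * ennreal (pos_ind q * V k q) \<partial>lborel)"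
    proof (cases "q > 0")
      case q: True
      then have c: "c q > 0" by (simp add: c_def)
      have "(\<integral>\<^sup>+m. ennreal (pos_ind q * pos_ind m * (m * H (m * q) m)) \<partial>lborel) =
         \<bar>c q\<bar> * (\<integral>\<^sup>+k. ennreal (pos_ind q * pos_ind (0 + c q * k) * ((0 + c q * k) * H ((0 + c q * k) * q) (0 + c q * k))) \<partial>lborel)"
        using c by (intro nn_integral_real_affine) auto
      also have "\<dots> = (\<integral>\<^sup>+k. ennreal (c q) * ennreal (pos_ind q * pos_ind (0 + c q * k) * ((0 + c q * k) * H ((0 + c q * k) * q) (0 + c q * k))) \<partial>lborel)"
        using c by (subst nn_integral_cmult) auto
      also have "\<dots> = (\<integral>\<^sup>+k. ennreal (pos_ind k * U k) * ennreal (pos_ind q * V k q) \<partial>lborel)"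
      proof (intro nn_integral_cong)
        fix k :: real
        show "ennreal (c q) * ennreal (pos_ind q * pos_ind (0 + c q * k) * ((0 + c q * k) * H ((0 + c q * k) * q) (0 + c q * k)))
          = ennreal (pos_ind k * U k) * ennreal (pos_ind q * V k q)"
        proof (cases "k > 0")
          case k: True
          have eq: "c q * (c q * k * H (c q * k * q) (c q * k)) = U k * V k q"
            using subordination_kernel[OF s t k q, of x] by (simp only: c_def H_def U_def V_def e_def mult.assoc)
          have "V k q \<ge> 0" using q by (simp add: V_def)
          moreover have "c q * k > 0" using c k by simp
          ultimately show ?thesis using q k c nonneg eq by (simp add: ennreal_mult[symmetric])
        qed (use c in \<open>auto simp: indicator_def zero_less_mult_iff\<close>)
      qed
      finally show ?thesis .
    qed (auto simp: indicator_def)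
  qed
  also have "\<dots> = (\<integral>\<^sup>+k. \<integral>\<^sup>+q. ennreal (pos_ind k * U k) * ennreal (pos_ind q * V k q) \<partial>lborel \<partial>lborel)"
    by (rule nn_integral_lborel_swap) measurable
  also have "\<dots> = (\<integral>\<^sup>+k. ennreal (pos_ind k * ((s + t) * k powr e * exp (- (k * ((s + t)\<^sup>2 + (norm x)\<^sup>2))))) * gauss_mass TYPE(real) \<partial>lborel)"
  proof (rule nn_integral_cong)
    fix k :: real
    show "(\<integral>\<^sup>+q. ennreal (pos_ind k * U k) * ennreal (pos_ind q * V k q) \<partial>lborel) =
      ennreal (pos_ind k * ((s + t) * k powr e * exp (- (k * ((s + t)\<^sup>2 + (norm x)\<^sup>2))))) * gauss_mass TYPE(real)"
    proof (cases "k > 0")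
      case k: True
      have "(\<integral>\<^sup>+q. ennreal (pos_ind k * U k) * ennreal (pos_ind q * V k q) \<partial>lborel) =
         ennreal (U k) * (\<integral>\<^sup>+q. ennreal (pos_ind q * V k q) \<partial>lborel)"
        using k by (subst nn_integral_cmult) auto
      also have "\<dots> = ennreal (U k) * (ennreal (k powr (- (1/2)) * ((s + t) / (s * t))) * gauss_mass TYPE(real))"
        unfolding V_def nn_integral_levy[OF s t k] ..
      also have "\<dots> = ennreal (U k * (k powr (- (1/2)) * ((s + t) / (s * t)))) * gauss_mass TYPE(real)"
        using nonneg(4)[of k] s t by (subst ennreal_mult) (auto simp: mult.assoc)
      also have "U k * (k powr (- (1/2)) * ((s + t) / (s * t))) = (s + t) * k powr e * exp (- (k * ((s + t)\<^sup>2 + (norm x)\<^sup>2)))"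
      proof -
        have "k powr e = k powr (real DIM('a) / 2) * k powr (- (1/2))"
          by (simp only: powr_add[symmetric]) (simp add: e_def diff_divide_distrib)
        then show ?thesis using s t by (simp add: U_def)
      qed
      finally show ?thesis using k by simp
    qed (auto simp: indicator_def)
  qed
  also have "\<dots> = ennreal (G * poisson (s + t) x) * gauss_mass TYPE(real)"
    unfolding G_def using poisson_eq_Gamma_integral[of "s + t" x] s t by (simp add: nn_integral_multc e_def)
  finally show ?thesis by (simp only: mult_ac)
qed

definition poisson_mass :: "'a::euclidean_space itself \<Rightarrow> real" where
  "poisson_mass _ = enn2real (\<integral>\<^sup>+y. ennreal (poisson 1 y) \<partial>(lborel :: 'a measure))"

lemma nn_integral_poisson_finite: "(\<integral>\<^sup>+y. ennreal (poisson 1 y) \<partial>(lborel :: 'a::euclidean_space measure)) < \<infinity>"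
proof -
  have "(\<integral>\<^sup>+y. ennreal (poisson 1 y) \<partial>(lborel :: 'a measure)) \<le>
    (\<integral>\<^sup>+y. indicator (cball 0 1) y + ennreal (norm y powr (- (real DIM('a) + 1)) * indicator {1..} (norm y)) \<partial>(lborel :: 'a measure))"
  proof (intro nn_integral_mono)
    fix y :: 'a
    show "ennreal (poisson 1 y) \<le> indicator (cball 0 1) y + ennreal (norm y powr (- (real DIM('a) + 1)) * indicator {1..} (norm y))"
    proof (cases "norm y \<le> 1")
      case True
      have "(1::real) \<le> (1\<^sup>2 + (norm y)\<^sup>2) powr ((real DIM('a) + 1) / 2)"
        by (rule ge_one_powr_ge_zero) auto
      then have "poisson 1 y \<le> 1" unfolding poisson_def by (intro divide_le_eq_1_pos[THEN iffD2]) auto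
      then have "ennreal (poisson 1 y) \<le> 1" using ennreal_leI by fastforce
      then show ?thesis using True by (auto intro: order_trans add_increasing2)
    next
      case False
      then have "y \<noteq> 0" by auto
      from poisson_le[of 1, OF _ this] False show ?thesis by (simp add: ennreal_leI)
    qed
  qed
  also have "\<dots> = emeasure (lborel :: 'a measure) (cball 0 1) +
    (\<integral>\<^sup>+y. ennreal (norm y powr (- (real DIM('a) + 1)) * indicator {1..} (norm y)) \<partial>(lborel :: 'a measure))"
    by (subst nn_integral_add) (auto intro!: borel_measurable_indicator)
  also have "\<dots> < \<infinity>"
    using nn_integral_shell_above[of norm "lborel :: 'a measure" "unit_ball_vol DIM('a)" "DIM('a)" "real DIM('a) + 1"]
      emeasure_lborel_norm_le[where 'a='a] emeasure_lborel_cball_finite[of "0::'a" 1]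
    by (auto simp: less_top[symmetric] top_unique)
  finally show ?thesis .
qed

lemma nn_integral_poisson:
  assumes "s > 0"
  shows "(\<integral>\<^sup>+y. ennreal (poisson s y) \<partial>(lborel :: 'a::euclidean_space measure)) = ennreal (poisson_mass TYPE('a))"
proof -
  have "(\<integral>\<^sup>+y. ennreal (poisson s y) \<partial>(lborel :: 'a measure)) = ennreal (s ^ DIM('a)) * (\<integral>\<^sup>+y. ennreal (poisson s (s *\<^sub>R y)) \<partial>(lborel :: 'a measure))"
    by (rule nn_integral_lborel_scale[symmetric]) (use assms in auto)
  also have "\<dots> = (\<integral>\<^sup>+y. ennreal (s ^ DIM('a)) * ennreal (poisson s (s *\<^sub>R y)) \<partial>(lborel :: 'a measure))"
    by (rule nn_integral_cmult[symmetric]) measurable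
  also have "\<dots> = (\<integral>\<^sup>+y. ennreal (poisson 1 y) \<partial>(lborel :: 'a measure))"
    using poisson_scale[of s 1, where 'a='a] assms poisson_nonneg[of 1, where 'a='a]
    by (intro nn_integral_cong) (simp add: ennreal_mult[symmetric])
  finally show ?thesis unfolding poisson_mass_def using nn_integral_poisson_finite[where 'a='a]
    by (simp add: ennreal_enn2real_if less_top)
qed

lemma poisson_mass_pos: "poisson_mass TYPE('a::euclidean_space) > 0"
proof -
  have "(\<integral>\<^sup>+y. ennreal (poisson 1 y) \<partial>(lborel :: 'a measure)) \<noteq> 0"
  proof
    assume "(\<integral>\<^sup>+y. ennreal (poisson 1 y) \<partial>(lborel :: 'a measure)) = 0"
    then have "emeasure (lborel :: 'a measure) {y. ennreal (poisson 1 y) \<noteq> 0} = 0"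
      by (subst (asm) nn_integral_0_iff) auto
    moreover have "{y::'a. ennreal (poisson 1 y) \<noteq> 0} = UNIV"
      using poisson_pos[of 1, where 'a='a] by (auto simp: ennreal_eq_0_iff not_le)
    ultimately show False by simp
  qed
  then show ?thesis using nn_integral_poisson_finite[where 'a='a]
    by (simp add: poisson_mass_def enn2real_positive_iff less_top zero_less_iff_neq_zero)
qed

text \<open>The unnormalised identity leaves the constant \<open>J\<close> unknown. Integrating it
  over \<open>x\<close> gives the squared mass on one side and the mass times \<open>J\<close> on
  the other, which determines \<open>J\<close>.\<close>

theorem poisson_semigroup:
  fixes x :: "'a::euclidean_space"
  assumes s: "s > 0" and t: "t > 0"
  shows "(\<integral>\<^sup>+y. ennreal (poisson s y) * ennreal (poisson t (x - y)) \<partial>lborel) =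
    ennreal (poisson_mass TYPE('a) * poisson (s + t) x)"
proof -
  define G where "G = Gamma ((real DIM('a) + 1) / 2)"
  define c where "c = poisson_mass TYPE('a)"
  define J where "J = gauss_mass TYPE('a) * gauss_mass TYPE(real)"
  define S where "S x = (\<integral>\<^sup>+y. ennreal (poisson s y) * ennreal (poisson t (x - y)) \<partial>lborel)" for x :: 'a
  have G: "G > 0" unfolding G_def by (intro Gamma_real_pos) (simp add: add_pos_pos)
  have c: "c > 0" unfolding c_def by (rule poisson_mass_pos)
  have SG: "ennreal (G\<^sup>2) * S x = J * ennreal (G * poisson (s + t) x)" for x
  proof -
    have "ennreal (G\<^sup>2) * S x = (\<integral>\<^sup>+y. ennreal (G\<^sup>2) * (ennreal (poisson s y) * ennreal (poisson t (x - y))) \<partial>lborel)"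
      unfolding S_def by (rule nn_integral_cmult[symmetric]) measurable
    also have "\<dots> = (\<integral>\<^sup>+y. ennreal (G * poisson s y) * ennreal (G * poisson t (x - y)) \<partial>lborel)"
      using G s t by (intro nn_integral_cong) (simp add: ennreal_mult[symmetric] poisson_nonneg power2_eq_square mult_ac)
    finally show ?thesis using poisson_convolution_unnormalised[OF s t, of x] by (simp add: J_def G_def)
  qed
  have "(\<integral>\<^sup>+x. S x \<partial>lborel) = (\<integral>\<^sup>+y. \<integral>\<^sup>+x. ennreal (poisson s y) * ennreal (poisson t (x - y)) \<partial>(lborel :: 'a measure) \<partial>lborel)"
    unfolding S_def by (rule nn_integral_lborel_swap) measurable
  also have "\<dots> = (\<integral>\<^sup>+y. ennreal (poisson s y) * ennreal c \<partial>(lborel :: 'a measure))"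
  proof (intro nn_integral_cong)
    fix y :: 'a
    have "(\<integral>\<^sup>+x. ennreal (poisson t (x - y)) \<partial>lborel) = (\<integral>\<^sup>+x. ennreal (poisson t ((y + x) - y)) \<partial>lborel)"
      by (rule nn_integral_lborel_shift[symmetric, of "\<lambda>x. ennreal (poisson t (x - y))"]) measurable
    then have "(\<integral>\<^sup>+x. ennreal (poisson t (x - y)) \<partial>lborel) = ennreal c"
      using nn_integral_poisson[OF t, where 'a='a] by (simp add: c_def)
    then show "(\<integral>\<^sup>+x. ennreal (poisson s y) * ennreal (poisson t (x - y)) \<partial>lborel) = ennreal (poisson s y) * ennreal c"
      by (simp add: nn_integral_cmult)
  qed
  also have "\<dots> = ennreal c * ennreal c"
    using nn_integral_poisson[OF s, where 'a='a] by (simp add: nn_integral_multc c_def)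
  finally have SI: "(\<integral>\<^sup>+x. S x \<partial>lborel) = ennreal c * ennreal c" .
  have Sm: "S \<in> borel_measurable borel" unfolding S_def by measurable
  have "ennreal (G\<^sup>2) * (ennreal c * ennreal c) = (\<integral>\<^sup>+x. ennreal (G\<^sup>2) * S x \<partial>lborel)"
    unfolding SI[symmetric] using Sm by (intro nn_integral_cmult[symmetric]) auto
  also have "\<dots> = (\<integral>\<^sup>+x. (J * ennreal G) * ennreal (poisson (s + t) x) \<partial>(lborel :: 'a measure))"
    unfolding SG using G s t by (intro nn_integral_cong) (simp add: ennreal_mult poisson_nonneg mult.assoc)
  also have "\<dots> = (J * ennreal G) * ennreal c"
    using nn_integral_poisson[of "s + t", where 'a='a] s t by (simp add: nn_integral_cmult c_def)
  finally have "ennreal (G * c) * (ennreal (G * c)) = J * ennreal (G * c)"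
    using G c by (simp add: ennreal_mult power2_eq_square mult_ac)
  then have "ennreal (G * c) * J = ennreal (G * c) * ennreal (G * c)" by (simp only: mult.commute)
  then have J: "J = ennreal (G * c)"
    unfolding ennreal_mult_cancel_left using G c by auto
  have "ennreal (G\<^sup>2) * S x = ennreal (G\<^sup>2) * ennreal (c * poisson (s + t) x)"
    unfolding SG J using G c s t by (simp add: ennreal_mult[symmetric] poisson_nonneg power2_eq_square mult_ac)
  then show ?thesis
    using G by (simp add: ennreal_mult_cancel_left S_def c_def)
qed

section \<open>Inverting the convolution with the space-time kernel\<close>

lemma fst_borel_measurable [measurable]: "fst \<in> borel_measurable (borel :: ('a::euclidean_space \<times> 'b::euclidean_space) measure)"
  and snd_borel_measurable [measurable]: "snd \<in> borel_measurable (borel :: ('a \<times> 'b) measure)"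
  by (intro borel_measurable_continuous_onI continuous_intros)+

text \<open>The kernel \<open>P_kernel\<close> for an arbitrary Euclidean space of
  positions.\<close>

definition spacetime_kernel :: "'x::euclidean_space \<times> real \<Rightarrow> real" where
  "spacetime_kernel z = (if snd z > 0 then poisson (snd z) (fst z) else 0)"

lemma spacetime_kernel_nonneg: "spacetime_kernel z \<ge> 0"
  by (simp add: spacetime_kernel_def poisson_nonneg)

lemma spacetime_kernel_measurable[measurable]: "spacetime_kernel \<in> borel_measurable borel"
  unfolding spacetime_kernel_def by measurable

lemma nn_integral_lborel_prod:
  fixes f :: "'a::euclidean_space \<times> 'b::euclidean_space \<Rightarrow> ennreal"
  assumes [measurable]: "f \<in> borel_measurable borel"
  shows "(\<integral>\<^sup>+z. f z \<partial>lborel) = (\<integral>\<^sup>+t. \<integral>\<^sup>+x. f (x, t) \<partial>lborel \<partial>lborel)"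
proof -
  have f: "f \<in> borel_measurable (borel \<Otimes>\<^sub>M borel)" using assms by (simp add: borel_prod)
  have "(\<integral>\<^sup>+z. f z \<partial>lborel) = (\<integral>\<^sup>+z. f z \<partial>(lborel \<Otimes>\<^sub>M lborel))" by (simp add: lborel_prod)
  also have "\<dots> = (\<integral>\<^sup>+x. \<integral>\<^sup>+t. f (x, t) \<partial>lborel \<partial>lborel)"
    using f by (intro lborel.nn_integral_fst[symmetric]) simp
  also have "\<dots> = (\<integral>\<^sup>+t. \<integral>\<^sup>+x. f (x, t) \<partial>lborel \<partial>lborel)"
    using f by (intro nn_integral_lborel_swap) simp
  finally show ?thesis .
qed

lemma nn_integral_poisson_cmult:
  assumes "s > 0"
  shows "(\<integral>\<^sup>+y. ennreal (poisson s y) * c \<partial>(lborel :: 'a::euclidean_space measure)) = ennreal (poisson_mass TYPE('a)) * c"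
  using nn_integral_poisson[OF assms, where 'a='a] by (simp add: nn_integral_multc)

text \<open>All positive time slices of the kernel have the same mass, so only the length of the
  time interval counts. This yields local finiteness in spite of the singularity at the
  origin.\<close>

lemma nn_integral_spacetime_kernel_slab:
  assumes "a \<le> b"
  shows "(\<integral>\<^sup>+z. ennreal (spacetime_kernel z) * indicator {z. a \<le> snd z \<and> snd z \<le> b} z \<partial>(lborel :: ('x::euclidean_space \<times> real) measure))
    \<le> ennreal (poisson_mass TYPE('x) * (b - a))"
proof -
  have [measurable]: "{z::'x \<times> real. a \<le> snd z \<and> snd z \<le> b} \<in> sets borel" by measurable
  have "(\<integral>\<^sup>+z. ennreal (spacetime_kernel z) * indicator {z. a \<le> snd z \<and> snd z \<le> b} z \<partial>(lborel :: ('x \<times> real) measure)) =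
    (\<integral>\<^sup>+t. \<integral>\<^sup>+x. ennreal (spacetime_kernel (x, t)) * indicator {z. a \<le> snd z \<and> snd z \<le> b} (x, t) \<partial>(lborel :: 'x measure) \<partial>lborel)"
    by (intro nn_integral_lborel_prod) measurable
  also have "\<dots> \<le> (\<integral>\<^sup>+t. ennreal (poisson_mass TYPE('x)) * indicator {a..b} t \<partial>lborel)"
  proof (rule nn_integral_mono)
    fix t :: real
    show "(\<integral>\<^sup>+x. ennreal (spacetime_kernel (x, t)) * indicator {z. a \<le> snd z \<and> snd z \<le> b} (x, t) \<partial>(lborel :: 'x measure)) \<le>
      ennreal (poisson_mass TYPE('x)) * indicator {a..b} t"
    proof (cases "t > 0 \<and> t \<in> {a..b}")
      case True
      then show ?thesis using nn_integral_poisson[of t, where 'a='x] by (simp add: spacetime_kernel_def)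
    next
      case False
      then have "ennreal (spacetime_kernel (x, t)) * indicator {z. a \<le> snd z \<and> snd z \<le> b} (x, t) = 0" for x :: 'x
        by (auto simp: spacetime_kernel_def indicator_def)
      then show ?thesis by (simp only: nn_integral_const) simp
    qed
  qed
  also have "\<dots> = ennreal (poisson_mass TYPE('x) * (b - a))"
    using assms poisson_mass_pos[where 'a='x] by (simp add: nn_integral_cmult ennreal_mult)
  finally show ?thesis .
qed

abbreviation kernel_measure :: "('x::euclidean_space \<times> real) measure" where
  "kernel_measure \<equiv> density lborel (\<lambda>z. ennreal (spacetime_kernel z))"

lemma loc_finite_kernel_measure: "loc_finite (kernel_measure :: ('x::euclidean_space \<times> real) measure)"
  unfolding loc_finite_def
proof (intro conjI allI)
  fix R :: real
  show "emeasure (kernel_measure :: ('x \<times> real) measure) (cball 0 R) < \<infinity>"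
  proof (cases "R \<ge> 0")
    case True
    have "emeasure (kernel_measure :: ('x \<times> real) measure) (cball 0 R) =
      (\<integral>\<^sup>+z. ennreal (spacetime_kernel z) * indicator (cball 0 R) z \<partial>(lborel :: ('x \<times> real) measure))"
      by (intro emeasure_density) auto
    also have "\<dots> \<le> (\<integral>\<^sup>+z. ennreal (spacetime_kernel z) * indicator {z. - R \<le> snd z \<and> snd z \<le> R} z \<partial>(lborel :: ('x \<times> real) measure))"
    proof (intro nn_integral_mono mult_left_mono)
      fix z :: "'x \<times> real"
      show "(indicator (cball 0 R) z :: ennreal) \<le> indicator {z. - R \<le> snd z \<and> snd z \<le> R} z"
        using norm_snd_le[of "snd z" "fst z"] by (auto simp: indicator_def dist_norm)
    qed auto
    also have "\<dots> \<le> ennreal (poisson_mass TYPE('x) * (R - - R))"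
      using True by (intro nn_integral_spacetime_kernel_slab) auto
    finally show ?thesis by (auto intro: le_less_trans)
  qed simp
qed simp

text \<open>Averaging over the slice at time \<open>h\<close> carries the kernel slice at time
  \<open>s\<close> to the one at time \<open>s + h\<close>, up to the mass. The result is the kernel
  with the times up to \<open>h\<close> removed.\<close>

lemma nn_integral_kernel_semigroup:
  fixes f :: "'x::euclidean_space \<times> real \<Rightarrow> ennreal"
  assumes [measurable]: "f \<in> borel_measurable borel" and h: "h > 0"
  shows "(\<integral>\<^sup>+z. ennreal (spacetime_kernel z) * (\<integral>\<^sup>+w. ennreal (poisson h w) * f (z + (w, h)) \<partial>lborel) \<partial>lborel) =
    ennreal (poisson_mass TYPE('x)) * (\<integral>\<^sup>+z. ennreal (spacetime_kernel z * indicator {h<..} (snd z)) * f z \<partial>lborel)"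
proof -
  let ?c = "ennreal (poisson_mass TYPE('x))"
  have fm[measurable]: "(\<lambda>p. f (g p, k p)) \<in> borel_measurable M" if [measurable]: "g \<in> borel_measurable M" "k \<in> borel_measurable M"
    for g k and M :: "'z measure"
    by measurable
  have [measurable]: "(\<lambda>z. \<integral>\<^sup>+w. ennreal (poisson h w) * f (z + (w, h)) \<partial>lborel) \<in> borel_measurable (borel :: ('x \<times> real) measure)"
    by measurable
  have "(\<integral>\<^sup>+z. ennreal (spacetime_kernel z) * (\<integral>\<^sup>+w. ennreal (poisson h w) * f (z + (w, h)) \<partial>lborel) \<partial>lborel) =
    (\<integral>\<^sup>+s. \<integral>\<^sup>+x. ennreal (spacetime_kernel (x, s)) * (\<integral>\<^sup>+w. ennreal (poisson h w) * f ((x, s) + (w, h)) \<partial>lborel) \<partial>lborel \<partial>lborel)"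
    by (intro nn_integral_lborel_prod) measurable
  also have "\<dots> = (\<integral>\<^sup>+s. (\<integral>\<^sup>+v. ?c * (ennreal (pos_ind s * poisson (s + h) v) * f (v, s + h)) \<partial>lborel) \<partial>lborel)"
  proof (rule nn_integral_cong)
    fix s :: real
    show "(\<integral>\<^sup>+x. ennreal (spacetime_kernel (x, s)) * (\<integral>\<^sup>+w. ennreal (poisson h w) * f ((x, s) + (w, h)) \<partial>lborel) \<partial>lborel) =
      (\<integral>\<^sup>+v. ?c * (ennreal (pos_ind s * poisson (s + h) v) * f (v, s + h)) \<partial>lborel)"
    proof (cases "s > 0")
      case s: True
      have "(\<integral>\<^sup>+x. ennreal (spacetime_kernel (x, s)) * (\<integral>\<^sup>+w. ennreal (poisson h w) * f ((x, s) + (w, h)) \<partial>lborel) \<partial>lborel) =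
        (\<integral>\<^sup>+x. \<integral>\<^sup>+v. (ennreal (poisson s x) * ennreal (poisson h (v - x))) * f (v, s + h) \<partial>lborel \<partial>lborel)"
      proof (rule nn_integral_cong)
        fix x :: 'x
        have "(\<integral>\<^sup>+w. ennreal (poisson h w) * f ((x, s) + (w, h)) \<partial>lborel) =
          (\<integral>\<^sup>+w. ennreal (poisson h ((x + w) - x)) * f (x + w, s + h) \<partial>lborel)" by simp
        also have "\<dots> = (\<integral>\<^sup>+v. ennreal (poisson h (v - x)) * f (v, s + h) \<partial>lborel)"
          by (rule nn_integral_lborel_shift[of "\<lambda>v. ennreal (poisson h (v - x)) * f (v, s + h)"]) measurable
        finally show "ennreal (spacetime_kernel (x, s)) * (\<integral>\<^sup>+w. ennreal (poisson h w) * f ((x, s) + (w, h)) \<partial>lborel) =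
          (\<integral>\<^sup>+v. (ennreal (poisson s x) * ennreal (poisson h (v - x))) * f (v, s + h) \<partial>lborel)"
          using s by (simp add: spacetime_kernel_def nn_integral_cmult[symmetric] mult.assoc)
      qed
      also have "\<dots> = (\<integral>\<^sup>+v. \<integral>\<^sup>+x. (ennreal (poisson s x) * ennreal (poisson h (v - x))) * f (v, s + h) \<partial>lborel \<partial>lborel)"
        by (rule nn_integral_lborel_swap) measurable
      also have "\<dots> = (\<integral>\<^sup>+v. ennreal (poisson_mass TYPE('x) * poisson (s + h) v) * f (v, s + h) \<partial>lborel)"
        by (simp add: nn_integral_multc poisson_semigroup[OF s h])
      also have "\<dots> = (\<integral>\<^sup>+v. ?c * (ennreal (pos_ind s * poisson (s + h) v) * f (v, s + h)) \<partial>lborel)"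
        using s h poisson_mass_pos[where 'a='x] by (intro nn_integral_cong) (simp add: ennreal_mult poisson_nonneg mult.assoc)
      finally show ?thesis .
    qed (simp add: spacetime_kernel_def)
  qed
  also have "\<dots> = (\<integral>\<^sup>+s. (\<integral>\<^sup>+v. ?c * (ennreal (pos_ind (s - h) * poisson s v) * f (v, s)) \<partial>lborel) \<partial>lborel)"
  proof -
    define F where "F = (\<lambda>s. \<integral>\<^sup>+v. ?c * (ennreal (pos_ind (s - h) * poisson s v) * f (v, s)) \<partial>lborel)"
    have [measurable]: "F \<in> borel_measurable borel" unfolding F_def by measurable
    have "(\<integral>\<^sup>+s. F (h + s) \<partial>lborel) = (\<integral>\<^sup>+s. F s \<partial>lborel)" by (rule nn_integral_lborel_shift) measurable
    then show ?thesis by (simp add: F_def add.commute)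
  qed
  also have "\<dots> = (\<integral>\<^sup>+s. (\<integral>\<^sup>+v. ?c * (ennreal (spacetime_kernel (v, s) * indicator {h<..} (snd (v, s))) * f (v, s)) \<partial>lborel) \<partial>lborel)"
  proof (rule nn_integral_cong, rule nn_integral_cong)
    fix s :: real and v :: 'x
    show "?c * (ennreal (pos_ind (s - h) * poisson s v) * f (v, s)) = ?c * (ennreal (spacetime_kernel (v, s) * indicator {h<..} (snd (v, s))) * f (v, s))"
      using h by (simp add: spacetime_kernel_def indicator_def)
  qed
  also have "\<dots> = (\<integral>\<^sup>+z. ?c * (ennreal (spacetime_kernel z * indicator {h<..} (snd z)) * f z) \<partial>lborel)"
    by (rule nn_integral_lborel_prod[symmetric]) measurable
  also have "\<dots> = ?c * (\<integral>\<^sup>+z. (ennreal (spacetime_kernel z * indicator {h<..} (snd z)) * f z) \<partial>lborel)"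
    by (rule nn_integral_cmult) measurable
  finally show ?thesis .
qed

lemma poisson_tail:
  assumes h: "h > 0" and e: "e > 0"
  obtains R where "R > 0" "(\<integral>\<^sup>+w. ennreal (poisson h w * indicator (- cball 0 R) w) \<partial>(lborel :: 'x::euclidean_space measure)) \<le> ennreal e"
proof -
  define M where "M = density (lborel :: 'x measure) (\<lambda>w. ennreal (poisson h w))"
  have fin: "emeasure M A \<noteq> \<infinity>" for A
  proof -
    have "emeasure M A \<le> emeasure M (space M)" by (rule emeasure_space)
    also have "\<dots> < \<infinity>" using nn_integral_poisson[OF h, where 'a='x] by (simp add: M_def emeasure_density)
    finally show ?thesis by simp
  qed
  have "(\<lambda>n::nat. emeasure M (- cball 0 (real n))) \<longlonglongrightarrow> emeasure M (\<Inter>n. - cball 0 (real n))"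
    by (rule Lim_emeasure_decseq) (use fin in \<open>auto simp: M_def decseq_def\<close>)
  also have "(\<Inter>n. - cball (0::'x) (real n)) = {}"
  proof -
    have "\<exists>n. x \<in> cball 0 (real n)" for x :: 'x
      using reals_Archimedean2[of "norm x"] by (auto intro: less_imp_le)
    then show ?thesis by blast
  qed
  finally have "(\<lambda>n::nat. emeasure M (- cball 0 (real n))) \<longlonglongrightarrow> 0" by simp
  then have "\<forall>\<^sub>F n in sequentially. emeasure M (- cball 0 (real n)) < ennreal e"
    using e by (intro order_tendstoD) auto
  then have "\<forall>\<^sub>F n in sequentially. emeasure M (- cball 0 (real n)) < ennreal e \<and> n > 0"
    using eventually_gt_at_top[of 0] by eventually_elim auto
  then obtain n where n: "emeasure M (- cball 0 (real n)) < ennreal e" "n > 0"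
    by (auto simp: eventually_sequentially)
  have "emeasure M (- cball 0 (real n)) = (\<integral>\<^sup>+w. ennreal (poisson h w * indicator (- cball 0 (real n)) w) \<partial>(lborel :: 'x measure))"
    unfolding M_def by (subst emeasure_density) (auto intro!: nn_integral_cong simp: indicator_def)
  then show ?thesis using n that[of "real n"] by auto
qed

text \<open>The two terms come from small and from large arguments. The truncation at 0 provides the
  sign directly.\<close>

definition moment_const :: "'x::euclidean_space itself \<Rightarrow> real" where
  "moment_const _ = unit_ball_vol DIM('x) * max 0 (shell_below (real DIM('x) - 1) DIM('x))
     + unit_ball_vol DIM('x) * max 0 (shell_above (real DIM('x) + 1) DIM('x))"

text \<open>Dilation by \<open>r\<close> reduces to \<open>r = 1\<close> with time
  \<open>s / r\<close>. The bound in \<open>poisson_le\<close> has exponent \<open>N + 1\<close>;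
  the square lowers it to \<open>N - 1\<close>, which is integrable at 0, while the cap at 1 leaves
  \<open>N + 1\<close>, which is integrable at infinity.\<close>

lemma nn_integral_poisson_moment:
  assumes s: "s > 0" and r: "r > 0"
  shows "(\<integral>\<^sup>+w. ennreal (poisson s w * min ((norm w / r)\<^sup>2) 1) \<partial>(lborel :: 'x::euclidean_space measure)) \<le> ennreal (s * (moment_const TYPE('x) / r))"
proof -
  let ?N = "real DIM('x)"
  let ?g = "\<lambda>w::'x. norm w powr (- (?N - 1)) * indicator {..1} (norm w)"
  let ?k = "\<lambda>w::'x. norm w powr (- (?N + 1)) * indicator {1..} (norm w)"
  have N1: "?N \<ge> 1" using DIM_positive[where 'a='x] by linarith
  have V: "unit_ball_vol DIM('x) \<ge> 0" by simp
  have g: "(\<integral>\<^sup>+w. ennreal (?g w) \<partial>lborel) \<le> ennreal (unit_ball_vol DIM('x) * shell_below (?N - 1) ?N)"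
    by (rule nn_integral_shell_below) (use emeasure_lborel_norm_le[where 'a='x] N1 V in auto)
  have k: "(\<integral>\<^sup>+w. ennreal (?k w) \<partial>lborel) \<le> ennreal (unit_ball_vol DIM('x) * shell_above (?N + 1) ?N)"
    by (rule nn_integral_shell_above) (use emeasure_lborel_norm_le[where 'a='x] N1 V in auto)
  have "(\<integral>\<^sup>+w. ennreal (poisson s w * min ((norm w / r)\<^sup>2) 1) \<partial>(lborel :: 'x measure)) =
    ennreal (r ^ DIM('x)) * (\<integral>\<^sup>+w. ennreal (poisson s (r *\<^sub>R w) * min ((norm (r *\<^sub>R w) / r)\<^sup>2) 1) \<partial>(lborel :: 'x measure))"
    by (rule nn_integral_lborel_scale[symmetric, where f="\<lambda>w. ennreal (poisson s w * min ((norm w / r)\<^sup>2) 1)"]) (use r in auto)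
  also have "\<dots> = (\<integral>\<^sup>+w. ennreal (r ^ DIM('x)) * ennreal (poisson s (r *\<^sub>R w) * min ((norm (r *\<^sub>R w) / r)\<^sup>2) 1) \<partial>(lborel :: 'x measure))"
    by (rule nn_integral_cmult[symmetric]) measurable
  also have "\<dots> \<le> (\<integral>\<^sup>+w. ennreal (s / r) * (ennreal (?g w) + ennreal (?k w)) \<partial>lborel)"
  proof (rule nn_integral_mono)
    fix w :: 'x
    have "r ^ DIM('x) * poisson s (r *\<^sub>R w) = poisson (s / r) w"
      using poisson_scale[of r "s / r" w] s r by simp
    then have eq: "ennreal (r ^ DIM('x)) * ennreal (poisson s (r *\<^sub>R w) * min ((norm (r *\<^sub>R w) / r)\<^sup>2) 1) =
      ennreal (poisson (s / r) w * min ((norm w)\<^sup>2) 1)"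
      using r s by (simp add: ennreal_mult[symmetric] poisson_nonneg mult.assoc[symmetric])
    have "poisson (s / r) w * min ((norm w)\<^sup>2) 1 \<le> (s / r) * (?g w + ?k w)"
    proof (cases "w = 0")
      case False
      have le: "poisson (s / r) w \<le> (s / r) * norm w powr (- (?N + 1))"
        using poisson_le[of "s / r" w] False s r by simp
      have "norm w powr (- (?N + 1)) * min ((norm w)\<^sup>2) 1 \<le> ?g w + ?k w"
      proof (cases "norm w \<le> 1")
        case True
        have "norm w powr (- (?N + 1)) * (norm w)\<^sup>2 = norm w powr (- (?N + 1)) * norm w powr 2"
          using False by simp
        also have "\<dots> = norm w powr (- (?N - 1))" by (simp only: powr_add[symmetric]) simp
        finally have "norm w powr (- (?N + 1)) * (norm w)\<^sup>2 = norm w powr (- (?N - 1))" .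
        moreover have "min ((norm w)\<^sup>2) 1 = (norm w)\<^sup>2" using True by (simp add: min_def power_le_one)
        ultimately show ?thesis using True by simp
      next
        case F: False
        then have "1 \<le> (norm w)\<^sup>2" by (intro one_le_power) simp
        then have "min ((norm w)\<^sup>2) 1 = 1" by simp
        with F show ?thesis by simp
      qed
      then have "(s / r) * (norm w powr (- (?N + 1)) * min ((norm w)\<^sup>2) 1) \<le> (s / r) * (?g w + ?k w)"
        using s r by (intro mult_left_mono) auto
      moreover have "poisson (s / r) w * min ((norm w)\<^sup>2) 1 \<le> ((s / r) * norm w powr (- (?N + 1))) * min ((norm w)\<^sup>2) 1"
        by (intro mult_right_mono le) auto
      ultimately show ?thesis by (simp add: mult.assoc)
    qed (use s r in auto)
    then have "ennreal (poisson (s / r) w * min ((norm w)\<^sup>2) 1) \<le> ennreal ((s / r) * (?g w + ?k w))"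
      by (rule ennreal_leI)
    also have "\<dots> = ennreal (s / r) * (ennreal (?g w) + ennreal (?k w))"
      using s r by (subst ennreal_mult) (auto simp: ennreal_plus[symmetric] simp del: ennreal_plus)
    finally show "ennreal (r ^ DIM('x)) * ennreal (poisson s (r *\<^sub>R w) * min ((norm (r *\<^sub>R w) / r)\<^sup>2) 1) \<le>
      ennreal (s / r) * (ennreal (?g w) + ennreal (?k w))" unfolding eq .
  qed
  also have "\<dots> = ennreal (s / r) * ((\<integral>\<^sup>+w. ennreal (?g w) \<partial>lborel) + (\<integral>\<^sup>+w. ennreal (?k w) \<partial>lborel))"
    by (subst nn_integral_cmult, measurable, subst nn_integral_add, measurable)
  also have "\<dots> \<le> ennreal (s / r) * (ennreal (unit_ball_vol DIM('x) * max 0 (shell_below (?N - 1) ?N)) + ennreal (unit_ball_vol DIM('x) * max 0 (shell_above (?N + 1) ?N)))"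
    using V by (intro mult_left_mono add_mono order_trans[OF g] order_trans[OF k] ennreal_leI) auto
  also have "\<dots> = ennreal ((s / r) * moment_const TYPE('x))"
    unfolding moment_const_def using s r V
    by (subst ennreal_mult) (auto simp: ennreal_plus)
  finally show ?thesis by (simp add: mult_ac)
qed

lemma integral_lborel_reflect:
  fixes f :: "'a::euclidean_space \<Rightarrow> 'b::euclidean_space"
  assumes "f \<in> borel_measurable borel"
  shows "(LINT x|lborel. f (- x)) = (LINT x|lborel. f x)"
proof -
  have "lborel = density (distr lborel borel (\<lambda>x::'a. 0 + (- 1) *\<^sub>R x)) (\<lambda>_. ennreal (\<bar>- 1\<bar>^DIM('a)))"
    by (rule lborel_affine) simp
  then have "lborel = distr lborel borel (\<lambda>x::'a. - x)" by (simp add: density_1)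
  then have "(LINT x|lborel. f x) = (LINT x|distr lborel borel (\<lambda>x. - x). f x)" by metis
  also have "\<dots> = (LINT x|lborel. f (- x))" using assms by (intro integral_distr) auto
  finally show ?thesis by simp
qed

definition diff2 :: "('x::euclidean_space \<times> real \<Rightarrow> complex) \<Rightarrow> 'x \<Rightarrow> 'x \<times> real \<Rightarrow> complex" where
  "diff2 \<phi> w y = \<phi> (y + (w, 0)) + \<phi> (y - (w, 0)) - 2 * \<phi> y"

lemma poisson_integrable_bounded:
  fixes f :: "'x::euclidean_space \<Rightarrow> complex"
  assumes s: "s > 0" and f: "f \<in> borel_measurable borel" and B: "\<And>w. cmod (f w) \<le> B"
  shows "integrable lborel (\<lambda>w. poisson s w *\<^sub>R f w)"
proof (rule integrableI_bounded)
  show "(\<lambda>w. poisson s w *\<^sub>R f w) \<in> borel_measurable lborel" using f by measurable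
  have B0: "B \<ge> 0" using B norm_ge_zero order_trans by blast
  have "(\<integral>\<^sup>+w. ennreal (norm (poisson s w *\<^sub>R f w)) \<partial>lborel) \<le> (\<integral>\<^sup>+w. ennreal (poisson s w) * ennreal B \<partial>(lborel :: 'x measure))"
    using s B B0 by (intro nn_integral_mono) (simp add: ennreal_mult[symmetric] ennreal_leI mult_left_mono poisson_nonneg)
  also have "\<dots> < \<infinity>" unfolding nn_integral_poisson_cmult[OF s] by (simp add: ennreal_mult_less_top)
  finally show "(\<integral>\<^sup>+w. ennreal (norm (poisson s w *\<^sub>R f w)) \<partial>lborel) < \<infinity>" .
qed

text \<open>Evenness of the Poisson kernel in space turns the first difference into half of a second one,
  against which the kernel has a finite moment of order \<open>s\<close>.\<close>

lemma poisson_average_error: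
  fixes \<phi> :: "'x::euclidean_space \<times> real \<Rightarrow> complex"
  assumes s: "s > 0" and phi: "\<phi> \<in> test_funs"
  shows "ennreal (cmod ((LINT w|lborel. poisson s w *\<^sub>R \<phi> (y + (w, s))) - of_real (poisson_mass TYPE('x)) * \<phi> y)) \<le>
    (\<integral>\<^sup>+w. ennreal (poisson s w * cmod (diff2 \<phi> w (y + (0, s)))) \<partial>lborel) +
    ennreal (poisson_mass TYPE('x) * cmod (\<phi> (y + (0, s)) - \<phi> y))"
proof -
  define y' where "y' = y + (0, s)"
  define c where "c = poisson_mass TYPE('x)"
  have c: "c > 0" unfolding c_def by (rule poisson_mass_pos)
  have [measurable]: "\<phi> \<in> borel_measurable borel" by (rule test_funs_measurable[OF phi])
  have [measurable]: "(\<lambda>w. \<phi> (y' + (w, 0))) \<in> borel_measurable borel" "(\<lambda>w. \<phi> (y' - (w, 0))) \<in> borel_measurable borel"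
    by measurable
  obtain B where B: "\<And>x. cmod (\<phi> x) \<le> B" using test_funs_bounded[OF phi] by blast
  have i: "integrable lborel (\<lambda>w. poisson s w *\<^sub>R \<phi> (y' + (w, 0)))" "integrable lborel (\<lambda>w. poisson s w *\<^sub>R \<phi> (y' - (w, 0)))"
    "integrable lborel (\<lambda>w::'x. poisson s w *\<^sub>R (2 * \<phi> y'))"
    by (intro poisson_integrable_bounded[OF s, of _ B] B poisson_integrable_bounded[OF s, of _ "2 * B"], measurable)+
      (simp add: norm_mult B)
  define I where "I = (LINT w|lborel. poisson s w *\<^sub>R \<phi> (y' + (w, 0)))"
  have refl: "(LINT w|lborel. poisson s w *\<^sub>R \<phi> (y' - (w, 0))) = I"
  proof -
    have "(LINT w|lborel. poisson s (- w) *\<^sub>R \<phi> (y' + (- w, 0))) = I"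
      unfolding I_def by (rule integral_lborel_reflect[of "\<lambda>w. poisson s w *\<^sub>R \<phi> (y' + (w, 0))"]) measurable
    moreover have "y' + (- w, 0) = y' - (w, 0)" for w by (simp add: prod_eq_iff)
    ultimately show ?thesis by simp
  qed
  have "(LINT w|lborel. poisson s w *\<^sub>R diff2 \<phi> w y') = I + I - (LINT w|(lborel :: 'x measure). poisson s w *\<^sub>R (2 * \<phi> y'))"
    using i refl by (simp add: diff2_def scaleR_add_right scaleR_diff_right I_def)
  also have "(LINT w|(lborel :: 'x measure). poisson s w *\<^sub>R (2 * \<phi> y')) = (LINT w|(lborel :: 'x measure). poisson s w) *\<^sub>R (2 * \<phi> y')"
    by (rule integral_scaleR_left)
      (auto intro!: integrableI_nonneg simp: poisson_nonneg s less_imp_le nn_integral_poisson[OF s])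
  also have "(LINT w|(lborel :: 'x measure). poisson s w) = c"
    using nn_integral_poisson[OF s, where 'a='x] c s by (subst integral_eq_nn_integral) (auto simp: poisson_nonneg c_def)
  finally have "2 * (I - of_real c * \<phi> y') = (LINT w|lborel. poisson s w *\<^sub>R diff2 \<phi> w y')"
    by (simp add: scaleR_conv_of_real algebra_simps)
  then have "2 * cmod (I - of_real c * \<phi> y') = cmod (LINT w|lborel. poisson s w *\<^sub>R diff2 \<phi> w y')"
    by (metis norm_mult norm_numeral)
  then have "cmod (I - of_real c * \<phi> y') \<le> cmod (LINT w|lborel. poisson s w *\<^sub>R diff2 \<phi> w y')"
    using norm_ge_zero[of "I - of_real c * \<phi> y'"] by linarith
  then have "ennreal (cmod (I - of_real c * \<phi> y')) \<le> ennreal (cmod (LINT w|lborel. poisson s w *\<^sub>R diff2 \<phi> w y'))"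
    by (rule ennreal_leI)
  also have "\<dots> \<le> (\<integral>\<^sup>+w. ennreal (norm (poisson s w *\<^sub>R diff2 \<phi> w y')) \<partial>lborel)"
    using i by (intro integral_norm_bound_ennreal) (simp add: diff2_def scaleR_add_right scaleR_diff_right)
  also have "\<dots> = (\<integral>\<^sup>+w. ennreal (poisson s w * cmod (diff2 \<phi> w y')) \<partial>lborel)"
    using s by (simp add: poisson_nonneg)
  finally have 1: "ennreal (cmod (I - of_real c * \<phi> y')) \<le> (\<integral>\<^sup>+w. ennreal (poisson s w * cmod (diff2 \<phi> w y')) \<partial>lborel)" .
  have "y + (w, s) = y' + (w, 0)" for w by (simp add: y'_def prod_eq_iff)
  then have "(LINT w|lborel. poisson s w *\<^sub>R \<phi> (y + (w, s))) - of_real c * \<phi> y = (I - of_real c * \<phi> y') + of_real c * (\<phi> y' - \<phi> y)"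
    by (simp add: I_def algebra_simps)
  then have "cmod ((LINT w|lborel. poisson s w *\<^sub>R \<phi> (y + (w, s))) - of_real c * \<phi> y) \<le> cmod (I - of_real c * \<phi> y') + c * cmod (\<phi> y' - \<phi> y)"
    using norm_triangle_ineq[of "I - of_real c * \<phi> y'" "of_real c * (\<phi> y' - \<phi> y)"] c by (simp add: norm_mult)
  then have "ennreal (cmod ((LINT w|lborel. poisson s w *\<^sub>R \<phi> (y + (w, s))) - of_real c * \<phi> y)) \<le>
    ennreal (cmod (I - of_real c * \<phi> y')) + ennreal (c * cmod (\<phi> y' - \<phi> y))"
    using c by (simp add: ennreal_plus[symmetric] ennreal_leI del: ennreal_plus)
  then show ?thesis using 1 unfolding c_def[symmetric] y'_def[symmetric] by (meson add_right_mono order_trans)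
qed

section \<open>Truncated time slices and the approximate inverse\<close>

lemma cball_sets_borel [measurable]: "cball (a :: 'a::euclidean_space) r \<in> sets borel"
  by simp

text \<open>The truncation at \<open>R\<close> gives compact support, so that convolution with the
  slice maps test functions to test functions.\<close>

definition slice_measure :: "real \<Rightarrow> real \<Rightarrow> ('x::euclidean_space \<times> real) measure" where
  "slice_measure h R = distr (density lborel (\<lambda>w. ennreal (poisson h w * indicator (cball 0 R) w))) borel (\<lambda>w. (w, h))"

text \<open>The tolerance \<open>h\<^sup>2\<close> leaves an error of order \<open>h\<close> after
  division by \<open>h\<close> in the difference quotient.\<close>

abbreviation tail_small :: "'x::euclidean_space itself \<Rightarrow> real \<Rightarrow> real \<Rightarrow> bool" where
  "tail_small X h R \<equiv>
    (\<integral>\<^sup>+w. ennreal (poisson h w * indicator (- cball 0 R) w) \<partial>(lborel :: 'x measure)) \<le> ennreal (h\<^sup>2)"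

lemma emeasure_slice_measure:
  assumes "S \<in> sets borel"
  shows "emeasure (slice_measure h R) S = (\<integral>\<^sup>+w. ennreal (poisson h w * indicator (cball 0 R) w) * indicator S (w, h) \<partial>(lborel :: 'x::euclidean_space measure))"
proof -
  have [measurable]: "S \<in> sets borel" by fact
  have "(\<lambda>w::'x. (w, h)) -` S \<in> sets borel" using measurable_sets_borel[of "\<lambda>w::'x. (w, h)" borel S] assms by simp
  then have "emeasure (slice_measure h R) S = (\<integral>\<^sup>+w. ennreal (poisson h w * indicator (cball 0 R) w) * indicator ((\<lambda>w. (w, h)) -` S) w \<partial>(lborel :: 'x measure))"
    unfolding slice_measure_def by (subst emeasure_distr) (auto simp: emeasure_density)
  then show ?thesis by (simp add: indicator_def)
qed

lemma loc_finite_slice_measure: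
  assumes "h > 0"
  shows "loc_finite (slice_measure h R :: ('x::euclidean_space \<times> real) measure)"
  unfolding loc_finite_def
proof (intro conjI allI)
  fix r
  have "emeasure (slice_measure h R :: ('x \<times> real) measure) (cball 0 r) \<le> (\<integral>\<^sup>+w. ennreal (poisson h w) \<partial>(lborel :: 'x measure))"
    by (subst emeasure_slice_measure) (auto intro!: nn_integral_mono simp: indicator_def)
  also have "\<dots> < \<infinity>" by (simp add: nn_integral_poisson[OF assms])
  finally show "emeasure (slice_measure h R :: ('x \<times> real) measure) (cball 0 r) < \<infinity>" .
qed (simp add: slice_measure_def)

lemma slice_measure_bounded:
  assumes "h > 0"
  shows "emeasure (slice_measure h R :: ('x::euclidean_space \<times> real) measure) (- cball 0 (R + h)) = 0"
proof -
  have "indicator (cball 0 R) w * indicator (- cball 0 (R + h)) (w, h) = (0::real)" for w :: 'x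
    using norm_Pair_le[of w h] assms by (auto simp: indicator_def)
  then have *: "ennreal (poisson h w * indicator (cball 0 R) w) * indicator (- cball 0 (R + h)) (w, h) = 0" for w :: 'x
    by (auto simp: indicator_def split: if_splits)
  show ?thesis by (subst emeasure_slice_measure) (simp, simp only: *, simp)
qed

lemma conv_slice_measure:
  assumes h: "h > 0" and phi: "\<phi> \<in> test_funs"
  shows "conv (slice_measure h R) \<phi> y = (LINT w|lborel. (poisson h w * indicator (cball 0 R) w) *\<^sub>R \<phi> (y + (w :: 'x::euclidean_space, h)))"
proof -
  have [measurable]: "\<phi> \<in> borel_measurable borel" by (rule test_funs_measurable[OF phi])
  have "conv (slice_measure h R) \<phi> y = (LINT w|density lborel (\<lambda>w. ennreal (poisson h w * indicator (cball 0 R) w)). \<phi> (y + (w, h)))"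
    unfolding conv_def slice_measure_def by (rule integral_distr) auto
  also have "\<dots> = (LINT w|lborel. (poisson h w * indicator (cball 0 R) w) *\<^sub>R \<phi> (y + (w, h)))"
    using h by (intro integral_density) (auto simp: poisson_nonneg)
  finally show ?thesis .
qed

text \<open>Up to the truncation, composing with the kernel cancels all times above \<open>h\<close>
  and leaves the slab of times in \<open>(0, h]\<close>, multiplied by the mass and divided by
  \<open>h\<close>. As \<open>h\<close> tends to 0 this becomes the squared mass times the
  identity.\<close>

definition inverse_approx :: "real \<Rightarrow> real \<Rightarrow> ('x::euclidean_space \<times> real \<Rightarrow> complex) \<Rightarrow> 'x \<times> real \<Rightarrow> complex" where
  "inverse_approx h R \<phi> y = of_real (1 / h) * (of_real (poisson_mass TYPE('x)) * \<phi> y - conv (slice_measure h R) \<phi> y)"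

lemma inverse_approx_test_funs:
  assumes "h > 0" "\<phi> \<in> test_funs"
  shows "inverse_approx h R \<phi> \<in> test_funs"
  unfolding inverse_approx_def
  by (intro test_funs_cmult test_funs_diff assms(2) test_funs_conv[OF loc_finite_slice_measure[OF assms(1)] assms(2) slice_measure_bounded[OF assms(1)]])

lemma iter_deriv_inverse_approx:
  assumes h: "h > 0" and phi: "\<phi> \<in> test_funs" and vs: "set vs \<subseteq> Basis"
  shows "iter_deriv vs (inverse_approx h R \<phi>) = inverse_approx h R (iter_deriv vs \<phi>)"
proof -
  have sm: "smooth \<phi>" "smooth (conv (slice_measure h R) \<phi>)"
    by (intro test_funs_smooth phi smooth_conv loc_finite_slice_measure h)+
  show ?thesis unfolding inverse_approx_def
    by (subst iter_deriv_cmult iter_deriv_diff; (intro smooth_diff smooth_cmult sm vs)?)+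
      (simp add: iter_deriv_cmult[OF sm(1) vs] iter_deriv_conv[OF loc_finite_slice_measure[OF h] phi vs])
qed

lemma conv_inverse_approx:
  fixes \<phi> :: "'x::euclidean_space \<times> real \<Rightarrow> complex"
  assumes h: "h > 0" and phi: "\<phi> \<in> test_funs" and M: "loc_finite M"
  shows "conv M (inverse_approx h R \<phi>) y =
    of_real (1 / h) * (of_real (poisson_mass TYPE('x)) * conv M \<phi> y - conv M (conv (slice_measure h R) \<phi>) y)"
proof -
  have "integrable M (\<lambda>z. \<phi> (y + z))" by (rule test_funs_conv_integrable[OF M phi])
  moreover have "integrable M (\<lambda>z. conv (slice_measure h R) \<phi> (y + z))"
    by (rule test_funs_conv_integrable[OF M test_funs_conv[OF loc_finite_slice_measure[OF h] phi slice_measure_bounded[OF h]]])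
  ultimately show ?thesis by (simp add: conv_def[of M] inverse_approx_def)
qed

text \<open>Only a time slab of length \<open>2 * r\<close> contributes, whatever the base point
  \<open>y\<close>, so the bound is uniform in \<open>y\<close>.\<close>

lemma potential_bounded:
  fixes \<phi> :: "'x::euclidean_space \<times> real \<Rightarrow> complex"
  assumes phi: "\<phi> \<in> test_funs"
  obtains A where "A \<ge> 0" "\<And>y. (\<integral>\<^sup>+z. ennreal (spacetime_kernel z * cmod (\<phi> (y + z))) \<partial>lborel) \<le> ennreal A"
proof -
  obtain B where B: "B > 0" "\<And>x. cmod (\<phi> x) \<le> B" using test_funs_bounded[OF phi] by blast
  obtain r where r: "r > 0" "\<And>x. \<phi> x \<noteq> 0 \<Longrightarrow> norm x \<le> r" using test_funsE[OF phi] by blast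
  let ?c = "poisson_mass TYPE('x)"
  have c: "?c > 0" by (rule poisson_mass_pos)
  show ?thesis
  proof (rule that[of "B * (?c * (2 * r))"])
    show "B * (?c * (2 * r)) \<ge> 0" using B r c by simp
    fix y :: "'x \<times> real"
    let ?S = "{z::'x \<times> real. - r - snd y \<le> snd z \<and> snd z \<le> r - snd y}"
    have [measurable]: "?S \<in> sets borel" by measurable
    have "(\<integral>\<^sup>+z. ennreal (spacetime_kernel z * cmod (\<phi> (y + z))) \<partial>lborel) \<le>
      (\<integral>\<^sup>+z. ennreal B * (ennreal (spacetime_kernel z) * indicator ?S z) \<partial>lborel)"
    proof (rule nn_integral_mono)
      fix z :: "'x \<times> real"
      show "ennreal (spacetime_kernel z * cmod (\<phi> (y + z))) \<le> ennreal B * (ennreal (spacetime_kernel z) * indicator ?S z)"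
      proof (cases "\<phi> (y + z) = 0")
        case False
        have "norm (snd (y + z)) \<le> norm (y + z)" using norm_snd_le[of "snd (y + z)" "fst (y + z)"] unfolding prod.collapse .
        also have "\<dots> \<le> r" by (rule r(2)[OF False])
        finally have "norm (snd (y + z)) \<le> r" .
        then have "z \<in> ?S" by auto
        moreover have "spacetime_kernel z * cmod (\<phi> (y + z)) \<le> B * spacetime_kernel z"
          using mult_right_mono[OF B(2)[of "y + z"] spacetime_kernel_nonneg[of z]] by (simp add: mult.commute)
        ultimately show ?thesis using B(1) spacetime_kernel_nonneg[of z]
          by (simp add: ennreal_mult[symmetric] ennreal_leI)
      qed simp
    qed
    also have "\<dots> = ennreal B * (\<integral>\<^sup>+z. ennreal (spacetime_kernel z) * indicator ?S z \<partial>lborel)"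
      by (rule nn_integral_cmult) measurable
    also have "\<dots> \<le> ennreal B * ennreal (?c * ((r - snd y) - (- r - snd y)))"
      using r(1) by (intro mult_left_mono nn_integral_spacetime_kernel_slab) auto
    also have "\<dots> = ennreal (B * (?c * (2 * r)))" using B(1) r(1) c by (simp add: ennreal_mult[symmetric])
    finally show "(\<integral>\<^sup>+z. ennreal (spacetime_kernel z * cmod (\<phi> (y + z))) \<partial>lborel) \<le> ennreal (B * (?c * (2 * r)))" .
  qed
qed

text \<open>The semigroup law is turned into an equality of measures: the image of the product
  density under \<open>fst p + (snd p, h)\<close> is \<open>m'\<close>. This transfers it from
  nonnegative to complex integrands. The truncation error is the tail mass \<open>h\<^sup>2\<close>
  times the uniform potential bound \<open>A\<close>.\<close>

lemma conv_conv_slice_close: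
  fixes \<phi> :: "'x::euclidean_space \<times> real \<Rightarrow> complex"
  assumes h: "h > 0" and phi: "\<phi> \<in> test_funs" and tail: "tail_small TYPE('x) h R"
    and A: "A \<ge> 0" "\<And>y. (\<integral>\<^sup>+z. ennreal (spacetime_kernel z * cmod (\<phi> (y + z))) \<partial>lborel) \<le> ennreal A"
  shows "cmod (of_real (poisson_mass TYPE('x)) * (LINT z|lborel. (spacetime_kernel z * indicator {h<..} (snd z)) *\<^sub>R \<phi> (y + z)) -
     conv kernel_measure (conv (slice_measure h R) \<phi>) y) \<le> A * h\<^sup>2"
proof -
  define c where "c = poisson_mass TYPE('x)"
  have c: "c > 0" unfolding c_def by (rule poisson_mass_pos)
  let ?P = "lborel \<Otimes>\<^sub>M lborel :: (('x \<times> real) \<times> 'x) measure"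
  have [measurable]: "\<phi> \<in> borel_measurable borel" by (rule test_funs_measurable[OF phi])
  have add_m[measurable]: "(\<lambda>p. fst p + (snd p, h)) \<in> ?P \<rightarrow>\<^sub>M (borel :: ('x \<times> real) measure)"
    by measurable
  define m where "m = density ?P (\<lambda>p. ennreal (spacetime_kernel (fst p) * poisson h (snd p)))"
  define m' where "m' = density (lborel :: ('x \<times> real) measure) (\<lambda>z. ennreal (c * (spacetime_kernel z * indicator {h<..} (snd z))))"
  have nnP: "(\<integral>\<^sup>+p. f p \<partial>?P) = (\<integral>\<^sup>+z. \<integral>\<^sup>+w. f (z, w) \<partial>lborel \<partial>lborel)" if "f \<in> borel_measurable ?P" for f
    by (rule lborel.nn_integral_fst[symmetric, OF that])
  have nnm: "(\<integral>\<^sup>+p. ennreal (spacetime_kernel (fst p) * poisson h (snd p)) * f (fst p + (snd p, h)) \<partial>?P) =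
    (\<integral>\<^sup>+z. ennreal (c * (spacetime_kernel z * indicator {h<..} (snd z))) * f z \<partial>lborel)"
    if [measurable]: "f \<in> borel_measurable borel" for f :: "'x \<times> real \<Rightarrow> ennreal"
  proof -
    have "(\<integral>\<^sup>+p. ennreal (spacetime_kernel (fst p) * poisson h (snd p)) * f (fst p + (snd p, h)) \<partial>?P) =
      (\<integral>\<^sup>+z. \<integral>\<^sup>+w. ennreal (spacetime_kernel z * poisson h w) * f (z + (w, h)) \<partial>lborel \<partial>lborel)"
      by (subst nnP) auto
    also have "\<dots> = (\<integral>\<^sup>+z. ennreal (spacetime_kernel z) * (\<integral>\<^sup>+w. ennreal (poisson h w) * f (z + (w, h)) \<partial>lborel) \<partial>lborel)"
      using h by (intro nn_integral_cong)
        (simp add: nn_integral_cmult[symmetric] ennreal_mult spacetime_kernel_nonneg poisson_nonneg mult.assoc)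
    also have "\<dots> = ennreal c * (\<integral>\<^sup>+z. ennreal (spacetime_kernel z * indicator {h<..} (snd z)) * f z \<partial>lborel)"
      unfolding c_def by (rule nn_integral_kernel_semigroup[OF that h])
    also have "\<dots> = (\<integral>\<^sup>+z. ennreal (c * (spacetime_kernel z * indicator {h<..} (snd z))) * f z \<partial>lborel)"
      using c by (simp add: nn_integral_cmult[symmetric] ennreal_mult spacetime_kernel_nonneg mult.assoc)
    finally show ?thesis .
  qed
  have distr: "distr m borel (\<lambda>p. fst p + (snd p, h)) = m'"
  proof (rule measure_eqI)
    fix S assume "S \<in> sets (distr m borel (\<lambda>p. fst p + (snd p, h)))"
    then have S[measurable]: "S \<in> sets borel" by simp
    have m_sets: "sets m = sets ?P" by (simp add: m_def)
    have "emeasure (distr m borel (\<lambda>p. fst p + (snd p, h))) S = (\<integral>\<^sup>+p. indicator S (fst p + (snd p, h)) \<partial>m)"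
      by (subst nn_integral_indicator[symmetric], simp, subst nn_integral_distr)
        (auto simp: m_sets measurable_cong_sets[OF m_sets refl])
    also have "\<dots> = (\<integral>\<^sup>+p. ennreal (spacetime_kernel (fst p) * poisson h (snd p)) * indicator S (fst p + (snd p, h)) \<partial>?P)"
      unfolding m_def by (rule nn_integral_density) measurable
    also have "\<dots> = (\<integral>\<^sup>+z. ennreal (c * (spacetime_kernel z * indicator {h<..} (snd z))) * indicator S z \<partial>lborel)"
      by (rule nnm) measurable
    also have "\<dots> = emeasure m' S" unfolding m'_def by (rule emeasure_density[symmetric]) auto
    finally show "emeasure (distr m borel (\<lambda>p. fst p + (snd p, h))) S = emeasure m' S" .
  qed (simp add: m'_def)
  define F where "F = (\<lambda>p :: ('x \<times> real) \<times> 'x. (spacetime_kernel (fst p) * poisson h (snd p)) *\<^sub>R \<phi> (y + (fst p + (snd p, h))))"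
  have Fm[measurable]: "F \<in> borel_measurable ?P" unfolding F_def by measurable
  have nF: "ennreal (norm (F p)) = ennreal (spacetime_kernel (fst p) * poisson h (snd p)) * ennreal (cmod (\<phi> (y + (fst p + (snd p, h)))))" for p
    using h by (simp add: F_def ennreal_mult spacetime_kernel_nonneg poisson_nonneg)
  have Fi: "integrable ?P F"
  proof (rule integrableI_bounded[OF Fm])
    have "(\<integral>\<^sup>+p. ennreal (norm (F p)) \<partial>?P) = (\<integral>\<^sup>+z. ennreal (c * (spacetime_kernel z * indicator {h<..} (snd z))) * ennreal (cmod (\<phi> (y + z))) \<partial>lborel)"
      unfolding nF by (rule nnm) measurable
    also have "\<dots> \<le> (\<integral>\<^sup>+z. ennreal c * ennreal (spacetime_kernel z * cmod (\<phi> (y + z))) \<partial>lborel)"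
      using c by (intro nn_integral_mono) (auto simp: indicator_def ennreal_mult[symmetric] spacetime_kernel_nonneg mult.assoc)
    also have "\<dots> = ennreal c * (\<integral>\<^sup>+z. ennreal (spacetime_kernel z * cmod (\<phi> (y + z))) \<partial>lborel)"
      by (rule nn_integral_cmult) measurable
    also have "\<dots> \<le> ennreal c * ennreal A" by (intro mult_left_mono A) simp
    also have "\<dots> < \<infinity>" by (simp add: ennreal_mult_less_top)
    finally show "(\<integral>\<^sup>+p. ennreal (norm (F p)) \<partial>?P) < \<infinity>" .
  qed
  have F1: "(LINT p|?P. F p) = of_real c * (LINT z|lborel. (spacetime_kernel z * indicator {h<..} (snd z)) *\<^sub>R \<phi> (y + z))"
  proof -
    have "(LINT p|?P. F p) = (LINT p|m. \<phi> (y + (fst p + (snd p, h))))"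
      unfolding m_def F_def using h
      by (intro integral_density[symmetric]) (auto simp: spacetime_kernel_nonneg poisson_nonneg)
    also have "\<dots> = (LINT z|distr m borel (\<lambda>p. fst p + (snd p, h)). \<phi> (y + z))"
      by (rule integral_distr[symmetric]) (auto simp: m_def)
    also have "\<dots> = (LINT z|lborel. (c * (spacetime_kernel z * indicator {h<..} (snd z))) *\<^sub>R \<phi> (y + z))"
      unfolding distr m'_def using c by (intro integral_density) (auto simp: spacetime_kernel_nonneg)
    also have "\<dots> = (LINT z|lborel. of_real c * ((spacetime_kernel z * indicator {h<..} (snd z)) *\<^sub>R \<phi> (y + z)))"
      by (simp add: scaleR_conv_of_real mult.assoc)
    also have "\<dots> = of_real c * (LINT z|lborel. (spacetime_kernel z * indicator {h<..} (snd z)) *\<^sub>R \<phi> (y + z))"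
      by (rule integral_mult_right_zero)
    finally show ?thesis .
  qed
  have [measurable]: "cball (0::'x) R \<in> sets borel" by simp
  define FR where "FR = (\<lambda>p. indicator (cball 0 R) (snd p) *\<^sub>R F p)"
  have FRm[measurable]: "FR \<in> borel_measurable ?P" unfolding FR_def by measurable
  have FRi: "integrable ?P FR"
    by (rule Bochner_Integration.integrable_bound[OF Fi FRm]) (auto simp: FR_def indicator_def)
  have F2: "conv kernel_measure (conv (slice_measure h R) \<phi>) y = (LINT p|?P. FR p)"
  proof -
    have cm: "conv (slice_measure h R) \<phi> \<in> borel_measurable borel"
      by (intro test_funs_measurable test_funs_conv[OF loc_finite_slice_measure[OF h] phi slice_measure_bounded[OF h]])
    have "conv kernel_measure (conv (slice_measure h R) \<phi>) y = (LINT z|lborel. spacetime_kernel z *\<^sub>R conv (slice_measure h R) \<phi> (y + z))"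
      unfolding conv_def[of kernel_measure]
      by (rule integral_density) (use cm in \<open>auto simp: spacetime_kernel_nonneg\<close>)
    also have "\<dots> = (LINT z|lborel. LINT w|lborel. FR (z, w))"
    proof (rule Bochner_Integration.integral_cong[OF refl])
      fix z :: "'x \<times> real"
      have "spacetime_kernel z *\<^sub>R conv (slice_measure h R) \<phi> (y + z) =
        (LINT w|lborel. spacetime_kernel z *\<^sub>R ((poisson h w * indicator (cball 0 R) w) *\<^sub>R \<phi> (y + z + (w, h))))"
        unfolding conv_slice_measure[OF h phi] by (rule integral_scaleR_right[symmetric])
      then show "spacetime_kernel z *\<^sub>R conv (slice_measure h R) \<phi> (y + z) = (LINT w|lborel. FR (z, w))"
        by (simp add: FR_def F_def mult_ac add.assoc)
    qed
    also have "\<dots> = (LINT p|?P. FR p)" by (rule lborel_pair.integral_fst'[OF FRi])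
    finally show ?thesis .
  qed
  have "ennreal (cmod ((LINT p|?P. F p) - (LINT p|?P. FR p))) = ennreal (cmod (LINT p|?P. F p - FR p))"
    using Fi FRi by simp
  also have "\<dots> \<le> (\<integral>\<^sup>+p. ennreal (norm (F p - FR p)) \<partial>?P)"
    by (intro integral_norm_bound_ennreal Bochner_Integration.integrable_diff Fi FRi)
  also have "\<dots> = (\<integral>\<^sup>+p. ennreal (poisson h (snd p) * indicator (- cball 0 R) (snd p)) * ennreal (spacetime_kernel (fst p) * cmod (\<phi> ((y + (snd p, h)) + fst p))) \<partial>?P)"
  proof (rule nn_integral_cong)
    fix p :: "('x \<times> real) \<times> 'x"
    have eq: "(y + (snd p, h)) + fst p = y + (fst p + (snd p, h))" by (simp only: add_ac)
    show "ennreal (norm (F p - FR p)) = ennreal (poisson h (snd p) * indicator (- cball 0 R) (snd p)) * ennreal (spacetime_kernel (fst p) * cmod (\<phi> ((y + (snd p, h)) + fst p)))"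
      unfolding eq using h
      by (simp add: FR_def F_def indicator_def ennreal_mult[symmetric] spacetime_kernel_nonneg poisson_nonneg mult_ac)
  qed
  also have "\<dots> = (\<integral>\<^sup>+z. \<integral>\<^sup>+w. ennreal (poisson h w * indicator (- cball 0 R) w) * ennreal (spacetime_kernel z * cmod (\<phi> ((y + (w, h)) + z))) \<partial>lborel \<partial>lborel)"
    by (subst nnP) auto
  also have "\<dots> = (\<integral>\<^sup>+w. \<integral>\<^sup>+z. ennreal (poisson h w * indicator (- cball 0 R) w) * ennreal (spacetime_kernel z * cmod (\<phi> ((y + (w, h)) + z))) \<partial>lborel \<partial>lborel)"
    by (rule nn_integral_lborel_swap) measurable
  also have "\<dots> = (\<integral>\<^sup>+w. ennreal (poisson h w * indicator (- cball 0 R) w) * (\<integral>\<^sup>+z. ennreal (spacetime_kernel z * cmod (\<phi> ((y + (w, h)) + z))) \<partial>lborel) \<partial>lborel)"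
    by (intro nn_integral_cong nn_integral_cmult) measurable
  also have "\<dots> \<le> (\<integral>\<^sup>+w. ennreal (poisson h w * indicator (- cball 0 R) w) * ennreal A \<partial>(lborel :: 'x measure))"
    by (intro nn_integral_mono mult_left_mono A) auto
  also have "\<dots> = (\<integral>\<^sup>+w. ennreal (poisson h w * indicator (- cball 0 R) w) \<partial>(lborel :: 'x measure)) * ennreal A"
    by (rule nn_integral_multc) measurable
  also have "\<dots> \<le> ennreal (h\<^sup>2) * ennreal A" by (rule mult_right_mono[OF tail]) simp
  also have "\<dots> = ennreal (A * h\<^sup>2)" using A(1) by (simp add: ennreal_mult[symmetric] mult.commute)
  finally show ?thesis using A(1) unfolding F1 F2 c_def by (simp add: ennreal_le_iff)
qed

lemma poisson_average_close:
  fixes \<phi> :: "'x::euclidean_space \<times> real \<Rightarrow> complex"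
  assumes phi: "\<phi> \<in> test_funs"
  obtains C where "C \<ge> 0" "\<And>s y. s > 0 \<Longrightarrow>
    cmod ((LINT w|lborel. poisson s w *\<^sub>R \<phi> (y + (w, s))) - of_real (poisson_mass TYPE('x)) * \<phi> y) \<le> C * s"
proof -
  let ?c = "poisson_mass TYPE('x)" and ?d = "real DIM('x \<times> real)" and ?q = "real (DIM('x \<times> real)\<^sup>2)"
  have c: "?c > 0" by (rule poisson_mass_pos)
  have sm: "smooth \<phi>" by (rule test_funs_smooth[OF phi])
  obtain B where B: "B > 0" "\<And>vs x. set vs \<subseteq> Basis \<Longrightarrow> length vs \<le> 2 \<Longrightarrow> cmod (iter_deriv vs \<phi> x) \<le> B"
    using test_funs_iter_bounded[OF phi, of 2] by metis
  have B0: "cmod (\<phi> x) \<le> B" for x using B(2)[of "[]" x] by simp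
  \<comment> \<open>The first entry is the Taylor bound for small \<open>w\<close>, the second
    bounds the four values in the second difference.\<close>
  define D where "D = max (2 * ?q * B) (4 * B)"
  have D: "D > 0" "4 * B \<le> D" "2 * ?q * B \<le> D" using B(1) by (auto simp: D_def)
  have d2: "cmod (diff2 \<phi> w y) \<le> D * min ((norm w / 1)\<^sup>2) 1" for w y
  proof -
    have "cmod (diff2 \<phi> w y) \<le> 2 * ?q * B * (norm (w, 0::real))\<^sup>2"
      unfolding diff2_def by (rule order_trans[OF smooth_second_difference[OF sm B(2)]]) auto
    also have "\<dots> \<le> D * (norm w)\<^sup>2" using D by (simp add: norm_Pair mult_right_mono)
    finally have 1: "cmod (diff2 \<phi> w y) \<le> D * (norm w)\<^sup>2" .
    have "cmod (diff2 \<phi> w y) \<le> cmod (\<phi> (y + (w, 0))) + cmod (\<phi> (y - (w, 0))) + cmod (2 * \<phi> y)"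
      unfolding diff2_def by (meson norm_triangle_ineq4 norm_triangle_ineq order_trans add_right_mono)
    also have "\<dots> \<le> B + B + 2 * B" using B0 by (intro add_mono) (auto simp: norm_mult)
    finally have "cmod (diff2 \<phi> w y) \<le> D * 1" using D by simp
    with 1 show ?thesis by (auto simp: min_def)
  qed
  show ?thesis
  proof (rule that[of "D * moment_const TYPE('x) + ?c * (?d * B)"])
    have mc: "moment_const TYPE('x) \<ge> 0" by (simp add: moment_const_def)
    then show "D * moment_const TYPE('x) + ?c * (?d * B) \<ge> 0" using D B c by simp
    fix s :: real and y :: "'x \<times> real" assume s: "s > 0"
    let ?e = "cmod ((LINT w|lborel. poisson s w *\<^sub>R \<phi> (y + (w, s))) - of_real ?c * \<phi> y)"
    have "ennreal ?e \<le> (\<integral>\<^sup>+w. ennreal (poisson s w * cmod (diff2 \<phi> w (y + (0, s)))) \<partial>lborel) + ennreal (?c * cmod (\<phi> (y + (0, s)) - \<phi> y))"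
      by (rule poisson_average_error[OF s phi])
    also have "\<dots> \<le> ennreal (D * (s * (moment_const TYPE('x) / 1))) + ennreal (?c * (?d * B * s))"
    proof (rule add_mono)
      have "(\<integral>\<^sup>+w. ennreal (poisson s w * cmod (diff2 \<phi> w (y + (0, s)))) \<partial>lborel) \<le>
        (\<integral>\<^sup>+w. ennreal D * ennreal (poisson s w * min ((norm w / 1)\<^sup>2) 1) \<partial>(lborel :: 'x measure))"
      proof (rule nn_integral_mono)
        fix w :: 'x
        have "poisson s w * cmod (diff2 \<phi> w (y + (0, s))) \<le> poisson s w * (D * min ((norm w / 1)\<^sup>2) 1)"
          using s by (intro mult_left_mono d2) (simp add: poisson_nonneg)
        then show "ennreal (poisson s w * cmod (diff2 \<phi> w (y + (0, s)))) \<le> ennreal D * ennreal (poisson s w * min ((norm w / 1)\<^sup>2) 1)"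
          using D s by (simp add: ennreal_mult[symmetric] ennreal_leI poisson_nonneg mult_ac)
      qed
      also have "\<dots> = ennreal D * (\<integral>\<^sup>+w. ennreal (poisson s w * min ((norm w / 1)\<^sup>2) 1) \<partial>(lborel :: 'x measure))"
        by (rule nn_integral_cmult) measurable
      also have "\<dots> \<le> ennreal D * ennreal (s * (moment_const TYPE('x) / 1))"
        by (intro mult_left_mono nn_integral_poisson_moment s) auto
      also have "\<dots> = ennreal (D * (s * (moment_const TYPE('x) / 1)))" using D s mc by (simp add: ennreal_mult)
      finally show "(\<integral>\<^sup>+w. ennreal (poisson s w * cmod (diff2 \<phi> w (y + (0, s)))) \<partial>lborel) \<le> ennreal (D * (s * (moment_const TYPE('x) / 1)))" .
      have "cmod (\<phi> (y + (0, s)) - \<phi> y) \<le> ?d * B * norm ((y + (0, s)) - y)"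
        by (rule smooth_lipschitz[OF sm]) (rule B(2), auto)
      then have "cmod (\<phi> (y + (0, s)) - \<phi> y) \<le> ?d * B * s" using s by (simp add: norm_Pair)
      then show "ennreal (?c * cmod (\<phi> (y + (0, s)) - \<phi> y)) \<le> ennreal (?c * (?d * B * s))"
        using c by (intro ennreal_leI mult_left_mono) auto
    qed
    also have "\<dots> = ennreal ((D * moment_const TYPE('x) + ?c * (?d * B)) * s)"
      using D B c s mc by (subst ennreal_plus[symmetric]) (auto simp: algebra_simps)
    finally show "?e \<le> (D * moment_const TYPE('x) + ?c * (?d * B)) * s"
      using D B c s mc by (subst (asm) ennreal_le_iff) auto
  qed
qed

text \<open>Slicing in time, the slice at time \<open>t\<close> deviates by at most
  \<open>C * t\<close>, hence by at most \<open>C * h\<close>, and the slab has length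
  \<open>h\<close>.\<close>

lemma conv_slab_close:
  fixes \<phi> :: "'x::euclidean_space \<times> real \<Rightarrow> complex"
  assumes h: "h > 0" and phi: "\<phi> \<in> test_funs" and C: "C \<ge> 0" "\<And>s y. s > 0 \<Longrightarrow>
    cmod ((LINT w|lborel. poisson s w *\<^sub>R \<phi> (y + (w, s))) - of_real (poisson_mass TYPE('x)) * \<phi> y) \<le> C * s"
  shows "cmod ((LINT z|lborel. (spacetime_kernel z * indicator {..h} (snd z)) *\<^sub>R \<phi> (y + z)) - of_real (h * poisson_mass TYPE('x)) * \<phi> y) \<le> C * h\<^sup>2"
proof -
  define c where "c = poisson_mass TYPE('x)"
  have [measurable]: "\<phi> \<in> borel_measurable borel" by (rule test_funs_measurable[OF phi])
  let ?F = "\<lambda>z. (spacetime_kernel z * indicator {..h} (snd z)) *\<^sub>R \<phi> (y + z)"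
  define I where "I t = (LINT w|lborel. poisson t w *\<^sub>R \<phi> (y + (w, t)))" for t
  have "integrable kernel_measure (\<lambda>z. \<phi> (y + z))"
    by (rule test_funs_conv_integrable[OF loc_finite_kernel_measure phi])
  then have K: "integrable lborel (\<lambda>z. spacetime_kernel z *\<^sub>R \<phi> (y + z))"
    by (subst (asm) integrable_density) (auto simp: spacetime_kernel_nonneg)
  have "integrable lborel ?F"
    by (rule Bochner_Integration.integrable_bound[OF K]) (auto simp: indicator_def)
  moreover have cp: "(\<lambda>(w, t). ?F (w, t)) = ?F" by auto
  ultimately have Fi: "integrable (lborel \<Otimes>\<^sub>M lborel) (\<lambda>(w, t). ?F (w, t))" unfolding cp lborel_prod by simp
  have eq: "(LINT w|lborel. ?F (w, t)) = indicator {0<..h} t *\<^sub>R I t" for t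
    by (cases "0 < t \<and> t \<le> h") (auto simp: I_def spacetime_kernel_def indicator_def)
  have "(LINT z|lborel. ?F z) = (LINT p|(lborel \<Otimes>\<^sub>M lborel). ?F p)" by (simp add: lborel_prod)
  also have "\<dots> = (LINT t|lborel. LINT w|lborel. ?F (w, t))"
    using lborel_pair.integral_snd[OF Fi] unfolding cp by simp
  also have "\<dots> = (LINT t|lborel. indicator {0<..h} t *\<^sub>R I t)" by (simp only: eq)
  finally have E: "(LINT z|lborel. ?F z) = (LINT t|lborel. indicator {0<..h} t *\<^sub>R I t)" .
  have Ii: "integrable lborel (\<lambda>t. indicator {0<..h} t *\<^sub>R I t)"
    using lborel_pair.integrable_snd[OF Fi] by (simp only: eq)
  have m: "emeasure lborel {0<..h} < top" "measure lborel {0<..h} = h" using h by simp_all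
  have ii: "integrable lborel (\<lambda>t. indicator {0<..h} t *\<^sub>R (of_real c * \<phi> y))"
    by (intro integrable_scaleR_left integrable_real_indicator) (use m in auto)
  have "(LINT t|lborel. indicator {0<..h} t *\<^sub>R (of_real c * \<phi> y)) = of_real (h * c) * \<phi> y"
    using h by (subst integral_scaleR_left) (auto simp: m scaleR_conv_of_real mult.assoc intro!: integrable_real_indicator)
  then have "(LINT z|lborel. ?F z) - of_real (h * c) * \<phi> y = (LINT t|lborel. indicator {0<..h} t *\<^sub>R I t - indicator {0<..h} t *\<^sub>R (of_real c * \<phi> y))"
    unfolding E using Ii ii by simp
  also have "cmod \<dots> \<le> (LINT t|lborel. indicator {0<..h} t *\<^sub>R (C * h))"
  proof (rule Bochner_Integration.integral_norm_bound_integral)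
    show "integrable lborel (\<lambda>t. indicator {0<..h} t *\<^sub>R I t - indicator {0<..h} t *\<^sub>R (of_real c * \<phi> y))" using Ii ii by simp
    show "integrable lborel (\<lambda>t. indicator {0<..h} t *\<^sub>R (C * h))" by (intro integrable_scaleR_left integrable_real_indicator) (use m in auto)
    fix t :: real
    show "cmod (indicator {0<..h} t *\<^sub>R I t - indicator {0<..h} t *\<^sub>R (of_real c * \<phi> y)) \<le> indicator {0<..h} t *\<^sub>R (C * h)"
    proof (cases "0 < t \<and> t \<le> h")
      case True
      have "cmod (I t - of_real c * \<phi> y) \<le> C * t" using C(2)[of t y] True by (simp add: I_def c_def)
      also have "\<dots> \<le> C * h" using True C by (intro mult_left_mono) auto
      finally show ?thesis using True by simp
    qed (auto simp: indicator_def)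
  qed
  also have "\<dots> = C * h\<^sup>2" using h by (subst integral_scaleR_left) (auto simp: m power2_eq_square intro!: integrable_real_indicator)
  finally show ?thesis by (simp add: c_def)
qed

text \<open>Times above \<open>h\<close> cancel up to the truncation error, and the slab contributes
  the squared mass times \<open>h\<close>, each with an error of order \<open>h\<^sup>2\<close>. The
  division by \<open>h\<close> leaves order \<open>h\<close>. Here \<open>D\<close> may depend on
  \<open>\<phi>\<close>; it only serves to identify the limit.\<close>

lemma conv_inverse_approx_close:
  fixes \<phi> :: "'x::euclidean_space \<times> real \<Rightarrow> complex"
  assumes phi: "\<phi> \<in> test_funs"
  obtains D where "\<And>h R y. h > 0 \<Longrightarrow> tail_small TYPE('x) h R \<Longrightarrow>
    cmod (conv kernel_measure (inverse_approx h R \<phi>) y - of_real ((poisson_mass TYPE('x))\<^sup>2) * \<phi> y) \<le> D * h"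
proof -
  define c where "c = poisson_mass TYPE('x)"
  have c: "c > 0" unfolding c_def by (rule poisson_mass_pos)
  obtain C where C: "C \<ge> 0" "\<And>s y. s > 0 \<Longrightarrow>
    cmod ((LINT w|lborel. poisson s w *\<^sub>R \<phi> (y + (w, s))) - of_real c * \<phi> y) \<le> C * s"
    using poisson_average_close[OF phi] unfolding c_def by blast
  obtain A where A: "A \<ge> 0" "\<And>y. (\<integral>\<^sup>+z. ennreal (spacetime_kernel z * cmod (\<phi> (y + z))) \<partial>lborel) \<le> ennreal A"
    using potential_bounded[OF phi] by blast
  have [measurable]: "\<phi> \<in> borel_measurable borel" by (rule test_funs_measurable[OF phi])
  show ?thesis
  proof (rule that[of "c * C + A"])
    fix h R y assume h: "h > 0" and tail: "tail_small TYPE('x) h R"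
    define X where "X = conv kernel_measure (conv (slice_measure h R) \<phi>) y"
    define S where "S = (LINT z|lborel. (spacetime_kernel z * indicator {..h} (snd z)) *\<^sub>R \<phi> (y + z))"
    define Y where "Y = (LINT z|lborel. (spacetime_kernel z * indicator {h<..} (snd z)) *\<^sub>R \<phi> (y + z))"
    have 1: "cmod (of_real c * Y - X) \<le> A * h\<^sup>2"
      unfolding c_def X_def Y_def by (rule conv_conv_slice_close[OF h phi tail A])
    have 2: "cmod (S - of_real (h * c) * \<phi> y) \<le> C * h\<^sup>2"
      unfolding c_def S_def by (rule conv_slab_close[OF h phi C(1) C(2)[unfolded c_def]])
    have "integrable kernel_measure (\<lambda>z. \<phi> (y + z))"
      by (rule test_funs_conv_integrable[OF loc_finite_kernel_measure phi])
    then have K: "integrable lborel (\<lambda>z. spacetime_kernel z *\<^sub>R \<phi> (y + z))"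
      by (subst (asm) integrable_density) (auto simp: spacetime_kernel_nonneg)
    have i: "integrable lborel (\<lambda>z. (spacetime_kernel z * indicator {..h} (snd z)) *\<^sub>R \<phi> (y + z))"
       "integrable lborel (\<lambda>z. (spacetime_kernel z * indicator {h<..} (snd z)) *\<^sub>R \<phi> (y + z))"
      by (rule Bochner_Integration.integrable_bound[OF K]; auto simp: indicator_def)+
    have "conv kernel_measure \<phi> y = (LINT z|lborel. spacetime_kernel z *\<^sub>R \<phi> (y + z))"
      unfolding conv_def by (rule integral_density) (auto simp: spacetime_kernel_nonneg)
    also have "\<dots> = (LINT z|lborel. (spacetime_kernel z * indicator {..h} (snd z)) *\<^sub>R \<phi> (y + z) + (spacetime_kernel z * indicator {h<..} (snd z)) *\<^sub>R \<phi> (y + z))"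
      by (intro Bochner_Integration.integral_cong) (auto simp: indicator_def)
    also have "\<dots> = S + Y" unfolding S_def Y_def using i by simp
    finally have "conv kernel_measure (inverse_approx h R \<phi>) y = of_real (1 / h) * (of_real c * (S + Y) - X)"
      unfolding conv_inverse_approx[OF h phi loc_finite_kernel_measure] X_def c_def by simp
    also have "\<dots> - of_real (c\<^sup>2) * \<phi> y = of_real (1 / h) * (of_real c * (S - of_real (h * c) * \<phi> y) + (of_real c * Y - X))"
      using h by (simp add: field_simps power2_eq_square)
    also have "cmod \<dots> \<le> (1 / h) * (c * (C * h\<^sup>2) + A * h\<^sup>2)"
    proof -
      have "cmod (of_real c * (S - of_real (h * c) * \<phi> y) + (of_real c * Y - X)) \<le> c * cmod (S - of_real (h * c) * \<phi> y) + cmod (of_real c * Y - X)"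
        using norm_triangle_ineq[of "of_real c * (S - of_real (h * c) * \<phi> y)" "of_real c * Y - X"] c by (simp add: norm_mult)
      also have "\<dots> \<le> c * (C * h\<^sup>2) + A * h\<^sup>2" using 1 2 c by (intro add_mono mult_left_mono) auto
      finally show ?thesis using h by (simp add: norm_mult norm_divide divide_right_mono)
    qed
    also have "\<dots> = (c * C + A) * h" using h by (simp add: power2_eq_square field_simps)
    finally show "cmod (conv kernel_measure (inverse_approx h R \<phi>) y - of_real ((poisson_mass TYPE('x))\<^sup>2) * \<phi> y) \<le> (c * C + A) * h"
      by (simp add: c_def)
  qed
qed

section \<open>Functions adapted to a ball, and how distributions act on them\<close>

text \<open>A bump normalised at scale \<open>r\<close>, with \<open>A\<close> independent of the
  scale. Two derivatives suffice: the second order feeds the second difference in space, the first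
  order the shift in time.\<close>

definition adapted :: "real \<Rightarrow> 'a::euclidean_space \<Rightarrow> real \<Rightarrow> ('a \<Rightarrow> complex) \<Rightarrow> bool" where
  "adapted A a r \<phi> \<longleftrightarrow> \<phi> \<in> test_funs \<and> (\<forall>x. cmod (\<phi> x) \<le> 1) \<and> (\<forall>x. r < dist a x \<longrightarrow> \<phi> x = 0) \<and>
     (\<forall>b\<in>Basis. \<forall>x. cmod (iter_deriv [b] \<phi> x) \<le> A / r) \<and>
     (\<forall>b\<in>Basis. \<forall>c\<in>Basis. \<forall>x. cmod (iter_deriv [c, b] \<phi> x) \<le> A / r\<^sup>2)"

lemma nn_integral_le_ball:
  fixes f :: "'a::euclidean_space \<Rightarrow> real"
  assumes "B \<ge> 0" "\<rho> \<ge> 0" "\<And>x. f x \<le> B" "\<And>x. \<rho> < dist a x \<Longrightarrow> f x \<le> 0"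
  shows "(\<integral>\<^sup>+x. ennreal (f x) \<partial>lborel) \<le> ennreal (B * (unit_ball_vol DIM('a) * \<rho> ^ DIM('a)))"
proof -
  have "(\<integral>\<^sup>+x. ennreal (f x) \<partial>lborel) \<le> (\<integral>\<^sup>+x. ennreal B * indicator (cball a \<rho>) x \<partial>lborel)"
    using assms by (intro nn_integral_mono) (auto simp: indicator_def not_le intro: ennreal_leI ennreal_neg)
  also have "\<dots> = ennreal B * emeasure lborel (cball a \<rho>)" by (rule nn_integral_cmult_indicator) simp
  also have "\<dots> = ennreal (B * (unit_ball_vol DIM('a) * \<rho> ^ DIM('a)))"
    unfolding emeasure_cball[OF assms(2)] using assms by (simp add: ennreal_mult)
  finally show ?thesis .
qed

text \<open>For \<open>norm w \<le> r\<close> the Taylor bound holds pointwise and the second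
  difference lives in the ball of radius \<open>2 * r\<close>. For larger \<open>w\<close> the
  supports drift apart, but the L1 norm is at most four times that of \<open>\<phi>\<close> by
  translation invariance.\<close>

lemma adapted_diff2_L1:
  fixes \<phi> :: "'x::euclidean_space \<times> real \<Rightarrow> complex"
  assumes ad: "adapted A a r \<phi>" and r: "r > 0" and A: "A \<ge> 0"
  shows "(\<integral>\<^sup>+y. ennreal (cmod (diff2 \<phi> w y)) \<partial>lborel) \<le>
    ennreal ((2 * real (DIM('x \<times> real)\<^sup>2) * A + 4) * (unit_ball_vol DIM('x \<times> real) * (2 * r) ^ DIM('x \<times> real)) * min ((norm w / r)\<^sup>2) 1)"
proof -
  let ?q = "real (DIM('x \<times> real)\<^sup>2)" and ?V = "unit_ball_vol DIM('x \<times> real) :: real"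
  have phi: "\<phi> \<in> test_funs" and b1: "\<And>x. cmod (\<phi> x) \<le> 1" and supp: "\<And>x. r < dist a x \<Longrightarrow> \<phi> x = 0"
    and b3: "\<And>b c x. b \<in> Basis \<Longrightarrow> c \<in> Basis \<Longrightarrow> cmod (iter_deriv [c, b] \<phi> x) \<le> A / r\<^sup>2"
    using ad unfolding adapted_def by blast+
  have V: "?V \<ge> 0" by simp
  show ?thesis
  proof (cases "norm w \<le> r")
    case True
    have "(\<integral>\<^sup>+y. ennreal (cmod (diff2 \<phi> w y)) \<partial>lborel) \<le> ennreal ((2 * ?q * (A / r\<^sup>2) * (norm w)\<^sup>2) * (?V * (2 * r) ^ DIM('x \<times> real)))"
    proof (rule nn_integral_le_ball[of _ _ _ a])
      show "cmod (diff2 \<phi> w y) \<le> 2 * ?q * (A / r\<^sup>2) * (norm w)\<^sup>2" for y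
      proof -
        have "cmod (diff2 \<phi> w y) \<le> 2 * ?q * (A / r\<^sup>2) * (norm (w, 0::real))\<^sup>2"
          unfolding diff2_def by (rule order_trans[OF smooth_second_difference[OF test_funs_smooth[OF phi] b3]]) auto
        then show ?thesis by (simp add: norm_Pair)
      qed
      show "cmod (diff2 \<phi> w y) \<le> 0" if y: "2 * r < dist a y" for y
      proof -
        have n: "norm (w, 0::real) \<le> r" using True by (simp add: norm_Pair)
        have "dist a y \<le> dist a (y + (w, 0)) + norm (w, 0::real)"
          using dist_triangle[of a y "y + (w, 0)"] by (simp add: dist_norm)
        moreover have "dist a y \<le> dist a (y - (w, 0)) + norm (w, 0::real)"
          using dist_triangle[of a y "y - (w, 0)"] by (simp add: dist_norm)
        ultimately have "\<phi> (y + (w, 0)) = 0" "\<phi> (y - (w, 0)) = 0" "\<phi> y = 0"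
          using y n r by (auto intro!: supp)
        then show ?thesis by (simp add: diff2_def)
      qed
    qed (use A r in auto)
    also have "\<dots> \<le> ennreal ((2 * ?q * A + 4) * (?V * (2 * r) ^ DIM('x \<times> real)) * min ((norm w / r)\<^sup>2) 1)"
    proof (rule ennreal_leI)
      have m: "min ((norm w / r)\<^sup>2) 1 = (norm w / r)\<^sup>2" using True r by (auto simp: min_def power_le_one)
      have "2 * ?q * (A / r\<^sup>2) * (norm w)\<^sup>2 = (2 * ?q * A) * (norm w / r)\<^sup>2" by (simp add: power_divide)
      also have "\<dots> \<le> (2 * ?q * A + 4) * (norm w / r)\<^sup>2" by (intro mult_right_mono) auto
      finally have "2 * ?q * (A / r\<^sup>2) * (norm w)\<^sup>2 * (?V * (2 * r) ^ DIM('x \<times> real)) \<le> (2 * ?q * A + 4) * (norm w / r)\<^sup>2 * (?V * (2 * r) ^ DIM('x \<times> real))"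
        using V r by (intro mult_right_mono) auto
      then show "2 * ?q * (A / r\<^sup>2) * (norm w)\<^sup>2 * (?V * (2 * r) ^ DIM('x \<times> real)) \<le> (2 * ?q * A + 4) * (?V * (2 * r) ^ DIM('x \<times> real)) * min ((norm w / r)\<^sup>2) 1"
        unfolding m by (simp only: mult_ac)
    qed
    finally show ?thesis .
  next
    case False
    have [measurable]: "\<phi> \<in> borel_measurable borel" by (rule test_funs_measurable[OF phi])
    have one: "(\<integral>\<^sup>+y. ennreal (cmod (\<phi> y)) \<partial>lborel) \<le> ennreal (1 * (?V * r ^ DIM('x \<times> real)))"
      by (rule nn_integral_le_ball[of _ _ _ a]) (use b1 supp r in auto)
    have sh: "(\<integral>\<^sup>+y. ennreal (cmod (\<phi> (v + y))) \<partial>lborel) = (\<integral>\<^sup>+y. ennreal (cmod (\<phi> y)) \<partial>lborel)" for v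
      by (rule nn_integral_lborel_shift[of "\<lambda>y. ennreal (cmod (\<phi> y))"]) measurable
    have "(\<integral>\<^sup>+y. ennreal (cmod (diff2 \<phi> w y)) \<partial>lborel) \<le>
      (\<integral>\<^sup>+y. ennreal (cmod (\<phi> ((w, 0) + y))) + ennreal (cmod (\<phi> (- (w, 0) + y))) + 2 * ennreal (cmod (\<phi> y)) \<partial>lborel)"
    proof (rule nn_integral_mono)
      fix y
      have "cmod (diff2 \<phi> w y) \<le> cmod (\<phi> (y + (w, 0))) + cmod (\<phi> (y - (w, 0))) + cmod (2 * \<phi> y)"
        unfolding diff2_def by (meson norm_triangle_ineq4 norm_triangle_ineq order_trans add_right_mono)
      then have "ennreal (cmod (diff2 \<phi> w y)) \<le> ennreal (cmod (\<phi> (y + (w, 0))) + cmod (\<phi> (y - (w, 0))) + 2 * cmod (\<phi> y))"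
        by (intro ennreal_leI) (simp add: norm_mult)
      also have "\<dots> = ennreal (cmod (\<phi> ((w, 0) + y))) + ennreal (cmod (\<phi> (- (w, 0) + y))) + 2 * ennreal (cmod (\<phi> y))"
        by (simp add: ennreal_plus ennreal_mult add.commute[of "(w, 0)"] del: add_uminus_conv_diff add: diff_conv_add_uminus add.commute[of _ y])
      finally show "ennreal (cmod (diff2 \<phi> w y)) \<le> ennreal (cmod (\<phi> ((w, 0) + y))) + ennreal (cmod (\<phi> (- (w, 0) + y))) + 2 * ennreal (cmod (\<phi> y))" .
    qed
    also have "\<dots> = (\<integral>\<^sup>+y. ennreal (cmod (\<phi> ((w, 0) + y))) \<partial>lborel) + (\<integral>\<^sup>+y. ennreal (cmod (\<phi> (- (w, 0) + y))) \<partial>lborel) + 2 * (\<integral>\<^sup>+y. ennreal (cmod (\<phi> y)) \<partial>lborel)"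
      by (simp add: nn_integral_add nn_integral_cmult)
    also have "\<dots> \<le> ennreal (1 * (?V * r ^ DIM('x \<times> real))) + ennreal (1 * (?V * r ^ DIM('x \<times> real))) + 2 * ennreal (1 * (?V * r ^ DIM('x \<times> real)))"
      unfolding sh by (intro add_mono mult_left_mono one) auto
    also have "\<dots> = ennreal (4 * (?V * r ^ DIM('x \<times> real)))"
    proof -
      have "ennreal (4 * (?V * r ^ DIM('x \<times> real))) = 4 * ennreal (?V * r ^ DIM('x \<times> real))" by (simp add: ennreal_mult')
      moreover have "x + x + 2 * x = 4 * x" for x :: ennreal
      proof -
        have "4 * x = (1 + 1 + 2) * x" by simp
        also have "\<dots> = x + x + 2 * x" by (simp only: distrib_right mult_1)
        finally show ?thesis by simp
      qed
      ultimately show ?thesis by simp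
    qed
    also have "\<dots> \<le> ennreal ((2 * ?q * A + 4) * (?V * (2 * r) ^ DIM('x \<times> real)) * min ((norm w / r)\<^sup>2) 1)"
    proof (rule ennreal_leI)
      have "1 \<le> norm w / r" using False r by (simp add: field_simps)
      then have "min ((norm w / r)\<^sup>2) 1 = 1" using one_le_power[of "norm w / r" 2] by simp
      moreover have "4 * (?V * r ^ DIM('x \<times> real)) \<le> (2 * ?q * A + 4) * (?V * (2 * r) ^ DIM('x \<times> real))"
        using A r V by (intro mult_mono power_mono) auto
      ultimately show "4 * (?V * r ^ DIM('x \<times> real)) \<le> (2 * ?q * A + 4) * (?V * (2 * r) ^ DIM('x \<times> real)) * min ((norm w / r)\<^sup>2) 1" by simp
    qed
    finally show ?thesis .
  qed
qed

text \<open>The numerator of the difference quotient splits into the second difference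
  \<open>E1\<close>, the time shift \<open>E2\<close> and the truncated tail \<open>E3\<close>. The
  first two have L1 norm of order \<open>h * r ^ N\<close>, and the tail has at most
  \<open>h\<^sup>2\<close> times the norm of \<open>\<phi>\<close>. The constant is independent of
  \<open>h\<close> and \<open>R\<close>, unlike the error in
  \<open>conv_inverse_approx_close\<close>.\<close>

lemma inverse_approx_L1:
  assumes A: "A \<ge> 0"
  obtains C where "C \<ge> 0" "\<And>\<phi> :: 'x::euclidean_space \<times> real \<Rightarrow> complex. \<And>a r h R. adapted A a r \<phi> \<Longrightarrow> r > 0 \<Longrightarrow> 0 < h \<Longrightarrow> h \<le> r \<Longrightarrow> tail_small TYPE('x) h R \<Longrightarrow>
    (\<integral>\<^sup>+y. ennreal (cmod (inverse_approx h R \<phi> y)) \<partial>lborel) \<le> ennreal (C * r ^ DIM('x)) + ennreal h * (\<integral>\<^sup>+y. ennreal (cmod (\<phi> y)) \<partial>lborel)"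
proof -
  let ?d = "real DIM('x \<times> real)" and ?q = "real (DIM('x \<times> real)\<^sup>2)" and ?V = "unit_ball_vol DIM('x \<times> real) :: real"
  define c where "c = poisson_mass TYPE('x)"
  define m where "m = moment_const TYPE('x)"
  have c: "c > 0" unfolding c_def by (rule poisson_mass_pos)
  have m: "m \<ge> 0" by (simp add: m_def moment_const_def)
  have V: "?V \<ge> 0" by simp
  define W where "W = ?V * 2 ^ DIM('x \<times> real)"
  have W: "W \<ge> 0" using V by (simp add: W_def)
  define C where "C = (2 * ?q * A + 4) * W * m + c * (?d * A) * W"
  show ?thesis
  proof (rule that[of C])
    show "C \<ge> 0" using A W m c by (simp add: C_def)
    fix \<phi> :: "'x \<times> real \<Rightarrow> complex" and a r h R
    assume ad: "adapted A a r \<phi>" and r: "r > 0" and h: "0 < h" "h \<le> r" and tail: "tail_small TYPE('x) h R"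
    have phi: "\<phi> \<in> test_funs" and supp: "\<And>x. r < dist a x \<Longrightarrow> \<phi> x = 0"
      and b2: "\<And>b x. b \<in> Basis \<Longrightarrow> cmod (iter_deriv [b] \<phi> x) \<le> A / r"
      using ad unfolding adapted_def by blast+
    have [measurable]: "\<phi> \<in> borel_measurable borel" by (rule test_funs_measurable[OF phi])
    have [measurable]: "inverse_approx h R \<phi> \<in> borel_measurable borel"
      by (intro test_funs_measurable inverse_approx_test_funs h phi)
    obtain B where B: "\<And>x. cmod (\<phi> x) \<le> B" using test_funs_bounded[OF phi] by blast
    \<comment> \<open>The space-time dimension exceeds that of space by one; the additional factor
      \<open>r\<close> cancels the \<open>1 / r\<close> of the moment and derivative bounds.\<close>
    define rd where "rd = r ^ DIM('x)"
    have rd: "rd > 0" "(2 * r) ^ DIM('x \<times> real) = 2 ^ DIM('x \<times> real) * (rd * r)"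
      using r by (simp_all add: rd_def power_mult_distrib)
    define E1 where "E1 y = (\<integral>\<^sup>+w. ennreal (poisson h w * cmod (diff2 \<phi> w (y + (0, h)))) \<partial>lborel)" for y
    define E2 where "E2 y = ennreal (c * cmod (\<phi> (y + (0, h)) - \<phi> y))" for y
    define E3 where "E3 y = (\<integral>\<^sup>+w. ennreal (poisson h w * indicator (- cball 0 R) w) * ennreal (cmod (\<phi> (y + (w, h)))) \<partial>lborel)" for y
    have d2m[measurable]: "(\<lambda>p. diff2 \<phi> (f p) (g p)) \<in> borel_measurable N" if [measurable]: "f \<in> borel_measurable N" "g \<in> borel_measurable N"
      for f g and N :: "'z measure" unfolding diff2_def by measurable
    have [measurable]: "E1 \<in> borel_measurable borel" unfolding E1_def by measurable
    have [measurable]: "E2 \<in> borel_measurable borel" unfolding E2_def by measurable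
    have [measurable]: "E3 \<in> borel_measurable borel" unfolding E3_def by measurable
    have pt: "ennreal h * ennreal (cmod (inverse_approx h R \<phi> y)) \<le> E1 y + E2 y + E3 y" for y
    proof -
      have i1: "integrable lborel (\<lambda>w. poisson h w *\<^sub>R \<phi> (y + (w, h)))"
        by (intro poisson_integrable_bounded[OF h(1), of _ B] B) measurable
      have i2: "integrable lborel (\<lambda>w. (poisson h w * indicator (cball 0 R) w) *\<^sub>R \<phi> (y + (w, h)))"
        by (rule Bochner_Integration.integrable_bound[OF i1]) (auto simp: indicator_def)
      define I where "I = (LINT w|lborel. poisson h w *\<^sub>R \<phi> (y + (w, h)))"
      have "I - conv (slice_measure h R) \<phi> y = (LINT w|lborel. poisson h w *\<^sub>R \<phi> (y + (w, h)) - (poisson h w * indicator (cball 0 R) w) *\<^sub>R \<phi> (y + (w, h)))"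
        unfolding conv_slice_measure[OF h(1) phi] I_def by (rule Bochner_Integration.integral_diff[OF i1 i2, symmetric])
      also have "\<dots> = (LINT w|lborel. (poisson h w * indicator (- cball 0 R) w) *\<^sub>R \<phi> (y + (w, h)))"
        by (rule Bochner_Integration.integral_cong) (auto simp: indicator_def)
      finally have "cmod (I - conv (slice_measure h R) \<phi> y) = cmod (LINT w|lborel. (poisson h w * indicator (- cball 0 R) w) *\<^sub>R \<phi> (y + (w, h)))"
        by (rule arg_cong)
      also have "ennreal \<dots> \<le> (\<integral>\<^sup>+w. ennreal (norm ((poisson h w * indicator (- cball 0 R) w) *\<^sub>R \<phi> (y + (w, h)))) \<partial>lborel)"
        by (rule integral_norm_bound_ennreal) (rule Bochner_Integration.integrable_bound[OF i1], auto simp: indicator_def)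
      also have "\<dots> = E3 y" unfolding E3_def using h(1)
        by (intro nn_integral_cong) (simp add: ennreal_mult poisson_nonneg indicator_def)
      finally have 3: "ennreal (cmod (I - conv (slice_measure h R) \<phi> y)) \<le> E3 y" .
      have 1: "ennreal (cmod (I - of_real c * \<phi> y)) \<le> E1 y + E2 y"
        unfolding I_def E1_def E2_def c_def by (rule poisson_average_error[OF h(1) phi])
      have "of_real h * inverse_approx h R \<phi> y = (I - conv (slice_measure h R) \<phi> y) - (I - of_real c * \<phi> y)"
        using h(1) by (simp add: inverse_approx_def c_def)
      then have "h * cmod (inverse_approx h R \<phi> y) \<le> cmod (I - conv (slice_measure h R) \<phi> y) + cmod (I - of_real c * \<phi> y)"
        using h(1) by (metis abs_of_pos norm_mult norm_of_real norm_triangle_ineq4)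
      then have "ennreal h * ennreal (cmod (inverse_approx h R \<phi> y)) \<le> ennreal (cmod (I - conv (slice_measure h R) \<phi> y)) + ennreal (cmod (I - of_real c * \<phi> y))"
        using h(1) by (simp add: ennreal_mult[symmetric] ennreal_plus[symmetric] ennreal_leI del: ennreal_plus)
      also have "\<dots> \<le> E3 y + (E1 y + E2 y)" by (intro add_mono 1 3)
      finally show ?thesis by (simp add: add_ac)
    qed
    have e1: "(\<integral>\<^sup>+y. E1 y \<partial>lborel) \<le> ennreal (h * ((2 * ?q * A + 4) * W * m * rd))"
    proof -
      let ?K = "(2 * ?q * A + 4) * (?V * (2 * r) ^ DIM('x \<times> real))"
      have K: "?K \<ge> 0" using A r V by (intro mult_nonneg_nonneg) auto
      have "(\<integral>\<^sup>+y. E1 y \<partial>lborel) = (\<integral>\<^sup>+w. \<integral>\<^sup>+y. ennreal (poisson h w * cmod (diff2 \<phi> w (y + (0, h)))) \<partial>lborel \<partial>lborel)"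
        unfolding E1_def by (rule nn_integral_lborel_swap) measurable
      also have "\<dots> \<le> (\<integral>\<^sup>+w. ennreal ?K * ennreal (poisson h w * min ((norm w / r)\<^sup>2) 1) \<partial>(lborel :: 'x measure))"
      proof (rule nn_integral_mono)
        fix w :: 'x
        have "(\<integral>\<^sup>+y. ennreal (poisson h w * cmod (diff2 \<phi> w (y + (0, h)))) \<partial>lborel) =
          ennreal (poisson h w) * (\<integral>\<^sup>+y. ennreal (cmod (diff2 \<phi> w ((0, h) + y))) \<partial>lborel)"
          using h(1) by (subst nn_integral_cmult[symmetric]) (auto simp: ennreal_mult poisson_nonneg add.commute)
        also have "(\<integral>\<^sup>+y. ennreal (cmod (diff2 \<phi> w ((0, h) + y))) \<partial>lborel) = (\<integral>\<^sup>+y. ennreal (cmod (diff2 \<phi> w y)) \<partial>lborel)"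
          by (rule nn_integral_lborel_shift[of "\<lambda>y. ennreal (cmod (diff2 \<phi> w y))"]) measurable
        also have "ennreal (poisson h w) * \<dots> \<le> ennreal (poisson h w) * ennreal (?K * min ((norm w / r)\<^sup>2) 1)"
          by (intro mult_left_mono adapted_diff2_L1[OF ad r A]) simp
        also have "\<dots> = ennreal ?K * ennreal (poisson h w * min ((norm w / r)\<^sup>2) 1)"
        proof -
          have "poisson h w * (?K * min ((norm w / r)\<^sup>2) 1) = ?K * (poisson h w * min ((norm w / r)\<^sup>2) 1)" by (simp only: mult_ac)
          then show ?thesis using K h(1) by (simp only: ennreal_mult[symmetric] poisson_nonneg less_imp_le mult_nonneg_nonneg min.bounded_iff zero_le_one zero_le_power2)
        qed
        finally show "(\<integral>\<^sup>+y. ennreal (poisson h w * cmod (diff2 \<phi> w (y + (0, h)))) \<partial>lborel) \<le> ennreal ?K * ennreal (poisson h w * min ((norm w / r)\<^sup>2) 1)" .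
      qed
      also have "\<dots> = ennreal ?K * (\<integral>\<^sup>+w. ennreal (poisson h w * min ((norm w / r)\<^sup>2) 1) \<partial>(lborel :: 'x measure))"
        by (rule nn_integral_cmult) measurable
      also have "\<dots> \<le> ennreal ?K * ennreal (h * (m / r))"
        unfolding m_def by (intro mult_left_mono nn_integral_poisson_moment h r) simp
      also have "\<dots> = ennreal (?K * (h * (m / r)))" using K h m r by (intro ennreal_mult[symmetric]) auto
      also have "?K * (h * (m / r)) = h * ((2 * ?q * A + 4) * W * m * rd)"
        unfolding rd(2) W_def using r by (simp add: mult_ac)
      finally show ?thesis .
    qed
    have e2: "(\<integral>\<^sup>+y. E2 y \<partial>lborel) \<le> ennreal (h * (c * (?d * A) * W * rd))"
    proof -
      have "(\<integral>\<^sup>+y. E2 y \<partial>lborel) \<le> ennreal ((c * (?d * (A / r) * h)) * (?V * (2 * r) ^ DIM('x \<times> real)))"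
        unfolding E2_def
      proof (rule nn_integral_le_ball[of _ _ _ a])
        fix y :: "'x \<times> real"
        have "cmod (\<phi> (y + (0, h)) - \<phi> y) \<le> ?d * (A / r) * norm ((y + (0, h)) - y)"
          by (rule smooth_lipschitz[OF test_funs_smooth[OF phi] b2])
        then show "c * cmod (\<phi> (y + (0, h)) - \<phi> y) \<le> c * (?d * (A / r) * h)"
          using h(1) c by (intro mult_left_mono) (auto simp: norm_Pair)
        \<comment> \<open>The condition \<open>h \<le> r\<close> keeps the time-shifted support
          inside the doubled ball.\<close>
        assume y: "2 * r < dist a y"
        have "dist a y \<le> dist a (y + (0, h)) + norm (0 :: 'x, h)"
          using dist_triangle[of a y "y + (0, h)"] by (simp add: dist_norm)
        then have "r < dist a (y + (0, h))" "r < dist a y" using y h r by (auto simp: norm_Pair)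
        then show "c * cmod (\<phi> (y + (0, h)) - \<phi> y) \<le> 0" by (simp add: supp)
      qed (use c A r h in auto)
      also have "(c * (?d * (A / r) * h)) * (?V * (2 * r) ^ DIM('x \<times> real)) = h * (c * (?d * A) * W * rd)"
        unfolding rd(2) W_def using r by (simp add: field_simps)
      finally show ?thesis .
    qed
    have e3: "(\<integral>\<^sup>+y. E3 y \<partial>lborel) \<le> ennreal (h\<^sup>2) * (\<integral>\<^sup>+y. ennreal (cmod (\<phi> y)) \<partial>lborel)"
    proof -
      have "(\<integral>\<^sup>+y. E3 y \<partial>lborel) = (\<integral>\<^sup>+w. \<integral>\<^sup>+y. ennreal (poisson h w * indicator (- cball 0 R) w) * ennreal (cmod (\<phi> (y + (w, h)))) \<partial>lborel \<partial>lborel)"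
        unfolding E3_def by (rule nn_integral_lborel_swap) measurable
      also have "\<dots> = (\<integral>\<^sup>+w. ennreal (poisson h w * indicator (- cball 0 R) w) * (\<integral>\<^sup>+y. ennreal (cmod (\<phi> y)) \<partial>lborel) \<partial>(lborel :: 'x measure))"
      proof (rule nn_integral_cong)
        fix w :: 'x
        have "(\<integral>\<^sup>+y. ennreal (cmod (\<phi> ((w, h) + y))) \<partial>lborel) = (\<integral>\<^sup>+y. ennreal (cmod (\<phi> y)) \<partial>lborel)"
          by (rule nn_integral_lborel_shift[of "\<lambda>y. ennreal (cmod (\<phi> y))"]) measurable
        then show "(\<integral>\<^sup>+y. ennreal (poisson h w * indicator (- cball 0 R) w) * ennreal (cmod (\<phi> (y + (w, h)))) \<partial>lborel) =
          ennreal (poisson h w * indicator (- cball 0 R) w) * (\<integral>\<^sup>+y. ennreal (cmod (\<phi> y)) \<partial>lborel)"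
          by (simp add: nn_integral_cmult add.commute)
      qed
      also have "\<dots> = (\<integral>\<^sup>+w. ennreal (poisson h w * indicator (- cball 0 R) w) \<partial>(lborel :: 'x measure)) * (\<integral>\<^sup>+y. ennreal (cmod (\<phi> y)) \<partial>lborel)"
        by (rule nn_integral_multc) measurable
      also have "\<dots> \<le> ennreal (h\<^sup>2) * (\<integral>\<^sup>+y. ennreal (cmod (\<phi> y)) \<partial>lborel)" by (rule mult_right_mono[OF tail]) simp
      finally show ?thesis .
    qed
    let ?L = "\<integral>\<^sup>+y. ennreal (cmod (\<phi> y)) \<partial>lborel"
    have "ennreal h * (\<integral>\<^sup>+y. ennreal (cmod (inverse_approx h R \<phi> y)) \<partial>lborel) = (\<integral>\<^sup>+y. ennreal h * ennreal (cmod (inverse_approx h R \<phi> y)) \<partial>lborel)"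
      by (rule nn_integral_cmult[symmetric]) measurable
    also have "\<dots> \<le> (\<integral>\<^sup>+y. E1 y + E2 y + E3 y \<partial>lborel)" by (intro nn_integral_mono pt)
    also have "\<dots> = (\<integral>\<^sup>+y. E1 y \<partial>lborel) + (\<integral>\<^sup>+y. E2 y \<partial>lborel) + (\<integral>\<^sup>+y. E3 y \<partial>lborel)"
      by (simp add: nn_integral_add)
    also have "\<dots> \<le> ennreal (h * ((2 * ?q * A + 4) * W * m * rd)) + ennreal (h * (c * (?d * A) * W * rd)) + ennreal (h\<^sup>2) * ?L"
      by (intro add_mono e1 e2 e3)
    also have "\<dots> = ennreal (h * (C * rd)) + ennreal (h\<^sup>2) * ?L"
      using A W m c h rd by (subst ennreal_plus[symmetric]) (auto simp: C_def algebra_simps)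
    also have "\<dots> = ennreal h * (ennreal (C * rd) + ennreal h * ?L)"
      using h(1) \<open>C \<ge> 0\<close> rd(1) by (simp add: ennreal_mult distrib_left power2_eq_square mult.assoc)
    finally have "ennreal h * (\<integral>\<^sup>+y. ennreal (cmod (inverse_approx h R \<phi> y)) \<partial>lborel) \<le> ennreal h * (ennreal (C * rd) + ennreal h * ?L)" .
    then have "ennreal (1 / h) * (ennreal h * (\<integral>\<^sup>+y. ennreal (cmod (inverse_approx h R \<phi> y)) \<partial>lborel)) \<le> ennreal (1 / h) * (ennreal h * (ennreal (C * rd) + ennreal h * ?L))"
      by (rule mult_left_mono) simp
    then show "(\<integral>\<^sup>+y. ennreal (cmod (inverse_approx h R \<phi> y)) \<partial>lborel) \<le> ennreal (C * r ^ DIM('x)) + ennreal h * ?L"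
      using h(1) by (simp add: mult.assoc[symmetric] ennreal_mult[symmetric] rd_def)
  qed
qed

text \<open>The premise on \<open>T\<close> is the dual form of a potential bounded by 1. It is
  applied to the approximate inverses of \<open>\<phi>\<close>, whose L1 norms are uniformly of
  order \<open>r ^ N\<close>, while their potentials converge to \<open>c\<^sup>2 * \<phi>\<close>
  with all derivatives. Division by \<open>c\<^sup>2\<close> makes up for the unnormalised
  kernel.\<close>

theorem distribution_adapted_bound:
  assumes A: "A \<ge> 0"
  obtains C where "C \<ge> 0" "\<And>T \<eta> a r. \<And>\<phi> :: 'x::euclidean_space \<times> real \<Rightarrow> complex. distribution T \<Longrightarrow> \<eta> \<in> test_funs \<Longrightarrow>
    (\<And>\<psi>. \<psi> \<in> test_funs \<Longrightarrow> ennreal (cmod (T (\<lambda>x. \<eta> x * conv kernel_measure \<psi> x))) \<le> (\<integral>\<^sup>+y. ennreal (cmod (\<psi> y)) \<partial>lborel)) \<Longrightarrow>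
    r > 0 \<Longrightarrow> adapted A a r \<phi> \<Longrightarrow> cmod (T (\<lambda>x. \<eta> x * \<phi> x)) \<le> C * r ^ DIM('x)"
proof -
  define c where "c = poisson_mass TYPE('x)"
  have c: "c > 0" unfolding c_def by (rule poisson_mass_pos)
  obtain C where C: "C \<ge> 0" "\<And>\<phi> :: 'x \<times> real \<Rightarrow> complex. \<And>a r h R. adapted A a r \<phi> \<Longrightarrow> r > 0 \<Longrightarrow> 0 < h \<Longrightarrow> h \<le> r \<Longrightarrow> tail_small TYPE('x) h R \<Longrightarrow>
    (\<integral>\<^sup>+y. ennreal (cmod (inverse_approx h R \<phi> y)) \<partial>lborel) \<le> ennreal (C * r ^ DIM('x)) + ennreal h * (\<integral>\<^sup>+y. ennreal (cmod (\<phi> y)) \<partial>lborel)"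
    using inverse_approx_L1[OF A, where 'x='x] by blast
  show ?thesis
  proof (rule that[of "C / c\<^sup>2"])
    show "C / c\<^sup>2 \<ge> 0" using C by simp
    fix T :: "('x \<times> real \<Rightarrow> complex) \<Rightarrow> complex" and \<eta> \<phi> :: "'x \<times> real \<Rightarrow> complex" and a r
    assume T: "distribution T" and eta: "\<eta> \<in> test_funs" and r: "r > 0" and ad: "adapted A a r \<phi>"
      and bound: "\<And>\<psi>. \<psi> \<in> test_funs \<Longrightarrow> ennreal (cmod (T (\<lambda>x. \<eta> x * conv kernel_measure \<psi> x))) \<le> (\<integral>\<^sup>+y. ennreal (cmod (\<psi> y)) \<partial>lborel)"
    have phi: "\<phi> \<in> test_funs" using ad by (simp add: adapted_def)
    define h where "h n = r / real (Suc n)" for n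
    have h: "h n > 0" "h n \<le> r" for n using r by (auto simp: h_def field_simps)
    have h0: "h \<longlonglongrightarrow> 0" unfolding h_def using LIMSEQ_inverse_real_of_nat
      by (auto intro!: tendsto_mult_right_zero simp: divide_inverse)
    have "\<exists>R. tail_small TYPE('x) (h n) R" for n
      using poisson_tail[OF h(1)[of n], of "(h n)\<^sup>2"] h(1)[of n] by (metis zero_less_power)
    then obtain R where R: "\<And>n. tail_small TYPE('x) (h n) (R n)" by metis
    define g where "g n = inverse_approx (h n) (R n) \<phi>" for n
    define u where "u n = conv kernel_measure (g n)" for n
    have g: "g n \<in> test_funs" for n unfolding g_def by (rule inverse_approx_test_funs[OF h(1) phi])
    have us: "smooth (u n)" for n unfolding u_def by (rule smooth_conv[OF loc_finite_kernel_measure g])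
    have vs: "smooth (\<lambda>x. of_real (c\<^sup>2) * \<phi> x)" by (intro smooth_cmult test_funs_smooth phi)
    have null: "unif_null (\<lambda>n x. u n x - of_real (c\<^sup>2) * \<phi> x)"
      unfolding unif_null_def
    proof (intro conjI allI impI)
      show "smooth (\<lambda>x. u n x - of_real (c\<^sup>2) * \<phi> x)" for n by (rule smooth_diff[OF us vs])
      fix ws :: "('x \<times> real) list" and e :: real assume ws: "set ws \<subseteq> Basis" and e: "e > 0"
      have phi': "iter_deriv ws \<phi> \<in> test_funs" by (rule iter_deriv_test_funs[OF phi ws])
      obtain D where D: "\<And>h R y. h > 0 \<Longrightarrow> tail_small TYPE('x) h R \<Longrightarrow>
        cmod (conv kernel_measure (inverse_approx h R (iter_deriv ws \<phi>)) y - of_real (c\<^sup>2) * iter_deriv ws \<phi> y) \<le> D * h"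
        unfolding c_def using conv_inverse_approx_close[OF phi'] by blast
      have eq: "iter_deriv ws (\<lambda>x. u n x - of_real (c\<^sup>2) * \<phi> x) x =
        conv kernel_measure (inverse_approx (h n) (R n) (iter_deriv ws \<phi>)) x - of_real (c\<^sup>2) * iter_deriv ws \<phi> x" for n x
        unfolding iter_deriv_diff[OF us vs ws] iter_deriv_cmult[OF test_funs_smooth[OF phi] ws]
        unfolding u_def iter_deriv_conv[OF loc_finite_kernel_measure g ws]
        unfolding g_def iter_deriv_inverse_approx[OF h(1) phi ws] ..
      have "(\<lambda>n. D * h n) \<longlonglongrightarrow> D * 0" by (intro tendsto_mult_left h0)
      then have "\<forall>\<^sub>F n in sequentially. D * h n < e" using e by (intro order_tendstoD) auto
      then show "\<forall>\<^sub>F n in sequentially. \<forall>x. cmod (iter_deriv ws (\<lambda>x. u n x - of_real (c\<^sup>2) * \<phi> x) x) \<le> e"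
      proof (rule eventually_mono, intro allI)
        fix n and x :: "'x \<times> real" assume "D * h n < e"
        then show "cmod (iter_deriv ws (\<lambda>x. u n x - of_real (c\<^sup>2) * \<phi> x) x) \<le> e"
          unfolding eq using D[OF h(1) R, of n x] by linarith
      qed
    qed
    have lim: "(\<lambda>n. T (\<lambda>x. \<eta> x * u n x)) \<longlonglongrightarrow> T (\<lambda>x. \<eta> x * (of_real (c\<^sup>2) * \<phi> x))"
      by (rule distribution_limit[OF T eta us vs null])
    obtain L where L: "L \<ge> 0" "(\<integral>\<^sup>+y. ennreal (cmod (\<phi> y)) \<partial>lborel) \<le> ennreal L"
    proof -
      have "(\<integral>\<^sup>+y. ennreal (cmod (\<phi> y)) \<partial>lborel) \<le> ennreal (1 * (unit_ball_vol DIM('x \<times> real) * r ^ DIM('x \<times> real)))"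
        by (rule nn_integral_le_ball[of _ _ _ a]) (use ad r in \<open>auto simp: adapted_def\<close>)
      then show ?thesis by (rule that[rotated]) (use r in auto)
    qed
    have le: "cmod (T (\<lambda>x. \<eta> x * u n x)) \<le> C * r ^ DIM('x) + h n * L" for n
    proof -
      have "ennreal (cmod (T (\<lambda>x. \<eta> x * u n x))) \<le> (\<integral>\<^sup>+y. ennreal (cmod (g n y)) \<partial>lborel)"
        unfolding u_def by (rule bound[OF g])
      also have "\<dots> \<le> ennreal (C * r ^ DIM('x)) + ennreal (h n) * (\<integral>\<^sup>+y. ennreal (cmod (\<phi> y)) \<partial>lborel)"
        unfolding g_def by (rule C(2)[OF ad r h R])
      also have "\<dots> \<le> ennreal (C * r ^ DIM('x)) + ennreal (h n) * ennreal L" by (intro add_left_mono mult_left_mono L) simp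
      also have "\<dots> = ennreal (C * r ^ DIM('x) + h n * L)"
        using C r L less_imp_le[OF h(1)[of n]] by (simp add: ennreal_mult[symmetric] ennreal_plus[symmetric] del: ennreal_plus)
      finally show ?thesis using C r L less_imp_le[OF h(1)[of n]] by (subst (asm) ennreal_le_iff) auto
    qed
    have "(\<lambda>n. C * r ^ DIM('x) + h n * L) \<longlonglongrightarrow> C * r ^ DIM('x) + 0 * L" by (intro tendsto_intros h0)
    then have "cmod (T (\<lambda>x. \<eta> x * (of_real (c\<^sup>2) * \<phi> x))) \<le> C * r ^ DIM('x) + 0 * L"
      by (rule LIMSEQ_le[OF tendsto_norm[OF lim]]) (use le in auto)
    moreover have "T (\<lambda>x. \<eta> x * (of_real (c\<^sup>2) * \<phi> x)) = of_real (c\<^sup>2) * T (\<lambda>x. \<eta> x * \<phi> x)"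
      using distribution_cmult[OF T test_funs_mult_left[OF eta test_funs_smooth[OF phi]], of "of_real (c\<^sup>2)"]
      by (simp add: mult_ac)
    ultimately have "c\<^sup>2 * cmod (T (\<lambda>x. \<eta> x * \<phi> x)) \<le> C * r ^ DIM('x)" by (simp add: norm_mult norm_power)
    then show "cmod (T (\<lambda>x. \<eta> x * \<phi> x)) \<le> C / c\<^sup>2 * r ^ DIM('x)" using c by (simp add: field_simps)
  qed
qed

section \<open>A partition of unity adapted to a cover\<close>

text \<open>The step is not compactly supported, but its derivative is; this bounds the derivatives
  of the step.\<close>

lemma step_deriv_test_funs: "iter_deriv [1] (\<lambda>t. complex_of_real (smooth_step t)) \<in> test_funs"
proof (rule test_funsI[of _ "{0..1}"])
  show "smooth (iter_deriv [1] (\<lambda>t. complex_of_real (smooth_step t)))"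
    by (rule smooth_iter_deriv[OF smooth_smooth_step]) auto
  fix t :: real assume "t \<notin> {0..1}"
  then consider "t < 0" | "t > 1" by force
  then have "((\<lambda>t. complex_of_real (smooth_step t)) has_derivative (\<lambda>_. 0)) (at t)"
  proof cases
    case 1
    have "((\<lambda>_. 0::complex) has_derivative (\<lambda>_. 0)) (at t)" by (rule has_derivative_const)
    then show ?thesis
      by (rule has_derivative_transform_within_open[of _ _ _ _ "{..<0}"]) (use 1 in \<open>auto simp: smooth_step_0\<close>)
  next
    case 2
    have "((\<lambda>_. 1::complex) has_derivative (\<lambda>_. 0)) (at t)" by (rule has_derivative_const)
    then show ?thesis
      by (rule has_derivative_transform_within_open[of _ _ _ _ "{1<..}"]) (use 2 in \<open>auto simp: smooth_step_1\<close>)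
  qed
  from frechet_derivative_at[OF this] show "iter_deriv [1] (\<lambda>t. complex_of_real (smooth_step t)) t = 0"
    by (metis iter_deriv.simps)
qed auto

definition lattice :: "'a::euclidean_space set" where
  "lattice = {z. \<forall>i\<in>Basis. z \<bullet> i \<in> \<int>}"

lemma lattice_near:
  fixes x :: "'a::euclidean_space"
  obtains z where "z \<in> lattice" "norm (x - z) \<le> DIM('a)"
proof -
  define z where "z = (\<Sum>i\<in>Basis. of_int \<lfloor>x \<bullet> i\<rfloor> *\<^sub>R i :: 'a)"
  have zi: "z \<bullet> i = of_int \<lfloor>x \<bullet> i\<rfloor>" if "i \<in> Basis" for i using that by (simp add: z_def)
  have "norm (x - z) \<le> (\<Sum>i\<in>Basis. \<bar>(x - z) \<bullet> i\<bar>)" by (rule norm_le_l1)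
  also have "\<dots> \<le> (\<Sum>i\<in>(Basis::'a set). 1)"
  proof (rule sum_mono)
    fix i :: 'a assume "i \<in> Basis"
    then have "(x - z) \<bullet> i = x \<bullet> i - of_int \<lfloor>x \<bullet> i\<rfloor>" by (simp add: inner_diff_left zi)
    then show "\<bar>(x - z) \<bullet> i\<bar> \<le> 1" by linarith
  qed
  finally show ?thesis using that[of z] by (simp add: lattice_def zi)
qed

text \<open>Lattice points are told apart by their integer offsets from the rounded coordinates of
  \<open>x\<close>. Rounding costs one unit, so each offset is one of the \<open>2 * L + 3\<close>
  integers of modulus at most \<open>L + 1\<close>.\<close>

lemma card_lattice_ball:
  fixes x :: "'a::euclidean_space" and L :: nat
  assumes "finite Z" "Z \<subseteq> lattice" "\<And>z. z \<in> Z \<Longrightarrow> norm (x - z) \<le> L"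
  shows "card Z \<le> (2 * L + 3) ^ DIM('a)"
proof -
  let ?f = "\<lambda>z. \<lambda>i\<in>(Basis::'a set). \<lfloor>z \<bullet> i\<rfloor> - \<lfloor>x \<bullet> i\<rfloor>"
  have inj: "inj_on ?f Z"
  proof (rule inj_onI)
    fix z w assume zw: "z \<in> Z" "w \<in> Z" "?f z = ?f w"
    show "z = w"
    proof (rule euclidean_eqI)
      fix i :: 'a assume i: "i \<in> Basis"
      have "?f z i = ?f w i" using zw(3) by (rule fun_cong)
      then have "\<lfloor>z \<bullet> i\<rfloor> = \<lfloor>w \<bullet> i\<rfloor>" using i by simp
      moreover have "z \<bullet> i \<in> \<int>" "w \<bullet> i \<in> \<int>" using zw(1,2) assms(2) i by (auto simp: lattice_def)
      ultimately show "z \<bullet> i = w \<bullet> i" by (metis Ints_cases floor_of_int)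
    qed
  qed
  have "?f ` Z \<subseteq> (Basis::'a set) \<rightarrow>\<^sub>E {- int (L + 1)..int (L + 1)}"
  proof (rule image_subsetI)
    fix z assume z: "z \<in> Z"
    have "\<lfloor>z \<bullet> i\<rfloor> - \<lfloor>x \<bullet> i\<rfloor> \<in> {- int (L + 1)..int (L + 1)}" if i: "i \<in> Basis" for i
    proof -
      have "\<bar>x \<bullet> i - z \<bullet> i\<bar> \<le> L" using Basis_le_norm[OF i, of "x - z"] assms(3)[OF z] by (simp add: inner_diff_left)
      then show ?thesis by (simp, linarith)
    qed
    then show "?f z \<in> (Basis::'a set) \<rightarrow>\<^sub>E {- int (L + 1)..int (L + 1)}" by auto
  qed
  moreover have "finite ((Basis::'a set) \<rightarrow>\<^sub>E {- int (L + 1)..int (L + 1)})" by (intro finite_PiE) auto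
  ultimately have "card (?f ` Z) \<le> card ((Basis::'a set) \<rightarrow>\<^sub>E {- int (L + 1)..int (L + 1)})" by (intro card_mono)
  also have "card {- int (L + 1)..int (L + 1)} = 2 * L + 3" by (subst card_atLeastAtMost_int, linarith)
  then have "card ((Basis::'a set) \<rightarrow>\<^sub>E {- int (L + 1)..int (L + 1)}) = (2 * L + 3) ^ DIM('a)"
    by (simp only: card_PiE[OF finite_Basis] prod_constant)
  finally show ?thesis using card_image[OF inj] by simp
qed

lemma sum_powi_le:
  fixes I :: "int set"
  assumes "finite I" "\<And>k. k \<in> I \<Longrightarrow> k \<le> K"
  shows "(\<Sum>k\<in>I. (2::real) powi k) \<le> 2 * 2 powi K"
proof -
  have "(\<Sum>k\<in>I. (2::real) powi k) = (\<Sum>n\<in>(\<lambda>k. nat (K - k)) ` I. 2 powi K * (1/2) ^ n)"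
  proof (subst sum.reindex)
    show "inj_on (\<lambda>k. nat (K - k)) I"
    proof (rule inj_onI)
      fix k l assume "k \<in> I" "l \<in> I" "nat (K - k) = nat (K - l)"
      then show "k = l" using assms(2)[of k] assms(2)[of l] by linarith
    qed
    show "(\<Sum>k\<in>I. (2::real) powi k) = sum ((\<lambda>n. 2 powi K * (1/2) ^ n) \<circ> (\<lambda>k. nat (K - k))) I"
    proof (rule sum.cong)
      fix k assume "k \<in> I"
      then have "(2::real) ^ nat (K - k) = 2 powi (K - k)" using assms(2) by (simp add: power_int_def)
      moreover have "(2::real) powi K = 2 powi (K - k) * 2 powi k" by (simp flip: power_int_add)
      ultimately show "(2::real) powi k = ((\<lambda>n. 2 powi K * (1/2) ^ n) \<circ> (\<lambda>k. nat (K - k))) k"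
        by (simp add: power_divide)
    qed simp
  qed
  also have "\<dots> \<le> (\<Sum>n. 2 powi K * (1/2) ^ n)"
    using assms(1) by (intro sum_le_suminf summable_mult summable_geometric) auto
  also have "\<dots> = 2 powi K * 2" by (subst suminf_mult) (auto intro: summable_geometric simp: suminf_geometric)
  finally show ?thesis by simp
qed

text \<open>A pair \<open>q = (k, z)\<close> stands for a ball with centre
  \<open>2 powi (- k)\<close> times \<open>z\<close> and radius of order
  \<open>2 powi (- k)\<close>; this map brings it to the origin at unit scale.\<close>

abbreviation scaled :: "int \<times> 'a::euclidean_space \<Rightarrow> 'a \<Rightarrow> 'a" where
  "scaled q x \<equiv> (2 powi fst q) *\<^sub>R x + (- snd q)"

text \<open>A point may lie in balls of arbitrarily many scales, so there is no bounded overlap. But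
  at each scale boundedly many lattice points are near it, and the geometric sum over the scales is
  dominated by the finest one.\<close>

lemma sum_lattice_powi_le:
  fixes P :: "(int \<times> 'a::euclidean_space) set" and L :: nat
  assumes P: "finite P" "snd ` P \<subseteq> lattice" "\<And>q. q \<in> P \<Longrightarrow> fst q \<le> K"
    and near: "\<And>q. q \<in> P \<Longrightarrow> norm (scaled q x) \<le> L"
  shows "(\<Sum>q\<in>P. (2::real) powi fst q) \<le> 2 * (2 * L + 3) ^ DIM('a) * 2 powi K"
proof -
  let ?M = "(2 * L + 3) ^ DIM('a)"
  have "(\<Sum>q\<in>P. (2::real) powi fst q) = (\<Sum>k\<in>fst ` P. \<Sum>q\<in>{q\<in>P. fst q = k}. 2 powi fst q)"
    by (rule sum.image_gen[OF P(1)])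
  also have "\<dots> \<le> (\<Sum>k\<in>fst ` P. real ?M * 2 powi k)"
  proof (rule sum_mono)
    fix k
    have "card {q\<in>P. fst q = k} = card (snd ` {q\<in>P. fst q = k})"
      by (rule card_image[symmetric]) (auto intro!: inj_onI simp: prod_eq_iff)
    also have "\<dots> \<le> ?M"
    proof (rule card_lattice_ball[where x="(2 powi k) *\<^sub>R x"])
      show "finite (snd ` {q\<in>P. fst q = k})" using P by auto
      show "snd ` {q\<in>P. fst q = k} \<subseteq> lattice" using P by auto
      fix z assume "z \<in> snd ` {q\<in>P. fst q = k}"
      then show "norm ((2 powi k) *\<^sub>R x - z) \<le> L" using near by auto
    qed
    finally have "real (card {q\<in>P. fst q = k}) \<le> real ?M" by (simp only: of_nat_le_iff)
    moreover have "(\<Sum>q\<in>{q\<in>P. fst q = k}. (2::real) powi fst q) = real (card {q\<in>P. fst q = k}) * 2 powi k" by simp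
    ultimately show "(\<Sum>q\<in>{q\<in>P. fst q = k}. (2::real) powi fst q) \<le> real ?M * 2 powi k"
      by (simp add: mult_right_mono)
  qed
  also have "\<dots> = real ?M * (\<Sum>k\<in>fst ` P. 2 powi k)" by (simp add: sum_distrib_left)
  also have "\<dots> \<le> real ?M * (2 * 2 powi K)"
    using P by (intro mult_left_mono sum_powi_le) auto
  finally show ?thesis by (simp add: mult_ac)
qed

text \<open>\<open>DIM('a)\<close> for the distance to a lattice point, 1 for the rescaled diameter
  of a covering set, and 1 more to make the inclusion strict.\<close>

definition bump_radius :: "'a::euclidean_space itself \<Rightarrow> nat" where
  "bump_radius _ = DIM('a) + 2"

definition unit_bump :: "'a::euclidean_space \<Rightarrow> complex" where
  "unit_bump = cutoff 0 (bump_radius TYPE('a))"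

lemma unit_bump_test_funs: "unit_bump \<in> test_funs"
  unfolding unit_bump_def by (rule cutoff_test_funs) (simp add: bump_radius_def)

lemma unit_bump_1: "norm (x::'a::euclidean_space) \<le> bump_radius TYPE('a) \<Longrightarrow> unit_bump x = 1"
  and unit_bump_0: "norm (x::'a::euclidean_space) \<ge> 2 * bump_radius TYPE('a) \<Longrightarrow> unit_bump x = 0"
  unfolding unit_bump_def by (intro cutoff_1 cutoff_0; simp add: bump_radius_def)+

lemma unit_bump_real: "unit_bump x = of_real (Re (unit_bump x))" "Re (unit_bump x) \<ge> 0"
  by (simp_all add: unit_bump_def cutoff_def ball_cutoff_nonneg)

lemma iter_deriv_sum:
  assumes "\<And>i. i \<in> I \<Longrightarrow> smooth (f i)" "set vs \<subseteq> Basis" "finite I"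
  shows "iter_deriv vs (\<lambda>x. \<Sum>i\<in>I. f i x) = (\<lambda>x. \<Sum>i\<in>I. iter_deriv vs (f i) x)"
  using assms(3,1)
proof (induction I)
  case empty
  then show ?case using iter_deriv_cmult[OF smooth_const assms(2), of 0 0] by simp
next
  case (insert i I)
  then have "iter_deriv vs (\<lambda>x. f i x + (\<Sum>i\<in>I. f i x)) = (\<lambda>x. iter_deriv vs (f i) x + iter_deriv vs (\<lambda>x. \<Sum>i\<in>I. f i x) x)"
    by (intro iter_deriv_add smooth_sum assms(2)) auto
  then show ?case using insert by simp
qed

text \<open>The balls are ordered from large to small, \<open>S j\<close> is the sum of the first
  \<open>j\<close> bumps, and the functions are the increments of \<open>smooth_step (S j)\<close>.
  They telescope to 1 wherever the full sum is at least 1. An increment is supported in its own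
  ball, and its derivatives involve only balls at least as large, so the geometric sum bounds them
  by the scale of that ball.\<close>

lemma partition_of_unity_lattice:
  obtains A :: real where "A \<ge> 0"
    "\<And>Q :: (int \<times> 'a::euclidean_space) set. finite Q \<Longrightarrow> snd ` Q \<subseteq> lattice \<Longrightarrow>
      \<exists>\<phi>. (\<forall>q\<in>Q. adapted A ((2 powi (- fst q)) *\<^sub>R snd q) (2 * real (bump_radius TYPE('a)) * 2 powi (- fst q)) (\<phi> q)) \<and>
        (\<forall>x. (\<exists>q\<in>Q. norm (scaled q x) \<le> bump_radius TYPE('a)) \<longrightarrow> (\<Sum>q\<in>Q. \<phi> q x) = 1)"
proof -
  let ?\<rho> = "real (bump_radius TYPE('a))"
  let ?F = "\<lambda>t. complex_of_real (smooth_step t)"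
  have rho: "?\<rho> > 0" by (simp add: bump_radius_def)
  obtain B where B: "B > 0" "\<And>vs x. set vs \<subseteq> Basis \<Longrightarrow> length vs \<le> 2 \<Longrightarrow> cmod (iter_deriv vs (unit_bump :: 'a \<Rightarrow> complex) x) \<le> B"
    using test_funs_iter_bounded[OF unit_bump_test_funs, of 2] by metis
  obtain G where G: "G > 0" "\<And>vs x. set vs \<subseteq> Basis \<Longrightarrow> length vs \<le> 1 \<Longrightarrow> cmod (iter_deriv vs (iter_deriv [1] ?F) x) \<le> G"
    using test_funs_iter_bounded[OF step_deriv_test_funs, of 1] by metis
  \<comment> \<open>The constant of \<open>sum_lattice_powi_le\<close> for
    \<open>L = 2 * bump_radius\<close>, the radius outside which \<open>unit_bump\<close>
    vanishes.\<close>
  define M where "M = 2 * (2 * real (2 * bump_radius TYPE('a)) + 3) ^ DIM('a)"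
  have M: "M > 0" by (simp add: M_def add_nonneg_pos)
  \<comment> \<open>\<open>A1\<close> and \<open>A2\<close> bound the first and second derivatives
    of an increment in units of the scale; the factor 2 comes from the two terms of the difference.
    \<open>A\<close> converts these bounds to the radius
    \<open>2 * ?\<rho> * 2 powi (- K)\<close>.\<close>
  define A1 where "A1 = 2 * (G * (B * M))"
  define A2 where "A2 = 2 * (G * (B * M)\<^sup>2 + G * (B * M))"
  define A where "A = A1 * (2 * ?\<rho>) + A2 * (2 * ?\<rho>)\<^sup>2"
  have A1: "A1 > 0" and A2: "A2 > 0" using G B M by (auto simp: A1_def A2_def intro!: add_pos_pos)
  show ?thesis
  proof (rule that[of A])
    show "A \<ge> 0" using A1 A2 rho by (simp add: A_def)
    fix Q :: "(int \<times> 'a) set" assume Q: "finite Q" "snd ` Q \<subseteq> lattice"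
    obtain qs0 where qs0: "set qs0 = Q" "distinct qs0" using finite_distinct_list[OF Q(1)] by blast
    \<comment> \<open>Increasing \<open>fst\<close> means decreasing radius.\<close>
    define qs where "qs = sort_key fst qs0"
    have qs: "set qs = Q" "distinct qs" "sorted (map fst qs)" using qs0 by (simp_all add: qs_def)
    define n where "n = length qs"
    define S where "S j x = (\<Sum>i<j. Re (unit_bump (scaled (qs ! i) x)))" for j x
    define f where "f i x = unit_bump (scaled (qs ! i) x)" for i and x :: 'a
    have sb: "smooth (unit_bump :: 'a \<Rightarrow> complex)" by (rule test_funs_smooth[OF unit_bump_test_funs])
    have fs: "smooth (f i)" for i unfolding f_def by (rule smooth_affine[OF sb])
    have cS: "(\<lambda>x. complex_of_real (S j x)) = (\<lambda>x. \<Sum>i<j. f i x)" for j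
      unfolding S_def f_def of_real_sum unit_bump_real(1)[symmetric] ..
    have Ss: "smooth (\<lambda>x. complex_of_real (S j x))" for j unfolding cS by (intro smooth_sum fs)
    have fd: "iter_deriv vs (f i) x = of_real ((2 powi fst (qs ! i)) ^ length vs) * iter_deriv vs unit_bump (scaled (qs ! i) x)"
      if "set vs \<subseteq> Basis" for vs i x
      using iter_deriv_affine[OF sb, of vs "2 powi fst (qs ! i)" "- snd (qs ! i)"] that unfolding f_def by metis
    have sum1: "(\<Sum>i\<in>{i. i < j \<and> norm (scaled (qs ! i) x) \<le> 2 * ?\<rho>}. (2::real) powi fst (qs ! i)) \<le> M * 2 powi K"
      if j: "j \<le> n" and K: "\<And>i. i < j \<Longrightarrow> fst (qs ! i) \<le> K" for j x K
    proof -
      let ?I = "{i. i < j \<and> norm (scaled (qs ! i) x) \<le> 2 * ?\<rho>}"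
      have inj: "inj_on ((!) qs) ?I" using qs(2) j by (intro inj_on_nth) (auto simp: n_def)
      have "(\<Sum>i\<in>?I. (2::real) powi fst (qs ! i)) = (\<Sum>q\<in>(!) qs ` ?I. 2 powi fst q)"
        using sum.reindex[OF inj, of "\<lambda>q. (2::real) powi fst q"] by simp
      also have "\<dots> \<le> 2 * real (2 * (2 * bump_radius TYPE('a)) + 3) ^ DIM('a) * 2 powi K"
      proof (rule order_trans[OF sum_lattice_powi_le[where K=K and x=x and L="2 * bump_radius TYPE('a)"]])
        show "finite ((!) qs ` ?I)" by simp
        show "snd ` (!) qs ` ?I \<subseteq> lattice" using Q(2) qs(1) j by (force simp: n_def)
      qed (use K in auto)
      finally show ?thesis by (simp add: M_def)
    qed
    have fzero: "iter_deriv vs (f i) x = 0" if "set vs \<subseteq> Basis" "\<not> norm (scaled (qs ! i) x) \<le> 2 * ?\<rho>" for vs i x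
    proof -
      have "fun_supp (unit_bump :: 'a \<Rightarrow> complex) \<subseteq> cball 0 (2 * ?\<rho>)"
        by (rule fun_supp_subset_closed) (auto intro: unit_bump_0)
      then have "scaled (qs ! i) x \<notin> fun_supp (iter_deriv vs unit_bump)"
        using that(2) fun_supp_iter_deriv[of vs "unit_bump :: 'a \<Rightarrow> complex"] by auto
      then show ?thesis using fd[OF that(1)] fun_supp_zero by simp
    qed
    have Sd: "cmod (iter_deriv vs (\<lambda>x. complex_of_real (S j x)) x) \<le> (B * M) * (2 powi K) ^ length vs"
      if vs: "set vs \<subseteq> Basis" "length vs \<in> {1, 2}" and j: "j \<le> n" and K: "\<And>i. i < j \<Longrightarrow> fst (qs ! i) \<le> K" for vs j x K
    proof -
      let ?I = "{i. i < j \<and> norm (scaled (qs ! i) x) \<le> 2 * ?\<rho>}"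
      have "iter_deriv vs (\<lambda>x. complex_of_real (S j x)) x = (\<Sum>i<j. iter_deriv vs (f i) x)"
        unfolding cS using iter_deriv_sum[of "{..<j}" f vs] fs vs(1) by simp
      also have "\<dots> = (\<Sum>i\<in>?I. iter_deriv vs (f i) x)"
        by (rule sum.mono_neutral_right) (auto intro: fzero[OF vs(1)])
      \<comment> \<open>One factor \<open>2 powi fst (qs ! i)\<close> is kept for the geometric sum;
        only the remaining ones are replaced by the finest scale.\<close>
      also have "cmod \<dots> \<le> (\<Sum>i\<in>?I. B * (2 powi K) ^ (length vs - 1) * 2 powi fst (qs ! i))"
      proof (rule sum_norm_le)
        fix i assume i: "i \<in> ?I"
        have le: "(2::real) powi fst (qs ! i) \<le> 2 powi K" using K[of i] i by (intro power_int_increasing) auto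
        have "(2 powi fst (qs ! i) :: real) ^ length vs = (2 powi fst (qs ! i)) ^ (length vs - 1) * 2 powi fst (qs ! i)"
          using vs(2) by (auto simp: power2_eq_square)
        also have "\<dots> \<le> (2 powi K) ^ (length vs - 1) * 2 powi fst (qs ! i)"
          using le by (intro mult_right_mono power_mono) auto
        finally have "(2 powi fst (qs ! i)) ^ length vs * cmod (iter_deriv vs unit_bump (scaled (qs ! i) x)) \<le> ((2 powi K) ^ (length vs - 1) * 2 powi fst (qs ! i)) * B"
          using B vs by (intro mult_mono) auto
        then show "cmod (iter_deriv vs (f i) x) \<le> B * (2 powi K) ^ (length vs - 1) * 2 powi fst (qs ! i)"
          unfolding fd[OF vs(1)] by (simp add: norm_mult norm_power norm_power_int mult_ac)
      qed
      also have "\<dots> = B * (2 powi K) ^ (length vs - 1) * (\<Sum>i\<in>?I. 2 powi fst (qs ! i))" by (simp add: sum_distrib_left)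
      also have "\<dots> \<le> B * (2 powi K) ^ (length vs - 1) * (M * 2 powi K)"
        using B by (intro mult_left_mono sum1[OF j K]) auto
      also have "\<dots> = (B * M) * (2 powi K) ^ length vs" using vs(2) by (auto simp: power2_eq_square)
      finally show ?thesis .
    qed
    define \<Phi> where "\<Phi> j x = ?F (S j x)" for j x
    have Phis: "smooth (\<Phi> j)" for j unfolding \<Phi>_def by (rule smooth_compose[OF smooth_smooth_step Ss])
    have sF1: "smooth (iter_deriv [1] ?F)" by (rule test_funs_smooth[OF step_deriv_test_funs])
    have P1: "iter_deriv [b] (\<Phi> j) = (\<lambda>x. iter_deriv [1] ?F (S j x) * iter_deriv [b] (\<lambda>x. complex_of_real (S j x)) x)" for b j
      unfolding \<Phi>_def by (rule iter_deriv_compose[OF smooth_smooth_step Ss])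
    have P2: "iter_deriv [c, b] (\<Phi> j) = (\<lambda>x. (iter_deriv [1] (iter_deriv [1] ?F) (S j x) * iter_deriv [c] (\<lambda>x. complex_of_real (S j x)) x) *
        iter_deriv [b] (\<lambda>x. complex_of_real (S j x)) x + iter_deriv [1] ?F (S j x) * iter_deriv [c, b] (\<lambda>x. complex_of_real (S j x)) x)"
      if b: "b \<in> Basis" for c b j
    proof -
      have "iter_deriv [c, b] (\<Phi> j) = iter_deriv [c] (iter_deriv [b] (\<Phi> j))" by simp
      also have "\<dots> = (\<lambda>x. iter_deriv [c] (\<lambda>x. iter_deriv [1] ?F (S j x)) x * iter_deriv [b] (\<lambda>x. complex_of_real (S j x)) x +
         iter_deriv [1] ?F (S j x) * iter_deriv [c] (iter_deriv [b] (\<lambda>x. complex_of_real (S j x))) x)"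
        unfolding P1
      proof (rule iter_deriv_mult_Basis)
        show "smooth (\<lambda>x. iter_deriv [1] ?F (S j x))" by (rule smooth_compose[OF sF1 Ss])
        show "smooth (iter_deriv [b] (\<lambda>x. complex_of_real (S j x)))" using b by (intro smooth_iter_deriv Ss) auto
      qed
      also have "iter_deriv [c] (iter_deriv [b] (\<lambda>x. complex_of_real (S j x))) = iter_deriv [c, b] (\<lambda>x. complex_of_real (S j x))" by simp
      finally show ?thesis unfolding iter_deriv_compose[OF sF1 Ss] .
    qed
    have b1: "cmod (iter_deriv [b] (\<Phi> j) x) \<le> (G * (B * M)) * 2 powi K"
      if b: "b \<in> Basis" and j: "j \<le> n" and K: "\<And>i. i < j \<Longrightarrow> fst (qs ! i) \<le> K" for b j K x
    proof -
      have "cmod (iter_deriv [1] ?F (S j x)) * cmod (iter_deriv [b] (\<lambda>x. complex_of_real (S j x)) x) \<le> G * ((B * M) * (2 powi K) ^ length [b])"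
        using G(2)[of "[]" "S j x"] Sd[OF _ _ j K, of "[b]" x] b G(1) by (intro mult_mono) auto
      then show ?thesis unfolding P1 by (simp add: norm_mult mult_ac del: iter_deriv.simps)
    qed
    have b2: "cmod (iter_deriv [c, b] (\<Phi> j) x) \<le> (G * (B * M)\<^sup>2 + G * (B * M)) * (2 powi K)\<^sup>2"
      if b: "b \<in> Basis" "c \<in> Basis" and j: "j \<le> n" and K: "\<And>i. i < j \<Longrightarrow> fst (qs ! i) \<le> K" for b c j K x
    proof -
      define s1 where "s1 = iter_deriv [b] (\<lambda>x. complex_of_real (S j x)) x"
      define s1' where "s1' = iter_deriv [c] (\<lambda>x. complex_of_real (S j x)) x"
      define s2 where "s2 = iter_deriv [c, b] (\<lambda>x. complex_of_real (S j x)) x"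
      define g1 where "g1 = iter_deriv [1] ?F (S j x)"
      define g2 where "g2 = iter_deriv [1] (iter_deriv [1] ?F) (S j x)"
      have s: "cmod s1 \<le> (B * M) * 2 powi K" "cmod s1' \<le> (B * M) * 2 powi K" "cmod s2 \<le> (B * M) * (2 powi K)\<^sup>2"
        using Sd[OF _ _ j K, of "[b]" x] Sd[OF _ _ j K, of "[c]" x] Sd[OF _ _ j K, of "[c, b]" x] b
        by (simp_all add: s1_def s1'_def s2_def power2_eq_square del: iter_deriv.simps)
      have g: "cmod g1 \<le> G" "cmod g2 \<le> G"
        using G(2)[of "[]" "S j x"] G(2)[of "[1]" "S j x"] by (simp_all add: g1_def g2_def)
      have BM: "B * M * 2 powi K \<ge> 0" using B M by simp
      have "cmod (g2 * s1' * s1 + g1 * s2) \<le> cmod g2 * cmod s1' * cmod s1 + cmod g1 * cmod s2"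
        using norm_triangle_ineq[of "g2 * s1' * s1" "g1 * s2"] by (simp add: norm_mult)
      also have "\<dots> \<le> G * ((B * M) * 2 powi K) * ((B * M) * 2 powi K) + G * ((B * M) * (2 powi K)\<^sup>2)"
        using s g G(1) BM B(1) M by (intro add_mono mult_mono mult_nonneg_nonneg) auto
      also have "\<dots> = (G * (B * M)\<^sup>2 + G * (B * M)) * (2 powi K)\<^sup>2" by (simp add: power2_eq_square algebra_simps)
      finally show ?thesis unfolding P2[OF b(1)] by (simp only: s1_def s1'_def s2_def g1_def g2_def)
    qed
    define \<phi>' where "\<phi>' j x = \<Phi> (Suc j) x - \<Phi> j x" for j x
    have ad: "adapted A ((2 powi (- fst (qs ! j))) *\<^sub>R snd (qs ! j)) (2 * ?\<rho> * 2 powi (- fst (qs ! j))) (\<phi>' j)" if j: "j < n" for j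
    proof -
      define K where "K = fst (qs ! j)"
      define z where "z = snd (qs ! j)"
      define t where "t = (2::real) powi K"
      have t: "t > 0" "(2::real) powi (- K) = 1 / t" by (simp_all add: t_def power_int_minus divide_inverse)
      define r where "r = 2 * ?\<rho> * (1 / t)"
      have r: "r > 0" using rho t by (simp add: r_def)
      have K: "fst (qs ! i) \<le> K" if "i < Suc j" for i
        using sorted_nth_mono[OF qs(3), of i j] that j by (simp add: K_def n_def)
      have K': "fst (qs ! i) \<le> K" if "i < j" for i using K[of i] that by simp
      have sm: "smooth (\<phi>' j)" unfolding \<phi>'_def by (rule smooth_diff[OF Phis Phis])
      have zero: "\<phi>' j x = 0" if x: "r < dist ((1 / t) *\<^sub>R z) x" for x
      proof -
        have "norm (scaled (qs ! j) x) = t * dist ((1 / t) *\<^sub>R z) x"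
        proof -
          have "scaled (qs ! j) x = t *\<^sub>R (x - (1 / t) *\<^sub>R z)" using t by (simp add: t_def K_def z_def scaleR_diff_right)
          then show ?thesis using t by (simp add: dist_norm norm_minus_commute)
        qed
        also have "\<dots> \<ge> t * r" using x t by (intro mult_left_mono) auto
        also have "t * r = 2 * ?\<rho>" using t by (simp add: r_def)
        finally have "unit_bump (scaled (qs ! j) x) = 0" by (intro unit_bump_0) simp
        then have "S (Suc j) x = S j x" by (simp add: S_def)
        then show ?thesis by (simp add: \<phi>'_def \<Phi>_def)
      qed
      have "adapted A ((1 / t) *\<^sub>R z) r (\<phi>' j)"
        unfolding adapted_def
      proof (intro conjI allI impI ballI)
        show "\<phi>' j \<in> test_funs"
          by (rule test_funsI[OF sm compact_cball[of "(1 / t) *\<^sub>R z" r]]) (use zero in \<open>auto simp: not_le\<close>)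
        show "cmod (\<phi>' j x) \<le> 1" for x
        proof -
          have "\<phi>' j x = of_real (smooth_step (S (Suc j) x) - smooth_step (S j x))" by (simp add: \<phi>'_def \<Phi>_def)
          moreover have "\<bar>smooth_step (S (Suc j) x) - smooth_step (S j x)\<bar> \<le> 1"
            using smooth_step_nonneg[of "S (Suc j) x"] smooth_step_nonneg[of "S j x"]
              smooth_step_le_1[of "S (Suc j) x"] smooth_step_le_1[of "S j x"] by linarith
          ultimately show ?thesis by (simp only: norm_of_real)
        qed
        show "\<phi>' j x = 0" if "r < dist ((1 / t) *\<^sub>R z) x" for x by (rule zero[OF that])
        fix b :: 'a and x assume b: "b \<in> Basis"
        have "cmod (iter_deriv [b] (\<phi>' j) x) = cmod (iter_deriv [b] (\<Phi> (Suc j)) x - iter_deriv [b] (\<Phi> j) x)"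
          unfolding \<phi>'_def using iter_deriv_diff[OF Phis Phis, of "[b]"] b by (simp del: iter_deriv.simps)
        also have "\<dots> \<le> (G * (B * M)) * t + (G * (B * M)) * t"
          using j K K' unfolding t_def by (intro order_trans[OF norm_triangle_ineq4] add_mono b1 b) auto
        also have "\<dots> = A1 * t" by (simp add: A1_def algebra_simps)
        also have "\<dots> \<le> A / r"
        proof -
          have "A1 * t * r = A1 * (2 * ?\<rho>)" using t by (simp add: r_def)
          also have "\<dots> \<le> A" using A2 by (simp add: A_def)
          finally show ?thesis using r by (simp add: pos_le_divide_eq)
        qed
        finally show "cmod (iter_deriv [b] (\<phi>' j) x) \<le> A / r" .
      next
        fix b c :: 'a and x assume b: "b \<in> Basis" "c \<in> Basis"
        have "cmod (iter_deriv [c, b] (\<phi>' j) x) = cmod (iter_deriv [c, b] (\<Phi> (Suc j)) x - iter_deriv [c, b] (\<Phi> j) x)"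
          unfolding \<phi>'_def using iter_deriv_diff[OF Phis Phis, of "[c, b]"] b by (simp del: iter_deriv.simps)
        also have "\<dots> \<le> (G * (B * M)\<^sup>2 + G * (B * M)) * t\<^sup>2 + (G * (B * M)\<^sup>2 + G * (B * M)) * t\<^sup>2"
          using j K K' unfolding t_def by (intro order_trans[OF norm_triangle_ineq4] add_mono b2 b) auto
        also have "\<dots> = A2 * t\<^sup>2" by (simp add: A2_def algebra_simps)
        also have "\<dots> \<le> A / r\<^sup>2"
        proof -
          have "A2 * t\<^sup>2 * r\<^sup>2 = A2 * (2 * ?\<rho>)\<^sup>2" using t by (simp add: r_def power_mult_distrib power_divide)
          also have "\<dots> \<le> A" using A1 rho by (simp add: A_def)
          finally show ?thesis using r by (simp add: pos_le_divide_eq)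
        qed
        finally show "cmod (iter_deriv [c, b] (\<phi>' j) x) \<le> A / r\<^sup>2" .
      qed
      then show ?thesis by (simp only: K_def[symmetric] z_def[symmetric] t(2) r_def)
    qed
    define idx where "idx q = (THE j. j < n \<and> qs ! j = q)" for q
    have idx: "idx (qs ! j) = j" if "j < n" for j
      unfolding idx_def using qs(2) that by (intro the_equality) (auto simp: n_def nth_eq_iff_index_eq)
    have Qn: "Q = (!) qs ` {..<n}" unfolding n_def qs(1)[symmetric] set_conv_nth by auto
    have inj: "inj_on ((!) qs) {..<n}" using qs(2) by (intro inj_on_nth) (auto simp: n_def)
    have tot: "(\<Sum>q\<in>Q. \<phi>' (idx q) x) = 1" if x: "q \<in> Q" "norm (scaled q x) \<le> ?\<rho>" for x q
    proof -
      obtain j where j: "j < n" "q = qs ! j" using x Qn by auto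
      have "(\<Sum>q\<in>Q. \<phi>' (idx q) x) = (\<Sum>j<n. \<phi>' (idx (qs ! j)) x)" unfolding Qn by (simp add: sum.reindex[OF inj])
      also have "\<dots> = (\<Sum>j<n. \<phi>' j x)" by (simp add: idx)
      also have "\<dots> = \<Phi> n x - \<Phi> 0 x" unfolding \<phi>'_def by (rule sum_lessThan_telescope)
      also have "\<Phi> 0 x = 0" by (simp add: \<Phi>_def S_def smooth_step_0)
      also have "S n x \<ge> 1"
      proof -
        have "Re (unit_bump (scaled (qs ! j) x)) \<le> S n x" unfolding S_def
          using j by (intro member_le_sum unit_bump_real) auto
        then show ?thesis using unit_bump_1[OF x(2)] j by simp
      qed
      then have "\<Phi> n x - 0 = 1" by (simp add: \<Phi>_def smooth_step_1)
      finally show ?thesis .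
    qed
    show "\<exists>\<phi>. (\<forall>q\<in>Q. adapted A ((2 powi (- fst q)) *\<^sub>R snd q) (2 * real (bump_radius TYPE('a)) * 2 powi (- fst q)) (\<phi> q)) \<and>
        (\<forall>x. (\<exists>q\<in>Q. norm (scaled q x) \<le> bump_radius TYPE('a)) \<longrightarrow> (\<Sum>q\<in>Q. \<phi> q x) = 1)"
    proof (intro exI[of _ "\<lambda>q. \<phi>' (idx q)"] conjI ballI allI impI)
      fix q assume "q \<in> Q"
      then obtain j where j: "j < n" "q = qs ! j" using Qn by auto
      then show "adapted A ((2 powi (- fst q)) *\<^sub>R snd q) (2 * real (bump_radius TYPE('a)) * 2 powi (- fst q)) (\<phi>' (idx q))"
        using ad[OF j(1)] idx[OF j(1)] by simp
    qed (use tot in blast)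
  qed
qed

section \<open>The upper bound by the Hausdorff content\<close>

lemma P_kernel_eq: "(P_kernel :: (real ^ 'n) \<times> real \<Rightarrow> real) = spacetime_kernel"
  by (auto simp: P_kernel_def spacetime_kernel_def poisson_def fun_eq_iff)

text \<open>The kernel is moved from the test function onto \<open>\<nu>\<close>, where the
  potential is represented by a function bounded by 1.\<close>

lemma admissible_potential_bound:
  fixes \<nu> :: "((real ^ 'n) \<times> real \<Rightarrow> complex) \<Rightarrow> complex"
  assumes ad: "admissible E \<nu>" and eta: "\<eta> \<in> test_funs"
    and U: "open U" "dist_supp \<nu> \<subseteq> U" "\<And>x. x \<in> U \<Longrightarrow> \<eta> x = 1" and psi: "\<psi> \<in> test_funs"
  shows "ennreal (cmod (\<nu> (\<lambda>x. \<eta> x * conv kernel_measure \<psi> x))) \<le> (\<integral>\<^sup>+y. ennreal (cmod (\<psi> y)) \<partial>lborel)"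
proof -
  have T: "distribution \<nu>" using ad by (simp add: admissible_def)
  obtain f where f[measurable]: "f \<in> borel_measurable lborel" and f1: "AE x in lborel. cmod (f x) \<le> 1"
    and fe: "\<And>\<phi>. \<phi> \<in> test_funs \<Longrightarrow> dist_conv P_kernel \<nu> \<phi> = (LINT x|lborel. f x * \<phi> x)"
    using ad unfolding admissible_def Linfty_norm_le_def by blast
  have [measurable]: "\<psi> \<in> borel_measurable borel" by (rule test_funs_measurable[OF psi])
  have "\<nu> (\<lambda>x. \<eta> x * conv kernel_measure \<psi> x) = dist_pair \<nu> (conv kernel_measure \<psi>)"
    by (rule dist_pair_eq[symmetric, OF T eta smooth_conv[OF loc_finite_kernel_measure psi] U])
  also have "\<dots> = dist_conv P_kernel \<nu> \<psi>"
    unfolding P_kernel_eq by (rule dist_conv_eq_conv[symmetric, OF spacetime_kernel_measurable spacetime_kernel_nonneg psi])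
  also have "\<dots> = (LINT x|lborel. f x * \<psi> x)" by (rule fe[OF psi])
  finally have eq: "\<nu> (\<lambda>x. \<eta> x * conv kernel_measure \<psi> x) = (LINT x|lborel. f x * \<psi> x)" .
  have "ennreal (cmod (LINT x|lborel. f x * \<psi> x)) \<le> (\<integral>\<^sup>+x. ennreal (cmod (f x * \<psi> x)) \<partial>lborel)"
  \<comment> \<open>A nonintegrable product would have integral 0 by convention, so the estimate
    holds in either case.\<close>
  proof (cases "integrable lborel (\<lambda>x. f x * \<psi> x)")
    case True
    then show ?thesis by (rule integral_norm_bound_ennreal)
  qed (simp add: not_integrable_integral_eq)
  also have "\<dots> \<le> (\<integral>\<^sup>+x. ennreal (cmod (\<psi> x)) \<partial>lborel)"
  proof (rule nn_integral_mono_AE)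
    show "AE x in lborel. ennreal (cmod (f x * \<psi> x)) \<le> ennreal (cmod (\<psi> x))"
      using f1
    proof eventually_elim
      case (elim x)
      then show ?case using mult_right_mono[OF elim, of "cmod (\<psi> x)"] by (intro ennreal_leI) (simp add: norm_mult)
    qed
  qed
  finally show ?thesis by (simp only: eq)
qed

text \<open>Covering sets may have diameter 0, while a ball needs a positive radius; this allows an
  enlargement at an arbitrarily small cost.\<close>

lemma power_add_small:
  assumes "d \<ge> 0" "e > 0"
  obtains \<delta> :: real where "\<delta> > 0" "(d + \<delta>) ^ n \<le> d ^ n + e"
proof -
  have "((\<lambda>x. (d + x) ^ n) \<longlongrightarrow> (d + 0) ^ n) (at_right 0)" by (intro tendsto_intros)
  then have "\<forall>\<^sub>F x in at_right 0. (d + x) ^ n < d ^ n + e" using assms by (intro order_tendstoD) auto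
  then have "\<forall>\<^sub>F x in at_right 0. (d + x) ^ n < d ^ n + e \<and> 0 < x" by (auto simp: eventually_at_filter elim: eventually_mono)
  then obtain x where "(d + x) ^ n < d ^ n + e" "0 < x" using eventually_happens'[OF trivial_limit_at_right_real] by blast
  then show ?thesis using that[of x] by simp
qed

lemma dyadic_size:
  assumes "(t::real) > 0"
  obtains k :: int where "t \<le> 2 powi (- k)" "2 powi (- k) \<le> 2 * t"
proof -
  define k where "k = - \<lceil>log 2 t\<rceil>"
  have p: "(2::real) powi (- k) = 2 powr of_int \<lceil>log 2 t\<rceil>" by (simp add: k_def powr_real_of_int')
  have "t = 2 powr (log 2 t)" using assms by simp
  also have "\<dots> \<le> 2 powr of_int \<lceil>log 2 t\<rceil>" by (intro powr_mono) auto
  finally have 1: "t \<le> 2 powi (- k)" using p by simp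
  have "2 powr of_int \<lceil>log 2 t\<rceil> \<le> 2 powr (1 + log 2 t)" by (intro powr_mono) linarith+
  also have "\<dots> = 2 * t" using assms by (simp add: powr_add)
  finally show ?thesis using that[of k] 1 p by simp
qed

text \<open>Trades an arbitrary covering set for a lattice ball of comparable size. The strict
  inequality makes the ball open, so that compactness of the support applies.\<close>

lemma bounded_subset_lattice_ball:
  fixes S :: "'a::euclidean_space set"
  assumes "bounded S" "t > 0" "diameter S \<le> t"
  obtains q :: "int \<times> 'a" where "snd q \<in> lattice" "2 powi (- fst q) \<le> 2 * t"
    "S \<subseteq> {x. norm (scaled q x) < bump_radius TYPE('a)}"
proof (cases "S = {}")
  case True
  obtain k :: int where k: "2 powi (- k) \<le> 2 * t" using dyadic_size[OF assms(2)] by blast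
  show ?thesis by (rule that[of "(k, 0)"]) (use k True in \<open>auto simp: lattice_def\<close>)
next
  case False
  then obtain a where a: "a \<in> S" by auto
  obtain k :: int where k: "t \<le> 2 powi (- k)" "2 powi (- k) \<le> 2 * t" using dyadic_size[OF assms(2)] by blast
  obtain z :: 'a where z: "z \<in> lattice" "norm ((2 powi k) *\<^sub>R a - z) \<le> DIM('a)" using lattice_near by blast
  show ?thesis
  proof (rule that[of "(k, z)"])
    show "S \<subseteq> {x. norm (scaled (k, z) x) < bump_radius TYPE('a)}"
    proof safe
      fix x assume x: "x \<in> S"
      have "norm (x - a) \<le> diameter S" using diameter_bounded_bound[OF assms(1) x a] by (simp add: dist_norm)
      also have "\<dots> \<le> 2 powi (- k)" using assms(3) k(1) by simp
      finally have "2 powi k * norm (x - a) \<le> 2 powi k * 2 powi (- k)" by (intro mult_left_mono) auto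
      also have "\<dots> = 1" by (simp add: power_int_minus)
      finally have n1: "norm ((2 powi k) *\<^sub>R (x - a)) \<le> 1" by (simp add: norm_power_int)
      have eq: "scaled (k, z) x = (2 powi k) *\<^sub>R (x - a) + ((2 powi k) *\<^sub>R a - z)" by (simp add: scaleR_diff_right)
      have "norm (scaled (k, z) x) \<le> 1 + real DIM('a)" unfolding eq by (rule norm_triangle_mono[OF n1 z(2)])
      then show "norm (scaled (k, z) x) < bump_radius TYPE('a)" by (simp add: bump_radius_def)
    qed
  qed (use z k in auto)
qed

theorem caloric_capacity_le_content:
  obtains C :: real where "C > 0"
    "\<And>E :: ((real ^ 'n) \<times> real) set. caloric_capacity E \<le> ennreal C * hausdorff_content CARD('n) E"
proof -
  let ?\<rho> = "real (bump_radius TYPE((real ^ 'n) \<times> real))"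
  obtain A :: real where A: "A \<ge> 0" and part: "\<And>Q :: (int \<times> ((real ^ 'n) \<times> real)) set. finite Q \<Longrightarrow> snd ` Q \<subseteq> lattice \<Longrightarrow>
      \<exists>\<phi>. (\<forall>q\<in>Q. adapted A ((2 powi (- fst q)) *\<^sub>R snd q) (2 * ?\<rho> * 2 powi (- fst q)) (\<phi> q)) \<and>
        (\<forall>x. (\<exists>q\<in>Q. norm (scaled q x) \<le> ?\<rho>) \<longrightarrow> (\<Sum>q\<in>Q. \<phi> q x) = 1)"
    by (rule partition_of_unity_lattice[where 'a="(real ^ 'n) \<times> real"]) (rule that)
  obtain C where C: "C \<ge> 0" and key: "\<And>T \<eta> a r. \<And>\<phi> :: (real ^ 'n) \<times> real \<Rightarrow> complex. distribution T \<Longrightarrow> \<eta> \<in> test_funs \<Longrightarrow>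
    (\<And>\<psi>. \<psi> \<in> test_funs \<Longrightarrow> ennreal (cmod (T (\<lambda>x. \<eta> x * conv kernel_measure \<psi> x))) \<le> (\<integral>\<^sup>+y. ennreal (cmod (\<psi> y)) \<partial>lborel)) \<Longrightarrow>
    r > 0 \<Longrightarrow> adapted A a r \<phi> \<Longrightarrow> cmod (T (\<lambda>x. \<eta> x * \<phi> x)) \<le> C * r ^ DIM(real ^ 'n)"
  proof (rule distribution_adapted_bound[OF A, where 'x="real ^ 'n"], goal_cases)
    case (1 C)
    show ?thesis by (rule 1(1)[OF 1(2)], rule 1(3)) (assumption | blast)+
  qed
  have rho: "?\<rho> > 0" by (simp add: bump_radius_def)
  \<comment> \<open>The adapted radius is \<open>2 * ?\<rho> * 2 powi (- k)\<close> and the scale is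
    at most twice the enlarged diameter, hence \<open>4 * ?\<rho>\<close>. The summand 1 allows
    division by \<open>D\<close>.\<close>
  define D where "D = C * (4 * ?\<rho>) ^ CARD('n) + 1"
  have D: "D > 0" "C * (4 * ?\<rho>) ^ CARD('n) \<le> D" using C rho by (auto simp: D_def add_nonneg_pos)
  show ?thesis
  proof (rule that[OF D(1)])
    fix E :: "((real ^ 'n) \<times> real) set"
    show "caloric_capacity E \<le> ennreal D * hausdorff_content CARD('n) E"
      unfolding caloric_capacity_def
    proof (rule SUP_least)
      fix \<nu> assume "\<nu> \<in> {\<nu>. admissible E \<nu>}"
      then have ad: "admissible E \<nu>" by simp
      have T: "distribution \<nu>" and K: "compact (dist_supp \<nu>)" "dist_supp \<nu> \<subseteq> E" using ad by (auto simp: admissible_def)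
      obtain \<eta> U where eta: "\<eta> \<in> test_funs" and U: "open U" "dist_supp \<nu> \<subseteq> U" "\<And>x. x \<in> U \<Longrightarrow> \<eta> x = (1::complex)"
        using cutoff_near_compact[OF K(1)] by blast
      have cover_bound: "ennreal (cmod (dist_pair \<nu> (\<lambda>_. 1))) \<le> ennreal D * (\<Sum>i. ennreal (diameter (S i) ^ CARD('n)))"
        if S: "E \<subseteq> (\<Union>i. S i)" "\<forall>i. bounded (S i)" for S :: "nat \<Rightarrow> ((real ^ 'n) \<times> real) set"
      proof (rule ennreal_le_epsilon)
        fix e :: real assume e: "e > 0"
        \<comment> \<open>The error is multiplied by \<open>D\<close> in the end, so the
          \<open>e' i\<close> are chosen to sum to \<open>e / D\<close>.\<close>
        define e' where "e' i = (e / D) * (1/2) ^ Suc i" for i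
        have e': "e' i > 0" for i using e D by (simp add: e'_def)
        have "\<exists>\<delta>>0. (diameter (S i) + \<delta>) ^ CARD('n) \<le> diameter (S i) ^ CARD('n) + e' i" for i
          using power_add_small[OF diameter_ge_0 e'] S(2) by metis
        then obtain \<delta> where \<delta>: "\<And>i. \<delta> i > 0" "\<And>i. (diameter (S i) + \<delta> i) ^ CARD('n) \<le> diameter (S i) ^ CARD('n) + e' i"
          by metis
        define t where "t i = diameter (S i) + \<delta> i" for i
        have t: "t i > 0" "diameter (S i) \<le> t i" for i
          using \<delta>(1)[of i] diameter_ge_0[of "S i"] S(2) by (auto simp: t_def add_nonneg_pos less_imp_le)
        have "\<exists>q :: int \<times> ((real ^ 'n) \<times> real). snd q \<in> lattice \<and> 2 powi (- fst q) \<le> 2 * t i \<and> S i \<subseteq> {x. norm (scaled q x) < ?\<rho>}" for i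
          using bounded_subset_lattice_ball[of "S i" "t i"] t[of i] S(2) by metis
        then obtain q :: "nat \<Rightarrow> int \<times> ((real ^ 'n) \<times> real)" where q: "\<And>i. snd (q i) \<in> lattice" "\<And>i. 2 powi (- fst (q i)) \<le> 2 * t i"
          "\<And>i. S i \<subseteq> {x. norm (scaled (q i) x) < ?\<rho>}" by metis
        define V where "V i = {x. norm (scaled (q i) x) < ?\<rho>}" for i
        have Vo: "open (V i)" for i unfolding V_def by (intro open_Collect_less continuous_intros)
        have "dist_supp \<nu> \<subseteq> (\<Union>i\<in>UNIV. V i)" using K(2) S(1) q(3) by (fastforce simp: V_def)
        then obtain J where J: "finite J" "dist_supp \<nu> \<subseteq> (\<Union>i\<in>J. V i)"
          using compactE_image[OF K(1), of UNIV V] Vo by metis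
        define Q where "Q = q ` J"
        have Q: "finite Q" "snd ` Q \<subseteq> lattice" using J q by (auto simp: Q_def)
        obtain \<phi> where phi: "\<And>p. p \<in> Q \<Longrightarrow> adapted A ((2 powi (- fst p)) *\<^sub>R snd p) (2 * ?\<rho> * 2 powi (- fst p)) (\<phi> p)"
          and one: "\<And>x p. p \<in> Q \<Longrightarrow> norm (scaled p x) \<le> ?\<rho> \<Longrightarrow> (\<Sum>q\<in>Q. \<phi> q x) = 1"
          using part[OF Q] by blast
        have pt: "\<phi> p \<in> test_funs" if "p \<in> Q" for p using phi[OF that] by (simp add: adapted_def)
        have ept: "(\<lambda>x. \<eta> x * \<phi> p x) \<in> test_funs" if "p \<in> Q" for p
          by (rule test_funs_mult_left[OF eta test_funs_smooth[OF pt[OF that]]])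
        \<comment> \<open>The cutoff times the partition is again a cutoff equal to 1 near the
          support, so the pairing with 1 becomes a finite sum of values on adapted
          functions.\<close>
        define \<eta>' where "\<eta>' = (\<lambda>x. \<Sum>p\<in>Q. \<eta> x * \<phi> p x)"
        have eta': "\<eta>' \<in> test_funs" unfolding \<eta>'_def by (rule test_funs_sum[OF ept])
        have "dist_pair \<nu> (\<lambda>_. 1) = \<nu> (\<lambda>x. \<eta>' x * 1)"
        proof (rule dist_pair_eq[OF T eta' smooth_const])
          show "open (U \<inter> (\<Union>i\<in>J. V i))" by (intro open_Int open_UN U Vo ballI)
          show "dist_supp \<nu> \<subseteq> U \<inter> (\<Union>i\<in>J. V i)" using U J by auto
          fix x assume x: "x \<in> U \<inter> (\<Union>i\<in>J. V i)"
          then obtain i where i: "i \<in> J" "norm (scaled (q i) x) < ?\<rho>" by (auto simp: V_def)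
          have "(\<Sum>p\<in>Q. \<phi> p x) = 1" by (rule one[of "q i"]) (use i in \<open>auto simp: Q_def\<close>)
          then show "\<eta>' x = 1" using U(3) x by (simp add: \<eta>'_def)
        qed
        also have "\<dots> = (\<Sum>p\<in>Q. \<nu> (\<lambda>x. \<eta> x * \<phi> p x))"
          unfolding \<eta>'_def mult_1_right by (rule distribution_sum[OF T ept])
        finally have "cmod (dist_pair \<nu> (\<lambda>_. 1)) \<le> (\<Sum>p\<in>Q. cmod (\<nu> (\<lambda>x. \<eta> x * \<phi> p x)))" by (simp only: norm_sum)
        also have "\<dots> \<le> (\<Sum>p\<in>Q. C * (2 * ?\<rho> * 2 powi (- fst p)) ^ CARD('n))"
        proof (rule sum_mono)
          fix p assume p: "p \<in> Q"
          have "cmod (\<nu> (\<lambda>x. \<eta> x * \<phi> p x)) \<le> C * (2 * ?\<rho> * 2 powi (- fst p)) ^ DIM(real ^ 'n)"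
            by (rule key[OF T eta admissible_potential_bound[OF ad eta U] _ phi[OF p]]) (use rho in auto)
          then show "cmod (\<nu> (\<lambda>x. \<eta> x * \<phi> p x)) \<le> C * (2 * ?\<rho> * 2 powi (- fst p)) ^ CARD('n)" by simp
        qed
        \<comment> \<open>Different covering sets may share a ball; the sum over \<open>J\<close>
          counts it once for each of them.\<close>
        also have "\<dots> \<le> (\<Sum>i\<in>J. C * (2 * ?\<rho> * 2 powi (- fst (q i))) ^ CARD('n))"
          unfolding Q_def using J C rho by (intro order_trans[OF sum_image_le]) auto
        also have "\<dots> \<le> (\<Sum>i\<in>J. D * (diameter (S i) ^ CARD('n) + e' i))"
        proof (rule sum_mono)
          fix i
          have "C * (2 * ?\<rho> * 2 powi (- fst (q i))) ^ CARD('n) \<le> C * (2 * ?\<rho> * (2 * t i)) ^ CARD('n)"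
            using C rho q(2) by (intro mult_left_mono power_mono) auto
          also have "2 * ?\<rho> * (2 * t i) = (4 * ?\<rho>) * t i" by simp
          also have "C * ((4 * ?\<rho>) * t i) ^ CARD('n) = (C * (4 * ?\<rho>) ^ CARD('n)) * t i ^ CARD('n)"
            by (simp only: power_mult_distrib mult.assoc)
          also have "\<dots> \<le> D * t i ^ CARD('n)" using D t[of i] by (intro mult_right_mono) auto
          also have "\<dots> \<le> D * (diameter (S i) ^ CARD('n) + e' i)"
            using D \<delta>(2)[of i] by (intro mult_left_mono) (auto simp: t_def)
          finally show "C * (2 * ?\<rho> * 2 powi (- fst (q i))) ^ CARD('n) \<le> D * (diameter (S i) ^ CARD('n) + e' i)" .
        qed
        finally have le: "cmod (dist_pair \<nu> (\<lambda>_. 1)) \<le> (\<Sum>i\<in>J. D * (diameter (S i) ^ CARD('n) + e' i))" .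
        have dg: "diameter (S i) \<ge> 0" for i using S(2) by (simp add: diameter_ge_0)
        have "ennreal (cmod (dist_pair \<nu> (\<lambda>_. 1))) \<le> ennreal (\<Sum>i\<in>J. D * (diameter (S i) ^ CARD('n) + e' i))" using le by (rule ennreal_leI)
        also have "\<dots> = (\<Sum>i\<in>J. ennreal D * (ennreal (diameter (S i) ^ CARD('n)) + ennreal (e' i)))"
          using D dg e' by (subst sum_ennreal[symmetric]) (auto simp: ennreal_mult ennreal_plus less_imp_le intro!: mult_nonneg_nonneg add_nonneg_nonneg)
        also have "\<dots> \<le> (\<Sum>i. ennreal D * (ennreal (diameter (S i) ^ CARD('n)) + ennreal (e' i)))"
          by (rule sum_le_suminf[OF summableI J(1)]) auto
        also have "\<dots> = ennreal D * ((\<Sum>i. ennreal (diameter (S i) ^ CARD('n))) + (\<Sum>i. ennreal (e' i)))"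
          by (simp add: ennreal_suminf_cmult suminf_add[symmetric])
        also have "(\<Sum>i. ennreal (e' i)) = ennreal (e / D)"
        proof -
          have "e' sums ((e / D) * 1)" unfolding e'_def using power_half_series by (rule sums_mult)
          then show ?thesis using e' by (subst suminf_ennreal2) (auto simp: sums_iff less_imp_le)
        qed
        also have "ennreal D * ((\<Sum>i. ennreal (diameter (S i) ^ CARD('n))) + ennreal (e / D)) = ennreal D * (\<Sum>i. ennreal (diameter (S i) ^ CARD('n))) + ennreal e"
          using D e by (simp add: distrib_left ennreal_mult[symmetric])
        finally show "ennreal (cmod (dist_pair \<nu> (\<lambda>_. 1))) \<le> ennreal D * (\<Sum>i. ennreal (diameter (S i) ^ CARD('n))) + ennreal e" .
      qed
      let ?X = "ennreal (cmod (dist_pair \<nu> (\<lambda>_. 1)))"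
      have one: "ennreal (1 / D) * ennreal D = 1" "ennreal D * ennreal (1 / D) = 1"
        using D by (simp_all add: ennreal_mult[symmetric])
      have "ennreal (1 / D) * ?X \<le> hausdorff_content CARD('n) E"
        unfolding hausdorff_content_def
      proof (rule INF_greatest)
        fix S :: "nat \<Rightarrow> ((real ^ 'n) \<times> real) set" assume "S \<in> {S. E \<subseteq> (\<Union>i. S i) \<and> (\<forall>i. bounded (S i))}"
        then have "ennreal (1 / D) * ?X \<le> ennreal (1 / D) * (ennreal D * (\<Sum>i. ennreal (diameter (S i) ^ CARD('n))))"
          by (intro mult_left_mono cover_bound) auto
        then show "ennreal (1 / D) * ?X \<le> (\<Sum>i. ennreal (diameter (S i) ^ CARD('n)))"
          by (simp only: mult.assoc[symmetric] one mult_1)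
      qed
      then have "ennreal D * (ennreal (1 / D) * ?X) \<le> ennreal D * hausdorff_content CARD('n) E" by (rule mult_left_mono) simp
      then show "?X \<le> ennreal D * hausdorff_content CARD('n) E" by (simp only: mult.assoc[symmetric] one mult_1)
    qed
  qed
qed

section \<open>Net contents on a binary tree\<close>

text \<open>Nodes are words of bits, most recent bit first.\<close>

locale bit_tree =
  fixes bit :: "nat \<Rightarrow> 'a \<Rightarrow> bool" and \<theta> :: real
  assumes theta: "0 < \<theta>" "\<theta> < 1"
begin

primrec code :: "nat \<Rightarrow> 'a \<Rightarrow> bool list" where
  "code 0 x = []"
| "code (Suc n) x = bit n x # code n x"

definition cyl :: "bool list \<Rightarrow> 'a set" where
  "cyl w = {x. code (length w) x = w}"

lemma length_code [simp]: "length (code n x) = n"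
  by (induction n) auto

lemma code_in_cyl: "x \<in> cyl (code n x)"
  by (simp add: cyl_def)

lemma cyl_Nil [simp]: "cyl [] = UNIV"
  by (simp add: cyl_def)

lemma cyl_Cons: "cyl (b # w) = {x \<in> cyl w. bit (length w) x = b}"
  by (auto simp: cyl_def)

lemma code_mono: "m \<le> n \<Longrightarrow> code n x = code n y \<Longrightarrow> code m x = code m y"
  by (induction n rule: dec_induct) auto

lemma cyl_nested:
  assumes "x \<in> cyl u" "x \<in> cyl v" "length u \<le> length v"
  shows "cyl v \<subseteq> cyl u"
proof
  fix y assume "y \<in> cyl v"
  then have "code (length v) y = code (length v) x" using assms by (simp add: cyl_def)
  then have "code (length u) y = code (length u) x" by (rule code_mono[OF assms(3)])
  then show "y \<in> cyl u" using assms by (simp add: cyl_def)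
qed

lemma cyl_unique: "x \<in> cyl u \<Longrightarrow> x \<in> cyl v \<Longrightarrow> length u = length v \<Longrightarrow> u = v"
  by (simp add: cyl_def)

text \<open>As a measure on words, the total weight of a cover obeys the additivity and continuity
  rules of measures.\<close>

definition cost :: "bool list measure" where
  "cost = density (count_space UNIV) (\<lambda>w. ennreal (\<theta> ^ length w))"

lemma sets_cost [simp]: "sets cost = UNIV"
  by (simp add: cost_def)

lemma cost_finite: "finite F \<Longrightarrow> emeasure cost F = (\<Sum>w\<in>F. ennreal (\<theta> ^ length w))"
  unfolding cost_def by (subst emeasure_density) (auto simp: nn_integral_count_space_indicator[symmetric] nn_integral_count_space_finite)

definition covers :: "bool list set \<Rightarrow> 'a set" where
  "covers U = (\<Union>w\<in>U. cyl w)"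

text \<open>There are only countably many words, so arbitrary sets of words may serve as
  covers.\<close>

definition net :: "'a set \<Rightarrow> ennreal" where
  "net A = (INF U\<in>{U. A \<subseteq> covers U}. emeasure cost U)"

lemma net_le: "A \<subseteq> covers U \<Longrightarrow> net A \<le> emeasure cost U"
  unfolding net_def by (rule INF_lower) auto

lemma net_mono: "A \<subseteq> B \<Longrightarrow> net A \<le> net B"
  unfolding net_def by (rule INF_superset_mono) auto

lemma net_le_cyl: "A \<subseteq> cyl w \<Longrightarrow> net A \<le> ennreal (\<theta> ^ length w)"
  using net_le[of A "{w}"] by (simp add: covers_def cost_finite)

lemma net_le_1: "net A \<le> 1"
  using net_le_cyl[of A "[]"] by simp

lemma net_neq_top: "net A \<noteq> top"
  using net_le_1[of A] by (auto simp: top_unique)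

lemma net_empty [simp]: "net {} = 0"
  using net_le[of "{}" "{}"] by simp

lemma net_coverE:
  assumes "e > 0"
  obtains U where "A \<subseteq> covers U" "emeasure cost U \<le> net A + ennreal e"
proof -
  have "net A < net A + ennreal e"
    using net_le_1[of A] assms by (cases "net A" rule: ennreal_cases) (auto simp: top_unique ennreal_plus[symmetric] ennreal_less_iff simp del: ennreal_plus)
  then obtain U where "A \<subseteq> covers U" "emeasure cost U < net A + ennreal e"
    unfolding net_def[of A] INF_less_iff by auto
  then show ?thesis using that by auto
qed

lemma net_subadd: "net (A \<union> B) \<le> net A + net B"
proof (rule ennreal_le_epsilon)
  fix e :: real assume e: "e > 0"
  obtain U where U: "A \<subseteq> covers U" "emeasure cost U \<le> net A + ennreal (e / 2)" using net_coverE[of "e / 2"] e by auto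
  obtain V where V: "B \<subseteq> covers V" "emeasure cost V \<le> net B + ennreal (e / 2)" using net_coverE[of "e / 2"] e by auto
  have "net (A \<union> B) \<le> emeasure cost (U \<union> V)" using U V by (intro net_le) (auto simp: covers_def)
  also have "\<dots> \<le> emeasure cost U + emeasure cost V" by (rule emeasure_subadditive) auto
  also have "\<dots> \<le> (net A + ennreal (e / 2)) + (net B + ennreal (e / 2))" by (intro add_mono U V)
  also have "\<dots> = net A + net B + (ennreal (e / 2) + ennreal (e / 2))" by (simp only: add_ac)
  also have "ennreal (e / 2) + ennreal (e / 2) = ennreal e" using e by (simp add: ennreal_plus[symmetric] del: ennreal_plus)
  finally show "net (A \<union> B) \<le> net A + net B + ennreal e" .
qed

text \<open>Cylinders of equal length are equal or disjoint, and otherwise they are nested or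
  disjoint. Comparing with strictly shorter words thus discards the nonempty cylinders contained in
  a larger one.\<close>

definition maxl :: "bool list set \<Rightarrow> bool list set" where
  "maxl U = {w\<in>U. \<forall>u\<in>U. length u < length w \<longrightarrow> cyl u \<inter> cyl w = {}}"

lemma maxl_subset: "maxl U \<subseteq> U"
  by (auto simp: maxl_def)

lemma maxl_cover:
  assumes "w \<in> U" "x \<in> cyl w"
  obtains u where "u \<in> maxl U" "x \<in> cyl u" "length u \<le> length w"
proof -
  let ?P = "\<lambda>n. \<exists>u\<in>U. x \<in> cyl u \<and> length u = n"
  define n where "n = (LEAST n. ?P n)"
  have P: "?P (length w)" using assms by auto
  have "?P n" unfolding n_def by (rule LeastI_ex) (use P in blast)
  then obtain u where u: "u \<in> U" "x \<in> cyl u" "length u = n" by auto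
  have "u \<in> maxl U"
    unfolding maxl_def
  proof (safe, rule u(1))
    fix v y assume v: "v \<in> U" "length v < length u" "y \<in> cyl v" "y \<in> cyl u"
    then have "cyl u \<subseteq> cyl v" by (intro cyl_nested[of y]) auto
    then have "?P (length v)" using v u by auto
    then have "n \<le> length v" unfolding n_def by (rule Least_le)
    then show "y \<in> {}" using v u by simp
  qed
  moreover have "n \<le> length w" unfolding n_def by (rule Least_le) (rule P)
  ultimately show ?thesis using that u by auto
qed

lemma covers_maxl: "covers (maxl U) = covers U"
proof
  show "covers (maxl U) \<subseteq> covers U" using maxl_subset[of U] unfolding covers_def by blast
  show "covers U \<subseteq> covers (maxl U)"
  proof
    fix x assume "x \<in> covers U"
    then obtain w where w: "w \<in> U" "x \<in> cyl w" unfolding covers_def by blast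
    obtain u where "u \<in> maxl U" "x \<in> cyl u" using maxl_cover[OF w] by blast
    then show "x \<in> covers (maxl U)" unfolding covers_def by blast
  qed
qed

text \<open>Where covers overlap, the shorter cylinder stays in \<open>maxl (U \<union> V)\<close> and the longer one is free
  to cover the intersection.\<close>

lemma strong_subadd:
  assumes "A \<subseteq> covers U" "B \<subseteq> covers V"
  shows "emeasure cost (maxl (U \<union> V)) + net (A \<inter> B) \<le> emeasure cost U + emeasure cost V"
proof -
  let ?W = "maxl (U \<union> V)"
  have "A \<inter> B \<subseteq> covers ((U \<union> V - ?W) \<union> (U \<inter> V))"
  proof
    fix x assume "x \<in> A \<inter> B"
    then obtain u v where uv: "u \<in> U" "x \<in> cyl u" "v \<in> V" "x \<in> cyl v" using assms unfolding covers_def by blast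
    consider "length u = length v" | "length u < length v" | "length v < length u" by linarith
    then show "x \<in> covers ((U \<union> V - ?W) \<union> (U \<inter> V))"
    proof cases
      case 1
      then have "u = v" using uv cyl_unique by blast
      then show ?thesis using uv by (auto simp: covers_def)
    next
      case 2
      then have "v \<notin> ?W" using uv unfolding maxl_def by blast
      then show ?thesis using uv by (auto simp: covers_def)
    next
      case 3
      then have "u \<notin> ?W" using uv unfolding maxl_def by blast
      then show ?thesis using uv by (auto simp: covers_def)
    qed
  qed
  then have "net (A \<inter> B) \<le> emeasure cost ((U \<union> V - ?W) \<union> (U \<inter> V))" by (rule net_le)
  also have "\<dots> \<le> emeasure cost (U \<union> V - ?W) + emeasure cost (U \<inter> V)" by (rule emeasure_subadditive) auto
  finally have "emeasure cost ?W + net (A \<inter> B) \<le> (emeasure cost ?W + emeasure cost (U \<union> V - ?W)) + emeasure cost (U \<inter> V)"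
    by (simp add: add.assoc add_left_mono)
  also have "emeasure cost ?W + emeasure cost (U \<union> V - ?W) = emeasure cost (U \<union> V)"
    using maxl_subset[of "U \<union> V"] by (subst plus_emeasure) (auto intro: arg_cong[of _ _ "emeasure cost"])
  also have "emeasure cost (U \<union> V) + emeasure cost (U \<inter> V) = emeasure cost U + emeasure cost V"
  proof -
    have "emeasure cost (U \<union> V) = emeasure cost U + emeasure cost (V - U)"
      by (subst plus_emeasure) auto
    moreover have "emeasure cost V = emeasure cost (V - U) + emeasure cost (U \<inter> V)"
      by (subst plus_emeasure) (auto intro: arg_cong[of _ _ "emeasure cost"])
    ultimately show ?thesis by (simp add: add_ac)
  qed
  finally show ?thesis .
qed

text \<open>The increasing sets lemma: near-optimal covers of the \<open>A n\<close> are merged one after the other, and strong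
  subadditivity keeps the accumulated excess below \<open>e\<close>.\<close>

lemma net_incseq:
  assumes inc: "incseq A" and le: "\<And>n. net (A n) \<le> a"
  shows "net (\<Union>n. A n) \<le> a"
proof (rule ennreal_le_epsilon)
  fix e :: real assume e: "e > 0"
  define e' where "e' n = e * (1/2) ^ Suc n" for n
  have e': "e' n > 0" for n using e by (simp add: e'_def)
  have "\<exists>U. A n \<subseteq> covers U \<and> emeasure cost U \<le> net (A n) + ennreal (e' n)" for n
    using net_coverE[OF e'] by metis
  then obtain U where U: "\<And>n. A n \<subseteq> covers (U n)" "\<And>n. emeasure cost (U n) \<le> net (A n) + ennreal (e' n)" by metis
  define W where "W = rec_nat (U 0) (\<lambda>n w. maxl (w \<union> U (Suc n)))"
  have W0: "W 0 = U 0" and WS: "W (Suc n) = maxl (W n \<union> U (Suc n))" for n by (simp_all add: W_def)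
  have Wc: "A n \<subseteq> covers (W n)" for n
  proof (cases n)
    case (Suc m)
    then show ?thesis using U(1)[of n] unfolding Suc WS covers_maxl by (auto simp: covers_def)
  qed (use U in \<open>simp add: W0\<close>)
  have We: "emeasure cost (W n) \<le> net (A n) + ennreal (\<Sum>k\<le>n. e' k)" for n
  proof (induction n)
    case 0
    then show ?case using U(2)[of 0] by (simp add: W0)
  next
    case (Suc n)
    have "A n \<inter> A (Suc n) = A n" using incseq_SucD[OF inc, of n] by auto
    then have "emeasure cost (W (Suc n)) + net (A n) \<le> emeasure cost (W n) + emeasure cost (U (Suc n))"
      using strong_subadd[OF Wc[of n] U(1)[of "Suc n"]] by (simp add: WS)
    also have "\<dots> \<le> (net (A n) + ennreal (\<Sum>k\<le>n. e' k)) + (net (A (Suc n)) + ennreal (e' (Suc n)))"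
      by (intro add_mono Suc U)
    also have "\<dots> = (net (A (Suc n)) + (ennreal (\<Sum>k\<le>n. e' k) + ennreal (e' (Suc n)))) + net (A n)" by (simp only: add_ac)
    also have "ennreal (\<Sum>k\<le>n. e' k) + ennreal (e' (Suc n)) = ennreal (\<Sum>k\<le>Suc n. e' k)"
      using e' by (simp add: ennreal_plus[symmetric] sum_nonneg less_imp_le del: ennreal_plus)
    finally have "net (A n) + emeasure cost (W (Suc n)) \<le> net (A n) + (net (A (Suc n)) + ennreal (\<Sum>k\<le>Suc n. e' k))"
      by (simp only: add.commute)
    then show ?case using net_neq_top[of "A n"] unfolding ennreal_add_left_cancel_le by simp
  qed
  have es: "(\<Sum>k\<le>n. e' k) \<le> e" for n
  proof -
    have s: "e' sums (e * 1)" unfolding e'_def using power_half_series by (rule sums_mult)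
    then have "(\<Sum>k\<le>n. e' k) \<le> suminf e'" using e' by (intro sum_le_suminf) (auto simp: sums_iff less_imp_le)
    then show ?thesis using s by (simp add: sums_iff)
  qed
  have Wb: "emeasure cost (W n) \<le> a + ennreal e" for n
    by (rule order_trans[OF We]) (intro add_mono le ennreal_leI es)
  \<comment> \<open>The words that stay in the merged covers from stage \<open>n\<close> on. For a
    point covered by all late stages, the length of its shortest word does not increase under
    merging, so it becomes constant, and the word \<open>code l x\<close> is then in every later
    cover. Each \<open>Z n\<close> costs no more than \<open>W n\<close>.\<close>
  define Z where "Z n = (\<Inter>m\<in>{n..}. W m)" for n
  have "(\<Union>n. A n) \<subseteq> covers (\<Union>n. Z n)"
  proof
    fix x assume "x \<in> (\<Union>n. A n)"
    then obtain n0 where n0: "x \<in> A n0" by auto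
    let ?L = "\<lambda>n. LEAST l. \<exists>w\<in>W n. x \<in> cyl w \<and> length w = l"
    have ex: "\<exists>l. \<exists>w\<in>W n. x \<in> cyl w \<and> length w = l" if "n \<ge> n0" for n
    proof -
      have "x \<in> covers (W n)" using Wc[of n] incseqD[OF inc that] n0 by blast
      then show ?thesis unfolding covers_def by blast
    qed
    have LW: "\<exists>w\<in>W n. x \<in> cyl w \<and> length w = ?L n" if "n \<ge> n0" for n by (rule LeastI_ex[OF ex[OF that]])
    have Ldec: "?L (Suc n) \<le> ?L n" if n: "n \<ge> n0" for n
    proof -
      obtain w where w: "w \<in> W n" "x \<in> cyl w" "length w = ?L n" using LW[OF n] by auto
      then obtain u where "u \<in> W (Suc n)" "x \<in> cyl u" "length u \<le> length w"
        unfolding WS by (metis UnI1 maxl_cover)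
      then show ?thesis using w by (metis (mono_tags, lifting) Least_le order_trans)
    qed
    define l where "l = (LEAST l. \<exists>n\<ge>n0. ?L n = l)"
    have "\<exists>n\<ge>n0. ?L n = l" unfolding l_def by (rule LeastI_ex) blast
    then obtain N where N: "N \<ge> n0" "?L N = l" by auto
    have const: "?L n = l" if "n \<ge> N" for n
    proof (rule antisym)
      show "?L n \<le> l" using that
      proof (induction n rule: dec_induct)
        case base then show ?case using N by simp
      next
        case (step n) then show ?case using Ldec[of n] N by simp
      qed
      show "l \<le> ?L n" unfolding l_def
        by (rule Least_le) (use order_trans[OF N(1) that] in blast)
    qed
    have "code l x \<in> W n" if n: "n \<ge> N" for n
    proof -
      obtain w where w: "w \<in> W n" "x \<in> cyl w" "length w = ?L n" using LW[of n] n N by auto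
      then have "w = code l x" using const[OF n] by (simp add: cyl_def)
      then show ?thesis using w by simp
    qed
    then have "code l x \<in> Z N" by (simp add: Z_def)
    then show "x \<in> covers (\<Union>n. Z n)" unfolding covers_def using code_in_cyl by blast
  qed
  then have "net (\<Union>n. A n) \<le> emeasure cost (\<Union>n. Z n)" by (rule net_le)
  also have "\<dots> = (SUP n. emeasure cost (Z n))"
    by (rule SUP_emeasure_incseq[symmetric]) (auto simp: incseq_def Z_def)
  also have "\<dots> \<le> a + ennreal e"
  proof (rule SUP_least)
    fix n
    have "emeasure cost (Z n) \<le> emeasure cost (W n)" by (rule emeasure_mono) (auto simp: Z_def)
    then show "emeasure cost (Z n) \<le> a + ennreal e" using Wb[of n] by simp
  qed
  finally show "net (\<Union>n. A n) \<le> a + ennreal e" .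
qed

section \<open>Mass distribution along the tree\<close>

definition node_net :: "'a set \<Rightarrow> bool list \<Rightarrow> real" where
  "node_net A w = enn2real (net (A \<inter> cyl w))"

lemma node_net_nonneg: "node_net A w \<ge> 0"
  by (simp add: node_net_def)

lemma ennreal_node_net: "ennreal (node_net A w) = net (A \<inter> cyl w)"
  by (simp add: node_net_def ennreal_enn2real_if net_neq_top)

lemma node_net_le: "node_net A w \<le> \<theta> ^ length w"
  using net_le_cyl[of "A \<inter> cyl w" w] theta by (simp flip: ennreal_node_net add: ennreal_le_iff)

lemma node_net_split: "node_net A w \<le> node_net A (True # w) + node_net A (False # w)"
proof -
  have "A \<inter> cyl w = (A \<inter> cyl (True # w)) \<union> (A \<inter> cyl (False # w))" by (auto simp: cyl_Cons)
  then have "net (A \<inter> cyl w) \<le> net (A \<inter> cyl (True # w)) + net (A \<inter> cyl (False # w))" by (metis net_subadd)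
  then have "ennreal (node_net A w) \<le> ennreal (node_net A (True # w) + node_net A (False # w))"
    by (simp add: ennreal_node_net node_net_nonneg)
  then show ?thesis by (subst (asm) ennreal_le_iff) (auto simp: node_net_nonneg)
qed

text \<open>The mass of a node goes to its children in proportion to their net contents. If both
  contents vanish, division by 0 yields 0, consistently with the mass of the node being 0.\<close>

primrec mass :: "'a set \<Rightarrow> bool list \<Rightarrow> real" where
  "mass A [] = node_net A []"
| "mass A (b # w) = mass A w * node_net A (b # w) / (node_net A (True # w) + node_net A (False # w))"

text \<open>By subadditivity the contents of the children add up to at least the content of the
  node, hence to at least its mass; so the proportionality factor is at most 1.\<close>

lemma mass_bounds: "0 \<le> mass A w \<and> mass A w \<le> node_net A w"
proof (induction w)
  case Nil
  then show ?case by (simp add: node_net_nonneg)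
next
  case (Cons b w)
  let ?s = "node_net A (True # w) + node_net A (False # w)"
  have s: "0 \<le> ?s" by (simp add: node_net_nonneg)
  have "mass A w \<le> ?s" using Cons node_net_split[of A w] by linarith
  then have "mass A w / ?s \<le> 1" using s by (auto simp: divide_le_eq_1)
  then have "mass A w / ?s * node_net A (b # w) \<le> 1 * node_net A (b # w)"
    by (intro mult_right_mono node_net_nonneg)
  then show ?case using Cons s by (simp add: node_net_nonneg)
qed

lemma mass_split: "mass A w = mass A (True # w) + mass A (False # w)"
proof (cases "node_net A (True # w) + node_net A (False # w) = 0")
  case True
  then have "mass A w = 0" using mass_bounds[of A w] node_net_split[of A w] by linarith
  then show ?thesis by simp
next
  case False
  then show ?thesis by (simp add: add_divide_distrib[symmetric] distrib_left[symmetric])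
qed

text \<open>The masses of one level are laid out as adjacent intervals, the child
  \<open>True\<close> before the child \<open>False\<close>, and \<open>node\<close> reads off the
  word whose interval contains \<open>u\<close>. Lebesgue measure on an interval thereby realises
  the mass distribution without an extension theorem.\<close>

primrec left_end :: "'a set \<Rightarrow> bool list \<Rightarrow> real" where
  "left_end A [] = 0"
| "left_end A (b # w) = left_end A w + (if b then 0 else mass A (True # w))"

primrec node :: "'a set \<Rightarrow> nat \<Rightarrow> real \<Rightarrow> bool list" where
  "node A 0 u = []"
| "node A (Suc n) u = (u < left_end A (node A n u) + mass A (True # node A n u)) # node A n u"

lemma length_node [simp]: "length (node A n u) = n"
  by (induction n) auto

lemma node_interval:
  assumes "0 \<le> u" "u < mass A []"
  shows "left_end A (node A n u) \<le> u \<and> u < left_end A (node A n u) + mass A (node A n u)"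
proof (induction n)
  case (Suc n)
  then show ?case using mass_split[of A "node A n u"] by (auto simp del: mass.simps)
qed (use assms in auto)

lemma node_measurable [measurable]: "node A n \<in> borel \<rightarrow>\<^sub>M count_space UNIV"
proof (induction n)
  case (Suc n)
  note [measurable] = Suc
  have [measurable]: "(\<lambda>u. left_end A (node A n u) + mass A (True # node A n u)) \<in> borel_measurable borel"
    by (rule measurable_compose[OF Suc]) simp
  have "{u. node A (Suc n) u = w} \<in> sets borel" for w
  proof (cases w)
    case (Cons b v)
    have "{u. node A (Suc n) u = w} = {u. node A n u = v \<and> (u < left_end A (node A n u) + mass A (True # node A n u)) = b}"
      unfolding Cons by auto
    also have "\<dots> \<in> sets borel" by measurable
    finally show ?thesis .
  qed simp
  then show ?case by (subst measurable_count_space_eq2_countable) (auto simp: vimage_def)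
qed simp

end

section \<open>Analytic sets and capacitability\<close>

text \<open>Projections of closed sets along the Baire space. The sequence supplies the integer
  parameters that are bounded one at a time in the capacitability argument.\<close>

definition analytic_set :: "'a::topological_space set \<Rightarrow> bool" where
  "analytic_set B \<longleftrightarrow> (\<exists>C :: ('a \<times> (nat \<Rightarrow> nat)) set. closed C \<and> B = fst ` C)"

lemma analytic_setI: "closed (C :: ('a::topological_space \<times> (nat \<Rightarrow> nat)) set) \<Longrightarrow> B = fst ` C \<Longrightarrow> analytic_set B"
  by (auto simp: analytic_set_def)

lemma analytic_set_closed:
  assumes "closed B" shows "analytic_set B"
  by (rule analytic_setI[of "B \<times> UNIV"]) (auto intro: closed_Times assms)

lemma continuous_on_coordinate:
  fixes f :: "'a::topological_space \<Rightarrow> nat \<Rightarrow> nat"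
  shows "continuous_on UNIV f \<Longrightarrow> continuous_on UNIV (\<lambda>x. f x i)"
  by (rule continuous_on_compose2[OF continuous_on_product_coordinates[of i]]) auto

text \<open>Coordinate 0 of the sequence selects the set, and the shifted sequence is the witness
  for membership in it.\<close>

lemma analytic_set_UN:
  assumes "\<And>n::nat. analytic_set (B n)"
  shows "analytic_set (\<Union>n. B n)"
proof -
  obtain C where C: "\<And>n. closed (C n :: ('a \<times> (nat \<Rightarrow> nat)) set)" "\<And>n. B n = fst ` C n"
    using assms unfolding analytic_set_def by metis
  define g where "g = (\<lambda>p :: 'a \<times> (nat \<Rightarrow> nat). (fst p, \<lambda>i. snd p (Suc i)))"
  have g: "continuous_on UNIV g"
    unfolding g_def by (intro continuous_intros continuous_on_coordinate)
  have c: "continuous_on UNIV (\<lambda>p :: 'a \<times> (nat \<Rightarrow> nat). snd p 0)"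
    by (intro continuous_on_coordinate continuous_intros)
  show ?thesis
  proof (rule analytic_setI)
    show "closed (\<Inter>n. ((\<lambda>p. snd p 0) -` (- {n})) \<union> g -` C n)"
    proof (intro closed_INT ballI closed_Un)
      fix n
      show "closed ((\<lambda>p :: 'a \<times> (nat \<Rightarrow> nat). snd p 0) -` (- {n}))"
        by (rule closed_vimage[OF _ c]) (simp add: closed_def open_discrete)
      show "closed (g -` C n)" by (rule closed_vimage[OF C(1) g])
    qed
    show "(\<Union>n. B n) = fst ` (\<Inter>n. ((\<lambda>p. snd p 0) -` (- {n})) \<union> g -` C n)"
    proof safe
      fix x n assume "x \<in> B n"
      then obtain \<sigma> where s: "(x, \<sigma>) \<in> C n" using C(2) by auto
      have "(x, case_nat n \<sigma>) \<in> (\<Inter>n. ((\<lambda>p. snd p 0) -` (- {n})) \<union> g -` C n)"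
        using s by (auto simp: g_def)
      then show "x \<in> fst ` (\<Inter>n. ((\<lambda>p. snd p 0) -` (- {n})) \<union> g -` C n)" by (rule image_eqI[rotated]) simp
    next
      fix x \<sigma> assume "(x, \<sigma>) \<in> (\<Inter>n. ((\<lambda>p. snd p 0) -` (- {n})) \<union> g -` C n)"
      then have "g (x, \<sigma>) \<in> C (\<sigma> 0)" by auto
      then have "fst (g (x, \<sigma>)) \<in> B (\<sigma> 0)" unfolding C(2) by (rule imageI)
      then have "x \<in> B (\<sigma> 0)" by (simp add: g_def)
      then show "fst (x, \<sigma>) \<in> (\<Union>n. B n)" by auto
    qed
  qed
qed

text \<open>One sequence holds the witnesses for all sets at once, interleaved by the pairing
  function.\<close>

lemma analytic_set_INT:
  assumes "\<And>n::nat. analytic_set (B n)"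
  shows "analytic_set (\<Inter>n. B n)"
proof -
  obtain C where C: "\<And>n. closed (C n :: ('a \<times> (nat \<Rightarrow> nat)) set)" "\<And>n. B n = fst ` C n"
    using assms unfolding analytic_set_def by metis
  define g where "g n = (\<lambda>p :: 'a \<times> (nat \<Rightarrow> nat). (fst p, \<lambda>k. snd p (prod_encode (n, k))))" for n
  have g: "continuous_on UNIV (g n)" for n
    unfolding g_def by (intro continuous_intros continuous_on_coordinate)
  show ?thesis
  proof (rule analytic_setI)
    show "closed (\<Inter>n. g n -` C n)" by (intro closed_INT ballI closed_vimage C g)
    show "(\<Inter>n. B n) = fst ` (\<Inter>n. g n -` C n)"
    proof safe
      fix x assume x: "x \<in> (\<Inter>n. B n)"
      have "\<exists>\<sigma>. (x, \<sigma>) \<in> C n" for n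
      proof -
        have "x \<in> fst ` C n" using x C(2) by auto
        then show ?thesis by auto
      qed
      then obtain \<sigma> where s: "\<And>n. (x, \<sigma> n) \<in> C n" by metis
      define \<tau> where "\<tau> j = (case prod_decode j of (n, k) \<Rightarrow> \<sigma> n k)" for j
      have "g n (x, \<tau>) = (x, \<sigma> n)" for n by (simp add: g_def \<tau>_def)
      then have "(x, \<tau>) \<in> (\<Inter>n. g n -` C n)" using s by auto
      then show "x \<in> fst ` (\<Inter>n. g n -` C n)" by (rule image_eqI[rotated]) simp
    next
      fix x \<sigma> n assume "(x, \<sigma>) \<in> (\<Inter>n. g n -` C n)"
      then have "g n (x, \<sigma>) \<in> C n" by auto
      then have "fst (g n (x, \<sigma>)) \<in> B n" unfolding C(2) by (rule imageI)
      then show "fst (x, \<sigma>) \<in> B n" by (simp add: g_def)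
    qed
  qed
qed

lemma open_eq_UN_closed:
  fixes S :: "'a::metric_space set"
  assumes "open S"
  obtains F :: "nat \<Rightarrow> 'a set" where "\<And>n. closed (F n)" "S = (\<Union>n. F n)"
proof (cases "S = UNIV")
  case True
  then show ?thesis using that[of "\<lambda>_. UNIV"] by auto
next
  case False
  define F where "F n = {x. infdist x (- S) \<ge> 1 / real (Suc n)}" for n
  have "closed (F n)" for n unfolding F_def by (intro closed_Collect_le continuous_intros)
  moreover have "S = (\<Union>n. F n)"
  proof safe
    fix x assume "x \<in> S"
    then have "infdist x (- S) > 0"
      using False assms by (subst infdist_pos_not_in_closed) auto
    then obtain n where "1 / real (Suc n) < infdist x (- S)" by (metis inverse_eq_divide reals_Archimedean)
    then show "x \<in> (\<Union>n. F n)" by (auto simp: F_def intro!: exI[of _ n])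
  next
    fix x n assume x: "x \<in> F n"
    show "x \<in> S"
    proof (rule ccontr)
      assume "x \<notin> S"
      then have "infdist x (- S) = 0" by (intro infdist_zero) auto
      then show False using x by (simp add: F_def)
    qed
  qed
  ultimately show ?thesis using that by blast
qed

text \<open>Analytic sets need not be closed under complement, so the induction carries the set
  together with its complement. Closed sets qualify because open sets are countable unions of closed
  ones.\<close>

lemma analytic_set_borel:
  fixes B :: "'a::metric_space set"
  assumes "B \<in> sets borel"
  shows "analytic_set B"
proof -
  have "B \<in> sigma_sets UNIV (Collect closed)" using assms unfolding borel_eq_closed by simp
  then have "analytic_set B \<and> analytic_set (- B)"
  proof induction
    case (Basic S)
    then have S: "closed S" by simp
    then obtain F where F: "\<And>n::nat. closed (F n)" "- S = (\<Union>n. F n)" using open_eq_UN_closed[of "- S"] by auto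
    have "analytic_set (- S)" unfolding F(2) by (intro analytic_set_UN analytic_set_closed F)
    then show ?case using analytic_set_closed[OF S] by simp
  next
    case Empty
    then show ?case using analytic_set_closed[of "{}"] analytic_set_closed[of UNIV] by simp
  next
    case (Compl S)
    then show ?case by (simp add: Compl_eq_Diff_UNIV[symmetric])
  next
    case (Union S)
    have "- (\<Union>i. S i) = (\<Inter>i. - S i)" by auto
    then show ?case using Union analytic_set_UN[of S] analytic_set_INT[of "\<lambda>i. - S i"] by simp
  qed
  then show ?thesis ..
qed

lemma compact_bounded_sequences: "compact {\<sigma> :: nat \<Rightarrow> nat. \<forall>i. \<sigma> i \<le> m i}"
proof -
  have "{\<sigma> :: nat \<Rightarrow> nat. \<forall>i. \<sigma> i \<le> m i} = (\<Pi>\<^sub>E i\<in>UNIV. {..m i})" by (auto simp: PiE_def)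
  moreover have "compactin (product_topology (\<lambda>i. euclidean) UNIV) (\<Pi>\<^sub>E i\<in>UNIV. {..m i})"
    by (subst compactin_PiE) (auto simp: compactin_euclidean_iff intro: finite_imp_compact)
  ultimately show ?thesis by (simp add: euclidean_product_topology)
qed

lemma tendsto_coordinatewise:
  fixes f :: "nat \<Rightarrow> nat \<Rightarrow> nat"
  assumes "\<And>i. (\<lambda>n. f n i) \<longlonglongrightarrow> l i"
  shows "f \<longlonglongrightarrow> l"
proof -
  have "limitin (product_topology (\<lambda>i. euclidean) UNIV) f l sequentially"
    using assms by (subst limitin_componentwise) auto
  then show ?thesis by (simp add: euclidean_product_topology)
qed

text \<open>The coordinates of the witness sequence are bounded one after the other; as the bound
  grows the sets increase, so some bound keeps the capacity above \<open>a\<close>. The sequences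
  obeying all bounds form a compact set, and \<open>K\<close> is the projection of a compact part of
  \<open>C\<close>. Every open neighbourhood of \<open>K\<close> already contains some stage
  \<open>E (f n)\<close>.\<close>

theorem choquet_capacitability:
  fixes c :: "'a::euclidean_space set \<Rightarrow> ennreal"
  assumes mono: "\<And>A B. A \<subseteq> B \<Longrightarrow> c A \<le> c B"
    and inc: "\<And>A a. incseq A \<Longrightarrow> (\<And>n::nat. c (A n) \<le> a) \<Longrightarrow> c (\<Union>n. A n) \<le> a"
    and B: "B \<in> sets borel" "bounded B" and a: "a < c B"
  obtains K where "compact K" "K \<subseteq> B" "\<And>U. open U \<Longrightarrow> K \<subseteq> U \<Longrightarrow> a < c U"
proof -
  obtain C :: "('a \<times> (nat \<Rightarrow> nat)) set" where C: "closed C" "B = fst ` C"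
    using analytic_set_borel[OF B(1)] unfolding analytic_set_def by blast
  obtain R where R: "\<And>x. x \<in> B \<Longrightarrow> norm x \<le> R" using B(2) unfolding bounded_iff by blast
  define E where "E l = fst ` {p\<in>C. \<forall>i<length l. snd p i \<le> l ! i}" for l
  have E0: "E [] = B" by (simp add: E_def C)
  have step: "\<exists>k. a < c (E (l @ [k]))" if l: "a < c (E l)" for l
  proof (rule ccontr)
    assume "\<nexists>k. a < c (E (l @ [k]))"
    then have le: "c (E (l @ [k])) \<le> a" for k by (simp add: not_less)
    have "incseq (\<lambda>k. E (l @ [k]))"
    proof (rule incseq_SucI)
      fix k
      have "{p\<in>C. \<forall>i<length (l @ [k]). snd p i \<le> (l @ [k]) ! i} \<subseteq> {p\<in>C. \<forall>i<length (l @ [Suc k]). snd p i \<le> (l @ [Suc k]) ! i}"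
        by (auto simp: nth_append split: if_splits)
      then show "E (l @ [k]) \<subseteq> E (l @ [Suc k])" unfolding E_def by (rule image_mono)
    qed
    then have "c (\<Union>k. E (l @ [k])) \<le> a" by (rule inc[OF _ le])
    moreover have "E l \<subseteq> (\<Union>k. E (l @ [k]))"
    proof
      fix x assume "x \<in> E l"
      then obtain p where p: "p \<in> C" "\<forall>i<length l. snd p i \<le> l ! i" "x = fst p" by (auto simp: E_def)
      have "\<forall>i<length (l @ [snd p (length l)]). snd p i \<le> (l @ [snd p (length l)]) ! i"
        using p by (auto simp: nth_append less_Suc_eq)
      then have "x \<in> E (l @ [snd p (length l)])" using p unfolding E_def by blast
      then show "x \<in> (\<Union>k. E (l @ [k]))" by blast
    qed
    ultimately show False using mono[of "E l" "\<Union>k. E (l @ [k])"] l by (meson not_le order_trans)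
  qed
  have "\<exists>f. \<forall>n. (length (f n) = n \<and> a < c (E (f n))) \<and> (\<exists>k. f (Suc n) = f n @ [k])"
  proof (rule dependent_nat_choice)
    show "\<exists>l. length l = 0 \<and> a < c (E l)" using a E0 by auto
    fix l n assume "length l = n \<and> a < c (E l)"
    then obtain k where "length l = n" "a < c (E (l @ [k]))" using step[of l] by blast
    then show "\<exists>l'. (length l' = Suc n \<and> a < c (E l')) \<and> (\<exists>k. l' = l @ [k])"
      by (intro exI[of _ "l @ [k]"]) auto
  qed
  then obtain f where f: "\<And>n. length (f n) = n" "\<And>n. a < c (E (f n))" "\<And>n. \<exists>k. f (Suc n) = f n @ [k]" by blast
  define m where "m i = f (Suc i) ! i" for i
  have fm: "f n ! i = m i" if "i < n" for i n
    using that
  proof (induction n)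
    case (Suc n)
    obtain k where k: "f (Suc n) = f n @ [k]" using f(3) by blast
    show ?case
    proof (cases "i < n")
      case True
      then show ?thesis using Suc k f(1)[of n] by (simp add: nth_append)
    next
      case False
      then have "i = n" using Suc by simp
      then show ?thesis by (simp add: m_def)
    qed
  qed simp
  define S where "S = {\<sigma> :: nat \<Rightarrow> nat. \<forall>i. \<sigma> i \<le> m i}"
  have S: "compact S" unfolding S_def by (rule compact_bounded_sequences)
  define X where "X = cball (0::'a) R \<times> S"
  have X: "compact X" unfolding X_def by (intro compact_Times compact_cball S)
  define K where "K = fst ` (C \<inter> X)"
  show ?thesis
  proof (rule that[of K])
    show "compact K" unfolding K_def
      by (intro compact_continuous_image closed_Int_compact C X continuous_intros)
    show "K \<subseteq> B" unfolding K_def C(2) by auto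
    fix U assume U: "open U" "K \<subseteq> U"
    have "\<exists>n. E (f n) \<subseteq> U"
    proof (rule ccontr)
      assume no: "\<nexists>n. E (f n) \<subseteq> U"
      have "\<exists>p. p \<in> C \<and> (\<forall>i<n. snd p i \<le> m i) \<and> fst p \<notin> U" for n
      proof -
        obtain x where x: "x \<in> E (f n)" "x \<notin> U" using no by blast
        then obtain p where "p \<in> C" "\<forall>i<n. snd p i \<le> f n ! i" "x = fst p" unfolding E_def f(1) by blast
        then show ?thesis using x(2) fm by (intro exI[of _ p]) auto
      qed
      then obtain p where p: "\<And>n. p n \<in> C" "\<And>n i. i < n \<Longrightarrow> snd (p n) i \<le> m i" "\<And>n. fst (p n) \<notin> U" by metis
      \<comment> \<open>The points \<open>p n\<close> obey only the first \<open>n\<close> bounds.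
        Cutting off the other coordinates puts them into the compact set \<open>X\<close>; each
        fixed coordinate is eventually unchanged, so the limit is also one of a subsequence of
        \<open>p\<close> and lies in \<open>C\<close>.\<close>
      define q where "q n = (fst (p n), \<lambda>i. min (snd (p n) i) (m i))" for n
      have qX: "q n \<in> X" for n
        using R[of "fst (p n)"] p(1)[of n] C(2) by (auto simp: X_def S_def q_def)
      then obtain y r where y: "y \<in> X" "strict_mono r" "(q \<circ> r) \<longlonglongrightarrow> y"
        using seq_compactE[OF compact_imp_seq_compact[OF X], of q] qX by blast
      have 1: "(\<lambda>n. fst (p (r n))) \<longlonglongrightarrow> fst y" using tendsto_fst[OF y(3)] by (simp add: q_def o_def)
      have "(\<lambda>n. snd (p (r n))) \<longlonglongrightarrow> snd y"
      proof (rule tendsto_coordinatewise)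
        fix i
        have c: "continuous_on UNIV (\<lambda>z :: 'a \<times> (nat \<Rightarrow> nat). snd z i)"
          by (intro continuous_on_coordinate continuous_intros)
        have "(\<lambda>n. snd ((q \<circ> r) n) i) \<longlonglongrightarrow> snd y i"
          by (rule continuous_on_tendsto_compose[OF c y(3)]) auto
        moreover have "\<forall>\<^sub>F n in sequentially. snd ((q \<circ> r) n) i = snd (p (r n)) i"
          using eventually_gt_at_top[of i]
        proof eventually_elim
          case (elim n)
          then have "i < r n" using seq_suble[OF y(2), of n] by simp
          then show ?case using p(2)[of i "r n"] by (simp add: q_def)
        qed
        ultimately show "(\<lambda>n. snd (p (r n)) i) \<longlonglongrightarrow> snd y i" by (rule Lim_transform_eventually)
      qed
      with 1 have "(\<lambda>n. (fst (p (r n)), snd (p (r n)))) \<longlonglongrightarrow> (fst y, snd y)" by (rule tendsto_Pair)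
      then have "y \<in> C" using closed_sequentially[OF C(1), of "\<lambda>n. p (r n)" y] p(1) by simp
      then have "fst y \<in> U" using y(1) U(2) unfolding K_def by auto
      moreover have "fst y \<in> - U"
        by (rule closed_sequentially[of "- U" "\<lambda>n. fst (p (r n))"]) (use U(1) p(3) 1 in auto)
      ultimately show False by simp
    qed
    then obtain n where "E (f n) \<subseteq> U" by blast
    then show "a < c U" using f(2)[of n] mono order_less_le_trans by blast
  qed
qed

section \<open>Frostman measures\<close>

definition basis_enum :: "nat \<Rightarrow> 'a::euclidean_space" where
  "basis_enum = (SOME h. bij_betw h {0..<DIM('a)} Basis)"

lemma basis_enum: "bij_betw basis_enum {0..<DIM('a)} (Basis :: 'a::euclidean_space set)"
  unfolding basis_enum_def using ex_bij_betw_nat_finite[OF finite_Basis] by (rule someI_ex)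

text \<open>The bits of the binary expansions of the coordinates of \<open>x - p\<close>, interleaved.\<close>

definition dyadic_bit :: "'a::euclidean_space \<Rightarrow> nat \<Rightarrow> 'a \<Rightarrow> bool" where
  "dyadic_bit p j x = odd \<lfloor>2 ^ Suc (j div DIM('a)) * ((x - p) \<bullet> basis_enum (j mod DIM('a)))\<rfloor>"

text \<open>The bits are invariant under integer translations, so cylinders repeat from box to box;
  within one box long codes force points to be close.\<close>

definition unit_box :: "'a::euclidean_space \<Rightarrow> 'a set" where
  "unit_box p = {x. \<forall>i\<in>Basis. 0 \<le> (x - p) \<bullet> i \<and> (x - p) \<bullet> i < 1}"

text \<open>One more bit, a parity, is exactly what the next dyadic level adds.\<close>

lemma floor_double:
  fixes r q :: real
  shows "\<lfloor>2 * r\<rfloor> = \<lfloor>2 * q\<rfloor> \<longleftrightarrow> \<lfloor>r\<rfloor> = \<lfloor>q\<rfloor> \<and> (odd \<lfloor>2 * r\<rfloor> \<longleftrightarrow> odd \<lfloor>2 * q\<rfloor>)"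
proof -
  have *: "\<lfloor>2 * r\<rfloor> = 2 * \<lfloor>r\<rfloor> + (if odd \<lfloor>2 * r\<rfloor> then 1 else 0)" for r :: real
  proof -
    have "\<lfloor>2 * r\<rfloor> = 2 * \<lfloor>r\<rfloor> \<or> \<lfloor>2 * r\<rfloor> = 2 * \<lfloor>r\<rfloor> + 1" by linarith
    then show ?thesis by auto
  qed
  show ?thesis
  proof
    assume eq: "\<lfloor>2 * r\<rfloor> = \<lfloor>2 * q\<rfloor>"
    then have "2 * \<lfloor>r\<rfloor> = 2 * \<lfloor>q\<rfloor>" using *[of r] *[of q] by presburger
    then show "\<lfloor>r\<rfloor> = \<lfloor>q\<rfloor> \<and> (odd \<lfloor>2 * r\<rfloor> \<longleftrightarrow> odd \<lfloor>2 * q\<rfloor>)" using eq by simp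
  next
    assume "\<lfloor>r\<rfloor> = \<lfloor>q\<rfloor> \<and> (odd \<lfloor>2 * r\<rfloor> \<longleftrightarrow> odd \<lfloor>2 * q\<rfloor>)"
    then show "\<lfloor>2 * r\<rfloor> = \<lfloor>2 * q\<rfloor>" using *[of r] *[of q] by presburger
  qed
qed

locale dyadic_tree =
  fixes p :: "'a::euclidean_space" and s :: real
  assumes s: "s > 0"
begin

text \<open>The weight is chosen so that a word of \<open>DIM('a) * k\<close> bits, describing a
  cube of side \<open>(1/2) ^ k\<close>, costs that side to the power \<open>s\<close>.\<close>

sublocale bit_tree "dyadic_bit p" "2 powr (- (s / DIM('a)))"
  using s powr_less_mono2_neg[of "- (s / DIM('a))" 1 2] by unfold_locales auto

lemma theta_pow: "(2 powr (- (s / DIM('a)))) ^ (DIM('a) * k) = ((1/2) ^ k) powr s"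
proof -
  have "(2 powr (- (s / DIM('a)))) ^ (DIM('a) * k) = 2 powr (- (s / DIM('a)) * real (DIM('a) * k))"
    by (simp add: powr_powr flip: powr_realpow)
  also have "- (s / DIM('a)) * real (DIM('a) * k) = - (real k * s)" by simp
  also have "2 powr (- (real k * s)) = (2 powr (- real k)) powr s" by (simp add: powr_powr)
  also have "2 powr (- real k) = (1/2) ^ k" by (simp add: powr_minus powr_realpow power_one_over inverse_eq_divide)
  finally show ?thesis .
qed

lemma code_add_iff: "code (n + m) x = code (n + m) y \<longleftrightarrow> code n x = code n y \<and> (\<forall>j<m. dyadic_bit p (n + j) x = dyadic_bit p (n + j) y)"
  by (induction m) (auto simp: less_Suc_eq)

text \<open>Inside the box, cylinders of these lengths are the half-open dyadic cubes of side
  \<open>(1/2) ^ k\<close>. The base case is where the box enters: all integer parts are 0.\<close>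

lemma code_iff:
  assumes "x \<in> unit_box p" "y \<in> unit_box p"
  shows "code (DIM('a) * k) x = code (DIM('a) * k) y \<longleftrightarrow>
    (\<forall>i\<in>Basis. \<lfloor>2 ^ k * ((x - p) \<bullet> i)\<rfloor> = \<lfloor>2 ^ k * ((y - p) \<bullet> i)\<rfloor>)"
proof (induction k)
  case 0
  have "\<lfloor>(x - p) \<bullet> i\<rfloor> = 0" "\<lfloor>(y - p) \<bullet> i\<rfloor> = 0" if "i \<in> Basis" for i
    using assms that by (auto simp: unit_box_def floor_eq_iff)
  then show ?case by simp
next
  case (Suc k)
  let ?d = "DIM('a)"
  let ?r = "\<lambda>x i. 2 ^ k * ((x - p) \<bullet> i)"
  have bit: "dyadic_bit p (?d * k + j) z = odd \<lfloor>2 * ?r z (basis_enum j)\<rfloor>" if "j < ?d" for j z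
  proof -
    have "(?d * k + j) div ?d = k" "(?d * k + j) mod ?d = j" using that by simp_all
    then show ?thesis by (simp add: dyadic_bit_def mult.assoc)
  qed
  have "code (?d * Suc k) x = code (?d * Suc k) y \<longleftrightarrow> code (?d * k + ?d) x = code (?d * k + ?d) y"
    by (simp add: add.commute)
  also have "\<dots> \<longleftrightarrow> (\<forall>i\<in>Basis. \<lfloor>?r x i\<rfloor> = \<lfloor>?r y i\<rfloor>) \<and> (\<forall>j<?d. odd \<lfloor>2 * ?r x (basis_enum j)\<rfloor> = odd \<lfloor>2 * ?r y (basis_enum j)\<rfloor>)"
    unfolding code_add_iff Suc by (auto simp: bit)
  also have "(\<forall>j<?d. odd \<lfloor>2 * ?r x (basis_enum j)\<rfloor> = odd \<lfloor>2 * ?r y (basis_enum j)\<rfloor>) \<longleftrightarrow>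
    (\<forall>i\<in>basis_enum ` {0..<?d}. odd \<lfloor>2 * ?r x i\<rfloor> = odd \<lfloor>2 * ?r y i\<rfloor>)" by auto
  also have "basis_enum ` {0..<?d} = (Basis :: 'a set)" using basis_enum by (rule bij_betw_imp_surj_on)
  also have "(\<forall>i\<in>Basis. \<lfloor>?r x i\<rfloor> = \<lfloor>?r y i\<rfloor>) \<and> (\<forall>i\<in>Basis. odd \<lfloor>2 * ?r x i\<rfloor> = odd \<lfloor>2 * ?r y i\<rfloor>) \<longleftrightarrow>
    (\<forall>i\<in>Basis. \<lfloor>2 * ?r x i\<rfloor> = \<lfloor>2 * ?r y i\<rfloor>)" using floor_double by blast
  finally show ?case by (simp add: mult.assoc)
qed

lemma code_eq_dist:
  assumes "x \<in> unit_box p" "y \<in> unit_box p" "code (DIM('a) * k) x = code (DIM('a) * k) y"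
  shows "dist x y \<le> DIM('a) * (1/2) ^ k"
proof -
  have "norm (x - y) \<le> (\<Sum>i\<in>Basis. \<bar>(x - y) \<bullet> i\<bar>)" by (rule norm_le_l1)
  also have "\<dots> \<le> (\<Sum>i\<in>(Basis::'a set). (1/2) ^ k)"
  proof (rule sum_mono)
    fix i :: 'a assume i: "i \<in> Basis"
    have "\<lfloor>2 ^ k * ((x - p) \<bullet> i)\<rfloor> = \<lfloor>2 ^ k * ((y - p) \<bullet> i)\<rfloor>" using assms code_iff i by blast
    then have "\<bar>2 ^ k * ((x - p) \<bullet> i) - 2 ^ k * ((y - p) \<bullet> i)\<bar> \<le> 1" by linarith
    moreover have "2 ^ k * ((x - p) \<bullet> i) - 2 ^ k * ((y - p) \<bullet> i) = 2 ^ k * ((x - y) \<bullet> i)"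
      by (simp add: inner_diff_left algebra_simps)
    ultimately have "2 ^ k * \<bar>(x - y) \<bullet> i\<bar> \<le> 1" by (simp add: abs_mult)
    then show "\<bar>(x - y) \<bullet> i\<bar> \<le> (1/2) ^ k" by (simp add: power_one_over field_simps)
  qed
  finally show ?thesis by (simp add: dist_norm)
qed

definition near_codes :: "nat \<Rightarrow> nat \<Rightarrow> 'a \<Rightarrow> bool list set" where
  "near_codes L k x = (\<lambda>y. code (DIM('a) * k) y) ` {y \<in> unit_box p. norm (y - x) \<le> L * (1/2) ^ k}"

lemma finite_near_codes: "finite (near_codes L k x)"
proof (rule finite_subset)
  show "near_codes L k x \<subseteq> {w. set w \<subseteq> UNIV \<and> length w = DIM('a) * k}" by (auto simp: near_codes_def)
  show "finite {w :: bool list. set w \<subseteq> UNIV \<and> length w = DIM('a) * k}" by (rule finite_lists_length_eq) simp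
qed

text \<open>A cube is represented by the integer vector of its rounded rescaled coordinates. These
  vectors lie in a lattice ball of radius \<open>L + DIM('a)\<close>, the second summand being the
  rounding error.\<close>

lemma card_near_codes: "card (near_codes L k x) \<le> (2 * (L + DIM('a)) + 3) ^ DIM('a)"
proof -
  let ?W = "near_codes L k x"
  define z where "z y = (\<Sum>i\<in>Basis. of_int \<lfloor>2 ^ k * ((y - p) \<bullet> i)\<rfloor> *\<^sub>R i)" for y
  have zi: "z y \<bullet> i = of_int \<lfloor>2 ^ k * ((y - p) \<bullet> i)\<rfloor>" if "i \<in> Basis" for y i
    using that by (simp add: z_def)
  have "\<forall>w\<in>?W. \<exists>y. y \<in> unit_box p \<and> norm (y - x) \<le> L * (1/2) ^ k \<and> code (DIM('a) * k) y = w"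
    by (auto simp: near_codes_def)
  then obtain y where y: "\<And>w. w \<in> ?W \<Longrightarrow> y w \<in> unit_box p" "\<And>w. w \<in> ?W \<Longrightarrow> norm (y w - x) \<le> L * (1/2) ^ k"
    "\<And>w. w \<in> ?W \<Longrightarrow> code (DIM('a) * k) (y w) = w" by metis
  have inj: "inj_on (\<lambda>w. z (y w)) ?W"
  proof (rule inj_onI)
    fix v w assume vw: "v \<in> ?W" "w \<in> ?W" "z (y v) = z (y w)"
    have "\<lfloor>2 ^ k * ((y v - p) \<bullet> i)\<rfloor> = \<lfloor>2 ^ k * ((y w - p) \<bullet> i)\<rfloor>" if "i \<in> Basis" for i
      using zi[OF that, of "y v"] zi[OF that, of "y w"] vw(3) by simp
    then have "code (DIM('a) * k) (y v) = code (DIM('a) * k) (y w)" using code_iff[OF y(1)[OF vw(1)] y(1)[OF vw(2)]] by blast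
    then show "v = w" using y(3) vw by simp
  qed
  have "card ((\<lambda>w. z (y w)) ` ?W) \<le> (2 * (L + DIM('a)) + 3) ^ DIM('a)"
  proof (rule card_lattice_ball[where x="2 ^ k *\<^sub>R (x - p)"])
    show "finite ((\<lambda>w. z (y w)) ` ?W)" using finite_near_codes by simp
    show "(\<lambda>w. z (y w)) ` ?W \<subseteq> lattice" by (auto simp: lattice_def zi)
    fix v assume "v \<in> (\<lambda>w. z (y w)) ` ?W"
    then obtain w where w: "w \<in> ?W" "v = z (y w)" by auto
    have 1: "norm (2 ^ k *\<^sub>R (x - y w)) \<le> L"
    proof -
      have "2 ^ k * norm (x - y w) \<le> 2 ^ k * (L * (1/2) ^ k)" using y(2)[OF w(1)] by (intro mult_left_mono) (auto simp: norm_minus_commute)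
      then show ?thesis by (simp add: power_one_over)
    qed
    have 2: "norm (2 ^ k *\<^sub>R (y w - p) - z (y w)) \<le> DIM('a)"
    proof -
      have "norm (2 ^ k *\<^sub>R (y w - p) - z (y w)) \<le> (\<Sum>i\<in>Basis. \<bar>(2 ^ k *\<^sub>R (y w - p) - z (y w)) \<bullet> i\<bar>)" by (rule norm_le_l1)
      also have "\<dots> \<le> (\<Sum>i\<in>(Basis::'a set). 1)"
      proof (rule sum_mono)
        fix i :: 'a assume i: "i \<in> Basis"
        have "(2 ^ k *\<^sub>R (y w - p) - z (y w)) \<bullet> i = 2 ^ k * ((y w - p) \<bullet> i) - of_int \<lfloor>2 ^ k * ((y w - p) \<bullet> i)\<rfloor>"
          by (simp only: inner_diff_left[of "2 ^ k *\<^sub>R (y w - p)"] inner_scaleR_left zi[OF i])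
        then show "\<bar>(2 ^ k *\<^sub>R (y w - p) - z (y w)) \<bullet> i\<bar> \<le> 1" by linarith
      qed
      finally show ?thesis by simp
    qed
    have eq: "2 ^ k *\<^sub>R (x - p) - v = 2 ^ k *\<^sub>R (x - y w) + (2 ^ k *\<^sub>R (y w - p) - z (y w))" by (simp add: w(2) algebra_simps)
    have "norm (2 ^ k *\<^sub>R (x - p) - v) \<le> real L + real DIM('a)" unfolding eq by (rule norm_triangle_mono[OF 1 2])
    then show "norm (2 ^ k *\<^sub>R (x - p) - v) \<le> real (L + DIM('a))" by simp
  qed
  then show ?thesis by (simp add: card_image[OF inj])
qed

lemma emeasure_cost_near_codes:
  "emeasure cost (near_codes L k x) \<le> ennreal (real ((2 * (L + DIM('a)) + 3) ^ DIM('a)) * ((1/2) ^ k) powr s)"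
proof -
  have "emeasure cost (near_codes L k x) = (\<Sum>w\<in>near_codes L k x. ennreal (((1/2) ^ k) powr s))"
    unfolding cost_finite[OF finite_near_codes] by (rule sum.cong) (auto simp: near_codes_def theta_pow)
  also have "\<dots> = ennreal (real (card (near_codes L k x)) * ((1/2) ^ k) powr s)" by (simp add: ennreal_mult ennreal_of_nat_eq_real_of_nat)
  also have "\<dots> \<le> ennreal (real ((2 * (L + DIM('a)) + 3) ^ DIM('a)) * ((1/2) ^ k) powr s)"
    using card_near_codes[of L k x] by (intro ennreal_leI mult_right_mono) (simp_all only: of_nat_le_iff powr_ge_zero)
  finally show ?thesis .
qed

text \<open>Cylinders are not open, so covers of \<open>K\<close> are fattened to neighbouring cylinders before the
  open sets around \<open>K\<close> are compared with it.\<close>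

lemma net_compact_pos:
  assumes K: "K \<subseteq> unit_box p" and a: "0 < a" and open_bd: "\<And>U. open U \<Longrightarrow> K \<subseteq> U \<Longrightarrow> a < net (U \<inter> unit_box p)"
  shows "net K > 0"
proof (rule ccontr)
  assume "\<not> net K > 0"
  then have K0: "net K = 0" by simp
  let ?d = "DIM('a)"
  \<comment> \<open>The number of neighbouring codes, times \<open>2 powr s\<close> for rounding the
    length of a word down to a multiple of the dimension.\<close>
  define N where "N = real ((2 * (2 * ?d + ?d) + 3) ^ ?d) * 2 powr s"
  have N: "N > 0" by (simp add: N_def)
  obtain b where b: "b > 0" "ennreal b \<le> a"
  proof (cases a rule: ennreal_cases)
    case (real r)
    then show ?thesis using that[of r] a by (auto simp: zero_less_iff_neq_zero)
  next
    case top
    then show ?thesis using that[of 1] by simp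
  qed
  obtain \<U> where U: "K \<subseteq> covers \<U>" "emeasure cost \<U> \<le> net K + ennreal (b / N)" using net_coverE[of "b / N"] b N by auto
  define \<U>' where "\<U>' = {w\<in>\<U>. cyl w \<inter> K \<noteq> {}}"
  have "\<forall>w\<in>\<U>'. \<exists>x. x \<in> cyl w \<inter> K" unfolding \<U>'_def by blast
  then obtain x where x: "\<And>w. w \<in> \<U>' \<Longrightarrow> x w \<in> cyl w" "\<And>w. w \<in> \<U>' \<Longrightarrow> x w \<in> K" by (metis Int_iff)
  define k where "k w = length w div ?d" for w :: "bool list"
  have kl: "?d * k w \<le> length w" "length w < ?d * Suc (k w)" for w
    using dividend_less_times_div[of ?d "length w"] by (simp_all add: k_def)
  \<comment> \<open>Within the box the cylinder of \<open>w\<close> has diameter at most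
    \<open>?d * (1/2) ^ k w\<close>; the doubled radius puts its points of \<open>K\<close> into the
    open ball.\<close>
  define G where "G = (\<Union>w\<in>\<U>'. ball (x w) (2 * ?d * (1/2) ^ k w))"
  have "K \<subseteq> G"
  proof
    fix y assume y: "y \<in> K"
    then obtain w where w: "w \<in> \<U>" "y \<in> cyl w" using U(1) by (auto simp: covers_def)
    then have w': "w \<in> \<U>'" using y by (auto simp: \<U>'_def)
    have "code (length w) (x w) = code (length w) y" using x(1)[OF w'] w by (simp add: cyl_def)
    then have "code (?d * k w) (x w) = code (?d * k w) y" by (rule code_mono[OF kl(1)])
    then have "dist (x w) y \<le> ?d * (1/2) ^ k w" using x(2)[OF w'] y K by (intro code_eq_dist) auto
    also have "\<dots> < 2 * ?d * (1/2) ^ k w" by simp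
    finally show "y \<in> G" using w' by (auto simp: G_def)
  qed
  moreover have "open G" unfolding G_def by auto
  ultimately have lt: "a < net (G \<inter> unit_box p)" by (intro open_bd)
  define F where "F w = near_codes (2 * ?d) (k w) (x w)" for w
  have "G \<inter> unit_box p \<subseteq> covers (\<Union>w\<in>\<U>'. F w)"
  proof
    fix y assume y: "y \<in> G \<inter> unit_box p"
    then obtain w where w: "w \<in> \<U>'" "dist (x w) y < 2 * ?d * (1/2) ^ k w" by (auto simp: G_def)
    then have "code (?d * k w) y \<in> F w" using y unfolding F_def near_codes_def by (intro imageI) (auto simp: dist_norm norm_minus_commute)
    then show "y \<in> covers (\<Union>w\<in>\<U>'. F w)" using w code_in_cyl unfolding covers_def by blast
  qed
  then have "net (G \<inter> unit_box p) \<le> emeasure cost (\<Union>w\<in>\<U>'. F w)" by (rule net_le)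
  also have "(\<Union>w\<in>\<U>'. F w) = (\<Union>i. \<Union>w\<in>{w\<in>\<U>'. to_nat w = i}. F w)" by auto
  also have "emeasure cost \<dots> \<le> (\<Sum>i. emeasure cost (\<Union>w\<in>{w\<in>\<U>'. to_nat w = i}. F w))"
    by (rule emeasure_subadditive_countably) auto
  also have "\<dots> \<le> (\<Sum>i. ennreal N * emeasure cost {w\<in>\<U>'. to_nat w = i})"
  proof (intro suminf_le summableI)
    fix i
    show "emeasure cost (\<Union>w\<in>{w\<in>\<U>'. to_nat w = i}. F w) \<le> ennreal N * emeasure cost {w\<in>\<U>'. to_nat w = i}"
    proof (cases "{w\<in>\<U>'. to_nat w = i} = {}")
      case False
      then obtain w where w: "w \<in> \<U>'" "to_nat w = i" by auto
      then have eq: "{w\<in>\<U>'. to_nat w = i} = {w}" by (auto dest: injD[OF inj_to_nat])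
      have "((1/2) ^ k w) powr s = 2 powr s * ((1/2) ^ Suc (k w)) powr s" by (simp add: powr_mult[symmetric])
      also have "((1/2) ^ Suc (k w)) powr s \<le> (2 powr (- (s / ?d))) ^ length w"
        unfolding theta_pow[symmetric] using kl(2)[of w] theta by (intro power_decreasing) auto
      finally have le: "((1/2) ^ k w) powr s \<le> 2 powr s * (2 powr (- (s / ?d))) ^ length w" by simp
      have "emeasure cost (F w) \<le> ennreal (real ((2 * (2 * ?d + ?d) + 3) ^ ?d) * ((1/2) ^ k w) powr s)"
        unfolding F_def by (rule emeasure_cost_near_codes)
      also have "\<dots> \<le> ennreal (real ((2 * (2 * ?d + ?d) + 3) ^ ?d) * (2 powr s * (2 powr (- (s / ?d))) ^ length w))"
        by (intro ennreal_leI mult_left_mono le) simp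
      also have "\<dots> = ennreal N * ennreal ((2 powr (- (s / ?d))) ^ length w)"
        using N by (simp add: N_def ennreal_mult[symmetric] mult.assoc)
      finally show ?thesis unfolding eq by (simp add: cost_finite)
    next
      case True
      then show ?thesis by (simp only: True) simp
    qed
  qed
  also have "\<dots> = ennreal N * (\<Sum>i. emeasure cost {w\<in>\<U>'. to_nat w = i})" by simp
  also have "(\<Sum>i. emeasure cost {w\<in>\<U>'. to_nat w = i}) = emeasure cost (\<Union>i. {w\<in>\<U>'. to_nat w = i})"
    by (rule suminf_emeasure) (auto simp: disjoint_family_on_def)
  also have "(\<Union>i. {w\<in>\<U>'. to_nat w = i}) = \<U>'" by auto
  also have "emeasure cost \<U>' \<le> emeasure cost \<U>" by (rule emeasure_mono) (auto simp: \<U>'_def)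
  also have "\<dots> \<le> ennreal (b / N)" using U(2) K0 by simp
  also have "ennreal N * ennreal (b / N) = ennreal b" using N b by (simp add: ennreal_mult[symmetric])
  finally have "net (G \<inter> unit_box p) \<le> ennreal b" by (simp add: mult_left_mono)
  then show False using lt b(2) by simp
qed

lemma node_cyl_mono: "m \<le> n \<Longrightarrow> cyl (node A n u) \<subseteq> cyl (node A m u)"
  by (induction n rule: dec_induct) (auto simp: cyl_Cons)

text \<open>For \<open>u\<close> in \<open>[0, M)\<close> the nodes containing \<open>u\<close> have
  positive mass, hence meet \<open>K\<close>, and the chosen points converge to \<open>f u\<close>
  in \<open>K\<close>; the measure is the image of Lebesgue measure under \<open>f\<close>. The
  limit may leave the half-open cylinders, so a ball is compared with all codes near it: their
  number is bounded, and each carries mass at most \<open>\<theta>\<close> to its length.\<close>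

theorem frostman:
  assumes K: "compact K" "K \<subseteq> unit_box p" "net K > 0"
  obtains \<mu> C where "sets \<mu> = sets borel" "emeasure \<mu> (- K) = 0" "0 < emeasure \<mu> UNIV" "emeasure \<mu> UNIV \<le> 1" "C \<ge> 0"
    "\<And>x r. r > 0 \<Longrightarrow> emeasure \<mu> (cball x r) \<le> ennreal (C * r powr s)"
proof -
  let ?d = "DIM('a)"
  define M where "M = mass K []"
  have M: "0 < M" "M \<le> 1"
  proof -
    have "ennreal M = net K" using ennreal_node_net[of K "[]"] by (simp add: M_def)
    then have "0 < ennreal M" "ennreal M \<le> 1" using K(3) net_le_1[of K] by simp_all
    then show "0 < M" "M \<le> 1" by (simp_all add: ennreal_le_1)
  qed
  define pt where "pt w = (SOME x. x \<in> K \<inter> cyl w)" for w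
  have pt: "pt (node K n u) \<in> K \<inter> cyl (node K n u)" if u: "0 \<le> u" "u < M" for n u
  proof -
    have "mass K (node K n u) > 0" using node_interval[of u K n] u by (simp add: M_def)
    then have "node_net K (node K n u) > 0" using mass_bounds[of K "node K n u"] by linarith
    then have "K \<inter> cyl (node K n u) \<noteq> {}" unfolding node_net_def by (metis enn2real_0 less_irrefl net_empty)
    then show ?thesis unfolding pt_def by (metis ex_in_conv someI_ex)
  qed
  \<comment> \<open>The value \<open>p\<close> outside \<open>[0, M)\<close> is a default on a set
    that \<open>\<nu>\<close> does not charge.\<close>
  define g where "g n u = (if 0 \<le> u \<and> u < M then pt (node K n u) else p)" for n u
  have g_dist: "dist (g n u) (g m u) \<le> ?d * (1/2) ^ k" if "?d * k \<le> n" "?d * k \<le> m" for n m k u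
  proof (cases "0 \<le> u \<and> u < M")
    case True
    then have a: "pt (node K n u) \<in> K \<inter> cyl (node K n u)" "pt (node K m u) \<in> K \<inter> cyl (node K m u)" using pt by auto
    have "pt (node K n u) \<in> cyl (node K (?d * k) u)" "pt (node K m u) \<in> cyl (node K (?d * k) u)"
      using a node_cyl_mono[OF that(1)] node_cyl_mono[OF that(2)] by blast+
    then have "code (?d * k) (pt (node K n u)) = code (?d * k) (pt (node K m u))" by (simp add: cyl_def)
    then have "dist (pt (node K n u)) (pt (node K m u)) \<le> ?d * (1/2) ^ k"
      using a K(2) by (intro code_eq_dist) auto
    then show ?thesis using True by (simp add: g_def)
  qed (auto simp: g_def)
  have half0: "(\<lambda>k. ?d * (1/2::real) ^ k) \<longlonglongrightarrow> 0"
    by (intro tendsto_mult_right_zero LIMSEQ_realpow_zero) auto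
  have "Cauchy (\<lambda>n. g n u)" for u
  proof (rule metric_CauchyI)
    fix e :: real assume "e > 0"
    then have "\<forall>\<^sub>F k in sequentially. ?d * (1/2::real) ^ k < e" using half0 by (intro order_tendstoD)
    then obtain k where k: "?d * (1/2::real) ^ k < e" by (auto simp: eventually_sequentially)
    show "\<exists>M. \<forall>m\<ge>M. \<forall>n\<ge>M. dist (g m u) (g n u) < e"
      by (intro exI[of _ "?d * k"] allI impI order.strict_trans1[OF g_dist k])
  qed
  then have "convergent (\<lambda>n. g n u)" for u by (rule Cauchy_convergent)
  then obtain f where f: "\<And>u. (\<lambda>n. g n u) \<longlonglongrightarrow> f u" unfolding convergent_def by metis
  have g_f: "dist (g (?d * k) u) (f u) \<le> ?d * (1/2) ^ k" for k u
  proof (rule tendsto_le[OF sequentially_bot tendsto_const])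
    show "(\<lambda>n. dist (g (?d * k) u) (g n u)) \<longlonglongrightarrow> dist (g (?d * k) u) (f u)" by (intro tendsto_dist tendsto_const f)
    show "\<forall>\<^sub>F n in sequentially. dist (g (?d * k) u) (g n u) \<le> ?d * (1/2) ^ k"
      using eventually_ge_at_top[of "?d * k"] by eventually_elim (rule g_dist, auto)
  qed
  have g_meas[measurable]: "g n \<in> borel_measurable borel" for n
  proof -
    have [measurable]: "(\<lambda>u. pt (node K n u)) \<in> borel_measurable borel"
      by (rule measurable_compose[OF node_measurable]) simp
    show ?thesis unfolding g_def by measurable
  qed
  have f_meas[measurable]: "f \<in> borel_measurable borel" by (rule borel_measurable_LIMSEQ_metric[OF g_meas f])
  have fK: "f u \<in> K" if "0 \<le> u" "u < M" for u
    by (rule closed_sequentially[OF compact_imp_closed[OF K(1)] _ f]) (use that pt in \<open>simp add: g_def\<close>)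
  define \<nu> where "\<nu> = density lborel (\<lambda>u. indicator {0..<M} u :: ennreal)"
  define \<mu> where "\<mu> = distr \<nu> borel f"
  have nu: "emeasure \<nu> S = emeasure lborel ({0..<M} \<inter> S)" if "S \<in> sets borel" for S
    unfolding \<nu>_def using that by (subst emeasure_density) (auto simp: indicator_inter_arith[symmetric])
  have mu: "emeasure \<mu> S = emeasure lborel ({0..<M} \<inter> f -` S)" if "S \<in> sets borel" for S
  proof -
    have S: "f -` S \<in> sets borel" using measurable_sets_borel[OF f_meas that] .
    have "f \<in> \<nu> \<rightarrow>\<^sub>M borel" "space \<nu> = UNIV" by (simp_all add: \<nu>_def)
    then show ?thesis unfolding \<mu>_def using that by (simp add: emeasure_distr nu[OF S])
  qed
  have mu_le: "emeasure \<mu> S \<le> 1" if "S \<in> sets borel" for S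
  proof -
    have "emeasure \<mu> S \<le> emeasure lborel {0..<M}" unfolding mu[OF that] by (rule emeasure_mono) auto
    also have "\<dots> \<le> 1" using M by simp
    finally show ?thesis .
  qed
  define N where "N = real ((2 * ((1 + ?d) + ?d) + 3) ^ ?d)"
  have N: "N \<ge> 0" by (simp add: N_def)
  show ?thesis
  proof (rule that[of \<mu> "N * 2 powr s + 1"])
    show "sets \<mu> = sets borel" by (simp add: \<mu>_def)
    have "{0..<M} \<inter> f -` (- K) = {}" using fK by auto
    then show "emeasure \<mu> (- K) = 0" using compact_imp_closed[OF K(1)] by (subst mu) auto
    show "0 < emeasure \<mu> UNIV" using M by (subst mu) auto
    show "emeasure \<mu> UNIV \<le> 1" by (rule mu_le) simp
    show "N * 2 powr s + 1 \<ge> 0" using N by simp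
    fix x r assume r: "(r::real) > 0"
    show "emeasure \<mu> (cball x r) \<le> ennreal ((N * 2 powr s + 1) * r powr s)"
    proof (cases "r \<le> 1")
      \<comment> \<open>For radii above 1 the total mass is at most 1, which is why the constant has
        the summand 1.\<close>
      case False
      have "1 \<le> r powr s" using False s by (intro ge_one_powr_ge_zero) auto
      then have "1 * 1 \<le> (N * 2 powr s + 1) * r powr s" using N by (intro mult_mono) auto
      then have "1 \<le> ennreal ((N * 2 powr s + 1) * r powr s)"
        by (subst ennreal_1[symmetric]) (intro ennreal_leI, simp)
      moreover have "emeasure \<mu> (cball x r) \<le> 1" by (rule mu_le) simp
      ultimately show ?thesis by (rule order_trans[rotated])
    next
      case True
      obtain k where k: "(1/2) ^ Suc k < r" "r \<le> (1/2) ^ k" using dyadic_scale_below[OF r True] by blast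
      \<comment> \<open>In units of \<open>(1/2) ^ k\<close>: 1 for the radius \<open>r\<close>, and
        \<open>?d\<close> for the distance between \<open>f u\<close> and its approximation at level
        \<open>?d * k\<close>.\<close>
      let ?W = "near_codes (1 + ?d) k x"
      have "{0..<M} \<inter> f -` cball x r \<subseteq> (\<Union>w\<in>?W. {left_end K w ..< left_end K w + mass K w})"
      proof
        fix u assume u: "u \<in> {0..<M} \<inter> f -` cball x r"
        then have u': "0 \<le> u" "u < M" "dist x (f u) \<le> r" by auto
        define y where "y = pt (node K (?d * k) u)"
        have y: "y \<in> K" "code (?d * k) y = node K (?d * k) u" using pt[OF u'(1,2), of "?d * k"] by (auto simp: y_def cyl_def)
        have "dist y (f u) \<le> ?d * (1/2) ^ k" using g_f[of k u] u' by (simp add: g_def y_def)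
        then have "dist y x \<le> ?d * (1/2) ^ k + (1/2) ^ k"
          using dist_triangle[of y x "f u"] u'(3) k(2) by (simp add: dist_commute)
        then have "node K (?d * k) u \<in> ?W" unfolding near_codes_def y(2)[symmetric] using y K(2)
          by (intro imageI) (auto simp: dist_norm algebra_simps)
        then show "u \<in> (\<Union>w\<in>?W. {left_end K w ..< left_end K w + mass K w})"
          using node_interval[of u K "?d * k"] u' by (auto simp: M_def)
      qed
      then have "emeasure \<mu> (cball x r) \<le> emeasure lborel (\<Union>w\<in>?W. {left_end K w ..< left_end K w + mass K w})"
        by (subst mu) (auto intro!: emeasure_mono finite_near_codes)
      also have "\<dots> \<le> (\<Sum>w\<in>?W. emeasure lborel {left_end K w ..< left_end K w + mass K w})"
        by (rule emeasure_subadditive_finite[OF finite_near_codes]) auto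
      also have "\<dots> = (\<Sum>w\<in>?W. ennreal (mass K w))"
        using mass_bounds[of K] by (intro sum.cong) auto
      also have "\<dots> \<le> (\<Sum>w\<in>?W. ennreal ((2 powr (- (s / ?d))) ^ length w))"
        using mass_bounds[of K] node_net_le[of K] by (intro sum_mono ennreal_leI) (meson order_trans)
      also have "\<dots> = emeasure cost ?W" by (simp add: cost_finite finite_near_codes)
      also have "\<dots> \<le> ennreal (N * ((1/2) ^ k) powr s)" unfolding N_def by (rule emeasure_cost_near_codes)
      also have "\<dots> \<le> ennreal ((N * 2 powr s + 1) * r powr s)"
      proof (rule ennreal_leI)
        have "((1/2) ^ k) powr s \<le> (2 * r) powr s" using k s by (intro powr_mono2) auto
        also have "\<dots> = 2 powr s * r powr s" using r by (simp add: powr_mult)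
        finally have "N * ((1/2) ^ k) powr s \<le> N * (2 powr s * r powr s)" using N by (rule mult_left_mono)
        also have "\<dots> \<le> (N * 2 powr s + 1) * r powr s" by (simp add: algebra_simps)
        finally show "N * ((1/2) ^ k) powr s \<le> (N * 2 powr s + 1) * r powr s" .
      qed
      finally show ?thesis .
    qed
  qed
qed

end

section \<open>From positive Hausdorff measure to a compact set of positive net content\<close>

context dyadic_tree
begin

text \<open>The content \<open>net\<close> imposes no restriction on the size of cylinders, but a
  small total cost makes every single diameter small. Hence a null content yields covers as fine as
  the Hausdorff measure demands; the second entry of \<open>b\<close> is chosen for this.\<close>

lemma small_cover_of_net_0:
  assumes A: "A \<subseteq> unit_box p" "net A = 0" and e: "e > 0" and \<delta>: "\<delta> > 0"
  obtains S :: "nat \<Rightarrow> 'a set" where "A \<subseteq> (\<Union>i. S i)" "\<And>i. bounded (S i)" "\<And>i. diameter (S i) \<le> \<delta>"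
    "(\<Sum>i. ennreal (diameter (S i) powr s)) \<le> ennreal e"
proof -
  let ?d = "DIM('a)" and ?\<theta> = "2 powr (- (s / DIM('a)))"
  define N where "N = (2 * real ?d) powr s"
  have N: "N > 0" by (simp add: N_def)
  define b where "b = min (e / N) (\<delta> powr s / N)"
  have b: "b > 0" "N * b \<le> e" "N * b \<le> \<delta> powr s" using e \<delta> N by (auto simp: b_def min_def field_simps)
  obtain U where U: "A \<subseteq> covers U" "emeasure cost U \<le> net A + ennreal b" using net_coverE[OF b(1)] by auto
  then have cb: "emeasure cost U \<le> ennreal b" using A(2) by simp
  define S where "S i = (\<Union>w\<in>{w\<in>U. to_nat w = i}. cyl w \<inter> unit_box p)" for i
  have single: "{w\<in>U. to_nat w = to_nat v} = {v}" if "v \<in> U" for v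
    using that by (auto dest: injD[OF inj_to_nat])
  have Sw: "S (to_nat w) = cyl w \<inter> unit_box p" if "w \<in> U" for w unfolding S_def single[OF that] by simp
  have diam: "bounded (cyl w \<inter> unit_box p) \<and> diameter (cyl w \<inter> unit_box p) powr s \<le> N * ?\<theta> ^ length w" for w
  proof -
    define k where "k = length w div ?d"
    have k: "?d * k \<le> length w" "length w < ?d * Suc k"
      using dividend_less_times_div[of ?d "length w"] by (simp_all add: k_def)
    have dist: "dist x y \<le> ?d * (1/2) ^ k" if "x \<in> cyl w \<inter> unit_box p" "y \<in> cyl w \<inter> unit_box p" for x y
    proof (rule code_eq_dist)
      have "code (length w) x = code (length w) y" using that by (simp add: cyl_def)
      then show "code (?d * k) x = code (?d * k) y" by (rule code_mono[OF k(1)])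
    qed (use that in auto)
    have bd: "bounded (cyl w \<inter> unit_box p)"
    proof (cases "cyl w \<inter> unit_box p = {}")
      case False
      then obtain x where "x \<in> cyl w \<inter> unit_box p" by blast
      then show ?thesis using dist unfolding bounded_def by blast
    qed (simp only: bounded_empty)
    have "diameter (cyl w \<inter> unit_box p) \<le> ?d * (1/2) ^ k" using dist by (intro diameter_le) (auto simp: dist_norm)
    also have "\<dots> = (2 * ?d) * (1/2) ^ Suc k" by simp
    finally have "diameter (cyl w \<inter> unit_box p) powr s \<le> ((2 * ?d) * (1/2) ^ Suc k) powr s"
      using diameter_ge_0[OF bd] s by (intro powr_mono2) auto
    also have "\<dots> = N * ((1/2) ^ Suc k) powr s" unfolding N_def by (subst powr_mult) auto
    also have "\<dots> \<le> N * ?\<theta> ^ length w"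
      unfolding theta_pow[symmetric] using N k(2) theta by (intro mult_left_mono power_decreasing) auto
    finally show ?thesis using bd by blast
  qed
  have Sd: "ennreal (diameter (S i) powr s) \<le> ennreal N * emeasure cost {w\<in>U. to_nat w = i}" and Sb: "bounded (S i)" for i
  proof -
    have "ennreal (diameter (S i) powr s) \<le> ennreal N * emeasure cost {w\<in>U. to_nat w = i} \<and> bounded (S i)"
    proof (cases "{w\<in>U. to_nat w = i} = {}")
      case True
      then show ?thesis unfolding S_def by (simp only: True) simp
    next
      case False
      then obtain w where w: "w \<in> U" "to_nat w = i" by auto
      have "ennreal (diameter (S i) powr s) \<le> ennreal (N * ?\<theta> ^ length w)"
        using diam[of w] Sw[OF w(1)] w(2) by (intro ennreal_leI) simp
      also have "\<dots> = ennreal N * emeasure cost {w\<in>U. to_nat w = i}"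
        using N single[OF w(1)] w(2) by (simp add: cost_finite ennreal_mult)
      finally show ?thesis using diam[of w] Sw[OF w(1)] w(2) by simp
    qed
    then show "ennreal (diameter (S i) powr s) \<le> ennreal N * emeasure cost {w\<in>U. to_nat w = i}" "bounded (S i)" by auto
  qed
  have NU: "ennreal N * emeasure cost V \<le> ennreal (N * b)" if "V \<subseteq> U" for V
  proof -
    have "emeasure cost V \<le> ennreal b" using emeasure_mono[OF that, of cost] cb by simp
    then show ?thesis using N b(1) by (simp add: ennreal_mult mult_left_mono)
  qed
  show ?thesis
  proof (rule that[of S])
    show "A \<subseteq> (\<Union>i. S i)"
    proof
      fix x assume x: "x \<in> A"
      then obtain w where "w \<in> U" "x \<in> cyl w" using U(1) by (auto simp: covers_def)
      then have "x \<in> S (to_nat w)" using x A(1) Sw by auto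
      then show "x \<in> (\<Union>i. S i)" by blast
    qed
    show "bounded (S i)" for i by (rule Sb)
    show "diameter (S i) \<le> \<delta>" for i
    proof -
      have "ennreal (diameter (S i) powr s) \<le> ennreal (N * b)" by (rule order_trans[OF Sd NU]) auto
      then have "diameter (S i) powr s \<le> \<delta> powr s" using b N by (subst (asm) ennreal_le_iff) auto
      then show ?thesis using s \<delta> diameter_ge_0[OF Sb[of i]] by (meson not_le powr_less_mono2 less_imp_le)
    qed
    have "(\<Sum>i. ennreal (diameter (S i) powr s)) \<le> (\<Sum>i. ennreal N * emeasure cost {w\<in>U. to_nat w = i})"
      by (intro suminf_le summableI Sd)
    also have "\<dots> = ennreal N * (\<Sum>i. emeasure cost {w\<in>U. to_nat w = i})" by simp
    also have "(\<Sum>i. emeasure cost {w\<in>U. to_nat w = i}) = emeasure cost (\<Union>i. {w\<in>U. to_nat w = i})"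
      by (rule suminf_emeasure) (auto simp: disjoint_family_on_def)
    also have "ennreal N * \<dots> \<le> ennreal (N * b)" by (rule NU) auto
    also have "\<dots> \<le> ennreal e" by (intro ennreal_leI b)
    finally show "(\<Sum>i. ennreal (diameter (S i) powr s)) \<le> ennreal e" .
  qed
qed

lemma unit_box_measurable: "unit_box p \<in> sets borel"
  unfolding unit_box_def by measurable

lemma bounded_unit_box: "bounded (unit_box p)"
proof -
  have "norm x \<le> norm p + DIM('a)" if "x \<in> unit_box p" for x
  proof -
    have "norm (x - p) \<le> (\<Sum>i\<in>Basis. \<bar>(x - p) \<bullet> i\<bar>)" by (rule norm_le_l1)
    also have "\<dots> \<le> (\<Sum>i\<in>(Basis::'a set). 1)" using that by (intro sum_mono) (auto simp: unit_box_def)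
    finally show ?thesis using norm_triangle_ineq[of "x - p" p] by simp
  qed
  then show ?thesis by (auto simp: bounded_iff)
qed

lemma compact_subset_net_pos:
  assumes E: "E \<in> sets borel" and pos: "net (E \<inter> unit_box p) > 0"
  obtains K where "compact K" "K \<subseteq> E \<inter> unit_box p" "net K > 0"
proof -
  obtain a where a: "0 < a" "a < net (E \<inter> unit_box p)" using dense[OF pos] by blast
  define c where "c A = net (A \<inter> unit_box p)" for A
  show thesis
  proof (rule choquet_capacitability[of c "E \<inter> unit_box p" a])
    show "c A \<le> c B" if "A \<subseteq> B" for A B unfolding c_def using that by (intro net_mono) auto
    show "c (\<Union>n. A n) \<le> b" if A: "incseq A" "\<And>n::nat. c (A n) \<le> b" for A b
    proof -
      have "incseq (\<lambda>n. A n \<inter> unit_box p)" using A(1) unfolding incseq_def by blast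
      then have "net (\<Union>n. A n \<inter> unit_box p) \<le> b" by (rule net_incseq) (use A(2) in \<open>simp add: c_def\<close>)
      moreover have "(\<Union>n. A n \<inter> unit_box p) = (\<Union>n. A n) \<inter> unit_box p" by blast
      ultimately show ?thesis by (simp only: c_def)
    qed
    show "E \<inter> unit_box p \<in> sets borel" using E unit_box_measurable by auto
    show "bounded (E \<inter> unit_box p)" using bounded_unit_box by (rule bounded_subset) auto
    show "a < c (E \<inter> unit_box p)" using a(2) by (simp add: c_def Int_assoc)
    fix K assume K: "compact K" "K \<subseteq> E \<inter> unit_box p" and U: "\<And>U. open U \<Longrightarrow> K \<subseteq> U \<Longrightarrow> a < c U"
    have "net K > 0" by (rule net_compact_pos[OF _ a(1)]) (use K U in \<open>auto simp: c_def\<close>)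
    with K show thesis by (rule that)
  qed
qed

end

lemma unit_boxes_cover:
  obtains P :: "nat \<Rightarrow> 'a::euclidean_space" where "(\<Union>n. unit_box (P n)) = UNIV"
proof -
  define Q where "Q l = (\<Sum>j<DIM('a). of_int (l ! j) *\<^sub>R (basis_enum j :: 'a))" for l :: "int list"
  have inB: "basis_enum j \<in> (Basis :: 'a set)" if "j < DIM('a)" for j
    using bij_betw_apply[OF basis_enum] that by auto
  have "\<exists>n. x \<in> unit_box (Q (from_nat n))" for x :: 'a
  proof -
    define l where "l = map (\<lambda>j. \<lfloor>x \<bullet> basis_enum j\<rfloor>) [0..<DIM('a)]"
    have "Q l \<bullet> basis_enum j = of_int \<lfloor>x \<bullet> basis_enum j\<rfloor>" if j: "j < DIM('a)" for j
    proof -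
      have "Q l \<bullet> basis_enum j = (\<Sum>i<DIM('a). of_int (l ! i) * ((basis_enum i :: 'a) \<bullet> basis_enum j))"
        by (simp add: Q_def inner_sum_left)
      also have "\<dots> = (\<Sum>i<DIM('a). if i = j then of_int (l ! i) else 0)"
      proof (rule sum.cong[OF refl])
        fix i assume i: "i \<in> {..<DIM('a)}"
        have "(basis_enum i :: 'a) = basis_enum j \<longleftrightarrow> i = j"
          using inj_on_eq_iff[OF bij_betw_imp_inj_on[OF basis_enum], of i j] i j by auto
        then show "of_int (l ! i) * ((basis_enum i :: 'a) \<bullet> basis_enum j) = (if i = j then of_int (l ! i) else 0)"
          using inner_Basis[OF inB inB, of i j] i j by auto
      qed
      also have "\<dots> = of_int \<lfloor>x \<bullet> basis_enum j\<rfloor>" using j by (simp add: l_def)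
      finally show ?thesis .
    qed
    then have "0 \<le> (x - Q l) \<bullet> basis_enum j \<and> (x - Q l) \<bullet> basis_enum j < 1" if "j < DIM('a)" for j
      using that by (simp add: inner_diff_left) linarith
    moreover have "\<exists>j<DIM('a). i = basis_enum j" if "i \<in> Basis" for i :: 'a
    proof -
      have "basis_enum ` {0..<DIM('a)} = (Basis :: 'a set)" using basis_enum by (rule bij_betw_imp_surj_on)
      with that have "i \<in> basis_enum ` {0..<DIM('a)}" by simp
      then show ?thesis by auto
    qed
    ultimately have "x \<in> unit_box (Q l)" unfolding unit_box_def by blast
    then show ?thesis by (metis from_nat_to_nat)
  qed
  then show ?thesis using that[of "\<lambda>n. Q (from_nat n)"] by blast
qed

text \<open>If the part in every box had net content 0, fine covers of the boxes with total cost
  \<open>e * (1/2) ^ Suc n\<close> would combine to one cover of \<open>E\<close> with total cost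
  \<open>e\<close>.\<close>

lemma hausdorff_measure_pos_imp_net_pos:
  fixes E :: "'a::euclidean_space set"
  assumes s: "s > 0" and H: "hausdorff_measure s E \<noteq> 0"
  obtains p where "bit_tree.net (dyadic_bit p) (2 powr (- (s / DIM('a)))) (E \<inter> unit_box p) > 0"
proof (rule ccontr)
  assume no: "\<not> thesis"
  obtain P :: "nat \<Rightarrow> 'a" where P: "(\<Union>n. unit_box (P n)) = UNIV" using unit_boxes_cover by blast
  have "hausdorff_measure s E \<le> 0"
    unfolding hausdorff_measure_def
  proof (rule SUP_least, rule ennreal_le_epsilon)
    fix \<delta> e :: real assume \<delta>: "\<delta> \<in> {0<..}" and e: "0 < e"
    have "\<exists>S :: nat \<Rightarrow> 'a set. E \<inter> unit_box (P n) \<subseteq> (\<Union>i. S i) \<and> (\<forall>i. bounded (S i) \<and> diameter (S i) \<le> \<delta>) \<and>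
      (\<Sum>i. ennreal (diameter (S i) powr s)) \<le> ennreal (e * (1/2) ^ Suc n)" for n
    proof -
      interpret dyadic_tree "P n" s by unfold_locales (rule s)
      have "net (E \<inter> unit_box (P n)) = 0" using that no by (metis zero_less_iff_neq_zero)
      from small_cover_of_net_0[OF Int_lower2 this, of "e * (1/2) ^ Suc n" \<delta>] e \<delta> show ?thesis by (metis greaterThan_iff mult_pos_pos zero_less_power half_gt_zero_iff zero_less_one)
    qed
    then obtain S :: "nat \<Rightarrow> nat \<Rightarrow> 'a set" where S: "\<And>n. E \<inter> unit_box (P n) \<subseteq> (\<Union>i. S n i)"
      "\<And>n i. bounded (S n i)" "\<And>n i. diameter (S n i) \<le> \<delta>"
      "\<And>n. (\<Sum>i. ennreal (diameter (S n i) powr s)) \<le> ennreal (e * (1/2) ^ Suc n)" by metis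
    define A where "A j = S (fst (prod_decode j)) (snd (prod_decode j))" for j
    have cov: "E \<subseteq> (\<Union>j. A j)"
    proof
      fix x assume x: "x \<in> E"
      then obtain n where "x \<in> E \<inter> unit_box (P n)" using P by blast
      then obtain i where "x \<in> S n i" using S(1) by blast
      then have "x \<in> A (prod_encode (n, i))" by (simp add: A_def)
      then show "x \<in> (\<Union>j. A j)" by blast
    qed
    have "(INF A\<in>{A :: nat \<Rightarrow> 'a set. E \<subseteq> (\<Union>i. A i) \<and> (\<forall>i. bounded (A i) \<and> diameter (A i) \<le> \<delta>)}.
       \<Sum>i. ennreal (diameter (A i) powr s)) \<le> (\<Sum>j. ennreal (diameter (A j) powr s))"
      by (rule INF_lower) (use cov S in \<open>auto simp: A_def\<close>)
    also have "\<dots> = (\<Sum>j. (\<lambda>(n, i). ennreal (diameter (S n i) powr s)) (prod_decode j))"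
      by (simp add: A_def split_beta)
    also have "\<dots> = (\<Sum>n. \<Sum>i. ennreal (diameter (S n i) powr s))"
      by (rule suminf_ennreal_2dimen) simp
    also have "\<dots> \<le> (\<Sum>n. ennreal (e * (1/2) ^ Suc n))" by (intro suminf_le summableI S)
    also have "\<dots> = ennreal e"
    proof -
      have "(\<lambda>n. e * (1/2) ^ Suc n) sums (e * 1)" using power_half_series by (rule sums_mult)
      then show ?thesis using e by (subst suminf_ennreal2) (auto simp: sums_iff)
    qed
    finally show "(INF A\<in>{A :: nat \<Rightarrow> 'a set. E \<subseteq> (\<Union>i. A i) \<and> (\<forall>i. bounded (A i) \<and> diameter (A i) \<le> \<delta>)}.
       \<Sum>i. ennreal (diameter (A i) powr s)) \<le> 0 + ennreal e" by simp
  qed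
  then show False using H by simp
qed

section \<open>The lower bound\<close>

text \<open>The time in the numerator is at most the space-time norm and cancels one power of
  it.\<close>

lemma spacetime_kernel_le:
  fixes z :: "'x::euclidean_space \<times> real"
  shows "spacetime_kernel z \<le> norm z powr (- real DIM('x))"
proof (cases "snd z > 0")
  case True
  let ?N = "real DIM('x)"
  have z: "norm z > 0" using True by auto
  have n2: "(snd z)\<^sup>2 + (norm (fst z))\<^sup>2 = (norm z)\<^sup>2" by (simp add: norm_prod_def)
  have "(norm z)\<^sup>2 = norm z powr 2" using z by simp
  then have "((norm z)\<^sup>2) powr ((?N + 1) / 2) = norm z powr (?N + 1)"
    by (simp only: powr_powr) (simp add: add_divide_distrib)
  then have "spacetime_kernel z = snd z / norm z powr (?N + 1)"
    using True by (simp add: spacetime_kernel_def poisson_def n2)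
  also have "\<dots> \<le> norm z / norm z powr (?N + 1)"
    using norm_snd_le[of "snd z" "fst z"] True by (intro divide_right_mono) auto
  also have "\<dots> = norm z powr (1 - (?N + 1))" using z by (simp only: powr_diff) simp
  finally show ?thesis by simp
qed (simp add: spacetime_kernel_def)

text \<open>The potential of \<open>\<mu>\<close> is bounded: within distance 1 by the shell
  estimate with exponent \<open>N < s\<close>, farther away because the kernel is at most 1 there.
  Dividing \<open>\<mu>\<close> by the bound gives \<open>T\<close>, and Fubini identifies its
  distributional potential with the function \<open>V / P\<close>.\<close>

lemma admissible_of_growth:
  fixes \<mu> :: "((real ^ 'n) \<times> real) measure" and C s :: real
  assumes sets_mu [measurable_cong]: "sets \<mu> = sets borel" and K: "compact K" "emeasure \<mu> (- K) = 0"
    and mass: "0 < emeasure \<mu> UNIV" "emeasure \<mu> UNIV \<le> 1"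
    and C: "C \<ge> 0" and s: "s > real CARD('n)" and growth: "\<And>x r. r > 0 \<Longrightarrow> emeasure \<mu> (cball x r) \<le> ennreal (C * r powr s)"
  obtains \<nu> where "admissible K \<nu>" "dist_pair \<nu> (\<lambda>_. 1) \<noteq> 0"
proof -
  let ?N = "real DIM(real ^ 'n)"
  have sp: "space \<mu> = UNIV" using sets_eq_imp_space_eq[OF sets_mu] by simp
  interpret finite_measure \<mu> by (rule finite_measureI) (use mass(2) in \<open>auto simp: sp top_unique\<close>)
  \<comment> \<open>The maximum covers the part near \<open>x\<close>, and the summand 1 the part
    beyond distance 1, where kernel and total mass are at most 1.\<close>
  define P where "P = max 0 (C * shell_below ?N s) + 1"
  have P: "P \<ge> 1" by (simp add: P_def)
  define V where "V x = (\<integral>\<^sup>+y. ennreal (spacetime_kernel (x - y)) \<partial>\<mu>)" for x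
  have V: "V x \<le> ennreal P" for x
  proof -
    have "V x \<le> (\<integral>\<^sup>+y. ennreal (norm (x - y) powr (- ?N) * indicator {..1} (norm (x - y))) + 1 \<partial>\<mu>)"
      unfolding V_def
    proof (rule nn_integral_mono)
      fix y
      have k: "spacetime_kernel (x - y) \<le> norm (x - y) powr (- ?N)" by (rule spacetime_kernel_le)
      show "ennreal (spacetime_kernel (x - y)) \<le> ennreal (norm (x - y) powr (- ?N) * indicator {..1} (norm (x - y))) + 1"
      proof (cases "norm (x - y) \<le> 1")
        case True
        then show ?thesis using k by (intro add_increasing2) (auto intro: ennreal_leI)
      next
        case False
        then have "norm (x - y) powr (- ?N) \<le> 1 powr (- ?N)" by (intro powr_mono2') auto
        then have "ennreal (spacetime_kernel (x - y)) \<le> ennreal 1" using k by (intro ennreal_leI) simp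
        then show ?thesis using False by simp
      qed
    qed
    also have "\<dots> = (\<integral>\<^sup>+y. ennreal (norm (x - y) powr (- ?N) * indicator {..1} (norm (x - y))) \<partial>\<mu>) + emeasure \<mu> UNIV"
      by (subst nn_integral_add) (auto simp: sp)
    also have "\<dots> \<le> ennreal (C * shell_below ?N s) + 1"
    proof (intro add_mono mass(2))
      show "(\<integral>\<^sup>+y. ennreal (norm (x - y) powr (- ?N) * indicator {..1} (norm (x - y))) \<partial>\<mu>) \<le> ennreal (C * shell_below ?N s)"
      proof (rule nn_integral_shell_below[OF _ _ C])
        fix r :: real assume r: "r > 0"
        have "{y \<in> space \<mu>. norm (x - y) \<le> r} = cball x r" by (auto simp: sp dist_norm)
        then show "emeasure \<mu> {y \<in> space \<mu>. norm (x - y) \<le> r} \<le> ennreal (C * r powr s)" using growth[OF r] by simp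
      qed (use s in auto)
    qed
    also have "\<dots> \<le> ennreal P" unfolding P_def
      by (subst ennreal_plus) (auto intro!: add_right_mono ennreal_leI)
    finally show ?thesis .
  qed
  define T where "T \<phi> = of_real (1 / P) * (LINT y|\<mu>. \<phi> y)" for \<phi> :: "(real ^ 'n) \<times> real \<Rightarrow> complex"
  have int: "integrable \<mu> \<phi>" if phi: "\<phi> \<in> test_funs" for \<phi>
  proof -
    obtain B where "\<And>x. cmod (\<phi> x) \<le> B" using test_funs_bounded[OF phi] by blast
    moreover have "\<phi> \<in> borel_measurable \<mu>" using test_funs_measurable[OF phi] by measurable
    ultimately show ?thesis by (intro integrable_const_bound[of _ B]) auto
  qed
  have T: "distribution T"
    unfolding distribution_def
  proof (intro conjI ballI allI impI)
    fix \<phi> \<psi> :: "(real ^ 'n) \<times> real \<Rightarrow> complex" assume "\<phi> \<in> test_funs" "\<psi> \<in> test_funs"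
    then show "T (\<lambda>x. \<phi> x + \<psi> x) = T \<phi> + T \<psi>" by (simp add: T_def int distrib_left add_divide_distrib)
  next
    fix c and \<phi> :: "(real ^ 'n) \<times> real \<Rightarrow> complex" assume "\<phi> \<in> test_funs"
    then show "T (\<lambda>x. c * \<phi> x) = c * T \<phi>" by (simp add: T_def)
  next
    fix L :: "((real ^ 'n) \<times> real) set"
    show "\<exists>C m. \<forall>\<phi>\<in>test_funs. fun_supp \<phi> \<subseteq> L \<longrightarrow>
      cmod (T \<phi>) \<le> C * (\<Sum>vs | set vs \<subseteq> Basis \<and> length vs \<le> m. SUP x. cmod (iter_deriv vs \<phi> x))"
    \<comment> \<open>A measure is a distribution of order 0, so the empty list of derivatives
      suffices.\<close>
    proof (rule exI[of _ 1], rule exI[of _ 0], intro ballI impI)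
      fix \<phi> :: "(real ^ 'n) \<times> real \<Rightarrow> complex" assume phi: "\<phi> \<in> test_funs"
      obtain B where B: "\<And>x. cmod (\<phi> x) \<le> B" using test_funs_bounded[OF phi] by blast
      let ?S = "SUP x. cmod (\<phi> x)"
      have le: "cmod (\<phi> x) \<le> ?S" for x by (rule cSUP_upper) (use B in \<open>auto intro!: bdd_aboveI\<close>)
      have S0: "?S \<ge> 0" using le[of 0] norm_ge_zero order_trans by blast
      have "cmod (LINT y|\<mu>. \<phi> y) \<le> (LINT y|\<mu>. ?S)"
        by (rule Bochner_Integration.integral_norm_bound_integral[OF int[OF phi]]) (use le in auto)
      also have "\<dots> = measure \<mu> UNIV * ?S" by (simp add: sp)
      also have "\<dots> \<le> 1 * ?S"
      proof (intro mult_right_mono S0)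
        show "measure \<mu> UNIV \<le> 1" using mass(2) by (simp add: emeasure_eq_measure)
      qed
      finally have "cmod (LINT y|\<mu>. \<phi> y) \<le> ?S" by simp
      then have "(1 / P) * cmod (LINT y|\<mu>. \<phi> y) \<le> 1 * ?S" using P by (intro mult_mono) auto
      then have "cmod (T \<phi>) \<le> ?S" using P by (simp add: T_def norm_mult norm_divide)
      moreover have "{vs. set vs \<subseteq> (Basis :: ((real ^ 'n) \<times> real) set) \<and> length vs \<le> 0} = {[]}" by auto
      ultimately show "cmod (T \<phi>) \<le> 1 * (\<Sum>vs | set vs \<subseteq> Basis \<and> length vs \<le> 0. SUP x. cmod (iter_deriv vs \<phi> x))" by simp
    qed
  qed
  have ae: "AE y in \<mu>. y \<in> K"
    by (rule AE_I[where N = "- K"]) (use K compact_imp_closed[OF K(1)] in \<open>auto simp: sets_mu\<close>)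
  have supp: "dist_supp T \<subseteq> K"
  proof -
    have "T \<phi> = 0" if "fun_supp \<phi> \<subseteq> - K" for \<phi>
    proof -
      have "AE y in \<mu>. \<phi> y = 0" using ae by eventually_elim (use that fun_supp_zero in blast)
      then show ?thesis by (simp add: T_def integral_eq_zero_AE)
    qed
    moreover have "open (- K)" using compact_imp_closed[OF K(1)] by auto
    ultimately show ?thesis unfolding dist_supp_def by blast
  qed
  have csupp: "compact (dist_supp T)"
    using supp K(1) closed_dist_supp[of T] by (metis compact_Int_closed inf.absorb_iff2)
  obtain \<eta> U where eta: "\<eta> \<in> test_funs" and U: "open U" "K \<subseteq> U" "\<And>x. x \<in> U \<Longrightarrow> \<eta> x = (1::complex)"
    using cutoff_near_compact[OF K(1)] by blast
  have pair: "dist_pair T \<psi> = of_real (1 / P) * (LINT y|\<mu>. \<psi> y)" if psi: "smooth \<psi>" for \<psi>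
  proof -
    have m: "\<psi> \<in> borel_measurable borel" "\<eta> \<in> borel_measurable borel"
      using psi test_funs_smooth[OF eta] by (auto intro: borel_measurable_continuous_onI smooth_continuous_on)
    have "dist_pair T \<psi> = T (\<lambda>x. \<eta> x * \<psi> x)" by (rule dist_pair_eq[OF T eta psi U(1)]) (use supp U in auto)
    also have "(LINT y|\<mu>. \<eta> y * \<psi> y) = (LINT y|\<mu>. \<psi> y)"
    proof (rule integral_cong_AE)
      show "AE y in \<mu>. \<eta> y * \<psi> y = \<psi> y" using ae by eventually_elim (use U in auto)
    qed (use m in measurable)
    then have "T (\<lambda>x. \<eta> x * \<psi> x) = of_real (1 / P) * (LINT y|\<mu>. \<psi> y)" by (simp only: T_def)
    finally show ?thesis .
  qed
  have bound: "Linfty_norm_le (dist_conv P_kernel T) 1"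
    unfolding Linfty_norm_le_def
  proof (intro bexI conjI ballI)
    have Vm[measurable]: "V \<in> borel_measurable borel"
      unfolding V_def by measurable
    show "(\<lambda>x. complex_of_real (enn2real (V x) / P)) \<in> borel_measurable lborel" by measurable
    have "enn2real (V x) \<le> P" for x using enn2real_mono[OF V[of x]] P by simp
    then show "AE x in lborel. cmod (complex_of_real (enn2real (V x) / P)) \<le> 1"
      using P by (intro AE_I2) (simp only: norm_of_real, simp add: divide_le_eq_1)
    fix \<phi> :: "(real ^ 'n) \<times> real \<Rightarrow> complex" assume phi: "\<phi> \<in> test_funs"
    have [measurable]: "\<phi> \<in> borel_measurable borel" by (rule test_funs_measurable[OF phi])
    interpret lm: pair_sigma_finite lborel \<mu> by unfold_locales
    define F where "F = (\<lambda>x y. spacetime_kernel (x - y) *\<^sub>R \<phi> x)"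
    have Fm[measurable]: "case_prod F \<in> borel_measurable (lborel \<Otimes>\<^sub>M \<mu>)" unfolding F_def by measurable
    have inner: "(\<integral>\<^sup>+y. ennreal (norm (F x y)) \<partial>\<mu>) = V x * ennreal (cmod (\<phi> x))" for x
      unfolding V_def F_def by (subst nn_integral_multc[symmetric]) (auto simp: ennreal_mult spacetime_kernel_nonneg)
    have Fi: "integrable (lborel \<Otimes>\<^sub>M \<mu>) (case_prod F)"
    proof (rule integrableI_bounded[OF Fm])
      have "(\<integral>\<^sup>+p. ennreal (norm (case_prod F p)) \<partial>(lborel \<Otimes>\<^sub>M \<mu>)) = (\<integral>\<^sup>+x. \<integral>\<^sup>+y. ennreal (norm (F x y)) \<partial>\<mu> \<partial>lborel)"
        by (subst nn_integral_fst[symmetric]) auto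
      also have "\<dots> \<le> (\<integral>\<^sup>+x. ennreal P * ennreal (cmod (\<phi> x)) \<partial>lborel)"
        unfolding inner by (intro nn_integral_mono mult_right_mono V) auto
      also have "\<dots> = ennreal P * (\<integral>\<^sup>+x. ennreal (cmod (\<phi> x)) \<partial>lborel)" by (rule nn_integral_cmult) measurable
      also have "\<dots> < \<infinity>"
      proof -
        obtain B where B: "B > 0" "\<And>x. cmod (\<phi> x) \<le> B" using test_funs_bounded[OF phi] by blast
        obtain r where r: "r > 0" "\<And>x. \<phi> x \<noteq> 0 \<Longrightarrow> norm x \<le> r" using test_funsE[OF phi] by blast
        have z: "\<phi> x = 0" if "r < dist 0 x" for x using r(2)[of x] that by (auto simp: dist_norm)
        have "(\<integral>\<^sup>+x. ennreal (cmod (\<phi> x)) \<partial>lborel) \<le> ennreal (B * (unit_ball_vol DIM((real ^ 'n) \<times> real) * r ^ DIM((real ^ 'n) \<times> real)))"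
          by (rule nn_integral_le_ball[of _ _ _ 0]) (use B r z in auto)
        also have "\<dots> < \<infinity>" by simp
        finally show ?thesis by (simp add: ennreal_mult_less_top)
      qed
      finally show "(\<integral>\<^sup>+p. ennreal (norm (case_prod F p)) \<partial>(lborel \<Otimes>\<^sub>M \<mu>)) < \<infinity>" .
    qed
    have cv: "conv kernel_measure \<phi> y = (LINT x|lborel. F x y)" for y
    proof -
      have "conv kernel_measure \<phi> y = (LINT z|lborel. spacetime_kernel z *\<^sub>R \<phi> (y + z))"
        unfolding conv_def by (rule integral_density) (auto simp: spacetime_kernel_nonneg)
      also have "\<dots> = (LINT z|lborel. F (y + z) y)" by (simp add: F_def)
      also have "\<dots> = (LINT x|lborel. F x y)"
        by (rule integral_lborel_shift[of "\<lambda>x. F x y"]) (unfold F_def, measurable)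
      finally show ?thesis .
    qed
    have "dist_conv P_kernel T \<phi> = dist_pair T (conv kernel_measure \<phi>)"
      unfolding P_kernel_eq by (rule dist_conv_eq_conv[OF spacetime_kernel_measurable spacetime_kernel_nonneg phi])
    also have "\<dots> = of_real (1 / P) * (LINT y|\<mu>. conv kernel_measure \<phi> y)"
      by (rule pair[OF smooth_conv[OF loc_finite_kernel_measure phi]])
    also have "(LINT y|\<mu>. conv kernel_measure \<phi> y) = (LINT x|lborel. LINT y|\<mu>. F x y)"
      unfolding cv by (rule lm.Fubini_integral[OF Fi])
    also have "\<dots> = (LINT x|lborel. of_real (enn2real (V x)) * \<phi> x)"
    proof (rule Bochner_Integration.integral_cong[OF refl])
      fix x
      have k: "integrable \<mu> (\<lambda>y. spacetime_kernel (x - y))"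
        using V[of x] by (intro integrableI_nonneg) (auto simp: spacetime_kernel_nonneg V_def intro: le_less_trans)
      have "(LINT y|\<mu>. F x y) = (LINT y|\<mu>. spacetime_kernel (x - y)) *\<^sub>R \<phi> x"
        unfolding F_def by (rule integral_scaleR_left) (use k in auto)
      also have "(LINT y|\<mu>. spacetime_kernel (x - y)) = enn2real (V x)"
        unfolding V_def by (rule integral_eq_nn_integral) (auto simp: spacetime_kernel_nonneg)
      finally show "(LINT y|\<mu>. F x y) = of_real (enn2real (V x)) * \<phi> x" by (simp add: scaleR_conv_of_real)
    qed
    also have "of_real (1 / P) * \<dots> = (LINT x|lborel. complex_of_real (enn2real (V x) / P) * \<phi> x)"
      by (subst integral_mult_right_zero[symmetric]) (simp add: mult.assoc)
    finally show "dist_conv P_kernel T \<phi> = (LINT x|lborel. complex_of_real (enn2real (V x) / P) * \<phi> x)" .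
  qed
  show ?thesis
  proof (rule that[of T])
    show "admissible K T" unfolding admissible_def using T csupp supp bound by blast
    have "dist_pair T (\<lambda>_. 1) = of_real (1 / P * measure \<mu> UNIV)"
      using pair[OF smooth_const, of 1] by (simp add: sp scaleR_conv_of_real)
    moreover have "measure \<mu> UNIV > 0" using mass(1) by (simp add: emeasure_eq_measure)
    ultimately show "dist_pair T (\<lambda>_. 1) \<noteq> 0" using P by simp
  qed
qed

theorem caloric_capacity_positive:
  fixes E :: "((real ^ 'n) \<times> real) set"
  assumes E: "E \<in> sets borel" and dim: "hausdorff_dim E > of_nat CARD('n)"
  shows "caloric_capacity E > 0"
proof -
  \<comment> \<open>An exponent strictly between \<open>N\<close> and the dimension: below the
    dimension the Hausdorff measure is nonzero, and above \<open>N\<close> the potential of the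
    Frostman measure is bounded.\<close>
  obtain q where q: "of_nat CARD('n) < q" "q < hausdorff_dim E" using dense[OF dim] by blast
  then have "q < top" using less_le_trans top_greatest by blast
  then obtain s where s: "q = ennreal s" "s \<ge> 0" by (cases q rule: ennreal_cases) auto
  have "ennreal (real CARD('n)) < ennreal s" using q(1) s by (simp add: ennreal_of_nat_eq_real_of_nat)
  then have sN: "s > real CARD('n)" using s(2) by (subst (asm) ennreal_less_iff) auto
  then have s0: "s > 0" by (rule le_less_trans[rotated]) simp
  have "hausdorff_measure s E \<noteq> 0"
  proof
    assume "hausdorff_measure s E = 0"
    then have "hausdorff_dim E \<le> ennreal s" unfolding hausdorff_dim_def using s0 by (intro INF_lower) auto
    then show False using q(2) s by simp
  qed
  then obtain p where p: "bit_tree.net (dyadic_bit p) (2 powr (- (s / DIM((real ^ 'n) \<times> real)))) (E \<inter> unit_box p) > 0"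
    using hausdorff_measure_pos_imp_net_pos[OF s0] by blast
  interpret dyadic_tree p s by unfold_locales (rule s0)
  obtain K where K: "compact K" "K \<subseteq> E \<inter> unit_box p" "net K > 0" using compact_subset_net_pos[OF E p] by blast
  then have "K \<subseteq> unit_box p" by blast
  from frostman[OF K(1) this K(3)] obtain \<mu> C where \<mu>: "sets \<mu> = sets borel" "emeasure \<mu> (- K) = 0" "0 < emeasure \<mu> UNIV"
    "emeasure \<mu> UNIV \<le> 1" "C \<ge> 0" "\<And>x r. r > 0 \<Longrightarrow> emeasure \<mu> (cball x r) \<le> ennreal (C * r powr s)" by metis
  obtain \<nu> where \<nu>: "admissible K \<nu>" "dist_pair \<nu> (\<lambda>_. 1) \<noteq> 0"
    using admissible_of_growth[OF \<mu>(1) K(1) \<mu>(2-5) sN \<mu>(6)] by blast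
  have "admissible E \<nu>" using \<nu>(1) K(2) unfolding admissible_def by blast
  then have "ennreal (cmod (dist_pair \<nu> (\<lambda>_. 1))) \<le> caloric_capacity E"
    unfolding caloric_capacity_def by (intro SUP_upper) auto
  moreover have "0 < ennreal (cmod (dist_pair \<nu> (\<lambda>_. 1)))" using \<nu>(2) by simp
  ultimately show ?thesis by (rule order.strict_trans2[rotated])
qed

theorem lemma4p1:
  shows "(\<exists>C::real. 0 < C \<and>
            (\<forall>E :: ((real ^ 'n) \<times> real) set. E \<in> sets borel \<longrightarrow>
               caloric_capacity_pos E \<le> caloric_capacity E \<and>
               caloric_capacity E \<le> ennreal C * hausdorff_content CARD('n) E)) \<and>
         (\<forall>E :: ((real ^ 'n) \<times> real) set. E \<in> sets borel \<longrightarrow>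
            hausdorff_dim E > of_nat CARD('n) \<longrightarrow> caloric_capacity E > 0)"
proof (intro conjI allI impI)
  have pos_le: "caloric_capacity_pos E \<le> caloric_capacity E" for E :: "((real ^ 'n) \<times> real) set"
    unfolding caloric_capacity_pos_def caloric_capacity_def by (rule SUP_subset_mono) auto
  show "\<exists>C::real. 0 < C \<and>
      (\<forall>E :: ((real ^ 'n) \<times> real) set. E \<in> sets borel \<longrightarrow>
         caloric_capacity_pos E \<le> caloric_capacity E \<and>
         caloric_capacity E \<le> ennreal C * hausdorff_content CARD('n) E)"
  proof (rule caloric_capacity_le_content)
    fix C :: real assume "C > 0"
      "\<And>E :: ((real ^ 'n) \<times> real) set. caloric_capacity E \<le> ennreal C * hausdorff_content CARD('n) E"
    then show ?thesis by (intro exI[of _ C] conjI allI impI pos_le)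
  qed
qed (rule caloric_capacity_positive)

end
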